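(* Let $(S_1,\dots,S_n)^T$ be uniformly distributed on $\mathcal{M}_n(\mathbb{R})$ and let $(U_1,\dots,U_n)^T$ be the corresponding vector of symmetric canonical moments (defined almost surely). Then $(U_1,\dots,U_n)^T$ is absolutely continuous with respect to Lebesgue measure on $(\mathcal{S}_p(\mathbb{R}))^n$ with density $$f(U_1,\dots,U_n)=\frac{1}{\mathcal{V}(\mathcal{M}_n(\mathbb{R}))}\prod_{k=1}^n\det\big(U_k(I_p-U_k)\big)^{(p+1)(n-k)/2}\mathbf{1}_{(0_p,I_p)}(U_k).$$ In particular $U_1,\dots,U_n$ are independent and $U_k\sim\mathrm{Beta}_p\big(\tfrac12(n-k+1)(p+1),\tfrac12(n-k+1)(p+1)\big)$.
   Context: $\mathcal{S}_p(\mathbb{R})$: real symmetric $p\times p$ matrices with Lebesgue measure $dX=\prod_{i\le j}dx_{i,j}$; $(0_p,I_p)=\{X\in\mathcal{S}_p(\mathbb{R}):0_p<X<I_p\}$ in the Loewner order. A real matrix measure on $[0,1]$: $p\times p$ matrix of signed Borel measures with $\mu(B)$ symmetric nonnegative definite, $\mu([0,1])=I_p$; moments $S_k=\int_0^1x^kd\mu$, $S_0=I_p$; $\mathcal{M}_n(\mathbb{R})$ is the set of moment vectors, $\mathcal{V}$ its volume, and the uniform distribution has density $\mathcal{V}(\mathcal{M}_n(\mathbb{R}))^{-1}\mathbf{1}_{\mathcal{M}_n(\mathbb{R})}$. With block Hankel matrices $\underline H_{2m}=(S_{i+j})_{i,j=0}^m$, $\overline H_{2m}=(S_{i+j+1}-S_{i+j+2})_{i,j=0}^{m-1}$,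 $\underline H_{2m+1}=(S_{i+j+1})_{i,j=0}^m$, $\overline H_{2m+1}=(S_{i+j}-S_{i+j+1})_{i,j=0}^m$ and block vectors $\underline h_{2m}=(S_{m+1},\dots,S_{2m})^T$, $\underline h_{2m-1}=(S_m,\dots,S_{2m-1})^T$, $\bar h_{2m}=(S_m-S_{m+1},\dots,S_{2m-1}-S_{2m})^T$, $\bar h_{2m-1}=(S_m-S_{m+1},\dots,S_{2m-2}-S_{2m-1})^T$, set $S_1^-=0_p$, $S_1^+=I_p$, $S_2^+=S_1$, $S^-_{n+1}=\underline h_n^T\underline H_{n-1}^{-1}\underline h_n$, $S^+_{n+1}=S_n-\bar h_n^T\overline H_{n-1}^{-1}\bar h_n$. On $\operatorname{Int}(\mathcal{M}_n(\mathbb{R}))=\{S_k^-<S_k<S_k^+\ \forall k\}$ the symmetric canonical moments are $U_k=(S_k^+-S_k^-)^{-1/2}(S_k-S_k^-)(S_k^+-S_k^-)^{-1/2}$. $\mathrm{Beta}_p(a,b)$ ($a,b>\tfrac12(p-1)$) is the law on $\mathcal{S}_p(\mathbb{R})$ with density $B_p(a,b)^{-1}(\det X)^{a-(p+1)/2}\det(I_p-X)^{b-(p+1)/2}\mathbf{1}_{(0_p,I_p)}(X)$, where $B_p(a,b)=\Gamma_p(a)\Gamma_p(b)/\Gamma_p(a+b)$ and $\Gamma_p(a)=\pi^{p(p-1)/4}\prod_{i=1}^p\Gamma(a-\tfrac12(i-1))$. *)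

theory Defs
  imports "HOL-Probability.Probability" "Jordan_Normal_Form.Determinant"
begin

definition psd :: "nat \<Rightarrow> real mat \<Rightarrow> bool" where
  "psd p A \<longleftrightarrow> (\<forall>v \<in> carrier_vec p. scalar_prod v (A *\<^sub>v v) \<ge> 0)"

definition pd :: "nat \<Rightarrow> real mat \<Rightarrow> bool" where
  "pd p A \<longleftrightarrow> (\<forall>v \<in> carrier_vec p. v \<noteq> 0\<^sub>v p \<longrightarrow> scalar_prod v (A *\<^sub>v v) > 0)"

definition mless :: "nat \<Rightarrow> real mat \<Rightarrow> real mat \<Rightarrow> bool" where
  "mless p A B \<longleftrightarrow> pd p (B - A)"

definition minv :: "real mat \<Rightarrow> real mat" where
  "minv A = (THE B. B \<in> carrier_mat (dim_row A) (dim_row A) \<and>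
                    A * B = 1\<^sub>m (dim_row A) \<and> B * A = 1\<^sub>m (dim_row A))"

definition msqrt :: "nat \<Rightarrow> real mat \<Rightarrow> real mat" where
  "msqrt p A = (THE B. B \<in> carrier_mat p p \<and> transpose_mat B = B \<and> psd p B \<and> B * B = A)"

definition borel01 :: "real set set" where
  "borel01 = {B \<in> sets borel. B \<subseteq> {0..1}}"

definition matrix_measure :: "nat \<Rightarrow> (real set \<Rightarrow> real mat) \<Rightarrow> bool" where
  "matrix_measure p \<mu> \<longleftrightarrow>
     (\<forall>B \<in> borel01. \<mu> B \<in> carrier_mat p p \<and> transpose_mat (\<mu> B) = \<mu> B \<and> psd p (\<mu> B)) \<and>
     (\<forall>A :: nat \<Rightarrow> real set. range A \<subseteq> borel01 \<longrightarrow> disjoint_family A \<longrightarrow>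
        (\<forall>i < p. \<forall>j < p. (\<lambda>m. \<mu> (A m) $$ (i, j)) sums (\<mu> (\<Union>m. A m) $$ (i, j)))) \<and>
     \<mu> {0..1} = 1\<^sub>m p"

definition qmeas :: "(real set \<Rightarrow> real mat) \<Rightarrow> real vec \<Rightarrow> real measure" where
  "qmeas \<mu> v = measure_of {0..1} borel01 (\<lambda>B. ennreal (scalar_prod v (\<mu> B *\<^sub>v v)))"

text \<open>k-th moment S_k = int x^k dmu, entrywise; the integral against the signed entry measure
  mu_ij is written out by polarisation mu_ij = (q(e_i+e_j) - q(e_i-e_j))/4.\<close>
definition mmoment :: "nat \<Rightarrow> (real set \<Rightarrow> real mat) \<Rightarrow> nat \<Rightarrow> real mat" where
  "mmoment p \<mu> k = Matrix.mat p p (\<lambda>(i, j).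
      ((\<integral>x. x ^ k \<partial>(qmeas \<mu> (unit_vec p i + unit_vec p j)))
     - (\<integral>x. x ^ k \<partial>(qmeas \<mu> (unit_vec p i - unit_vec p j)))) / 4)"

definition Tidx :: "nat \<Rightarrow> (nat \<times> nat) set" where
  "Tidx p = {(i, j). i \<le> j \<and> j < p}"

definition Kidx :: "nat \<Rightarrow> nat \<Rightarrow> (nat \<times> nat \<times> nat) set" where
  "Kidx p n = {1..n} \<times> Tidx p"

text \<open>Lebesgue measure dX = prod_{i<=j} dx_ij on S_p(R).\<close>
definition Sp :: "nat \<Rightarrow> (nat \<times> nat \<Rightarrow> real) measure" where
  "Sp p = PiM (Tidx p) (\<lambda>_. lborel)"

definition SpN :: "nat \<Rightarrow> nat \<Rightarrow> (nat \<times> nat \<times> nat \<Rightarrow> real) measure" where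
  "SpN p n = PiM (Kidx p n) (\<lambda>_. lborel)"

definition tmat :: "nat \<Rightarrow> (nat \<times> nat \<Rightarrow> real) \<Rightarrow> real mat" where
  "tmat p y = Matrix.mat p p (\<lambda>(i, j). y (min i j, max i j))"

definition smat :: "nat \<Rightarrow> (nat \<times> nat \<times> nat \<Rightarrow> real) \<Rightarrow> nat \<Rightarrow> real mat" where
  "smat p x k = Matrix.mat p p (\<lambda>(i, j). x (k, min i j, max i j))"

definition Sseq :: "nat \<Rightarrow> (nat \<times> nat \<times> nat \<Rightarrow> real) \<Rightarrow> nat \<Rightarrow> real mat" where
  "Sseq p x k = (if k = 0 then 1\<^sub>m p else smat p x k)"

definition Mn :: "nat \<Rightarrow> nat \<Rightarrow> (nat \<times> nat \<times> nat \<Rightarrow> real) set" where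
  "Mn p n = {x \<in> space (SpN p n). \<exists>\<mu>. matrix_measure p \<mu> \<and> (\<forall>k \<in> {1..n}. smat p x k = mmoment p \<mu> k)}"

definition Vol :: "nat \<Rightarrow> nat \<Rightarrow> real" where
  "Vol p n = measure (SpN p n) (Mn p n)"

definition hank :: "nat \<Rightarrow> nat \<Rightarrow> (nat \<Rightarrow> real mat) \<Rightarrow> real mat" where
  "hank p d f = Matrix.mat (d * p) (d * p) (\<lambda>(r, c). f (r div p + c div p) $$ (r mod p, c mod p))"

definition bcol :: "nat \<Rightarrow> nat \<Rightarrow> (nat \<Rightarrow> real mat) \<Rightarrow> real mat" where
  "bcol p d g = Matrix.mat (d * p) p (\<lambda>(r, c). g (r div p) $$ (r mod p, c))"

definition lowH :: "nat \<Rightarrow> (nat \<Rightarrow> real mat) \<Rightarrow> nat \<Rightarrow> real mat" where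
  "lowH p S N = (if even N then hank p (N div 2 + 1) S
                 else hank p (N div 2 + 1) (\<lambda>k. S (k + 1)))"

definition upH :: "nat \<Rightarrow> (nat \<Rightarrow> real mat) \<Rightarrow> nat \<Rightarrow> real mat" where
  "upH p S N = (if even N then hank p (N div 2) (\<lambda>k. S (k + 1) - S (k + 2))
                else hank p (N div 2 + 1) (\<lambda>k. S k - S (k + 1)))"

definition lowh :: "nat \<Rightarrow> (nat \<Rightarrow> real mat) \<Rightarrow> nat \<Rightarrow> real mat" where
  "lowh p S N = (if even N then bcol p (N div 2) (\<lambda>i. S (N div 2 + 1 + i))
                 else bcol p ((N + 1) div 2) (\<lambda>i. S ((N + 1) div 2 + i)))"

definition uph :: "nat \<Rightarrow> (nat \<Rightarrow> real mat) \<Rightarrow> nat \<Rightarrow> real mat" where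
  "uph p S N = (if even N then bcol p (N div 2) (\<lambda>i. S (N div 2 + i) - S (N div 2 + i + 1))
                else bcol p ((N + 1) div 2 - 1)
                       (\<lambda>i. S ((N + 1) div 2 + i) - S ((N + 1) div 2 + i + 1)))"

definition sminus :: "nat \<Rightarrow> (nat \<Rightarrow> real mat) \<Rightarrow> nat \<Rightarrow> real mat" where
  "sminus p S k = (if k \<le> 1 then 0\<^sub>m p p
      else transpose_mat (lowh p S (k - 1)) * minv (lowH p S (k - 2)) * lowh p S (k - 1))"

definition splus :: "nat \<Rightarrow> (nat \<Rightarrow> real mat) \<Rightarrow> nat \<Rightarrow> real mat" where
  "splus p S k = (if k \<le> 1 then 1\<^sub>m p else if k = 2 then S 1
      else S (k - 1) - transpose_mat (uph p S (k - 1)) * minv (upH p S (k - 2)) * uph p S (k - 1))"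

text \<open>Interior of the moment space.\<close>
definition Mint :: "nat \<Rightarrow> nat \<Rightarrow> (nat \<times> nat \<times> nat \<Rightarrow> real) set" where
  "Mint p n = {x \<in> space (SpN p n). \<forall>k \<in> {1..n}.
      mless p (sminus p (Sseq p x) k) (smat p x k) \<and> mless p (smat p x k) (splus p (Sseq p x) k)}"

definition canon :: "nat \<Rightarrow> (nat \<Rightarrow> real mat) \<Rightarrow> nat \<Rightarrow> real mat" where
  "canon p S k = (let R = minv (msqrt p (splus p S k - sminus p S k))
                  in R * (S k - sminus p S k) * R)"

definition Ucoords :: "nat \<Rightarrow> nat \<Rightarrow> (nat \<times> nat \<times> nat \<Rightarrow> real) \<Rightarrow> (nat \<times> nat \<times> nat \<Rightarrow> real)" where
  "Ucoords p n x = (if x \<in> Mint p n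
      then restrict (\<lambda>(k, i, j). canon p (Sseq p x) k $$ (i, j)) (Kidx p n)
      else restrict (\<lambda>_. 0) (Kidx p n))"

definition Ucoord :: "nat \<Rightarrow> nat \<Rightarrow> nat \<Rightarrow> (nat \<times> nat \<times> nat \<Rightarrow> real) \<Rightarrow> (nat \<times> nat \<Rightarrow> real)" where
  "Ucoord p n k x = restrict (\<lambda>(i, j). Ucoords p n x (k, i, j)) (Tidx p)"

definition in01 :: "nat \<Rightarrow> real mat \<Rightarrow> bool" where
  "in01 p X \<longleftrightarrow> mless p (0\<^sub>m p p) X \<and> mless p X (1\<^sub>m p)"

definition unif_dens :: "nat \<Rightarrow> nat \<Rightarrow> (nat \<times> nat \<times> nat \<Rightarrow> real) \<Rightarrow> ennreal" where
  "unif_dens p n x = ennreal (1 / Vol p n * indicator (Mn p n) x)"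

definition canon_dens :: "nat \<Rightarrow> nat \<Rightarrow> (nat \<times> nat \<times> nat \<Rightarrow> real) \<Rightarrow> ennreal" where
  "canon_dens p n u = ennreal (1 / Vol p n * (\<Prod>k \<in> {1..n}.
      (if in01 p (smat p u k)
       then Determinant.det (smat p u k * (1\<^sub>m p - smat p u k)) powr (real ((p + 1) * (n - k)) / 2)
       else 0)))"

definition mGamma :: "nat \<Rightarrow> real \<Rightarrow> real" where
  "mGamma p a = pi powr (real (p * (p - 1)) / 4) * (\<Prod>i \<in> {1..p}. Gamma (a - (real i - 1) / 2))"

definition mBeta :: "nat \<Rightarrow> real \<Rightarrow> real \<Rightarrow> real" where
  "mBeta p a b = mGamma p a * mGamma p b / mGamma p (a + b)"

definition beta_dens :: "nat \<Rightarrow> real \<Rightarrow> real \<Rightarrow> (nat \<times> nat \<Rightarrow> real) \<Rightarrow> ennreal" where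
  "beta_dens p a b y = ennreal (if in01 p (tmat p y)
      then Determinant.det (tmat p y) powr (a - (real p + 1) / 2)
         * Determinant.det (1\<^sub>m p - tmat p y) powr (b - (real p + 1) / 2) / mBeta p a b
      else 0)"

end

theory Submission
  imports Defs "Jordan_Normal_Form.Spectral_Radius"
begin

text \<open>
  Let \<open>D\<^sub>k = S\<^sub>k - S\<^sub>k\<^sup>-\<close>, \<open>E\<^sub>k = S\<^sub>k\<^sup>+ - S\<^sub>k\<close> and \<open>R\<^sub>k = D\<^sub>k + E\<^sub>k\<close>. Both \<open>D\<^sub>k\<close> and \<open>E\<^sub>k\<close> are Schur complements in block
  Hankel matrices, hence minima of a moment form over vector polynomials with prescribed leading coefficient. Comparing
  these minimisation problems in consecutive orders shows that \<open>R\<^bsub>k+1\<^esub>\<close> is the parallel sum of \<open>D\<^sub>k\<close> and \<open>E\<^sub>k\<close>;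
  therefore its determinant is the product of \<open>det (U\<^sub>j (I - U\<^sub>j))\<close> over \<open>j \<le> k\<close>. Given the earlier moments, \<open>S\<^sub>k\<close> is
  \<open>S\<^sub>k\<^sup>-\<close> plus the congruence of \<open>U\<^sub>k\<close> by the square root of \<open>R\<^sub>k\<close>, a map with Jacobian \<open>det R\<^sub>k\<close> to the power
  \<open>(p + 1) / 2\<close>, and the density follows by induction on the number of moments.

  The moment space agrees with the open set of the definition up to a null set: an interior point is the moment vector
  of an atomic measure supported on the eigenvalues of a Hankel pencil, and a boundary point has some singular \<open>D\<^sub>k\<close> or
  \<open>E\<^sub>k\<close> while the earlier moments are interior, which happens for only finitely many \<open>t\<close> when \<open>S\<^sub>k\<close> is shifted to
  \<open>S\<^sub>k + t I\<close>. The Beta normalisation is computed by splitting off the last column.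
\<close>

no_notation inner (infix \<open>\<bullet>\<close> 70)
no_notation vec_nth (infixl \<open>$\<close> 90)
hide_const (open) Determinants.det Finite_Cartesian_Product.vec Finite_Cartesian_Product.mat Finite_Cartesian_Product.row
hide_const (open) Finite_Cartesian_Product.transpose

text \<open>Writing R, U, D, E for the matrices of one order, det D = det R det U and det E = det R
  det (I - U). The parallel sum therefore multiplies det R by det U det (I - U) from one order to
  the next. Hence U_j enters det R_k for every k > j, which is n - j times up to order n, and the
  Jacobian exponent (p + 1) / 2 becomes (p + 1) (n - j) / 2. The inverses and roots behind S_k^-,
  S_k^+ and U_k are definite descriptions that mean something only when lower Hankel matrices are
  definite, so statements about order k + 1 assume interiority up to order k. Every substitution is
  reduced to affine maps of one real variable: Cholesky factors split a congruence into two
  triangular maps, and Tonelli treats one coordinate at a time. Measurability is reduced to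
  determinants and limits. Integrals against a matrix measure become limits of Riemann sums on grids
  of [0,1]. The volume is never computed: it is positive because S has the uniform density, and
  total mass one identifies it with the product of the Beta normalisations.\<close>

abbreviation qform :: "real mat \<Rightarrow> real vec \<Rightarrow> real" where
  "qform A v \<equiv> v \<bullet> (A *\<^sub>v v)"

section \<open>Symmetric matrices, quadratic forms, definiteness and inverses\<close>

definition sym_mat :: "nat \<Rightarrow> real mat \<Rightarrow> bool" where
  "sym_mat p A \<longleftrightarrow> A \<in> carrier_mat p p \<and> A\<^sup>T = A"

lemma sym_matD: "sym_mat p A \<Longrightarrow> A \<in> carrier_mat p p" "sym_mat p A \<Longrightarrow> A\<^sup>T = A"
  by (auto simp: sym_mat_def)

lemma sym_mat_index: "sym_mat p A \<Longrightarrow> i < p \<Longrightarrow> j < p \<Longrightarrow> A $$ (i, j) = A $$ (j, i)"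
  by (metis carrier_matD(1) carrier_matD(2) index_transpose_mat(1) sym_mat_def)

lemma sym_matI:
  "A \<in> carrier_mat p p \<Longrightarrow> (\<And>i j. i < p \<Longrightarrow> j < p \<Longrightarrow> A $$ (i, j) = A $$ (j, i)) \<Longrightarrow> sym_mat p A"
  unfolding sym_mat_def by (auto intro!: eq_matI)

lemma sym_mat_one[simp]: "sym_mat p (1\<^sub>m p)"
  by (auto simp: sym_mat_def)

lemma sym_mat_add: "sym_mat p A \<Longrightarrow> sym_mat p B \<Longrightarrow> sym_mat p (A + B)"
  by (auto simp: sym_mat_def transpose_add)

lemma sym_mat_minus: "sym_mat p A \<Longrightarrow> sym_mat p B \<Longrightarrow> sym_mat p (A - B)"
  by (auto simp: sym_mat_def transpose_minus)

lemma sym_mat_congruence: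
  assumes "sym_mat n A" "B \<in> carrier_mat n m"
  shows "sym_mat m (B\<^sup>T * A * B)"
proof -
  have A: "A \<in> carrier_mat n n" "A\<^sup>T = A" using assms(1) by (auto simp: sym_mat_def)
  have "(B\<^sup>T * A * B)\<^sup>T = B\<^sup>T * (A\<^sup>T * B)"
    using A(1) assms(2)
    by (subst transpose_mult[of _ m n _ m]) (auto simp: transpose_mult[of _ m n _ n])
  also have "\<dots> = B\<^sup>T * A * B"
    unfolding A(2) by (rule assoc_mult_mat[symmetric, OF _ A(1) assms(2)]) (use assms(2) in auto)
  finally show ?thesis using A(1) assms(2) unfolding sym_mat_def by auto
qed

lemma mult_square_carrier_mat[simp]:
  "A \<in> carrier_mat n n \<Longrightarrow> B \<in> carrier_mat n n \<Longrightarrow> A * B \<in> carrier_mat n n"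
  by auto

lemma qform_sum:
  assumes "A \<in> carrier_mat n n" "v \<in> carrier_vec n"
  shows "qform A v = (\<Sum>i<n. \<Sum>j<n. A $$ (i, j) * v $ i * v $ j)"
  using assms by (auto simp: scalar_prod_def atLeast0LessThan sum_distrib_left intro!: sum.cong)

lemma scalar_prod_transpose:
  assumes "A \<in> carrier_mat n m" "v \<in> carrier_vec n" "w \<in> carrier_vec m"
  shows "v \<bullet> (A *\<^sub>v w) = (A\<^sup>T *\<^sub>v v) \<bullet> (w :: real vec)"
proof -
  have "v \<bullet> (A *\<^sub>v w) = (\<Sum>i<n. \<Sum>j<m. v $ i * A $$ (i, j) * w $ j)"
    using assms by (auto simp: scalar_prod_def atLeast0LessThan sum_distrib_left mult.assoc intro!: sum.cong)
  also have "\<dots> = (\<Sum>j<m. \<Sum>i<n. v $ i * A $$ (i, j) * w $ j)" by (rule sum.swap)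
  also have "\<dots> = (A\<^sup>T *\<^sub>v v) \<bullet> w"
    using assms by (auto simp: scalar_prod_def atLeast0LessThan sum_distrib_left sum_distrib_right mult.assoc mult.left_commute mult.commute intro!: sum.cong)
  finally show ?thesis .
qed

lemma qform_congruence:
  assumes "A \<in> carrier_mat n n" "B \<in> carrier_mat n m" "v \<in> carrier_vec m"
  shows "qform (B\<^sup>T * A * B) v = qform A (B *\<^sub>v v)"
proof -
  have "B\<^sup>T * A * B = B\<^sup>T * (A * B)"
    by (rule assoc_mult_mat) (use assms in auto)
  then have "(B\<^sup>T * A * B) *\<^sub>v v = B\<^sup>T *\<^sub>v (A *\<^sub>v (B *\<^sub>v v))"
    using assms by (simp add: assoc_mult_mat_vec[of _ m n _ m] assoc_mult_mat_vec[of _ n n _ m])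
  also have "v \<bullet> \<dots> = qform A (B *\<^sub>v v)"
    using assms by (subst scalar_prod_transpose[of _ m n]) auto
  finally show ?thesis .
qed

lemma scalar_self_sum: "v \<in> carrier_vec n \<Longrightarrow> v \<bullet> v = (\<Sum>i<n. (v $ i)\<^sup>2 :: real)"
  by (auto simp: scalar_prod_def power2_eq_square atLeast0LessThan)

lemma scalar_self_nonneg: "v \<bullet> v \<ge> (0 :: real)"
  by (auto simp: scalar_prod_def intro!: sum_nonneg)

lemma scalar_self_pos:
  assumes "v \<in> carrier_vec n" "v \<noteq> 0\<^sub>v n"
  shows "v \<bullet> v > (0 :: real)"
proof -
  obtain i where "i < n" "v $ i \<noteq> 0" using assms by (metis eq_vecI carrier_vecD index_zero_vec)
  then show ?thesis unfolding scalar_self_sum[OF assms(1)]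
    by (intro sum_pos2[of _ i]) auto
qed

lemma mult_mat_vec_zero: "A \<in> carrier_mat n m \<Longrightarrow> A *\<^sub>v 0\<^sub>v m = (0\<^sub>v n :: real vec)"
  by (intro eq_vecI) auto

lemma psdD: "psd p A \<Longrightarrow> v \<in> carrier_vec p \<Longrightarrow> qform A v \<ge> 0"
  by (auto simp: psd_def)

lemma pdD: "pd p A \<Longrightarrow> v \<in> carrier_vec p \<Longrightarrow> v \<noteq> 0\<^sub>v p \<Longrightarrow> qform A v > 0"
  by (auto simp: pd_def)

lemma pd_psd:
  assumes "pd p A" "A \<in> carrier_mat p p" shows "psd p A"
  unfolding psd_def
proof
  fix v :: "real vec" assume v: "v \<in> carrier_vec p"
  show "qform A v \<ge> 0"
    using pdD[OF assms(1) v] assms(2) by (cases "v = 0\<^sub>v p") auto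
qed

lemma qform_add:
  assumes "A \<in> carrier_mat p p" "B \<in> carrier_mat p p" "v \<in> carrier_vec p"
  shows "qform (A + B) v = qform A v + qform B v"
  using assms
  by (simp add: add_mult_distrib_mat_vec[of A p p] scalar_prod_add_distrib[of _ p])

lemma qform_minus:
  assumes "A \<in> carrier_mat p p" "B \<in> carrier_mat p p" "v \<in> carrier_vec p"
  shows "qform (A - B) v = qform A v - qform B v"
  using assms
  by (simp add: minus_mult_distrib_mat_vec[of A p p] scalar_prod_minus_distrib[of _ p])

lemma pd_add: "pd p A \<Longrightarrow> pd p B \<Longrightarrow> A \<in> carrier_mat p p \<Longrightarrow> B \<in> carrier_mat p p \<Longrightarrow> pd p (A + B)"
  unfolding pd_def by (simp add: qform_add add_pos_pos)

lemma pd_add_psd: "pd p A \<Longrightarrow> psd p B \<Longrightarrow> A \<in> carrier_mat p p \<Longrightarrow> B \<in> carrier_mat p p \<Longrightarrow> pd p (A + B)"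
  unfolding pd_def psd_def by (simp add: qform_add add_pos_nonneg)

lemma pd_one: "pd p (1\<^sub>m p)"
  unfolding pd_def using scalar_self_pos by auto

lemma pd_det_nonzero:
  assumes "pd p A" "A \<in> carrier_mat p p" shows "det A \<noteq> 0"
proof
  assume "det A = 0"
  then obtain v where v: "v \<in> carrier_vec p" "v \<noteq> 0\<^sub>v p" "A *\<^sub>v v = 0\<^sub>v p"
    using det_0_iff_vec_prod_zero_field[OF assms(2)] by auto
  with pdD[OF assms(1) v(1,2)] show False by auto
qed

lemma mult_mat_vec_nonzero:
  assumes "A \<in> carrier_mat p p" "det A \<noteq> (0 :: real)" "v \<in> carrier_vec p" "v \<noteq> 0\<^sub>v p"
  shows "A *\<^sub>v v \<noteq> 0\<^sub>v p"
  using assms det_0_iff_vec_prod_zero_field[OF assms(1)] by auto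

lemma pd_congruence:
  assumes "pd p A" "A \<in> carrier_mat p p" "B \<in> carrier_mat p p" "det B \<noteq> 0"
  shows "pd p (B\<^sup>T * A * B)"
  unfolding pd_def
proof (intro ballI impI)
  fix v :: "real vec" assume v: "v \<in> carrier_vec p" "v \<noteq> 0\<^sub>v p"
  have "qform A (B *\<^sub>v v) > 0"
    using assms v by (intro pdD[OF assms(1)] mult_mat_vec_nonzero) auto
  then show "qform (B\<^sup>T * A * B) v > 0" by (simp only: qform_congruence[OF assms(2,3) v(1)])
qed

text \<open>Among square matrices a right inverse is also a left inverse, so the description in
  \<open>minv\<close> is settled by checking one product.\<close>

lemma minv_unique:
  assumes "A \<in> carrier_mat p p" "B \<in> carrier_mat p p" "A * B = 1\<^sub>m p"
  shows "minv A = B"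
proof -
  have BA: "B * A = 1\<^sub>m p" using mat_mult_left_right_inverse[OF assms] .
  show ?thesis unfolding minv_def
  proof (rule the_equality)
    show "B \<in> carrier_mat (dim_row A) (dim_row A) \<and> A * B = 1\<^sub>m (dim_row A) \<and> B * A = 1\<^sub>m (dim_row A)"
      using assms BA by auto
    fix C assume "C \<in> carrier_mat (dim_row A) (dim_row A) \<and> A * C = 1\<^sub>m (dim_row A) \<and> C * A = 1\<^sub>m (dim_row A)"
    then have C: "C \<in> carrier_mat p p" "C * A = 1\<^sub>m p" using assms by auto
    have "C = C * (A * B)" using C assms by auto
    also have "\<dots> = (C * A) * B" using C assms by (intro assoc_mult_mat[symmetric]) auto
    also have "\<dots> = B" using C assms by auto
    finally show "C = B" .
  qed
qed

lemma minv_props: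
  assumes "A \<in> carrier_mat p p" "det A \<noteq> (0 :: real)"
  shows "minv A \<in> carrier_mat p p" "A * minv A = 1\<^sub>m p" "minv A * A = 1\<^sub>m p"
proof -
  obtain B where B: "B \<in> carrier_mat p p" "A * B = 1\<^sub>m p" "B * A = 1\<^sub>m p"
    using det_non_zero_imp_unit[OF assms(1), where b = "()"] assms(2) assms(1)
    by (auto simp: Units_def ring_mat_def)
  have "minv A = B" by (rule minv_unique[OF assms(1) B(1,2)])
  then show "minv A \<in> carrier_mat p p" "A * minv A = 1\<^sub>m p" "minv A * A = 1\<^sub>m p" using B by auto
qed

lemma det_minv:
  assumes "A \<in> carrier_mat p p" "det A \<noteq> (0 :: real)"
  shows "det (minv A) = 1 / det A"
proof -
  note m = minv_props[OF assms]
  have "det A * det (minv A) = 1" using det_mult[OF assms(1) m(1)] m(2) by simp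
  then show ?thesis using assms by (simp add: field_simps)
qed

lemma sym_minv:
  assumes "sym_mat p A" "det A \<noteq> 0" shows "sym_mat p (minv A)"
proof -
  note A = sym_matD[OF assms(1)]
  note m = minv_props[OF A(1) assms(2)]
  have "A * (minv A)\<^sup>T = (minv A * A)\<^sup>T" using A m by (subst transpose_mult[of _ p p _ p]) auto
  also have "\<dots> = 1\<^sub>m p" using m by auto
  finally have "minv A = (minv A)\<^sup>T" by (intro minv_unique) (use A m in auto)
  then show ?thesis using m unfolding sym_mat_def by auto
qed

text \<open>Exhibits the inverse as a congruence of \<open>A\<close> itself; \<open>pd_minv\<close>
  obtains definiteness from this.\<close>

lemma minv_congruence_self:
  assumes "sym_mat p A" "det A \<noteq> 0"
  shows "(minv A)\<^sup>T * A * minv A = minv A"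
proof -
  note A = sym_matD[OF assms(1)]
  note m = minv_props[OF A(1) assms(2)]
  show ?thesis using sym_matD(2)[OF sym_minv[OF assms]] m by auto
qed

lemma pd_minv:
  assumes "sym_mat p A" "pd p A" shows "pd p (minv A)"
proof -
  note A = sym_matD[OF assms(1)]
  have d: "det A \<noteq> 0" using pd_det_nonzero[OF assms(2) A(1)] .
  note m = minv_props[OF A(1) d]
  have "det (minv A) \<noteq> 0" using d by (simp add: det_minv[OF A(1) d])
  then have "pd p ((minv A)\<^sup>T * A * minv A)" by (intro pd_congruence) (use assms A m in auto)
  then show ?thesis by (simp add: minv_congruence_self[OF assms(1) d])
qed

text \<open>Polarisation: the form at a sum of two unit vectors exposes the off-diagonal entries. It
  lets a matrix be identified through the minimum values of a variational problem.\<close>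

lemma sym_mat_eqI_qform:
  assumes "sym_mat p A" "sym_mat p B" "\<And>v. v \<in> carrier_vec p \<Longrightarrow> qform A v = qform B v"
  shows "A = B"
proof -
  note A = sym_matD[OF assms(1)] and B = sym_matD[OF assms(2)]
  define M where "M = A - B"
  have M: "sym_mat p M" unfolding M_def using sym_mat_minus[OF assms(1,2)] .
  have Mc: "M \<in> carrier_mat p p" using M by (auto simp: sym_mat_def)
  have q0: "qform M v = 0" if "v \<in> carrier_vec p" for v
    unfolding M_def using assms(3)[OF that] by (simp add: qform_minus[OF A(1) B(1) that])
  have u: "unit_vec p i \<bullet> (M *\<^sub>v unit_vec p j) = M $$ (i, j)" if "i < p" "j < p" for i j
    using that Mc by (simp add: scalar_prod_left_unit)
  have "M $$ (i, j) = 0" if ij: "i < p" "j < p" for i j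
  proof -
    let ?e = "unit_vec p i :: real vec" and ?f = "unit_vec p j :: real vec"
    have "qform M (?e + ?f) = qform M ?e + qform M ?f + M $$ (i, j) + M $$ (j, i)"
    proof -
      have "M *\<^sub>v (?e + ?f) = M *\<^sub>v ?e + M *\<^sub>v ?f"
        using Mc by (intro mult_add_distrib_mat_vec) auto
      moreover have "M *\<^sub>v ?e \<in> carrier_vec p" "M *\<^sub>v ?f \<in> carrier_vec p" using Mc by auto
      ultimately show ?thesis
        using u[OF ij] u[OF ij(2,1)]
        by (simp add: add_scalar_prod_distrib[of _ p] scalar_prod_add_distrib[of _ p])
    qed
    then show ?thesis using q0 sym_mat_index[OF M ij] by simp
  qed
  then show "A = B" using A(1) B(1) unfolding M_def by (intro eq_matI) auto
qed

subsection \<open>Schur complements\<close>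

text \<open>Elimination of the leading block of a symmetric 2 x 2 block matrix. Invertibility of
  \<open>A\<close> carries the factorisation and the determinant; definiteness of \<open>A\<close>
  enters lemma by lemma, where inequalities do.\<close>

locale schur_block =
  fixes n m :: nat and A B C :: "real mat"
  assumes A: "sym_mat n A" and B: "B \<in> carrier_mat n m" and C: "sym_mat m C"
    and detA: "det A \<noteq> 0"
begin

definition "M = four_block_mat A B B\<^sup>T C"
definition "S = C - B\<^sup>T * minv A * B"

lemma A': "A \<in> carrier_mat n n" "A\<^sup>T = A" and C': "C \<in> carrier_mat m m" "C\<^sup>T = C"
  using A C by (auto simp: sym_mat_def)

lemmas Ainv = minv_props[OF A'(1) detA]

lemma S_sym: "sym_mat m S"
  unfolding S_def by (intro sym_mat_minus C sym_mat_congruence[OF sym_minv[OF A detA] B])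

lemma S_carrier: "S \<in> carrier_mat m m" using S_sym by (auto simp: sym_mat_def)

text \<open>Block Gauss elimination as a congruence by a unit triangular matrix. Both the quadratic
  form and the determinant of \<open>M\<close> are read off from it.\<close>

lemma M_factor:
  "M = (four_block_mat (1\<^sub>m n) (minv A * B) (0\<^sub>m m n) (1\<^sub>m m))\<^sup>T * four_block_mat A (0\<^sub>m n m) (0\<^sub>m m n) S
     * four_block_mat (1\<^sub>m n) (minv A * B) (0\<^sub>m m n) (1\<^sub>m m)"
proof -
  have X: "minv A * B \<in> carrier_mat n m" using Ainv B by auto
  have XT: "(minv A * B)\<^sup>T = B\<^sup>T * minv A"
    using Ainv B sym_matD(2)[OF sym_minv[OF A detA]] by (subst transpose_mult[of _ n n _ m]) auto
  have AX: "A * (minv A * B) = B" using Ainv B A' by (subst assoc_mult_mat[symmetric, of _ n n _ n _ m]) auto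
  have XA: "(B\<^sup>T * minv A) * A = B\<^sup>T" using Ainv B A' by (subst assoc_mult_mat[of _ m n _ n _ n]) auto
  have T: "(four_block_mat (1\<^sub>m n) (minv A * B) (0\<^sub>m m n) (1\<^sub>m m))\<^sup>T
      = four_block_mat (1\<^sub>m n) (0\<^sub>m n m) (B\<^sup>T * minv A) (1\<^sub>m m)"
    using X by (subst transpose_four_block_mat[of _ n n _ m _ m]) (auto simp: XT)
  have 1: "four_block_mat (1\<^sub>m n) (0\<^sub>m n m) (B\<^sup>T * minv A) (1\<^sub>m m) * four_block_mat A (0\<^sub>m n m) (0\<^sub>m m n) S
      = four_block_mat A (0\<^sub>m n m) (B\<^sup>T) S"
    using A' B Ainv S_carrier XA by (subst mult_four_block_mat[of _ n n _ m _ m _ _ n _ m]) auto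
  have SC: "B\<^sup>T * (minv A * B) + S = C"
  proof -
    have "B\<^sup>T * (minv A * B) = B\<^sup>T * minv A * B"
      using B Ainv by (intro assoc_mult_mat[symmetric, of _ m n _ n _ m]) auto
    then show ?thesis unfolding S_def using B Ainv C' by (intro eq_matI) auto
  qed
  have "four_block_mat A (0\<^sub>m n m) (B\<^sup>T) S * four_block_mat (1\<^sub>m n) (minv A * B) (0\<^sub>m m n) (1\<^sub>m m) = M"
    unfolding M_def
    using A' B Ainv S_carrier X AX SC
    by (subst mult_four_block_mat[of _ n n _ m _ m _ _ n _ m]) auto
  then show ?thesis unfolding T 1 by simp
qed

lemma qform_block_diag:
  assumes "X \<in> carrier_mat n n" "Y \<in> carrier_mat m m" "u \<in> carrier_vec n" "v \<in> carrier_vec m"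
  shows "qform (four_block_mat X (0\<^sub>m n m) (0\<^sub>m m n) Y) (u @\<^sub>v v) = qform X u + qform Y v"
proof -
  have "four_block_mat X (0\<^sub>m n m) (0\<^sub>m m n) Y *\<^sub>v (u @\<^sub>v v) = (X *\<^sub>v u) @\<^sub>v (Y *\<^sub>v v)"
    using assms by (subst four_block_mat_mult_vec[of _ n n _ m _ m]) auto
  then show ?thesis using assms by (simp add: scalar_prod_append[of _ n _ m])
qed

text \<open>Completing the square in \<open>u\<close>: for fixed \<open>v\<close> everything except
  \<open>qform S v\<close> sits in one term, so for definite \<open>A\<close> the Schur complement
  is the minimum of the form over \<open>u\<close>.\<close>

lemma qform_M:
  assumes u: "u \<in> carrier_vec n" and v: "v \<in> carrier_vec m"
  shows "qform M (u @\<^sub>v v) = qform A (u + minv A *\<^sub>v (B *\<^sub>v v)) + qform S v"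
proof -
  let ?T = "four_block_mat (1\<^sub>m n) (minv A * B) (0\<^sub>m m n) (1\<^sub>m m)"
  let ?D = "four_block_mat A (0\<^sub>m n m) (0\<^sub>m m n) S"
  have X: "minv A * B \<in> carrier_mat n m" using Ainv B by auto
  have c: "?T \<in> carrier_mat (n + m) (n + m)" "?D \<in> carrier_mat (n + m) (n + m)" "u @\<^sub>v v \<in> carrier_vec (n + m)"
    using A' S_carrier X u v by auto
  have Tv: "?T *\<^sub>v (u @\<^sub>v v) = (u + minv A *\<^sub>v (B *\<^sub>v v)) @\<^sub>v v"
    using X u v Ainv B
    by (subst four_block_mat_mult_vec[of _ n n _ m _ m]) (auto simp: assoc_mult_mat_vec[of _ n n _ m])
  have "qform M (u @\<^sub>v v) = qform ?D (?T *\<^sub>v (u @\<^sub>v v))"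
    unfolding M_factor by (rule qform_congruence[OF c(2,1,3)])
  also have "\<dots> = qform A (u + minv A *\<^sub>v (B *\<^sub>v v)) + qform S v"
    unfolding Tv using A' S_carrier u v Ainv B by (intro qform_block_diag) auto
  finally show ?thesis .
qed

lemma det_M: "det M = det A * det S"
proof -
  let ?T = "four_block_mat (1\<^sub>m n) (minv A * B) (0\<^sub>m m n) (1\<^sub>m m)"
  let ?D = "four_block_mat A (0\<^sub>m n m) (0\<^sub>m m n) S"
  have X: "minv A * B \<in> carrier_mat n m" using Ainv B by auto
  have T: "?T \<in> carrier_mat (n + m) (n + m)" "det ?T = 1"
    using X by (auto simp: det_four_block_mat_lower_left_zero[of _ n _ m])
  have D: "?D \<in> carrier_mat (n + m) (n + m)" "det ?D = det A * det S"
    using A' S_carrier by (auto simp: det_four_block_mat_lower_left_zero[of _ n _ m])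
  have TT: "?T\<^sup>T \<in> carrier_mat (n + m) (n + m)" using T by simp
  have "?T\<^sup>T * ?D \<in> carrier_mat (n + m) (n + m)" using TT D(1) by (rule mult_carrier_mat)
  then show ?thesis
    unfolding M_factor det_mult[OF \<open>?T\<^sup>T * ?D \<in> _\<close> T(1)] det_mult[OF TT D(1)]
      det_transpose[OF T(1)] T(2) D(2) by simp
qed

lemma qform_M_ge:
  assumes "pd n A" "u \<in> carrier_vec n" "v \<in> carrier_vec m"
  shows "qform S v \<le> qform M (u @\<^sub>v v)"
proof -
  have "qform A (u + minv A *\<^sub>v (B *\<^sub>v v)) \<ge> 0"
    by (rule psdD[OF pd_psd[OF assms(1) A'(1)]]) (use assms Ainv B in auto)
  then show ?thesis using qform_M[OF assms(2,3)] by simp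
qed

text \<open>The choice u = - A^(-1) B v annihilates the completed square, so the value is taken and
  is not merely a bound.\<close>

lemma qform_M_attained:
  assumes "v \<in> carrier_vec m"
  shows "\<exists>u \<in> carrier_vec n. qform M (u @\<^sub>v v) = qform S v"
proof -
  let ?w = "minv A *\<^sub>v (B *\<^sub>v v)"
  have w: "?w \<in> carrier_vec n" using Ainv B assms by auto
  have "- ?w + ?w = 0\<^sub>v n" using w by auto
  then have "qform M ((- ?w) @\<^sub>v v) = qform S v"
    using qform_M[of "- ?w" v] w assms A' by simp
  then show ?thesis using w by (intro bexI[of _ "- ?w"]) auto
qed

lemma psd_S:
  assumes "psd (n + m) M" shows "psd m S"
  unfolding psd_def
proof
  fix v :: "real vec" assume v: "v \<in> carrier_vec m"
  obtain u where "u \<in> carrier_vec n" "qform M (u @\<^sub>v v) = qform S v" using qform_M_attained[OF v] by auto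
  then show "qform S v \<ge> 0" using psdD[OF assms, of "u @\<^sub>v v"] v by auto
qed

lemma pd_M_iff:
  assumes pdA: "pd n A" shows "pd (n + m) M \<longleftrightarrow> pd m S"
proof
  assume M: "pd (n + m) M"
  show "pd m S" unfolding pd_def
  proof (intro ballI impI)
    fix v :: "real vec" assume v: "v \<in> carrier_vec m" "v \<noteq> 0\<^sub>v m"
    obtain u where u: "u \<in> carrier_vec n" "qform M (u @\<^sub>v v) = qform S v" using qform_M_attained[OF v(1)] by auto
    have "u @\<^sub>v v \<noteq> 0\<^sub>v n @\<^sub>v 0\<^sub>v m" using u v by (simp add: append_vec_eq[of _ n])
    moreover have "0\<^sub>v n @\<^sub>v 0\<^sub>v m = (0\<^sub>v (n + m) :: real vec)" by (intro eq_vecI) auto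
    ultimately show "qform S v > 0" using pdD[OF M, of "u @\<^sub>v v"] u v by auto
  qed
next
  assume S: "pd m S"
  show "pd (n + m) M" unfolding pd_def
  proof (intro ballI impI)
    fix x :: "real vec" assume x: "x \<in> carrier_vec (n + m)" "x \<noteq> 0\<^sub>v (n + m)"
    define u v where "u = vec_first x n" and "v = vec_last x m"
    have uv: "u \<in> carrier_vec n" "v \<in> carrier_vec m" "x = u @\<^sub>v v"
      using x(1) unfolding u_def v_def by auto
    have zz: "0\<^sub>v n @\<^sub>v 0\<^sub>v m = (0\<^sub>v (n + m) :: real vec)" by (intro eq_vecI) auto
    \<comment> \<open>For \<open>v = 0\<close> the Schur part vanishes and positivity must come from
      \<open>A\<close> at a nonzero \<open>u\<close>.\<close>
    show "qform M x > 0"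
    proof (cases "v = 0\<^sub>v m")
      case False
      then have "qform S v > 0" using pdD[OF S uv(2)] by auto
      then show ?thesis using qform_M_ge[OF pdA uv(1,2)] unfolding uv(3) by simp
    next
      case True
      then have "u \<noteq> 0\<^sub>v n" using x(2) zz uv(3) by auto
      then have "qform A u > 0" using pdD[OF pdA uv(1)] by auto
      moreover have "u + minv A *\<^sub>v (B *\<^sub>v v) = u"
        using uv mult_mat_vec_zero[OF B] mult_mat_vec_zero[OF Ainv(1)] by (simp add: True)
      ultimately show ?thesis unfolding uv(3) qform_M[OF uv(1,2)] using True S_carrier by simp
    qed
  qed
qed

end

section \<open>Bordered matrices: Sylvester's criterion and Cholesky factors\<close>

definition lead :: "nat \<Rightarrow> real mat \<Rightarrow> real mat" where
  "lead n A = Matrix.mat n n (\<lambda>ij. A $$ ij)"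

definition lastcol :: "nat \<Rightarrow> real mat \<Rightarrow> real mat" where
  "lastcol n A = Matrix.mat n 1 (\<lambda>(i, _). A $$ (i, n))"

definition mat1 :: "real \<Rightarrow> real mat" where
  "mat1 c = Matrix.mat 1 1 (\<lambda>_. c)"

lemma lead_carrier[simp]: "lead n A \<in> carrier_mat n n"
  and lastcol_carrier[simp]: "lastcol n A \<in> carrier_mat n 1"
  and mat1_carrier[simp]: "mat1 c \<in> carrier_mat 1 1"
  by (auto simp: lead_def lastcol_def mat1_def)

lemma lastcol_carrier'[simp]: "lastcol n A \<in> carrier_mat n (Suc 0)"
  and mat1_carrier'[simp]: "mat1 c \<in> carrier_mat (Suc 0) (Suc 0)"
  by (auto simp: lastcol_def mat1_def)

lemma lastcol_dim[simp]: "dim_row (lastcol n A) = n" "dim_col (lastcol n A) = 1"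
  by (auto simp: lastcol_def)

lemma lead_index[simp]: "i < n \<Longrightarrow> j < n \<Longrightarrow> lead n A $$ (i, j) = A $$ (i, j)"
  by (auto simp: lead_def)

lemma sym_lead: "sym_mat (Suc n) A \<Longrightarrow> sym_mat n (lead n A)"
  by (intro sym_matI) (auto simp: lead_def sym_mat_index)

lemma sym_mat1[simp]: "sym_mat 1 (mat1 c)" "sym_mat (Suc 0) (mat1 c)"
  by (auto simp: sym_mat_def mat1_def intro!: eq_matI)

lemma det_mat1[simp]: "det (mat1 c) = c"
  using det_single[of "mat1 c"] by (auto simp: mat1_def)

lemma pd_mat1[simp]: "pd 1 (mat1 c) \<longleftrightarrow> c > 0"
proof
  assume "pd 1 (mat1 c)"
  then have "qform (mat1 c) (unit_vec 1 0) > 0" by (rule pdD) (auto simp: unit_vec_nonzero)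
  then show "c > 0" by (simp add: mat1_def scalar_prod_def)
next
  assume "c > 0"
  show "pd 1 (mat1 c)" unfolding pd_def
  proof (intro ballI impI)
    fix v :: "real vec" assume v: "v \<in> carrier_vec 1" "v \<noteq> 0\<^sub>v 1"
    then have "v $ 0 \<noteq> 0" by (metis carrier_vecD eq_vecI index_zero_vec less_one)
    then have "c * (v $ 0)\<^sup>2 > 0" using \<open>c > 0\<close> by simp
    then show "qform (mat1 c) v > 0" using v
      by (simp add: mat1_def scalar_prod_def power2_eq_square mult.left_commute)
  qed
qed

lemmas pd_mat1'[simp] = pd_mat1[unfolded One_nat_def]

lemma split_last:
  assumes "sym_mat (Suc n) A"
  shows "A = four_block_mat (lead n A) (lastcol n A) (lastcol n A)\<^sup>T (mat1 (A $$ (n, n)))"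
proof (rule eq_matI)
  have A: "A \<in> carrier_mat (Suc n) (Suc n)" using sym_matD(1)[OF assms] .
  fix i j assume "i < dim_row (four_block_mat (lead n A) (lastcol n A) (lastcol n A)\<^sup>T (mat1 (A $$ (n, n))))"
    "j < dim_col (four_block_mat (lead n A) (lastcol n A) (lastcol n A)\<^sup>T (mat1 (A $$ (n, n))))"
  then have "i < Suc n" "j < Suc n" by (auto simp: lead_def mat1_def)
  then show "A $$ (i, j) = four_block_mat (lead n A) (lastcol n A) (lastcol n A)\<^sup>T (mat1 (A $$ (n, n))) $$ (i, j)"
    using sym_mat_index[OF assms, of i j]
    by (auto simp: lead_def mat1_def lastcol_def less_Suc_eq)
qed (use sym_matD(1)[OF assms] in \<open>auto simp: lead_def mat1_def\<close>)

lemma schur_block_last: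
  assumes "sym_mat (Suc n) A" "det (lead n A) \<noteq> 0"
  shows "schur_block n 1 (lead n A) (lastcol n A) (mat1 (A $$ (n, n)))"
  using assms sym_lead by unfold_locales auto

text \<open>The last pivot, kept as a scalar expression in the last column because the Beta integral
  is later taken over exactly that column and the corner entry.\<close>

definition schur_last :: "nat \<Rightarrow> real mat \<Rightarrow> real" where
  "schur_last n A = A $$ (n, n) - qform (minv (lead n A)) (vec n (\<lambda>i. A $$ (i, n)))"

lemma schur_last_eq:
  assumes "sym_mat (Suc n) A" "det (lead n A) \<noteq> 0"
  shows "schur_block.S (lead n A) (lastcol n A) (mat1 (A $$ (n, n))) = mat1 (schur_last n A)"
proof -
  interpret schur_block n 1 "lead n A" "lastcol n A" "mat1 (A $$ (n, n))"
    by (rule schur_block_last[OF assms])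
  have "col (lastcol n A) 0 = vec n (\<lambda>i. A $$ (i, n))" by (auto simp: lastcol_def)
  then have q: "((lastcol n A)\<^sup>T * minv (lead n A) * lastcol n A) $$ (0, 0)
      = qform (minv (lead n A)) (vec n (\<lambda>i. A $$ (i, n)))"
    using Ainv(1) B
    by (subst assoc_mult_mat[of _ 1 n _ n _ 1]) (auto simp: scalar_prod_def lastcol_def intro!: sum.cong)
  have "(mat1 (A $$ (n, n)) - (lastcol n A)\<^sup>T * minv (lead n A) * lastcol n A) $$ (0, 0)
      = mat1 (A $$ (n, n)) $$ (0, 0) - ((lastcol n A)\<^sup>T * minv (lead n A) * lastcol n A) $$ (0, 0)"
    by (rule index_minus_mat(1)) (auto simp: lastcol_def)
  then have "S $$ (0, 0) = schur_last n A"
    unfolding S_def schur_last_def q by (simp add: mat1_def)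
  then show ?thesis using S_carrier by (intro eq_matI) (auto simp: mat1_def)
qed

lemma schur_last:
  assumes "sym_mat (Suc n) A" "det (lead n A) \<noteq> 0"
  shows "det A = det (lead n A) * schur_last n A"
    and "pd n (lead n A) \<Longrightarrow> pd (Suc n) A \<longleftrightarrow> schur_last n A > 0"
proof -
  interpret schur_block n 1 "lead n A" "lastcol n A" "mat1 (A $$ (n, n))"
    by (rule schur_block_last[OF assms])
  have M: "M = A" unfolding M_def using split_last[OF assms(1)] by simp
  note S = schur_last_eq[OF assms]
  show "det A = det (lead n A) * schur_last n A" using det_M unfolding M S by simp
  show "pd n (lead n A) \<Longrightarrow> pd (Suc n) A \<longleftrightarrow> schur_last n A > 0"
    using pd_M_iff unfolding M S by simp
qed

lemma pd_lead:
  assumes "pd (Suc n) A" "A \<in> carrier_mat (Suc n) (Suc n)" shows "pd n (lead n A)"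
  unfolding pd_def
proof (intro ballI impI)
  fix v :: "real vec" assume v: "v \<in> carrier_vec n" "v \<noteq> 0\<^sub>v n"
  define w where "w = vec (Suc n) (\<lambda>i. if i < n then v $ i else 0)"
  have w: "w \<in> carrier_vec (Suc n)" by (auto simp: w_def)
  obtain i where "i < n" "v $ i \<noteq> 0" using v by (metis carrier_vecD eq_vecI index_zero_vec)
  then have "w $ i \<noteq> 0" by (simp add: w_def)
  then have "w \<noteq> 0\<^sub>v (Suc n)" using \<open>i < n\<close> by auto
  then have "0 < qform A w" using pdD[OF assms(1) w] by simp
  also have "qform A w = qform (lead n A) v"
    unfolding qform_sum[OF assms(2) w] qform_sum[OF lead_carrier v(1)]
    by (simp add: w_def)
  finally show "qform (lead n A) v > 0" .
qed

lemma pd_det_pos: "sym_mat n A \<Longrightarrow> pd n A \<Longrightarrow> det A > 0"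
proof (induction n arbitrary: A)
  case 0
  then show ?case using det_dim_zero by (auto simp: sym_mat_def)
next
  case (Suc n)
  have l: "pd n (lead n A)" using pd_lead[OF Suc(3)] Suc(2) by (auto simp: sym_mat_def)
  have "det (lead n A) > 0" using Suc(1)[OF sym_lead[OF Suc(2)] l] .
  then show ?case using schur_last[OF Suc(2)] l Suc(3) by simp
qed

lemma pd_Suc_iff:
  assumes "sym_mat (Suc n) A"
  shows "pd (Suc n) A \<longleftrightarrow> pd n (lead n A) \<and> det A > 0"
proof
  assume "pd (Suc n) A"
  then show "pd n (lead n A) \<and> det A > 0"
    using pd_lead pd_det_pos[OF assms] assms by (auto simp: sym_mat_def)
next
  assume *: "pd n (lead n A) \<and> det A > 0"
  then have "det (lead n A) > 0" using pd_det_pos[OF sym_lead[OF assms]] by auto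
  then show "pd (Suc n) A" using * schur_last[OF assms] by (auto simp: zero_less_mult_iff)
qed

lemma lead_lead: "m \<le> n \<Longrightarrow> lead m (lead n A) = lead m A"
  by (intro eq_matI) (auto simp: lead_def)

lemma lead_self: "A \<in> carrier_mat n n \<Longrightarrow> lead n A = A"
  by (intro eq_matI) (auto simp: lead_def)

text \<open>Replaces the quantifier over all vectors in \<open>pd\<close> by finitely many
  determinant inequalities, which is what makes sets defined by definiteness measurable.\<close>

lemma sylvester_criterion:
  "sym_mat n A \<Longrightarrow> pd n A \<longleftrightarrow> (\<forall>m \<in> {1..n}. det (lead m A) > 0)"
proof (induction n arbitrary: A)
  case 0
  then show ?case by (auto simp: pd_def)
next
  case (Suc n)
  have "(\<forall>m \<in> {1..Suc n}. det (lead m A) > 0) \<longleftrightarrow> (\<forall>m \<in> {1..n}. det (lead m (lead n A)) > 0) \<and> det A > 0"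
    using Suc(2) by (auto simp: atLeastAtMostSuc_conv lead_lead lead_self sym_mat_def)
  then show ?case using Suc.IH[OF sym_lead[OF Suc(2)]] pd_Suc_iff[OF Suc(2)] by simp
qed

text \<open>The positive diagonal is part of the notion, so such a matrix is invertible and its
  determinant is a positive product.\<close>

definition lower_tri :: "nat \<Rightarrow> real mat \<Rightarrow> bool" where
  "lower_tri n C \<longleftrightarrow> C \<in> carrier_mat n n \<and> (\<forall>i<n. \<forall>j<n. i < j \<longrightarrow> C $$ (i, j) = 0) \<and> (\<forall>i<n. C $$ (i, i) > 0)"

lemma det_lower_tri:
  assumes "lower_tri n C" shows "det C = (\<Prod>i<n. C $$ (i, i))"
  using assms det_lower_triangular[of n C] unfolding lower_tri_def
  by (auto simp: diag_mat_def prod.distinct_set_conv_list[symmetric] atLeast0LessThan)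

lemma mat_add_minus_cancel:
  "X \<in> carrier_mat n m \<Longrightarrow> Y \<in> carrier_mat n m \<Longrightarrow> X + (Y - X) = (Y :: real mat)"
  by (intro eq_matI) auto

text \<open>Bordering: if the leading block is C C^T, the new row is X^T with C X equal to the last
  column, and the new diagonal entry is the root of the last pivot. The factors serve to split
  substitutions in integrals into triangular ones.\<close>

lemma cholesky:
  "sym_mat n A \<Longrightarrow> pd n A \<Longrightarrow> \<exists>C. lower_tri n C \<and> A = C * C\<^sup>T"
proof (induction n arbitrary: A)
  case 0
  then show ?case by (intro exI[of _ A]) (auto simp: sym_mat_def lower_tri_def)
next
  case (Suc n)
  let ?L = "lead n A"
  have l: "pd n ?L" using pd_lead[OF Suc(3)] Suc(2) by (auto simp: sym_mat_def)
  have dl: "det ?L \<noteq> 0" using pd_det_nonzero[OF l] by auto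
  obtain C where LC: "lower_tri n C" "?L = C * C\<^sup>T" using Suc(1)[OF sym_lead[OF Suc(2)] l] by auto
  have Cc: "C \<in> carrier_mat n n" using LC by (auto simp: lower_tri_def)
  have dC: "det C \<noteq> 0" using LC(1) det_lower_tri[OF LC(1)] unfolding lower_tri_def
    by (metis (no_types, lifting) lessThan_iff prod_pos less_irrefl)
  note i = minv_props[OF Cc dC]
  let ?B = "lastcol n A"
  define X where "X = minv C * ?B"
  define s where "s = schur_last n A"
  have s: "s > 0" unfolding s_def using schur_last(2)[OF Suc(2) dl l] Suc(3) by simp
  have X: "X \<in> carrier_mat n 1" using i unfolding X_def by (intro mult_carrier_mat[of _ n n]) auto
  interpret schur_block n 1 "?L" "?B" "mat1 (A $$ (n, n))"
    by (rule schur_block_last[OF Suc(2) dl])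
  have CX: "C * X = ?B" unfolding X_def using i Cc left_mult_one_mat[OF lastcol_carrier]
    by (subst assoc_mult_mat[symmetric, of _ n n _ n _ 1]) auto
  have "C * C\<^sup>T * ((minv C)\<^sup>T * minv C) = C * ((C\<^sup>T * (minv C)\<^sup>T) * minv C)"
    using Cc i by (simp add: assoc_mult_mat[of _ n n _ n _ n])
  also have "C\<^sup>T * (minv C)\<^sup>T = 1\<^sub>m n" using transpose_mult[OF i(1) Cc] i by simp
  also have "C * (1\<^sub>m n * minv C) = 1\<^sub>m n" using i Cc by simp
  finally have mL: "minv ?L = (minv C)\<^sup>T * minv C" using LC(2) Cc i
    by (intro minv_unique[of _ n]) auto
  \<comment> \<open>X^T X is the term that the Schur complement subtracts from the corner, so adding
    the pivot \<open>s\<close> restores the corner entry.\<close>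
  have XX: "X\<^sup>T * X = ?B\<^sup>T * minv ?L * ?B"
  proof -
    have "X\<^sup>T = ?B\<^sup>T * (minv C)\<^sup>T" unfolding X_def by (rule transpose_mult[OF i(1) lastcol_carrier])
    then have "X\<^sup>T * X = ?B\<^sup>T * (minv C)\<^sup>T * (minv C * ?B)" unfolding X_def by simp
    also have "\<dots> = ?B\<^sup>T * ((minv C)\<^sup>T * (minv C * ?B))"
      using i by (intro assoc_mult_mat[of _ 1 n _ n _ 1]) auto
    also have "(minv C)\<^sup>T * (minv C * ?B) = minv ?L * ?B"
      unfolding mL using i by (intro assoc_mult_mat[symmetric, of _ n n _ n _ 1]) auto
    also have "?B\<^sup>T * (minv ?L * ?B) = ?B\<^sup>T * minv ?L * ?B"
      using Ainv by (intro assoc_mult_mat[symmetric, of _ 1 n _ n _ 1]) auto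
    finally show ?thesis .
  qed
  have ss: "mat1 (sqrt s) * mat1 (sqrt s) = mat1 s" using s
    by (auto simp: mat1_def scalar_prod_def intro!: eq_matI)
  have sT: "(mat1 (sqrt s))\<^sup>T = mat1 (sqrt s)" using sym_mat1 by (auto simp: sym_mat_def)
  have XS: "X\<^sup>T * X + mat1 s = mat1 (A $$ (n, n))"
  proof -
    have "S = mat1 s" using schur_last_eq[OF Suc(2) dl] by (simp add: s_def)
    moreover have "X\<^sup>T * X + S = mat1 (A $$ (n, n))" unfolding XX S_def
      using Ainv by (intro mat_add_minus_cancel[of _ 1]) (auto simp: mat1_def intro!: mult_carrier_mat[of _ _ n])
    ultimately show ?thesis by simp
  qed
  define D where "D = four_block_mat C (0\<^sub>m n 1) X\<^sup>T (mat1 (sqrt s))"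
  have DT: "D\<^sup>T = four_block_mat C\<^sup>T X (0\<^sub>m 1 n) (mat1 (sqrt s))"
    unfolding D_def using Cc X by (subst transpose_four_block_mat[of _ n n _ 1 _ 1]) (auto simp: sT)
  have XC: "X\<^sup>T * C\<^sup>T = ?B\<^sup>T" using transpose_mult[OF Cc X] CX by simp
  have "D * D\<^sup>T = four_block_mat (C * C\<^sup>T + 0\<^sub>m n 1 * 0\<^sub>m 1 n) (C * X + 0\<^sub>m n 1 * mat1 (sqrt s))
     (X\<^sup>T * C\<^sup>T + mat1 (sqrt s) * 0\<^sub>m 1 n) (X\<^sup>T * X + mat1 (sqrt s) * mat1 (sqrt s))"
    unfolding DT unfolding D_def by (rule mult_four_block_mat) (use Cc X in auto)
  also have "\<dots> = four_block_mat ?L ?B ?B\<^sup>T (mat1 (A $$ (n, n)))"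
  proof -
    have "C * C\<^sup>T + 0\<^sub>m n 1 * 0\<^sub>m 1 n = ?L" using LC Cc by simp
    moreover have "C * X + 0\<^sub>m n 1 * mat1 (sqrt s) = ?B"
      unfolding CX left_mult_zero_mat[OF mat1_carrier] by (rule right_add_zero_mat) simp
    moreover have "X\<^sup>T * C\<^sup>T + mat1 (sqrt s) * 0\<^sub>m 1 n = ?B\<^sup>T" unfolding XC
      using right_mult_zero_mat[OF mat1_carrier, of "sqrt s" n] by simp
    ultimately show ?thesis unfolding ss XS by simp
  qed
  also have "\<dots> = A" using split_last[OF Suc(2)] by simp
  finally have "A = D * D\<^sup>T" by simp
  moreover have "lower_tri (Suc n) D"
    using LC(1) s X Cc unfolding lower_tri_def D_def
    by (auto simp: less_Suc_eq mat1_def four_block_mat_def Let_def)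
  ultimately show ?case by blast
qed

subsection \<open>The spectral theorem and square roots\<close>

text \<open>A complex eigenvector x + i y exists. Symmetry equates x . (A y) with (A x) . y, which
  forces Im l (x . x + y . y) = 0; so the eigenvalue is real, and whichever of x, y is nonzero is a
  real eigenvector.\<close>

lemma real_sym_eigenvector:
  assumes A: "sym_mat n A" and n: "n > 0"
  shows "\<exists>v l. v \<in> carrier_vec n \<and> v \<noteq> 0\<^sub>v n \<and> A *\<^sub>v v = l \<cdot>\<^sub>v v"
proof -
  have Ac: "A \<in> carrier_mat n n" using A by (auto simp: sym_mat_def)
  let ?A = "map_mat complex_of_real A"
  have cA: "?A \<in> carrier_mat n n" using Ac by auto
  obtain l where "eigenvalue ?A l" using spectrum_non_empty[OF cA n] unfolding spectrum_def by auto
  then obtain z where z: "z \<in> carrier_vec n" "z \<noteq> 0\<^sub>v n" "?A *\<^sub>v z = l \<cdot>\<^sub>v z"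
    unfolding eigenvalue_def eigenvector_def using Ac by auto
  define x where "x = map_vec Re z"
  define y where "y = map_vec Im z"
  have xy: "x \<in> carrier_vec n" "y \<in> carrier_vec n" using z by (auto simp: x_def y_def)
  have idx: "(\<Sum>j<n. complex_of_real (A $$ (i, j)) * z $ j) = l * z $ i" if "i < n" for i
    using arg_cong[OF z(3), of "\<lambda>v. v $ i"] that z(1) Ac
    by (simp add: scalar_prod_def atLeast0LessThan)
  have Ax: "A *\<^sub>v x = Re l \<cdot>\<^sub>v x - Im l \<cdot>\<^sub>v y"
  proof (rule eq_vecI)
    fix i assume "i < dim_vec (Re l \<cdot>\<^sub>v x - Im l \<cdot>\<^sub>v y)"
    then have i: "i < n" using xy by simp
    show "(A *\<^sub>v x) $ i = (Re l \<cdot>\<^sub>v x - Im l \<cdot>\<^sub>v y) $ i"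
      using arg_cong[OF idx[OF i], of Re] i xy z(1) Ac
      by (simp add: scalar_prod_def atLeast0LessThan x_def y_def)
  qed (use xy Ac in auto)
  have Ay: "A *\<^sub>v y = Im l \<cdot>\<^sub>v x + Re l \<cdot>\<^sub>v y"
  proof (rule eq_vecI)
    fix i assume "i < dim_vec (Im l \<cdot>\<^sub>v x + Re l \<cdot>\<^sub>v y)"
    then have i: "i < n" using xy by simp
    show "(A *\<^sub>v y) $ i = (Im l \<cdot>\<^sub>v x + Re l \<cdot>\<^sub>v y) $ i"
      using arg_cong[OF idx[OF i], of Im] i xy z(1) Ac
      by (simp add: scalar_prod_def atLeast0LessThan x_def y_def)
  qed (use xy Ac in auto)
  have "x \<bullet> (A *\<^sub>v y) = (A *\<^sub>v x) \<bullet> y"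
    using scalar_prod_transpose[OF Ac xy] sym_matD(2)[OF A] by simp
  then have "Im l * (x \<bullet> x + y \<bullet> y) = 0"
    unfolding Ax Ay using xy
    by (simp add: scalar_prod_add_distrib[of _ n] minus_scalar_prod_distrib[of _ n] algebra_simps
        comm_scalar_prod[of x n y])
  moreover have nz: "x \<noteq> 0\<^sub>v n \<or> y \<noteq> 0\<^sub>v n"
  proof (rule ccontr)
    assume "\<not> ?thesis"
    then have "x = 0\<^sub>v n" "y = 0\<^sub>v n" by auto
    have "z = 0\<^sub>v n"
    proof (rule eq_vecI)
      fix i assume "i < dim_vec (0\<^sub>v n :: complex vec)"
      then have i: "i < n" by simp
      have "x $ i = 0" "y $ i = 0" using \<open>x = 0\<^sub>v n\<close> \<open>y = 0\<^sub>v n\<close> i by auto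
      then show "z $ i = 0\<^sub>v n $ i" using i z(1) by (simp add: x_def y_def complex_eq_iff)
    qed (use z in auto)
    then show False using z by simp
  qed
  then have "x \<bullet> x + y \<bullet> y > 0"
    using scalar_self_pos[OF xy(1)] scalar_self_pos[OF xy(2)] scalar_self_nonneg[of x] scalar_self_nonneg[of y]
    by linarith
  ultimately have "Im l = 0" by auto
  then have "A *\<^sub>v x = Re l \<cdot>\<^sub>v x" "A *\<^sub>v y = Re l \<cdot>\<^sub>v y"
    unfolding Ax Ay using xy by auto
  then show ?thesis using nz xy by blast
qed

text \<open>Reflection in the hyperplane orthogonal to v - e_0 exchanges the two unit vectors. For v
  = e_0 there is no such hyperplane and the identity serves.\<close>

lemma householder_reflection:
  assumes v: "v \<in> carrier_vec n" "v \<bullet> v = (1 :: real)" and n: "n > 0"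
  shows "\<exists>Q. sym_mat n Q \<and> Q * Q = 1\<^sub>m n \<and> Q *\<^sub>v unit_vec n 0 = v"
proof (cases "v = unit_vec n 0")
  case True
  then show ?thesis by (intro exI[of _ "1\<^sub>m n"]) auto
next
  case False
  define w where "w = v - unit_vec n 0"
  define c where "c = 2 / (w \<bullet> w)"
  have w: "w \<in> carrier_vec n" using v by (auto simp: w_def)
  have "w \<noteq> 0\<^sub>v n"
  proof
    assume "w = 0\<^sub>v n"
    then have "v = unit_vec n 0"
      using v by (intro eq_vecI) (auto simp: w_def vec_eq_iff)
    then show False using False by simp
  qed
  then have ww: "w \<bullet> w > 0" using scalar_self_pos[OF w] by simp
  have cw: "c * (w \<bullet> w) = 2" using ww by (simp add: c_def)
  \<comment> \<open>Since both vectors have length one, w . w = - 2 w_0; this yields c w_0 = -1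
    below.\<close>
  have www: "w \<bullet> w = 2 - 2 * v $ 0"
  proof -
    have "w \<bullet> w = v \<bullet> v - v \<bullet> unit_vec n 0 - (unit_vec n 0 \<bullet> v - unit_vec n 0 \<bullet> unit_vec n 0)"
      unfolding w_def using v by (simp add: scalar_prod_minus_distrib[of _ n] minus_scalar_prod_distrib[of _ n])
    then show ?thesis using v n by (simp add: scalar_prod_left_unit scalar_prod_right_unit)
  qed
  define Q where "Q = Matrix.mat n n (\<lambda>(i, j). (if i = j then 1 else 0) - c * w $ i * w $ j)"
  have Q: "Q \<in> carrier_mat n n" by (auto simp: Q_def)
  have sumw: "(\<Sum>k<n. w $ k * w $ k) = w \<bullet> w" using w by (simp add: scalar_prod_def atLeast0LessThan)
  have "Q * Q = 1\<^sub>m n"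
  proof (rule eq_matI)
    fix i j assume "i < dim_row (1\<^sub>m n :: real mat)" "j < dim_col (1\<^sub>m n :: real mat)"
    then have ij: "i < n" "j < n" by auto
    have "(Q * Q) $$ (i, j) = (\<Sum>k<n. ((if i = k then 1 else 0) - c * w $ i * w $ k) *
        ((if k = j then 1 else 0) - c * w $ k * w $ j))"
      using ij by (simp add: Q_def scalar_prod_def atLeast0LessThan)
    also have "\<dots> = (\<Sum>k<n. (if i = k then (if k = j then 1 else 0) else 0)
       - (if k = j then c * w $ i * w $ k else 0) - (if i = k then c * w $ k * w $ j else 0)
       + c * c * w $ i * w $ j * (w $ k * w $ k))"
      by (intro sum.cong) (auto simp: algebra_simps)
    also have "\<dots> = (if i = j then 1 else 0) - c * w $ i * w $ j - c * w $ i * w $ j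
       + c * c * w $ i * w $ j * (w \<bullet> w)"
      using ij by (simp add: sum.distrib sum_subtractf sum_distrib_left[symmetric] sumw sum.delta sum.delta')
    also have "c * c * w $ i * w $ j * (w \<bullet> w) = c * w $ i * w $ j * (c * (w \<bullet> w))"
      by (simp add: algebra_simps)
    also have "\<dots> = 2 * (c * w $ i * w $ j)" unfolding cw by simp
    finally show "(Q * Q) $$ (i, j) = 1\<^sub>m n $$ (i, j)" using ij by simp
  qed (use Q in auto)
  moreover have "Q *\<^sub>v unit_vec n 0 = v"
  proof (rule eq_vecI)
    fix i assume "i < dim_vec v"
    then have i: "i < n" using v by simp
    have w0: "w $ 0 = v $ 0 - 1" using n v by (simp add: w_def)
    have "c * w $ 0 = -1"
      using ww www unfolding c_def w0 by (simp add: field_simps)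
    moreover have "(Q *\<^sub>v unit_vec n 0) $ i = (if i = 0 then 1 else 0) - c * w $ 0 * w $ i"
      using i n Q by (simp add: scalar_prod_right_unit) (simp add: Q_def)
    ultimately show "(Q *\<^sub>v unit_vec n 0) $ i = v $ i"
      using i n v by (simp add: w_def)
  qed (use Q v in auto)
  moreover have "sym_mat n Q" by (intro sym_matI) (auto simp: Q_def)
  ultimately show ?thesis by blast
qed

text \<open>Deflation: a reflection carries a unit eigenvector to e_0; by symmetry the first row and
  column of the conjugated matrix vanish off the corner, and the induction hypothesis diagonalises
  the remaining block.\<close>

lemma spectral_theorem:
  "sym_mat n A \<Longrightarrow> \<exists>V d. V \<in> carrier_mat n n \<and> V\<^sup>T * V = 1\<^sub>m n \<and> V * V\<^sup>T = 1\<^sub>m n \<and> A = V * mat_diag n d * V\<^sup>T"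
proof (induction n arbitrary: A)
  case 0
  then show ?case
    by (intro exI[of _ "1\<^sub>m 0"] exI[of _ "\<lambda>_. 0"]) (auto simp: sym_mat_def intro!: eq_matI)
next
  case (Suc n)
  let ?N = "Suc n"
  note A = sym_matD[OF Suc(2)]
  obtain u l where u: "u \<in> carrier_vec ?N" "u \<noteq> 0\<^sub>v ?N" "A *\<^sub>v u = l \<cdot>\<^sub>v u"
    using real_sym_eigenvector[OF Suc(2)] by auto
  define v where "v = (1 / sqrt (u \<bullet> u)) \<cdot>\<^sub>v u"
  have uu: "u \<bullet> u > 0" using scalar_self_pos[OF u(1,2)] .
  have v: "v \<in> carrier_vec ?N" "v \<bullet> v = 1"
    using u uu by (auto simp: v_def smult_scalar_prod_distrib[of _ ?N] scalar_prod_smult_distrib[of _ ?N])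
  have Av: "A *\<^sub>v v = l \<cdot>\<^sub>v v"
    unfolding v_def using u A by (simp add: mult_mat_vec[of _ ?N ?N] smult_smult_assoc mult.commute)
  obtain Q where Q: "sym_mat ?N Q" "Q * Q = 1\<^sub>m ?N" "Q *\<^sub>v unit_vec ?N 0 = v"
    using householder_reflection[OF v] by auto
  note Qc = sym_matD[OF Q(1)]
  define E where "E = Q * A * Q"
  have E: "sym_mat ?N E" unfolding E_def using sym_mat_congruence[OF Suc(2) Qc(1)] Qc by simp
  note Ec = sym_matD[OF E]
  have Qv: "Q *\<^sub>v v = unit_vec ?N 0"
  proof -
    have "Q *\<^sub>v v = (Q * Q) *\<^sub>v unit_vec ?N 0" unfolding Q(3)[symmetric] using Qc by (simp add: assoc_mult_mat_vec[of _ ?N ?N _ ?N])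
    then show ?thesis using Q(2) by simp
  qed
  have Ee: "E *\<^sub>v unit_vec ?N 0 = l \<cdot>\<^sub>v unit_vec ?N 0"
  proof -
    have "E *\<^sub>v unit_vec ?N 0 = Q *\<^sub>v (A *\<^sub>v (Q *\<^sub>v unit_vec ?N 0))"
      unfolding E_def using Qc A by (simp add: assoc_mult_mat_vec[of _ ?N ?N _ ?N])
    also have "\<dots> = l \<cdot>\<^sub>v unit_vec ?N 0"
      unfolding Q(3) Av using Qc v Qv by (simp add: mult_mat_vec[of _ ?N ?N])
    finally show ?thesis .
  qed
  have E0: "E $$ (i, 0) = (if i = 0 then l else 0)" if "i < ?N" for i
    using arg_cong[OF Ee, of "\<lambda>x. x $ i"] that Ec by (simp add: scalar_prod_right_unit)
  have E0': "E $$ (0, i) = (if i = 0 then l else 0)" if "i < ?N" for i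
    using E0[OF that] sym_mat_index[OF E, of 0 i] that by simp
  define F where "F = Matrix.mat n n (\<lambda>(i, j). E $$ (Suc i, Suc j))"
  have F: "sym_mat n F" using sym_mat_index[OF E] by (intro sym_matI) (auto simp: F_def)
  obtain W d where W: "W \<in> carrier_mat n n" "W\<^sup>T * W = 1\<^sub>m n" "W * W\<^sup>T = 1\<^sub>m n" "F = W * mat_diag n d * W\<^sup>T"
    using Suc.IH[OF F] by auto
  have EF: "E = four_block_mat (mat1 l) (0\<^sub>m 1 n) (0\<^sub>m n 1) F"
  proof (rule eq_matI)
    fix i j assume "i < dim_row (four_block_mat (mat1 l) (0\<^sub>m 1 n) (0\<^sub>m n 1) F)"
      "j < dim_col (four_block_mat (mat1 l) (0\<^sub>m 1 n) (0\<^sub>m n 1) F)"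
    then have "i < ?N" "j < ?N" by (auto simp: F_def mat1_def)
    then show "E $$ (i, j) = four_block_mat (mat1 l) (0\<^sub>m 1 n) (0\<^sub>m n 1) F $$ (i, j)"
      using E0 E0' by (cases i; cases j) (auto simp: F_def mat1_def)
  qed (use Ec in \<open>auto simp: F_def mat1_def\<close>)
  define Z where "Z = four_block_mat (1\<^sub>m 1) (0\<^sub>m 1 n) (0\<^sub>m n 1) W"
  have Z: "Z \<in> carrier_mat ?N ?N" unfolding Z_def using four_block_carrier_mat[OF one_carrier_mat[of 1] W(1)] by simp
  have ZT: "Z\<^sup>T = four_block_mat (1\<^sub>m 1) (0\<^sub>m 1 n) (0\<^sub>m n 1) W\<^sup>T"
    unfolding Z_def using W by (subst transpose_four_block_mat[of _ 1 1 _ n _ n]) auto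
  have mul: "four_block_mat X (0\<^sub>m 1 n) (0\<^sub>m n 1) Y * four_block_mat X' (0\<^sub>m 1 n) (0\<^sub>m n 1) Y'
      = four_block_mat (X * X') (0\<^sub>m 1 n) (0\<^sub>m n 1) (Y * Y')"
    if "X \<in> carrier_mat 1 1" "X' \<in> carrier_mat 1 1" "Y \<in> carrier_mat n n" "Y' \<in> carrier_mat n n"
    for X X' Y Y' :: "real mat"
    using that by (subst mult_four_block_mat[of _ 1 1 _ n _ n _ _ 1 _ n])
      (auto simp del: One_nat_def intro!: cong_four_block_mat)
  have one: "four_block_mat (1\<^sub>m 1) (0\<^sub>m 1 n) (0\<^sub>m n 1) (1\<^sub>m n) = (1\<^sub>m ?N :: real mat)"
    using four_block_one_mat[of 1 n] by simp
  have ZZ: "Z\<^sup>T * Z = 1\<^sub>m ?N" "Z * Z\<^sup>T = 1\<^sub>m ?N"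
    unfolding ZT unfolding Z_def using W by (simp_all add: mul one[simplified] del: One_nat_def) (simp_all add: one[simplified])
  define dd where "dd = (\<lambda>i. case i of 0 \<Rightarrow> l | Suc i \<Rightarrow> d i)"
  have D: "mat_diag ?N dd = four_block_mat (mat1 l) (0\<^sub>m 1 n) (0\<^sub>m n 1) (mat_diag n d)"
  proof (rule eq_matI)
    fix i j assume "i < dim_row (four_block_mat (mat1 l) (0\<^sub>m 1 n) (0\<^sub>m n 1) (mat_diag n d))"
      "j < dim_col (four_block_mat (mat1 l) (0\<^sub>m 1 n) (0\<^sub>m n 1) (mat_diag n d))"
    then have "i < ?N" "j < ?N" by (auto simp: mat1_def mat_diag_def)
    then show "mat_diag ?N dd $$ (i, j) = four_block_mat (mat1 l) (0\<^sub>m 1 n) (0\<^sub>m n 1) (mat_diag n d) $$ (i, j)"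
      by (cases i; cases j) (auto simp: dd_def mat1_def mat_diag_def)
  qed (auto simp: mat1_def mat_diag_def)
  have EZ: "E = Z * mat_diag ?N dd * Z\<^sup>T"
  proof -
    have "1\<^sub>m 1 * mat1 l * 1\<^sub>m 1 = mat1 l"
      by (metis left_mult_one_mat mat1_carrier right_mult_one_mat)
    then show ?thesis unfolding ZT D unfolding Z_def EF
      using W by (simp add: mul del: One_nat_def)
  qed
  define V where "V = Q * Z"
  have V: "V \<in> carrier_mat ?N ?N" unfolding V_def using Qc Z by simp
  have VT: "V\<^sup>T = Z\<^sup>T * Q" unfolding V_def using transpose_mult[OF Qc(1) Z] Qc by simp
  have as: "\<And>X Y Z. X \<in> carrier_mat ?N ?N \<Longrightarrow> Y \<in> carrier_mat ?N ?N \<Longrightarrow> Z \<in> carrier_mat ?N ?N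
    \<Longrightarrow> X * Y * Z = X * (Y * Z :: real mat)" by (rule assoc_mult_mat)
  have canc: "Q * (Q * X) = X" "Z\<^sup>T * (Z * X) = X" "Z * (Z\<^sup>T * X) = X" if "X \<in> carrier_mat ?N ?N" for X
    using that Qc Z as[of Q Q X] as[of "Z\<^sup>T" Z X] as[of "Z" "Z\<^sup>T" X] Q(2) ZZ by simp_all
  have QQA: "Q * E * Q = A" unfolding E_def using Qc A by (simp add: as canc Q(2))
  have "V\<^sup>T * V = 1\<^sub>m ?N" unfolding VT unfolding V_def using Qc Z by (simp add: as canc ZZ)
  moreover have "V * V\<^sup>T = 1\<^sub>m ?N" unfolding VT unfolding V_def using Qc Z by (simp add: as canc Q(2))
  moreover have "A = V * mat_diag ?N dd * V\<^sup>T" unfolding VT unfolding V_def QQA[symmetric] EZ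
    using Qc Z by (simp add: as)
  ultimately show ?case using V by blast
qed

lemma qform_mat_diag:
  assumes "v \<in> carrier_vec n" shows "qform (mat_diag n d) v = (\<Sum>i<n. d i * (v $ i)\<^sup>2)"
proof -
  have "qform (mat_diag n d) v = (\<Sum>i<n. \<Sum>j<n. if i = j then d i * (v $ i)\<^sup>2 else 0)"
    unfolding qform_sum[OF mat_diag_dim assms]
    by (intro sum.cong) (auto simp: mat_diag_def power2_eq_square)
  then show ?thesis by (simp add: sum.delta)
qed

lemma orthogonal_vec_nonzero:
  assumes "V \<in> carrier_mat n n" "V * V\<^sup>T = (1\<^sub>m n :: real mat)" "v \<in> carrier_vec n" "v \<noteq> 0\<^sub>v n"
  shows "V\<^sup>T *\<^sub>v v \<noteq> 0\<^sub>v n"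
proof
  assume "V\<^sup>T *\<^sub>v v = 0\<^sub>v n"
  then have "V *\<^sub>v (V\<^sup>T *\<^sub>v v) = 0\<^sub>v n" using assms by (simp add: mult_mat_vec_zero)
  moreover have "V *\<^sub>v (V\<^sup>T *\<^sub>v v) = (V * V\<^sup>T) *\<^sub>v v"
    using assms(1,3) by (intro assoc_mult_mat_vec[symmetric]) auto
  ultimately have "(V * V\<^sup>T) *\<^sub>v v = 0\<^sub>v n" by metis
  then show False using assms(3,4) unfolding assms(2) by simp
qed

lemma qform_spectral:
  assumes "V \<in> carrier_mat n n" "v \<in> carrier_vec n"
  shows "qform (V * mat_diag n d * V\<^sup>T) v = (\<Sum>i<n. d i * ((V\<^sup>T *\<^sub>v v) $ i)\<^sup>2)"
  using qform_congruence[of "mat_diag n d" n "V\<^sup>T" n v] qform_mat_diag[of "V\<^sup>T *\<^sub>v v" n d] assms by simp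

lemma pd_spectral:
  assumes V: "V \<in> carrier_mat n n" "V\<^sup>T * V = 1\<^sub>m n" "V * V\<^sup>T = 1\<^sub>m n"
  shows "pd n (V * mat_diag n d * V\<^sup>T) \<longleftrightarrow> (\<forall>i<n. d i > 0)"
    and "psd n (V * mat_diag n d * V\<^sup>T) \<longleftrightarrow> (\<forall>i<n. d i \<ge> 0)"
proof -
  have q: "qform (V * mat_diag n d * V\<^sup>T) (V *\<^sub>v unit_vec n i) = d i" if "i < n" for i
  proof -
    have "V\<^sup>T *\<^sub>v (V *\<^sub>v unit_vec n i) = (V\<^sup>T * V) *\<^sub>v unit_vec n i" using V(1) by simp
    then have e: "V\<^sup>T *\<^sub>v (V *\<^sub>v unit_vec n i) = unit_vec n i" unfolding V(2) by simp
    have "qform (V * mat_diag n d * V\<^sup>T) (V *\<^sub>v unit_vec n i) = (\<Sum>j<n. d j * (unit_vec n i $ j)\<^sup>2)"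
      using V by (subst qform_spectral) (auto simp: e)
    also have "\<dots> = (\<Sum>j<n. if i = j then d i else 0)" using that by (intro sum.cong) auto
    finally show ?thesis using that by simp
  qed
  have nz: "V *\<^sub>v unit_vec n i \<noteq> 0\<^sub>v n" if "i < n" for i
    using orthogonal_vec_nonzero[of "V\<^sup>T" n "unit_vec n i"] V that by simp
  have ci: "V *\<^sub>v unit_vec n i \<in> carrier_vec n" for i using V by auto
  show "pd n (V * mat_diag n d * V\<^sup>T) \<longleftrightarrow> (\<forall>i<n. d i > 0)"
  proof
    assume "pd n (V * mat_diag n d * V\<^sup>T)"
    then show "\<forall>i<n. d i > 0" using pdD[OF _ ci nz] q by metis
  next
    assume d: "\<forall>i<n. d i > 0"
    show "pd n (V * mat_diag n d * V\<^sup>T)" unfolding pd_def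
    proof (intro ballI impI)
      fix v :: "real vec" assume v: "v \<in> carrier_vec n" "v \<noteq> 0\<^sub>v n"
      have "V\<^sup>T *\<^sub>v v \<noteq> 0\<^sub>v n" using orthogonal_vec_nonzero[OF V(1,3) v] .
      moreover have "V\<^sup>T *\<^sub>v v \<in> carrier_vec n" using V v by auto
      ultimately obtain i where i: "i < n" "(V\<^sup>T *\<^sub>v v) $ i \<noteq> 0" by (metis carrier_vecD eq_vecI index_zero_vec)
      show "qform (V * mat_diag n d * V\<^sup>T) v > 0" unfolding qform_spectral[OF V(1) v(1)]
      proof (rule sum_pos2[of _ i])
        show "0 < d i * ((V\<^sup>T *\<^sub>v v) $ i)\<^sup>2" using d i by simp
        show "0 \<le> d j * ((V\<^sup>T *\<^sub>v v) $ j)\<^sup>2" if "j \<in> {..<n}" for j using d that by (simp add: less_imp_le)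
      qed (use i in auto)
    qed
  qed
  show "psd n (V * mat_diag n d * V\<^sup>T) \<longleftrightarrow> (\<forall>i<n. d i \<ge> 0)"
  proof
    assume "psd n (V * mat_diag n d * V\<^sup>T)"
    then show "\<forall>i<n. d i \<ge> 0" using psdD[OF _ ci] q by metis
  next
    assume d: "\<forall>i<n. d i \<ge> 0"
    show "psd n (V * mat_diag n d * V\<^sup>T)" unfolding psd_def
      using d by (auto simp: qform_spectral[OF V(1)] intro!: sum_nonneg simp del: index_mult_mat_vec)
  qed
qed

lemma det_orthogonal:
  assumes V: "V \<in> carrier_mat n n" "V * V\<^sup>T = (1\<^sub>m n :: real mat)" shows "det V * det V = 1"
  using det_mult[of V n "V\<^sup>T"] V det_transpose[OF V(1)] by simp

lemma det_mat_diag: "det (mat_diag n d) = (\<Prod>i<n. d i :: real)"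
  using det_lower_triangular[of n "mat_diag n d"]
  by (auto simp: mat_diag_def diag_mat_def prod.distinct_set_conv_list[symmetric] atLeast0LessThan)

lemma det_spectral:
  assumes V: "V \<in> carrier_mat n n" "V * V\<^sup>T = (1\<^sub>m n :: real mat)"
  shows "det (V * mat_diag n d * V\<^sup>T) = (\<Prod>i<n. d i)"
proof -
  have "det (V * mat_diag n d * V\<^sup>T) = (det V * det V) * (\<Prod>i<n. d i)"
    using V det_transpose[OF V(1)] det_mult[of "V * mat_diag n d" n "V\<^sup>T"] det_mult[OF V(1) mat_diag_dim, of d]
    by (simp add: det_mat_diag mult_carrier_mat[of _ n n])
  then show ?thesis by (simp add: det_orthogonal[OF V])
qed

text \<open>Nonnegative eigenvalues with nonzero product are positive. In the boundary argument this
  turns failure of definiteness into the vanishing of a determinant.\<close>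

lemma psd_det_nonzero_pd:
  assumes "sym_mat n A" "psd n A" "det A \<noteq> 0" shows "pd n A"
proof -
  obtain V d where V: "V \<in> carrier_mat n n" "V\<^sup>T * V = 1\<^sub>m n" "V * V\<^sup>T = 1\<^sub>m n" and A: "A = V * mat_diag n d * V\<^sup>T"
    using spectral_theorem[OF assms(1)] by auto
  have "\<forall>i<n. d i \<ge> 0" using assms(2) pd_spectral(2)[OF V] unfolding A by simp
  moreover have "(\<Prod>i<n. d i) \<noteq> 0" using assms(3) det_spectral[OF V(1,3)] unfolding A by simp
  ultimately have "\<forall>i<n. d i > 0" by (metis finite_lessThan lessThan_iff less_le prod_zero)
  then show ?thesis using pd_spectral(1)[OF V] unfolding A by simp
qed

lemma mat_diag_zero_on: "(\<And>i. i < n \<Longrightarrow> d i = 0) \<Longrightarrow> mat_diag n d = (0\<^sub>m n n :: real mat)"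
  by (auto simp: mat_diag_def intro!: eq_matI)

text \<open>With X = B - C and Y = B + C one has X Y + Y X = 2 (B^2 - C^2) = 0. Testing this on an
  eigenvector v of X with eigenvalue l gives 2 l (v . Y v) = 0, and Y is positive definite, so X has
  no nonzero eigenvalue.\<close>

lemma psd_sqrt_unique:
  assumes B: "sym_mat n B" "psd n B" and C: "sym_mat n C" "psd n C"
    and BC: "B * B = C * C" and d: "det (B * B) \<noteq> 0"
  shows "B = C"
proof -
  note b = sym_matD[OF B(1)] and c = sym_matD[OF C(1)]
  have "det B \<noteq> 0" using d det_mult[OF b(1) b(1)] by auto
  then have "pd n B" by (rule psd_det_nonzero_pd[OF B])
  define X where "X = B - C"
  define Y where "Y = B + C"
  have X: "sym_mat n X" and Y: "sym_mat n Y" unfolding X_def Y_def using sym_mat_minus sym_mat_add B C by auto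
  note x = sym_matD[OF X] and y = sym_matD[OF Y]
  have pdY: "pd n Y" unfolding Y_def using pd_add_psd[OF \<open>pd n B\<close> C(2) b(1) c(1)] .
  have XY: "X * Y + Y * X = 0\<^sub>m n n"
  proof -
    have 1: "X * Y = (B * B + B * C) - (C * B + C * C)"
      unfolding X_def Y_def using b(1) c(1)
      by (simp add: minus_mult_distrib_mat[of _ n n _ _ n] mult_add_distrib_mat[of _ n n _ n])
    have 2: "Y * X = (B * B + C * B) - (B * C + C * C)"
      unfolding X_def Y_def using b(1) c(1)
      by (simp add: add_mult_distrib_mat[of _ n n _ _ n] mult_minus_distrib_mat[of _ n n _ n] minus_carrier_mat)
    have cc: "B * C \<in> carrier_mat n n" "C * B \<in> carrier_mat n n" "C * C \<in> carrier_mat n n" using b c by auto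
    show ?thesis unfolding 1 2 BC using cc b(1) c(1) by (intro eq_matI) (auto simp del: index_mult_mat(1))
  qed
  obtain V l where V: "V \<in> carrier_mat n n" "V\<^sup>T * V = 1\<^sub>m n" "V * V\<^sup>T = 1\<^sub>m n" and Xs: "X = V * mat_diag n l * V\<^sup>T"
    using spectral_theorem[OF X] by auto
  have "l i = 0" if i: "i < n" for i
  proof -
    let ?v = "V *\<^sub>v unit_vec n i"
    have v: "?v \<in> carrier_vec n" using V by auto
    have e: "V\<^sup>T *\<^sub>v ?v = unit_vec n i"
    proof -
      have "V\<^sup>T *\<^sub>v ?v = (V\<^sup>T * V) *\<^sub>v unit_vec n i" using V(1) by simp
      then show ?thesis unfolding V(2) by simp
    qed
    have nz: "?v \<noteq> 0\<^sub>v n" using orthogonal_vec_nonzero[of "V\<^sup>T" n "unit_vec n i"] V i by simp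
    have de: "mat_diag n l *\<^sub>v unit_vec n i = l i \<cdot>\<^sub>v unit_vec n i"
      using i by (intro eq_vecI) (auto simp: mat_diag_def scalar_prod_right_unit)
    have Xv: "X *\<^sub>v ?v = l i \<cdot>\<^sub>v ?v"
    proof -
      have "X *\<^sub>v ?v = V *\<^sub>v (mat_diag n l *\<^sub>v (V\<^sup>T *\<^sub>v ?v))"
        unfolding Xs using V(1) v by (simp add: assoc_mult_mat_vec[of _ n n _ n])
      then show ?thesis unfolding e de using V(1) by (simp add: mult_mat_vec[of _ n n])
    qed
    have Yv: "Y *\<^sub>v ?v \<in> carrier_vec n" using y v by auto
    have "0\<^sub>m n n *\<^sub>v ?v = 0\<^sub>v n" by (intro eq_vecI) (simp_all add: scalar_prod_left_zero[OF v])
    then have "0 = ?v \<bullet> ((X * Y + Y * X) *\<^sub>v ?v)" unfolding XY using scalar_prod_right_zero[OF v] by simp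
    also have "\<dots> = ?v \<bullet> (X *\<^sub>v (Y *\<^sub>v ?v)) + ?v \<bullet> (Y *\<^sub>v (X *\<^sub>v ?v))"
      using x(1) y(1) v
      by (simp add: add_mult_distrib_mat_vec[of _ n n] scalar_prod_add_distrib[of _ n] del: mult_mat_vec_carrier)
        (simp add: scalar_prod_add_distrib[of _ n])
    also have "?v \<bullet> (X *\<^sub>v (Y *\<^sub>v ?v)) = (X *\<^sub>v ?v) \<bullet> (Y *\<^sub>v ?v)"
      using scalar_prod_transpose[OF x(1) v Yv] x(2) by simp
    also have "(X *\<^sub>v ?v) \<bullet> (Y *\<^sub>v ?v) + ?v \<bullet> (Y *\<^sub>v (X *\<^sub>v ?v)) = 2 * l i * qform Y ?v"
      unfolding Xv using v y Yv by (simp add: mult_mat_vec[of _ n n])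
    finally show "l i = 0" using pdD[OF pdY v nz] by simp
  qed
  then have "X = 0\<^sub>m n n" unfolding Xs
    using V by (subst (1) mat_diag_zero_on[of n l]) auto
  then show "B = C" unfolding X_def using b(1) c(1)
    by (intro eq_matI) (auto simp: mat_eq_iff)
qed

lemma msqrt_spectral:
  assumes V: "V \<in> carrier_mat n n" "V\<^sup>T * V = 1\<^sub>m n" "V * V\<^sup>T = 1\<^sub>m n" and d: "\<And>i. i < n \<Longrightarrow> d i > 0"
  shows "msqrt n (V * mat_diag n d * V\<^sup>T) = V * mat_diag n (\<lambda>i. sqrt (d i)) * V\<^sup>T"
proof -
  define B where "B = V * mat_diag n (\<lambda>i. sqrt (d i)) * V\<^sup>T"
  have sym: "sym_mat n (V * mat_diag n f * V\<^sup>T)" for f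
  proof -
    have "sym_mat n (mat_diag n f)" by (intro sym_matI) (auto simp: mat_diag_def)
    from sym_mat_congruence[OF this, of "V\<^sup>T" n] show ?thesis using V by simp
  qed
  note B = sym_matD[OF sym[of "\<lambda>i. sqrt (d i)"], folded B_def]
  have pB: "psd n B" unfolding B_def using d by (subst pd_spectral(2)[OF V]) (auto intro: less_imp_le)
  have BB: "B * B = V * mat_diag n d * V\<^sup>T"
  proof -
    have "B * B = V * (mat_diag n (\<lambda>i. sqrt (d i)) * (V\<^sup>T * V) * mat_diag n (\<lambda>i. sqrt (d i))) * V\<^sup>T"
      unfolding B_def using V(1) by (simp add: assoc_mult_mat[of _ n n _ n _ n])
    also have "mat_diag n (\<lambda>i. sqrt (d i)) * (V\<^sup>T * V) * mat_diag n (\<lambda>i. sqrt (d i)) = mat_diag n d"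
      unfolding V(2) using d by (simp add: right_mult_one_mat[OF mat_diag_dim]) (auto simp: mat_diag_def less_imp_le)
    finally show ?thesis .
  qed
  have dt: "det (B * B) \<noteq> 0" unfolding BB det_spectral[OF V(1,3)] using d by (simp add: less_imp_neq[symmetric])
  show ?thesis unfolding msqrt_def
  proof (rule the_equality, unfold B_def[symmetric])
    show "B \<in> carrier_mat n n \<and> B\<^sup>T = B \<and> psd n B \<and> B * B = V * mat_diag n d * V\<^sup>T"
      using B pB BB by auto
    fix C assume C: "C \<in> carrier_mat n n \<and> C\<^sup>T = C \<and> psd n C \<and> C * C = V * mat_diag n d * V\<^sup>T"
    show "C = B"
      using C BB dt psd_sqrt_unique[of n C B] B pB by (auto simp: sym_mat_def)
  qed
qed

lemma pd_spectralE:
  assumes "sym_mat n A" "pd n A"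
  obtains V d where "V \<in> carrier_mat n n" "V\<^sup>T * V = 1\<^sub>m n" "V * V\<^sup>T = 1\<^sub>m n" "A = V * mat_diag n d * V\<^sup>T"
    "\<And>i. i < n \<Longrightarrow> d i > 0"
proof -
  obtain V d where V: "V \<in> carrier_mat n n" "V\<^sup>T * V = 1\<^sub>m n" "V * V\<^sup>T = 1\<^sub>m n" and A: "A = V * mat_diag n d * V\<^sup>T"
    using spectral_theorem[OF assms(1)] by auto
  then show ?thesis using that pd_spectral(1)[OF V] assms(2) by auto
qed

lemma msqrt_props:
  assumes "sym_mat n A" "pd n A"
  shows "sym_mat n (msqrt n A)" "pd n (msqrt n A)" "msqrt n A * msqrt n A = A"
proof -
  obtain V d where V: "V \<in> carrier_mat n n" "V\<^sup>T * V = 1\<^sub>m n" "V * V\<^sup>T = 1\<^sub>m n" and A: "A = V * mat_diag n d * V\<^sup>T"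
    and d: "\<And>i. i < n \<Longrightarrow> d i > 0" using pd_spectralE[OF assms] by blast
  have m: "msqrt n A = V * mat_diag n (\<lambda>i. sqrt (d i)) * V\<^sup>T"
    unfolding A by (rule msqrt_spectral[OF V]) (rule d)
  have sd: "sym_mat n (mat_diag n (\<lambda>i. sqrt (d i)))" by (intro sym_matI) (auto simp: mat_diag_def)
  have "sym_mat n (V * mat_diag n (\<lambda>i. sqrt (d i)) * V\<^sup>T)"
    using sym_mat_congruence[OF sd, of "V\<^sup>T" n] V by simp
  then show "sym_mat n (msqrt n A)" by (simp only: m)
  show "pd n (msqrt n A)" unfolding m by (subst pd_spectral(1)[OF V]) (use d in auto)
  have "msqrt n A * msqrt n A = V * (mat_diag n (\<lambda>i. sqrt (d i)) * (V\<^sup>T * V) * mat_diag n (\<lambda>i. sqrt (d i))) * V\<^sup>T"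
    unfolding m using V(1) by (simp add: assoc_mult_mat[of _ n n _ n _ n])
  also have "mat_diag n (\<lambda>i. sqrt (d i)) * (V\<^sup>T * V) * mat_diag n (\<lambda>i. sqrt (d i)) = mat_diag n d"
    unfolding V(2) using d by (simp add: right_mult_one_mat[OF mat_diag_dim]) (auto simp: mat_diag_def less_imp_le)
  finally show "msqrt n A * msqrt n A = A" unfolding A .
qed

lemma msqrt_det_pos:
  assumes "sym_mat n A" "pd n A"
  shows "det (msqrt n A) > 0" "det (msqrt n A) = sqrt (det A)"
proof -
  note m = msqrt_props[OF assms] and mc = sym_matD[OF msqrt_props(1)[OF assms]]
  show p: "det (msqrt n A) > 0" using pd_det_pos[OF m(1,2)] .
  have "det (msqrt n A) * det (msqrt n A) = det A" using det_mult[OF mc(1) mc(1)] m(3) by simp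
  then show "det (msqrt n A) = sqrt (det A)" using p by (metis abs_of_pos real_sqrt_abs2)
qed

text \<open>On \<open>{0..1}\<close> the square root is a limit of polynomials, so the matrix square root is a pointwise limit of
  polynomials in the matrix; this is what makes it measurable.\<close>

fun sqrt_iter :: "nat \<Rightarrow> real \<Rightarrow> real" where
  "sqrt_iter 0 a = 0"
| "sqrt_iter (Suc k) a = sqrt_iter k a + (a - sqrt_iter k a * sqrt_iter k a) / 2"

fun msqrt_iter :: "nat \<Rightarrow> nat \<Rightarrow> real mat \<Rightarrow> real mat" where
  "msqrt_iter n 0 A = 0\<^sub>m n n"
| "msqrt_iter n (Suc k) A = msqrt_iter n k A + (1 / 2) \<cdot>\<^sub>m (A - msqrt_iter n k A * msqrt_iter n k A)"

text \<open>The error is multiplied in each step by 1 - (sqrt a + y) / 2, where y is the current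
  iterate; while y stays between 0 and sqrt a, this factor lies between 0 and 1 - sqrt a /
  2.\<close>

lemma sqrt_iter_error:
  assumes "0 < a" "a \<le> 1"
  shows "0 \<le> sqrt_iter k a" "sqrt_iter k a \<le> sqrt a" "sqrt a - sqrt_iter k a \<le> (1 - sqrt a / 2) ^ k"
proof -
  have s: "0 < sqrt a" "sqrt a \<le> 1" "sqrt a * sqrt a = a" using assms by auto
  have "0 \<le> sqrt_iter k a \<and> sqrt_iter k a \<le> sqrt a \<and> sqrt a - sqrt_iter k a \<le> (1 - sqrt a / 2) ^ k"
  proof (induction k)
    case 0
    then show ?case using s by simp
  next
    case (Suc k)
    define y where "y = sqrt_iter k a"
    have y: "0 \<le> y" "y \<le> sqrt a" "sqrt a - y \<le> (1 - sqrt a / 2) ^ k" using Suc by (auto simp: y_def)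
    have e: "sqrt a - sqrt_iter (Suc k) a = (sqrt a - y) * (1 - (sqrt a + y) / 2)"
      unfolding sqrt_iter.simps y_def[symmetric] using s(3) by (simp add: algebra_simps)
    have f: "0 \<le> 1 - (sqrt a + y) / 2" "1 - (sqrt a + y) / 2 \<le> 1 - sqrt a / 2"
    proof -
      have "sqrt a + y \<le> 2" using y(1,2) s(1,2) by linarith
      then show "0 \<le> 1 - (sqrt a + y) / 2" "1 - (sqrt a + y) / 2 \<le> 1 - sqrt a / 2" using y(1) by simp_all
    qed
    have "(sqrt a - y) * (1 - (sqrt a + y) / 2) \<le> (1 - sqrt a / 2) ^ k * (1 - sqrt a / 2)"
      by (rule mult_mono[OF y(3) f(2) _ f(1)]) (intro zero_le_power order_trans[OF f(1) f(2)])
    moreover have "0 \<le> (sqrt a - y) * (1 - (sqrt a + y) / 2)"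
      by (rule mult_nonneg_nonneg[OF _ f(1)]) (use y in simp)
    moreover have "0 \<le> sqrt_iter (Suc k) a"
    proof -
      have "y * y \<le> a" using mult_mono[OF y(2) y(2) less_imp_le[OF s(1)] y(1)] s(3) by simp
      then show ?thesis unfolding sqrt_iter.simps y_def[symmetric] using y by simp
    qed
    ultimately show ?case unfolding power_Suc using e by (simp add: mult.commute)
  qed
  then show "0 \<le> sqrt_iter k a" "sqrt_iter k a \<le> sqrt a" "sqrt a - sqrt_iter k a \<le> (1 - sqrt a / 2) ^ k" by auto
qed

lemma sqrt_iter_tendsto:
  assumes "0 < a" "a \<le> 1" shows "(\<lambda>k. sqrt_iter k a) \<longlonglongrightarrow> sqrt a"
proof -
  have s: "0 < sqrt a" "sqrt a \<le> 1" using assms by auto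
  have "norm (1 - sqrt a / 2) < 1"
    unfolding real_norm_def abs_less_iff using s by (intro conjI) linarith+
  then have "(\<lambda>k. (1 - sqrt a / 2) ^ k) \<longlonglongrightarrow> 0" by (rule LIMSEQ_power_zero)
  then have "(\<lambda>k. sqrt a - sqrt_iter k a) \<longlonglongrightarrow> 0"
    by (rule tendsto_sandwich[OF _ _ tendsto_const, rotated 2])
      (use sqrt_iter_error[OF assms] in auto)
  then have "(\<lambda>k. sqrt a - (sqrt a - sqrt_iter k a)) \<longlonglongrightarrow> sqrt a - 0" by (intro tendsto_intros)
  then show ?thesis by simp
qed

text \<open>The iteration uses only sums, multiples and squares, which commute with conjugation by
  an orthogonal matrix; so it acts on the eigenvalues separately.\<close>

lemma msqrt_iter_spectral:
  assumes V: "V \<in> carrier_mat n n" "V\<^sup>T * V = 1\<^sub>m n"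
  shows "msqrt_iter n k (V * mat_diag n a * V\<^sup>T) = V * mat_diag n (\<lambda>i. sqrt_iter k (a i)) * V\<^sup>T"
proof (induction k)
  case 0
  then show ?case using V by (simp add: mat_diag_zero_on)
next
  case (Suc k)
  let ?Y = "mat_diag n (\<lambda>i. sqrt_iter k (a i))"
  have VT: "V\<^sup>T \<in> carrier_mat n n" using V by simp
  have "V * ?Y * V\<^sup>T * (V * ?Y * V\<^sup>T) = V * (?Y * (V\<^sup>T * V) * ?Y) * V\<^sup>T"
    using V(1) by (simp add: assoc_mult_mat[of _ n n _ n _ n])
  also have "?Y * (V\<^sup>T * V) * ?Y = mat_diag n (\<lambda>i. sqrt_iter k (a i) * sqrt_iter k (a i))"
    unfolding V(2) by (simp add: right_mult_one_mat[OF mat_diag_dim])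
  finally have YY: "V * ?Y * V\<^sup>T * (V * ?Y * V\<^sup>T) = V * mat_diag n (\<lambda>i. sqrt_iter k (a i) * sqrt_iter k (a i)) * V\<^sup>T" .
  have add: "V * X * V\<^sup>T + V * Z * V\<^sup>T = V * (X + Z) * V\<^sup>T"
    and minus: "V * X * V\<^sup>T - V * Z * V\<^sup>T = V * (X - Z) * V\<^sup>T"
    if "X \<in> carrier_mat n n" "Z \<in> carrier_mat n n" for X Z :: "real mat"
    using that V(1) VT
    by (simp_all add: mult_add_distrib_mat[of _ n n _ n] add_mult_distrib_mat[of _ n n _ _ n] minus_carrier_mat
      mult_minus_distrib_mat[of _ n n _ n] minus_mult_distrib_mat[of _ n n _ _ n]
      mult_smult_distrib[of _ n n _ n] mult_smult_assoc_mat[of _ n n _ n])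
  have smult: "c \<cdot>\<^sub>m (V * X * V\<^sup>T) = V * (c \<cdot>\<^sub>m X) * V\<^sup>T" if "X \<in> carrier_mat n n" for X :: "real mat" and c
    using that V(1) VT by (simp add: mult_smult_distrib[of _ n n _ n] mult_smult_assoc_mat[of _ n n _ n])
  have "msqrt_iter n (Suc k) (V * mat_diag n a * V\<^sup>T)
      = V * (?Y + (1 / 2) \<cdot>\<^sub>m (mat_diag n a - mat_diag n (\<lambda>i. sqrt_iter k (a i) * sqrt_iter k (a i)))) * V\<^sup>T"
    unfolding msqrt_iter.simps Suc YY
    by (simp only: minus smult add mat_diag_dim minus_carrier_mat smult_carrier_mat)
  also have "?Y + (1 / 2) \<cdot>\<^sub>m (mat_diag n a - mat_diag n (\<lambda>i. sqrt_iter k (a i) * sqrt_iter k (a i)))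
      = mat_diag n (\<lambda>i. sqrt_iter (Suc k) (a i))"
    by (auto simp: mat_diag_def intro!: eq_matI)
  finally show ?case .
qed

lemma triple_product_index:
  assumes "A \<in> carrier_mat n n" "i < n" "j < n"
  shows "(A * mat_diag n d * A\<^sup>T) $$ (i, j) = (\<Sum>k<n. A $$ (i, k) * d k * (A $$ (j, k) :: real))"
  using assms by (simp add: mat_diag_mult_right[OF assms(1)] scalar_prod_def atLeast0LessThan)

text \<open>The scalar convergence covers (0,1], so the spectrum is first scaled into this interval
  by \<open>c\<close>, which dominates every eigenvalue and depends measurably on the entries; the
  factor \<open>sqrt c\<close> undoes the scaling.\<close>

lemma msqrt_tendsto:
  assumes "sym_mat n A" "pd n A" and ij: "i < n" "j < n"
  defines "c \<equiv> (\<Sum>i<n. \<Sum>j<n. \<bar>A $$ (i, j)\<bar>)"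
  shows "(\<lambda>k. sqrt c * msqrt_iter n k ((1 / c) \<cdot>\<^sub>m A) $$ (i, j)) \<longlonglongrightarrow> msqrt n A $$ (i, j)"
proof -
  obtain V d where V: "V \<in> carrier_mat n n" "V\<^sup>T * V = 1\<^sub>m n" "V * V\<^sup>T = 1\<^sub>m n" and A: "A = V * mat_diag n d * V\<^sup>T"
    and d: "\<And>i. i < n \<Longrightarrow> d i > 0" using pd_spectralE[OF assms(1,2)] by blast
  have Ac: "A \<in> carrier_mat n n" using assms(1) by (auto simp: sym_mat_def)
  \<comment> \<open>An eigenvalue is the value of the form at a unit eigenvector, whose entries have
    absolute value at most one.\<close>
  have dc: "d k \<le> c" if k: "k < n" for k
  proof -
    let ?v = "V *\<^sub>v unit_vec n k"
    have v: "?v \<in> carrier_vec n" using V by auto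
    have e: "V\<^sup>T *\<^sub>v ?v = unit_vec n k"
    proof -
      have "V\<^sup>T *\<^sub>v ?v = (V\<^sup>T * V) *\<^sub>v unit_vec n k" using V(1) by simp
      then show ?thesis unfolding V(2) by simp
    qed
    have "qform A ?v = (\<Sum>j<n. d j * (unit_vec n k $ j)\<^sup>2)"
      unfolding A by (subst qform_spectral[OF V(1) v]) (simp add: e)
    also have "\<dots> = (\<Sum>j<n. if k = j then d k else 0)" using k by (intro sum.cong) auto
    finally have q: "qform A ?v = d k" using k by simp
    have "?v \<bullet> ?v = (V\<^sup>T *\<^sub>v ?v) \<bullet> unit_vec n k"
      using scalar_prod_transpose[OF V(1) v unit_vec_carrier, of k] by simp
    then have "?v \<bullet> ?v = 1" unfolding e using k by (simp add: scalar_prod_left_unit)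
    then have "(\<Sum>i<n. (?v $ i)\<^sup>2) = 1" using scalar_self_sum[OF v] by simp
    then have le1: "\<bar>?v $ i\<bar> \<le> 1" if "i < n" for i
      using member_le_sum[of i "{..<n}" "\<lambda>i. (?v $ i)\<^sup>2"] that by (simp add: abs_square_le_1)
    have "d k = (\<Sum>i<n. \<Sum>j<n. A $$ (i, j) * ?v $ i * ?v $ j)" using q qform_sum[OF Ac v] by simp
    also have "\<dots> \<le> (\<Sum>i<n. \<Sum>j<n. \<bar>A $$ (i, j)\<bar>)"
    proof (intro sum_mono)
      fix i j assume "i \<in> {..<n}" "j \<in> {..<n}"
      then have "\<bar>?v $ i\<bar> * \<bar>?v $ j\<bar> \<le> 1 * 1" using le1[of i] le1[of j] by (intro mult_mono) auto
      then have "\<bar>A $$ (i, j)\<bar> * (\<bar>?v $ i\<bar> * \<bar>?v $ j\<bar>) \<le> \<bar>A $$ (i, j)\<bar> * 1" by (intro mult_left_mono) auto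
      then have "\<bar>A $$ (i, j) * ?v $ i * ?v $ j\<bar> \<le> \<bar>A $$ (i, j)\<bar>" by (simp add: abs_mult mult.assoc)
      then show "A $$ (i, j) * ?v $ i * ?v $ j \<le> \<bar>A $$ (i, j)\<bar>" by linarith
    qed
    finally show "d k \<le> c" by (simp add: c_def)
  qed
  have c0: "c > 0" using dc[OF ij(1)] d[OF ij(1)] by linarith
  have sA: "(1 / c) \<cdot>\<^sub>m A = V * mat_diag n (\<lambda>i. d i / c) * V\<^sup>T"
  proof -
    have "(1 / c) \<cdot>\<^sub>m A = V * ((1 / c) \<cdot>\<^sub>m mat_diag n d) * V\<^sup>T"
      unfolding A using V by (simp add: mult_smult_distrib[of _ n n _ n] mult_smult_assoc_mat[of _ n n _ n])
    also have "(1 / c) \<cdot>\<^sub>m mat_diag n d = mat_diag n (\<lambda>i. d i / c)" by (auto simp: mat_diag_def)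
    finally show ?thesis .
  qed
  have "(\<lambda>k. sqrt c * (\<Sum>l<n. V $$ (i, l) * sqrt_iter k (d l / c) * V $$ (j, l)))
      \<longlonglongrightarrow> sqrt c * (\<Sum>l<n. V $$ (i, l) * sqrt (d l / c) * V $$ (j, l))"
    using d dc c0 by (intro tendsto_intros sqrt_iter_tendsto) (auto simp: divide_le_eq_1)
  also have "sqrt c * (\<Sum>l<n. V $$ (i, l) * sqrt (d l / c) * V $$ (j, l)) = (\<Sum>l<n. V $$ (i, l) * sqrt (d l) * V $$ (j, l))"
    using c0 by (simp add: sum_distrib_left real_sqrt_divide)
  also have "\<dots> = msqrt n A $$ (i, j)"
  proof -
    have "msqrt n A = V * mat_diag n (\<lambda>i. sqrt (d i)) * V\<^sup>T"
      unfolding A by (rule msqrt_spectral[OF V]) (rule d)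
    then show ?thesis by (simp only: triple_product_index[OF V(1) ij])
  qed
  also have "(\<lambda>k. sqrt c * (\<Sum>l<n. V $$ (i, l) * sqrt_iter k (d l / c) * V $$ (j, l)))
      = (\<lambda>k. sqrt c * msqrt_iter n k ((1 / c) \<cdot>\<^sub>m A) $$ (i, j))"
    unfolding sA msqrt_iter_spectral[OF V(1,2)] triple_product_index[OF V(1) ij] ..
  finally show ?thesis .
qed

subsection \<open>Hankel forms and polynomials\<close>

text \<open>Integration of q against the (a, b) entry of a matrix measure, expressed through the
  sequence alone, so no measure need exist yet. \<open>moment_form\<close> is the corresponding
  formal integral of w f^T dmu f.\<close>

definition moment_fun :: "(nat \<Rightarrow> real mat) \<Rightarrow> nat \<Rightarrow> nat \<Rightarrow> real poly \<Rightarrow> real" where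
  "moment_fun S a b q = (\<Sum>k\<le>degree q. coeff q k * S k $$ (a, b))"

definition moment_form :: "nat \<Rightarrow> (nat \<Rightarrow> real mat) \<Rightarrow> real poly \<Rightarrow> (nat \<Rightarrow> real poly) \<Rightarrow> real" where
  "moment_form p S w f = (\<Sum>a<p. \<Sum>b<p. moment_fun S a b (w * f a * f b))"

text \<open>Any bound past the degree may serve as range of summation, so polynomials of different
  degrees can be handled over one range.\<close>

lemma moment_fun_sum:
  assumes "\<And>k. k \<ge> N \<Longrightarrow> coeff q k = 0"
  shows "moment_fun S a b q = (\<Sum>k<N. coeff q k * S k $$ (a, b))"
proof -
  have "moment_fun S a b q = (\<Sum>k\<in>{k. coeff q k \<noteq> 0}. coeff q k * S k $$ (a, b))"
    unfolding moment_fun_def by (rule sum.mono_neutral_right) (auto intro: le_degree)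
  also have "\<dots> = (\<Sum>k<N. coeff q k * S k $$ (a, b))"
    using assms by (intro sum.mono_neutral_left) (auto intro: leI)
  finally show ?thesis .
qed

lemma moment_fun_add: "moment_fun S a b (q + r) = moment_fun S a b q + moment_fun S a b r"
proof -
  define N where "N = Suc (max (degree q) (degree r))"
  have "coeff q k = 0" "coeff r k = 0" "coeff (q + r) k = 0" if "k \<ge> N" for k
    using that by (auto simp: N_def coeff_eq_0)
  then show ?thesis by (simp add: moment_fun_sum[of N] sum.distrib algebra_simps)
qed

lemma moment_fun_smult: "moment_fun S a b (Polynomial.smult c q) = c * moment_fun S a b q"
proof -
  have "coeff q k = 0" "coeff (Polynomial.smult c q) k = 0" if "k \<ge> Suc (degree q)" for k
    using that by (auto simp: coeff_eq_0)
  then show ?thesis by (simp add: moment_fun_sum[of "Suc (degree q)"] sum_distrib_left mult.assoc del: sum.lessThan_Suc)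
qed

lemma moment_fun_0[simp]: "moment_fun S a b 0 = 0"
  by (simp add: moment_fun_def)

lemma moment_fun_diff: "moment_fun S a b (q - r) = moment_fun S a b q - moment_fun S a b r"
  using moment_fun_add[of S a b "q - r" r] by simp

lemma moment_fun_setsum: "moment_fun S a b (\<Sum>i\<in>A. f i) = (\<Sum>i\<in>A. moment_fun S a b (f i))"
  by (induction A rule: infinite_finite_induct) (auto simp: moment_fun_add)

lemma moment_fun_monom[simp]: "moment_fun S a b (monom c k) = c * S k $$ (a, b)"
  by (subst moment_fun_sum[of "Suc k"]) (auto simp: sum.delta if_distrib[of "\<lambda>x. x * _"] cong: if_cong)

text \<open>\<open>T\<close> plays the role of the moment sequence of w dmu. The weights 1, x, 1 - x
  and x (1 - x) give the four kinds of Hankel matrices.\<close>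

definition weighted_moments :: "nat \<Rightarrow> (nat \<Rightarrow> real mat) \<Rightarrow> real poly \<Rightarrow> (nat \<Rightarrow> real mat) \<Rightarrow> bool" where
  "weighted_moments p S w T \<longleftrightarrow> (\<forall>k. \<forall>a<p. \<forall>b<p. T k $$ (a, b) = moment_fun S a b (w * monom 1 k))"

definition pX :: "real poly" where "pX = [:0, 1:]"

lemma X_monom: "pX * monom c k = monom c (Suc k)"
  by (simp add: pX_def monom_Suc)

lemma weighted_moments_simps:
  assumes "\<And>k. S k \<in> carrier_mat p p"
  shows "weighted_moments p S 1 S" "weighted_moments p S pX (\<lambda>k. S (k + 1))"
    "weighted_moments p S (1 - pX) (\<lambda>k. S k - S (k + 1))"
    "weighted_moments p S (pX * (1 - pX)) (\<lambda>k. S (k + 1) - S (k + 2))"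
proof -
  have dim: "dim_row (S k) = p" "dim_col (S k) = p" for k using assms[of k] by auto
  have 1: "(1 - pX) * monom 1 k = monom 1 k - monom 1 (Suc k)" for k :: nat
    by (simp only: left_diff_distrib mult_1_left X_monom)
  have 2: "pX * (1 - pX) * monom 1 k = monom 1 (Suc k) - monom 1 (Suc (Suc k))" for k :: nat
    unfolding mult.assoc 1 by (simp only: right_diff_distrib X_monom)
  show "weighted_moments p S 1 S" unfolding weighted_moments_def by simp
  show "weighted_moments p S pX (\<lambda>k. S (k + 1))" unfolding weighted_moments_def X_monom by simp
  show "weighted_moments p S (1 - pX) (\<lambda>k. S k - S (k + 1))"
    unfolding weighted_moments_def 1 by (simp add: moment_fun_diff dim)
  show "weighted_moments p S (pX * (1 - pX)) (\<lambda>k. S (k + 1) - S (k + 2))"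
    unfolding weighted_moments_def 2 by (simp add: moment_fun_diff dim)
qed

lemma sum_lessThan_mult:
  "(\<Sum>r<d * p. g r) = (\<Sum>i<d. \<Sum>a<p. g (i * p + a :: nat))" for g :: "nat \<Rightarrow> 'a :: comm_monoid_add"
proof -
  have "(\<Sum>r<d * p. g r) = (\<Sum>i<d. sum g {i * p..<i * p + p})"
    by (rule sum.nat_group[symmetric])
  also have "\<dots> = (\<Sum>i<d. \<Sum>a<p. g (i * p + a))"
  proof (rule sum.cong[OF refl])
    fix i
    show "sum g {i * p..<i * p + p} = (\<Sum>a<p. g (i * p + a))"
      using sum.shift_bounds_nat_ivl[of g 0 "i * p" p] by (simp add: atLeast0LessThan add.commute)
  qed
  finally show ?thesis .
qed

definition poly_of_block :: "nat \<Rightarrow> nat \<Rightarrow> real vec \<Rightarrow> nat \<Rightarrow> real poly" where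
  "poly_of_block p d F a = (\<Sum>i<d. monom (F $ (i * p + a)) i)"

definition block_of_poly :: "nat \<Rightarrow> nat \<Rightarrow> (nat \<Rightarrow> real poly) \<Rightarrow> real vec" where
  "block_of_poly p d f = vec (d * p) (\<lambda>r. coeff (f (r mod p)) (r div p))"

lemma block_index_less: "i < d \<Longrightarrow> a < p \<Longrightarrow> i * p + a < d * (p :: nat)"
proof -
  assume "i < d" "a < p"
  then have "i * p + a < i * p + p" by simp
  also have "\<dots> = Suc i * p" by simp
  also have "\<dots> \<le> d * p" using \<open>i < d\<close> by (intro mult_le_mono1) simp
  finally show ?thesis .
qed

lemma coeff_poly_of_block: "coeff (poly_of_block p d F a) i = (if i < d then F $ (i * p + a) else 0)"
  unfolding poly_of_block_def coeff_sum coeff_monom by (simp add: sum.delta')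

lemma poly_of_block_of_poly:
  assumes "\<And>i. i \<ge> d \<Longrightarrow> coeff (f a) i = 0" "a < p"
  shows "poly_of_block p d (block_of_poly p d f) a = f a"
  using assms by (intro poly_eqI) (auto simp: coeff_poly_of_block block_of_poly_def block_index_less)

lemma hank_carrier[simp]: "hank p d T \<in> carrier_mat (d * p) (d * p)"
  by (auto simp: hank_def)

lemma bcol_carrier[simp]: "bcol p d T \<in> carrier_mat (d * p) p"
  by (auto simp: bcol_def)

lemma hank_index:
  "i < d \<Longrightarrow> a < p \<Longrightarrow> j < d \<Longrightarrow> b < p \<Longrightarrow> hank p d T $$ (i * p + a, j * p + b) = T (i + j) $$ (a, b)"
  using block_index_less[of i d a p] block_index_less[of j d b p] by (simp add: hank_def)

text \<open>Position i * p + a of a stacked vector is read as the coefficient of x^i in component a;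
  the block T (i + j) then integrates x^(i + j) with weight w, so Hankel forms become formal
  integrals.\<close>

lemma qform_hank:
  assumes "weighted_moments p S w T" "F \<in> carrier_vec (d * p)"
  shows "qform (hank p d T) F = moment_form p S w (poly_of_block p d F)"
proof -
  have "qform (hank p d T) F = (\<Sum>i<d. \<Sum>a<p. \<Sum>j<d. \<Sum>b<p. T (i + j) $$ (a, b) * F $ (i * p + a) * F $ (j * p + b))"
    unfolding qform_sum[OF hank_carrier assms(2)] sum_lessThan_mult
    by (intro sum.cong refl) (simp add: hank_index)
  also have "\<dots> = (\<Sum>a<p. \<Sum>i<d. \<Sum>b<p. \<Sum>j<d. T (i + j) $$ (a, b) * F $ (i * p + a) * F $ (j * p + b))"
    by (subst sum.swap) (intro sum.cong refl sum.swap)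
  also have "\<dots> = (\<Sum>a<p. \<Sum>b<p. \<Sum>i<d. \<Sum>j<d. T (i + j) $$ (a, b) * F $ (i * p + a) * F $ (j * p + b))"
    by (intro sum.cong refl sum.swap)
  also have "\<dots> = moment_form p S w (poly_of_block p d F)"
    unfolding moment_form_def
  proof (intro sum.cong refl)
    fix a b assume "a \<in> {..<p}" "b \<in> {..<p}"
    have "w * poly_of_block p d F a * poly_of_block p d F b =
        (\<Sum>i<d. \<Sum>j<d. w * monom (F $ (i * p + a)) i * monom (F $ (j * p + b)) j)"
      unfolding poly_of_block_def mult.assoc sum_product by (simp add: sum_distrib_left)
    also have "\<dots> = (\<Sum>i<d. \<Sum>j<d. Polynomial.smult (F $ (i * p + a) * F $ (j * p + b)) (w * monom 1 (i + j)))"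
      by (intro sum.cong refl) (simp add: mult.assoc mult_monom smult_monom flip: mult_smult_right)
    finally show "(\<Sum>i<d. \<Sum>j<d. T (i + j) $$ (a, b) * F $ (i * p + a) * F $ (j * p + b))
        = moment_fun S a b (w * poly_of_block p d F a * poly_of_block p d F b)"
      using \<open>a \<in> _\<close> \<open>b \<in> _\<close> assms(1)
      by (simp add: moment_fun_setsum moment_fun_smult weighted_moments_def) (simp add: mult_ac)
  qed
  finally show ?thesis .
qed

text \<open>Common shape of S_k - S_k^- and S_k^+ - S_k: \<open>T\<close> is the sequence for the
  weight that belongs to the gap and to the parity of k, and \<open>d\<close> is the number of block
  rows of the Hankel matrix that is inverted.\<close>

definition hankel_schur :: "nat \<Rightarrow> nat \<Rightarrow> (nat \<Rightarrow> real mat) \<Rightarrow> real mat" where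
  "hankel_schur p d T = T (2 * d)
     - (bcol p d (\<lambda>i. T (d + i)))\<^sup>T * minv (hank p d T) * bcol p d (\<lambda>i. T (d + i))"

text \<open>A vector-valued polynomial of degree at most \<open>d\<close> whose leading coefficient is prescribed (possibly \<open>0\<close>). The Schur
  complement of the top block of a Hankel matrix is the minimum of the moment form over this class.\<close>

definition monic_like :: "nat \<Rightarrow> nat \<Rightarrow> (nat \<Rightarrow> real poly) \<Rightarrow> real vec \<Rightarrow> bool" where
  "monic_like p d f v \<longleftrightarrow> v \<in> carrier_vec p \<and> (\<forall>a<p. coeff (f a) d = v $ a \<and> (\<forall>i>d. coeff (f a) i = 0))"

lemma hank_cong: "(\<And>k. k < 2 * d - 1 \<Longrightarrow> T k = T' k) \<Longrightarrow> hank p d T = hank p d T'"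
proof (intro eq_matI)
  fix i j assume *: "\<And>k. k < 2 * d - 1 \<Longrightarrow> T k = T' k" and "i < dim_row (hank p d T')" "j < dim_col (hank p d T')"
  then have ij: "i < d * p" "j < d * p" by (auto simp: hank_def)
  then have "i div p < d" "j div p < d" using less_mult_imp_div_less by blast+
  then have "i div p + j div p < 2 * d - 1" by linarith
  then show "hank p d T $$ (i, j) = hank p d T' $$ (i, j)" using ij * by (simp add: hank_def)
qed (auto simp: hank_def)

lemma bcol_cong: "(\<And>k. k < d \<Longrightarrow> T k = T' k) \<Longrightarrow> bcol p d T = bcol p d T'"
  by (intro eq_matI) (auto simp: bcol_def less_mult_imp_div_less)

text \<open>Definiteness is assumed for \<open>d\<close> block rows only: that makes the Schur
  complement of the next block row meaningful and leaves its sign open.\<close>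

locale hankel_block =
  fixes p d :: nat and T :: "nat \<Rightarrow> real mat"
  assumes T_sym: "\<And>k. sym_mat p (T k)" and pd_hank: "pd (d * p) (hank p d T)"
begin

lemma hank_sym: "sym_mat (e * p) (hank p e T)"
proof (rule sym_matI)
  fix i j assume ij: "i < e * p" "j < e * p"
  then have "p > 0" by (cases p) auto
  then show "hank p e T $$ (i, j) = hank p e T $$ (j, i)"
    using ij sym_mat_index[OF T_sym, of "i mod p" "j mod p"] by (auto simp: hank_def add.commute)
qed simp

lemma det_hank: "det (hank p d T) \<noteq> 0"
  using pd_det_nonzero[OF pd_hank] by simp

sublocale schur_block "d * p" p "hank p d T" "bcol p d (\<lambda>i. T (d + i))" "T (2 * d)"
  by unfold_locales (auto simp: hank_sym T_sym det_hank)

lemma S_eq: "S = hankel_schur p d T"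
  unfolding S_def hankel_schur_def ..

lemma T_carrier: "T k \<in> carrier_mat p p" using T_sym by (auto simp: sym_mat_def)

lemma M_eq: "M = hank p (d + 1) T"
  unfolding M_def
proof (rule eq_matI)
  fix i j assume "i < dim_row (hank p (d + 1) T)" "j < dim_col (hank p (d + 1) T)"
  then have ij: "i < d * p + p" "j < d * p + p" by (auto simp: hank_def)
  then have p: "p > 0" by (cases p) auto
  have D: "k div p = d" "k mod p = k - d * p" if "\<not> k < d * p" "k < d * p + p" for k
  proof -
    have "k = (k - d * p) + d * p" "k - d * p < p" using that by auto
    then show "k div p = d" "k mod p = k - d * p" using p
      by (metis div_less div_mult_self3 mult.commute add.commute add.right_neutral less_not_refl, metis mod_less mod_mult_self1)
  qed
  have dl: "k div p < d" if "k < d * p" for k using that less_mult_imp_div_less by blast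
  have sw: "T k $$ (x mod p, y) = T k $$ (y, x mod p)" if "y < p" for k x y
    using sym_mat_index[OF T_sym, of "x mod p" y k] p that by simp
  show "four_block_mat (hank p d T) (bcol p d (\<lambda>i. T (d + i))) (bcol p d (\<lambda>i. T (d + i)))\<^sup>T (T (2 * d)) $$ (i, j)
      = hank p (d + 1) T $$ (i, j)"
    using ij p T_carrier[of "2 * d"] D[of i] D[of j] sw[of "j - d * p" "i div p + d" i] sw[of "i - d * p" "d + j div p" j]
    by (auto simp: hank_def bcol_def mult_2 add.commute)
qed (use T_carrier[of "2 * d"] in \<open>auto simp: hank_def bcol_def\<close>)

lemma hankel_schur_sym: "sym_mat p (hankel_schur p d T)"
  using S_sym unfolding S_eq .

lemma pd_hank_Suc: "pd ((d + 1) * p) (hank p (d + 1) T) \<longleftrightarrow> pd p (hankel_schur p d T)"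
  using pd_M_iff[OF pd_hank] unfolding M_eq S_eq by (simp add: add.commute)

lemma psd_hankel_schur: "psd ((d + 1) * p) (hank p (d + 1) T) \<Longrightarrow> psd p (hankel_schur p d T)"
  using psd_S unfolding M_eq S_eq by (simp add: add.commute)

text \<open>Coefficients below degree d form the free part of the stacked vector and the coefficient
  v of x^d its last block, so the bound for Schur complements applies.\<close>

lemma hankel_schur_le:
  assumes "weighted_moments p S' w T" "monic_like p d f v"
  shows "qform (hankel_schur p d T) v \<le> moment_form p S' w f"
proof -
  define u where "u = block_of_poly p d f"
  have v: "v \<in> carrier_vec p" using assms(2) by (auto simp: monic_like_def)
  have u: "u \<in> carrier_vec (d * p)" by (auto simp: u_def block_of_poly_def)
  have uv: "u @\<^sub>v v = block_of_poly p (d + 1) f"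
  proof (rule eq_vecI)
    fix r assume "r < dim_vec (block_of_poly p (d + 1) f)"
    then have r: "r < d * p + p" by (simp add: block_of_poly_def)
    show "(u @\<^sub>v v) $ r = block_of_poly p (d + 1) f $ r"
    proof (cases "r < d * p")
      case True
      then show ?thesis using u v by (simp add: u_def block_of_poly_def)
    next
      case False
      then obtain a where a: "r = d * p + a" "a < p" using r by (metis add_less_cancel_left le_Suc_ex leI)
      then show ?thesis using u v assms(2) by (simp add: block_of_poly_def monic_like_def)
    qed
  qed (use u v in \<open>auto simp: block_of_poly_def\<close>)
  have "qform S v \<le> qform M (u @\<^sub>v v)" by (rule qform_M_ge[OF pd_hank u v])
  also have "\<dots> = moment_form p S' w (poly_of_block p (d + 1) (block_of_poly p (d + 1) f))"
    unfolding M_eq uv by (rule qform_hank[OF assms(1)]) (simp add: block_of_poly_def)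
  also have "\<dots> = moment_form p S' w f" unfolding moment_form_def
    using assms(2) by (intro sum.cong refl) (simp add: poly_of_block_of_poly monic_like_def)
  finally show ?thesis unfolding S_eq .
qed

lemma hankel_schur_attained:
  assumes "weighted_moments p S' w T" "v \<in> carrier_vec p"
  shows "\<exists>f. monic_like p d f v \<and> moment_form p S' w f = qform (hankel_schur p d T) v"
proof -
  obtain u where u: "u \<in> carrier_vec (d * p)" "qform M (u @\<^sub>v v) = qform S v"
    using qform_M_attained[OF assms(2)] by auto
  let ?f = "poly_of_block p (d + 1) (u @\<^sub>v v)"
  have "qform M (u @\<^sub>v v) = moment_form p S' w ?f"
    unfolding M_eq using append_carrier_vec[OF u(1) assms(2)]
    by (intro qform_hank[OF assms(1)]) (simp add: add.commute)
  moreover have "monic_like p d ?f v"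
    using u assms(2) by (auto simp: monic_like_def coeff_poly_of_block)
  ultimately show ?thesis using u(2) unfolding S_eq by metis
qed

end

text \<open>The polarised identity x f f' + (1 - x) g g' = F F' + x (1 - x) G G' is required because
  \<open>moment_form\<close> multiplies different components of the vector polynomial.\<close>

lemma moment_form_split:
  "moment_form p S pX f + moment_form p S (1 - pX) g
    = moment_form p S 1 (\<lambda>a. pX * f a + (1 - pX) * g a) + moment_form p S (pX * (1 - pX)) (\<lambda>a. f a - g a)"
proof -
  have *: "x * f * f' + (1 - x) * g * g' = 1 * (x * f + (1 - x) * g) * (x * f' + (1 - x) * g')
      + x * (1 - x) * (f - g) * (f' - g')" for x f f' g g' :: "real poly"
    by (simp add: algebra_simps)
  show ?thesis unfolding moment_form_def sum.distrib[symmetric] moment_fun_add[symmetric] * ..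
qed

text \<open>The hypotheses say that \<open>R\<close> is the parallel sum \<open>(D\<^sup>-\<^sup>1 + E\<^sup>-\<^sup>1)\<^sup>-\<^sup>1\<close>, given by its variational
  characterisation: it is the Schur complement of the block \<open>D + E\<close> in the matrix with blocks \<open>D + E, D, D, D\<close>.\<close>

lemma parallel_sum:
  assumes D: "sym_mat p D" "pd p D" and E: "sym_mat p E" "pd p E" and R: "sym_mat p R"
    and le: "\<And>v a. v \<in> carrier_vec p \<Longrightarrow> a \<in> carrier_vec p \<Longrightarrow> qform R v \<le> qform D (a + v) + qform E a"
    and att: "\<And>v. v \<in> carrier_vec p \<Longrightarrow> \<exists>a \<in> carrier_vec p. qform D (a + v) + qform E a \<le> qform R v"
  shows "pd p R" "det R = det D * det E / det (D + E)"
proof -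
  note Dc = sym_matD[OF D(1)] and Ec = sym_matD[OF E(1)]
  have N: "sym_mat p (D + E)" "pd p (D + E)" using sym_mat_add[OF D(1) E(1)] pd_add[OF D(2) E(2) Dc(1) Ec(1)] by auto
  note Nc = sym_matD[OF N(1)]
  have dN: "det (D + E) \<noteq> 0" using pd_det_nonzero[OF N(2) Nc(1)] .
  \<comment> \<open>At (a, v) this block matrix has the form D (a + v) + E (a), so its Schur
    complement is the minimum over \<open>a\<close> that the hypotheses ascribe to
    \<open>R\<close>.\<close>
  interpret schur_block p p "D + E" D D by unfold_locales (use N D Dc dN in auto)
  have qM: "qform M (a @\<^sub>v v) = qform D (a + v) + qform E a" if "a \<in> carrier_vec p" "v \<in> carrier_vec p" for a v
  proof -
    have "M *\<^sub>v (a @\<^sub>v v) = ((D + E) *\<^sub>v a + D *\<^sub>v v) @\<^sub>v (D *\<^sub>v a + D *\<^sub>v v)"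
      unfolding M_def Dc(2) by (rule four_block_mat_mult_vec[of _ p p _ p _ p]) (use that Dc Nc in auto)
    then have "qform M (a @\<^sub>v v) = a \<bullet> ((D + E) *\<^sub>v a + D *\<^sub>v v) + v \<bullet> (D *\<^sub>v a + D *\<^sub>v v)"
      using that Dc(1) Nc(1) by (auto intro: scalar_prod_append[of _ p _ p])
    then show ?thesis using that Dc(1) Ec(1)
      by (simp add: add_mult_distrib_mat_vec[of _ p p] mult_add_distrib_mat_vec[of _ p p] scalar_prod_add_distrib[of _ p]
          add_scalar_prod_distrib[of _ p])
  qed
  have "R = S"
  proof (rule sym_mat_eqI_qform[OF R S_sym])
    fix v :: "real vec" assume v: "v \<in> carrier_vec p"
    show "qform R v = qform S v"
    proof (rule antisym)
      obtain u where u: "u \<in> carrier_vec p" "qform M (u @\<^sub>v v) = qform S v" using qform_M_attained[OF v] by auto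
      then show "qform R v \<le> qform S v" using le[OF v u(1)] qM[OF u(1) v] by simp
      obtain a where "a \<in> carrier_vec p" "qform D (a + v) + qform E a \<le> qform R v" using att[OF v] by auto
      then show "qform S v \<le> qform R v" using qform_M_ge[OF N(2) _ v] qM[OF _ v] by force
    qed
  qed
  show "pd p R" unfolding pd_def
  proof (intro ballI impI)
    fix v :: "real vec" assume v: "v \<in> carrier_vec p" "v \<noteq> 0\<^sub>v p"
    obtain a where a: "a \<in> carrier_vec p" "qform D (a + v) + qform E a \<le> qform R v" using att[OF v(1)] by auto
    show "qform R v > 0"
    proof (cases "a = 0\<^sub>v p")
      case True
      then have "qform D (a + v) > 0" using pdD[OF D(2) v] v by simp
      moreover have "qform E a \<ge> 0" using psdD[OF pd_psd[OF E(2) Ec(1)] a(1)] .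
      ultimately show ?thesis using a(2) by simp
    next
      case False
      then have "qform E a > 0" using pdD[OF E(2) a(1)] by simp
      moreover have "qform D (a + v) \<ge> 0" by (rule psdD[OF pd_psd[OF D(2) Dc(1)]]) (use a v in auto)
      ultimately show ?thesis using a(2) by simp
    qed
  qed
  \<comment> \<open>The expression D - D (D + E)^(-1) D, rewritten with I = (D + E)^(-1) D + (D +
    E)^(-1) E; as a product its determinant factors.\<close>
  have "S = D * (minv (D + E) * E)"
  proof -
    have c: "minv (D + E) * D \<in> carrier_mat p p" "minv (D + E) * E \<in> carrier_mat p p" using Ainv Dc Ec by auto
    have "1\<^sub>m p = minv (D + E) * D + minv (D + E) * E"
      using Ainv Dc(1) Ec(1) by (simp add: mult_add_distrib_mat[of _ p p _ p])
    then have "D = D * (minv (D + E) * D + minv (D + E) * E)" using Dc(1) by (metis right_mult_one_mat)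
    also have "\<dots> = D * (minv (D + E) * D) + D * (minv (D + E) * E)"
      by (rule mult_add_distrib_mat[OF Dc(1) c])
    finally have "D = D * (minv (D + E) * D) + D * (minv (D + E) * E)" .
    moreover have "D * minv (D + E) * D = D * (minv (D + E) * D)" by (rule assoc_mult_mat[OF Dc(1) Ainv(1) Dc(1)])
    moreover have "P + Q - P = Q" if "P \<in> carrier_mat p p" "Q \<in> carrier_mat p p" for P Q :: "real mat"
      using that by (intro eq_matI) auto
    moreover have "D * (minv (D + E) * D) \<in> carrier_mat p p" "D * (minv (D + E) * E) \<in> carrier_mat p p" using c Dc by auto
    ultimately show ?thesis unfolding S_def Dc(2) by metis
  qed
  then have "det S = det D * (det (minv (D + E)) * det E)"
    using det_mult[OF Dc(1), of "minv (D + E) * E"] det_mult[OF Ainv(1) Ec(1)] Ainv(1) Ec(1) by simp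
  then show "det R = det D * det E / det (D + E)"
    using \<open>R = S\<close> det_minv[OF Nc(1) dN] by simp
qed

subsection \<open>Moment sequences\<close>

text \<open>\<open>low_gap\<close>, \<open>up_gap\<close> and \<open>moment_range\<close> are the
  matrices D_k, E_k and R_k of the opening comment.\<close>

definition low_gap :: "nat \<Rightarrow> (nat \<Rightarrow> real mat) \<Rightarrow> nat \<Rightarrow> real mat" where
  "low_gap p S k = S k - sminus p S k"

definition up_gap :: "nat \<Rightarrow> (nat \<Rightarrow> real mat) \<Rightarrow> nat \<Rightarrow> real mat" where
  "up_gap p S k = splus p S k - S k"

definition moment_range :: "nat \<Rightarrow> (nat \<Rightarrow> real mat) \<Rightarrow> nat \<Rightarrow> real mat" where
  "moment_range p S k = splus p S k - sminus p S k"

text \<open>The pairs of weights are those in the representation of nonnegative polynomials on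
  [0,1]: f^2 + x (1 - x) g^2 in even degree, x f^2 + (1 - x) g^2 in odd degree.\<close>

definition low_weight :: "nat \<Rightarrow> real poly" where
  "low_weight k = (if even k then 1 else pX)"

definition up_weight :: "nat \<Rightarrow> real poly" where
  "up_weight k = (if even k then pX * (1 - pX) else 1 - pX)"

definition low_seq :: "(nat \<Rightarrow> real mat) \<Rightarrow> nat \<Rightarrow> nat \<Rightarrow> real mat" where
  "low_seq S k = (if even k then S else (\<lambda>j. S (j + 1)))"

definition up_seq :: "(nat \<Rightarrow> real mat) \<Rightarrow> nat \<Rightarrow> nat \<Rightarrow> real mat" where
  "up_seq S k = (if even k then (\<lambda>j. S (j + 1) - S (j + 2)) else (\<lambda>j. S j - S (j + 1)))"

lemma pd_dim0: "pd 0 A"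
  unfolding pd_def by auto

locale moment_seq =
  fixes p :: nat and S :: "nat \<Rightarrow> real mat"
  assumes S_sym: "\<And>k. sym_mat p (S k)" and S_0: "S 0 = 1\<^sub>m p"
begin

lemma S_carrier: "S k \<in> carrier_mat p p" using S_sym by (auto simp: sym_mat_def)

lemma S_dim[simp]: "dim_row (S k) = p" "dim_col (S k) = p" using S_carrier[of k] by auto

lemma low_seq_sym: "sym_mat p (low_seq S k j)" and up_seq_sym: "sym_mat p (up_seq S k j)"
  by (auto simp: low_seq_def up_seq_def S_sym intro!: sym_mat_minus)

lemma weighted_low: "weighted_moments p S (low_weight k) (low_seq S k)"
  and weighted_up: "weighted_moments p S (up_weight k) (up_seq S k)"
  using weighted_moments_simps[of S p, OF S_carrier] by (auto simp: low_weight_def up_weight_def low_seq_def up_seq_def)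

text \<open>With an empty Hankel matrix nothing is subtracted. This brings the conventions S_1^- =
  0, S_1^+ = I and S_2^+ = S_1 under the general formula.\<close>

lemma hankel_schur_0: "sym_mat p (T 0) \<Longrightarrow> hankel_schur p 0 T = T 0"
proof -
  assume T: "sym_mat p (T 0)"
  have h: "hank p 0 T \<in> carrier_mat 0 0" using hank_carrier[of p 0 T] by simp
  have b: "bcol p 0 (\<lambda>i. T (0 + i)) \<in> carrier_mat 0 p" using bcol_carrier[of p 0] by simp
  have m: "minv (hank p 0 T) \<in> carrier_mat 0 0" using minv_props(1)[OF h] det_dim_zero[OF h] by simp
  have "((bcol p 0 (\<lambda>i. T (0 + i)))\<^sup>T * minv (hank p 0 T)) * bcol p 0 (\<lambda>i. T (0 + i)) = 0\<^sub>m p p"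
    using b m by (intro eq_matI) (auto simp: scalar_prod_def)
  then show ?thesis unfolding hankel_schur_def using T by (auto simp: sym_mat_def)
qed

text \<open>Parity bookkeeping: in either parity the Hankel matrix inverted in S_k^- has k div 2
  block rows.\<close>

lemma low_gap_eq: "k \<ge> 1 \<Longrightarrow> low_gap p S k = hankel_schur p (k div 2) (low_seq S k)"
proof -
  assume k: "k \<ge> 1"
  show ?thesis
  proof (cases "k = 1")
    case True
    have "S (Suc 0) - 0\<^sub>m p p = S (Suc 0)" by (intro eq_matI) auto
    with True show ?thesis using hankel_schur_0[of "low_seq S k", OF low_seq_sym] S_carrier[of 1]
      by (simp add: low_gap_def sminus_def low_seq_def)
  next
    case False
    then have k2: "k \<ge> 2" using k by simp
    show ?thesis
    proof (cases "even k")
      case True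
      then obtain m where "k = 2 * m" "m \<ge> 1" using k by (auto elim!: evenE)
      then have "odd (k - 1)" "even (k - 2)" "(k - 2) div 2 + 1 = m" by auto
      then show ?thesis using k2 True \<open>k = 2 * m\<close> \<open>m \<ge> 1\<close>
        by (simp add: low_gap_def sminus_def hankel_schur_def low_seq_def lowh_def lowH_def)
    next
      case False
      then obtain m where "k = 2 * m + 1" by (auto elim!: oddE)
      then have "m \<ge> 1" "even (k - 1)" "odd (k - 2)" "(k - 2) div 2 + 1 = m" using k2 by (auto intro: Suc_leI)
      then show ?thesis using k2 False \<open>k = 2 * m + 1\<close>
        by (simp add: low_gap_def sminus_def hankel_schur_def low_seq_def lowh_def lowH_def add.commute)
    qed
  qed
qed

text \<open>The corner block of the weighted sequence is S_(k-1) - S_k, so the subtraction of S_k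
  has to be moved past the Schur term, which is what \<open>comm\<close> does.\<close>

lemma up_gap_eq: "k \<ge> 1 \<Longrightarrow> up_gap p S k = hankel_schur p ((k - 1) div 2) (up_seq S k)"
proof -
  assume k: "k \<ge> 1"
  consider "k = 1" | "k = 2" | "k \<ge> 3" using k by linarith
  then show ?thesis
  proof cases
    case 1
    then show ?thesis using hankel_schur_0[of "up_seq S k", OF up_seq_sym] S_carrier[of 1] S_0
      by (simp add: up_gap_def splus_def up_seq_def)
  next
    case 2
    have "S (Suc (Suc 0)) = S 2" by (simp add: numeral_2_eq_2)
    with 2 show ?thesis using hankel_schur_0[of "up_seq S k", OF up_seq_sym] S_carrier[of 1] S_0
      by (simp add: up_gap_def splus_def up_seq_def)
  next
    case 3
    have comm: "A - B - C = A - C - B" if "A \<in> carrier_mat p p" "B \<in> carrier_mat p p" "C \<in> carrier_mat p p" for A B C :: "real mat"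
      using that by (intro eq_matI) auto
    have c: "(bcol p d t)\<^sup>T * Y * bcol p d t \<in> carrier_mat p p" for d t Y
      by (intro carrier_matI) (auto simp: bcol_def)
    show ?thesis
    proof (cases "even k")
      case True
      then obtain m where "k = 2 * m" by (auto elim!: evenE)
      then obtain l where "k = 2 * l + 2" using 3 by (metis Suc_eq_plus1 add_2_eq_Suc' mult_Suc_right not0_implies_Suc not_numeral_le_zero mult_0_right add.commute)
      then have "odd (k - 1)" "even (k - 2)" "(k - 2) div 2 = l" "(k - 1) div 2 = l" "(k - 1 + 1) div 2 - 1 = l" by auto
      then show ?thesis using 3 True \<open>k = 2 * l + 2\<close> comm[OF S_carrier c S_carrier]
        by (simp add: up_gap_def splus_def hankel_schur_def up_seq_def uph_def upH_def add.commute)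
    next
      case False
      then obtain m where "k = 2 * m + 1" by (auto elim!: oddE)
      then have "m \<ge> 1" "even (k - 1)" "odd (k - 2)" "(k - 2) div 2 + 1 = m" using 3 by (auto intro: Suc_leI)
      then show ?thesis using 3 False \<open>k = 2 * m + 1\<close> comm[OF S_carrier c S_carrier]
        by (simp add: up_gap_def splus_def hankel_schur_def up_seq_def uph_def upH_def add.commute)
    qed
  qed
qed

definition interior :: "nat \<Rightarrow> bool" where
  "interior n \<longleftrightarrow> (\<forall>k \<in> {1..n}. pd p (low_gap p S k) \<and> pd p (up_gap p S k))"

lemma interior_mono: "interior n \<Longrightarrow> m \<le> n \<Longrightarrow> interior m"
  by (auto simp: interior_def)

lemma interior_Suc: "interior (Suc n) \<longleftrightarrow> interior n \<and> pd p (low_gap p S (Suc n)) \<and> pd p (up_gap p S (Suc n))"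
  by (auto simp: interior_def atLeastAtMostSuc_conv)

lemma low_seq_minus2: "2 \<le> k \<Longrightarrow> low_seq S (k - 2) = low_seq S k"
  and up_seq_minus2: "2 \<le> k \<Longrightarrow> up_seq S (k - 2) = up_seq S k"
  by (simp_all add: low_seq_def up_seq_def)

text \<open>Orders k - 2 and k share their weights, and their Hankel matrices differ by one block
  row; hence strong induction in steps of two, where the gap of order k is the Schur complement that
  is added.\<close>

lemma interior_hank:
  "interior n \<Longrightarrow> k \<le> n \<Longrightarrow> pd ((k div 2 + 1) * p) (hank p (k div 2 + 1) (low_seq S k))"
  "interior n \<Longrightarrow> 1 \<le> k \<Longrightarrow> k \<le> n \<Longrightarrow> pd (((k - 1) div 2 + 1) * p) (hank p ((k - 1) div 2 + 1) (up_seq S k))"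
proof -
  assume n: "interior n"
  show "pd ((k div 2 + 1) * p) (hank p (k div 2 + 1) (low_seq S k))" if "k \<le> n"
    using that
  proof (induction k rule: less_induct)
    case (less k)
    show ?case
    proof (cases "k = 0")
      case True
      have "hank p 1 S = 1\<^sub>m p"
        using S_0 by (intro eq_matI) (auto simp: hank_def)
      then show ?thesis using True pd_one[of p] by (simp add: low_seq_def)
    next
      case False
      have prev: "pd (k div 2 * p) (hank p (k div 2) (low_seq S k))"
      proof (cases "k < 2")
        case True
        then show ?thesis by (simp add: pd_dim0)
      next
        case False
        then have "(k - 2) div 2 + 1 = k div 2" by (auto simp: le_div_geq)
        then show ?thesis using less.IH[of "k - 2"] less.prems False low_seq_minus2[of k] by simp
      qed
      interpret hankel_block p "k div 2" "low_seq S k"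
        by unfold_locales (rule low_seq_sym, rule prev)
      have "pd p (low_gap p S k)" using n False less.prems by (simp add: interior_def)
      then show ?thesis using pd_hank_Suc low_gap_eq[of k] False by simp
    qed
  qed
  show "pd (((k - 1) div 2 + 1) * p) (hank p ((k - 1) div 2 + 1) (up_seq S k))" if "1 \<le> k" "k \<le> n"
    using that
  proof (induction k rule: less_induct)
    case (less k)
    have prev: "pd ((k - 1) div 2 * p) (hank p ((k - 1) div 2) (up_seq S k))"
    proof (cases "k < 3")
      case True
      then have "(k - 1) div 2 = 0" by simp
      then show ?thesis by (simp add: pd_dim0)
    next
      case False
      then have "(k - 2 - 1) div 2 + 1 = (k - 1) div 2" by (auto simp: le_div_geq)
      then show ?thesis using less.IH[of "k - 2"] less.prems False up_seq_minus2[of k] by simp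
    qed
    interpret hankel_block p "(k - 1) div 2" "up_seq S k"
      by unfold_locales (rule up_seq_sym, rule prev)
    have "pd p (up_gap p S k)" using n less.prems by (simp add: interior_def)
    then show ?case using pd_hank_Suc up_gap_eq[of k] less.prems by simp
  qed
qed

text \<open>The bounds of order n + 1 invert Hankel matrices of order n - 1, so interiority up to n
  already makes them well defined. This is why \<open>k\<close> may reach n + 1.\<close>

lemma interior_hankel_block:
  assumes "interior n" "1 \<le> k" "k \<le> n + 1"
  shows "hankel_block p (k div 2) (low_seq S k)" "hankel_block p ((k - 1) div 2) (up_seq S k)"
proof -
  have "pd (k div 2 * p) (hank p (k div 2) (low_seq S k))"
  proof (cases "k < 2")
    case False
    then have "(k - 2) div 2 + 1 = k div 2" by (auto simp: le_div_geq)
    then show ?thesis using interior_hank(1)[OF assms(1), of "k - 2"] assms False low_seq_minus2[of k] by simp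
  qed (simp add: pd_dim0)
  then show "hankel_block p (k div 2) (low_seq S k)" by unfold_locales (rule low_seq_sym)
  have "pd ((k - 1) div 2 * p) (hank p ((k - 1) div 2) (up_seq S k))"
  proof (cases "k < 3")
    case True
    then have "(k - 1) div 2 = 0" by simp
    then show ?thesis by (simp add: pd_dim0)
  next
    case False
    then have "(k - 2 - 1) div 2 + 1 = (k - 1) div 2" by (auto simp: le_div_geq)
    then show ?thesis using interior_hank(2)[OF assms(1), of "k - 2"] assms False up_seq_minus2[of k] by simp
  qed
  then show "hankel_block p ((k - 1) div 2) (up_seq S k)" by unfold_locales (rule up_seq_sym)
qed

lemma gap_sym:
  assumes "interior n" "1 \<le> k" "k \<le> n + 1"
  shows "sym_mat p (low_gap p S k)" "sym_mat p (up_gap p S k)" "sym_mat p (sminus p S k)" "sym_mat p (moment_range p S k)"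
    "moment_range p S k = low_gap p S k + up_gap p S k"
proof -
  interpret L: hankel_block p "k div 2" "low_seq S k" by (rule interior_hankel_block[OF assms])
  interpret U: hankel_block p "(k - 1) div 2" "up_seq S k" by (rule interior_hankel_block[OF assms])
  show l: "sym_mat p (low_gap p S k)" using L.hankel_schur_sym low_gap_eq[OF assms(2)] by simp
  show u: "sym_mat p (up_gap p S k)" using U.hankel_schur_sym up_gap_eq[OF assms(2)] by simp
  \<comment> \<open>The dimensions of a difference are by definition those of the subtrahend, so
    they are recovered from \<open>low_gap\<close>.\<close>
  have sm: "sminus p S k \<in> carrier_mat p p" using l unfolding low_gap_def sym_mat_def
    by (metis carrier_matD carrier_matI index_minus_mat(2,3))
  have up: "dim_col (uph p S j) = p" for j by (simp add: uph_def bcol_def)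
  have sp: "splus p S k \<in> carrier_mat p p" unfolding splus_def
    by (intro carrier_matI) (simp_all add: up)
  have "sminus p S k = S k - low_gap p S k" unfolding low_gap_def using sm S_carrier[of k] by (intro eq_matI) auto
  then show "sym_mat p (sminus p S k)" using sym_mat_minus[OF S_sym l] by simp
  show e: "moment_range p S k = low_gap p S k + up_gap p S k"
    unfolding moment_range_def low_gap_def up_gap_def using sm sp by (intro eq_matI) auto
  show "sym_mat p (moment_range p S k)" unfolding e using sym_mat_add[OF l u] .
qed

lemma coeff_X_mult: "coeff (pX * q) i = (if i = 0 then 0 else coeff q (i - 1))"
  unfolding pX_def by (cases i) auto

lemma coeff_1mX_mult: "coeff ((1 - pX) * q) i = coeff q i - (if i = 0 then 0 else coeff q (i - 1))"
  unfolding left_diff_distrib coeff_diff coeff_X_mult by simp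

lemma even_ge1: "even k \<Longrightarrow> 1 \<le> k \<Longrightarrow> \<exists>m. k = 2 * m + 2" for k :: nat
  by presburger

lemma monic_likeI:
  assumes "v \<in> carrier_vec p" "\<And>a. a < p \<Longrightarrow> coeff (f a) d = v $ a" "\<And>a i. a < p \<Longrightarrow> i > d \<Longrightarrow> coeff (f a) i = 0"
  shows "monic_like p d f v"
  using assms by (auto simp: monic_like_def)

lemma monic_likeD:
  assumes "monic_like p d f v" "a < p"
  shows "coeff (f a) d = v $ a" "i > d \<Longrightarrow> coeff (f a) i = 0"
  using assms by (auto simp: monic_like_def)

text \<open>The identity \<open>x f\<^sup>2 + (1 - x) g\<^sup>2 = F\<^sup>2 + x (1 - x) G\<^sup>2\<close> with \<open>F = x f + (1 - x) g\<close> and \<open>G = f - g\<close>, together with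
  \<open>f = F + (1 - x) G\<close> and \<open>g = F - x G\<close>, turns the two minimisation problems of order \<open>k\<close> into those of order \<open>k + 1\<close>.\<close>

lemma moment_range_step:
  assumes n: "interior k" and k: "k \<ge> 1"
  shows "pd p (moment_range p S (Suc k))"
    "det (moment_range p S (Suc k)) = det (low_gap p S k) * det (up_gap p S k) / det (moment_range p S k)"
proof -
  let ?D = "low_gap p S k" and ?E = "up_gap p S k" and ?R = "moment_range p S (Suc k)"
  note g = gap_sym[OF n k le_add1]
  have k': "1 \<le> Suc k" "Suc k \<le> k + 1" by auto
  note g' = gap_sym[OF n k']
  interpret L: hankel_block p "k div 2" "low_seq S k" by (rule interior_hankel_block[OF n k le_add1])
  interpret U: hankel_block p "(k - 1) div 2" "up_seq S k" by (rule interior_hankel_block[OF n k le_add1])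
  interpret L': hankel_block p "Suc k div 2" "low_seq S (Suc k)" by (rule interior_hankel_block[OF n k'])
  interpret U': hankel_block p "k div 2" "up_seq S (Suc k)" using interior_hankel_block[OF n k'] by simp
  have pdD': "pd p ?D" and pdE: "pd p ?E" using n k by (auto simp: interior_def)
  note D_le = L.hankel_schur_le[OF weighted_low, folded low_gap_eq[OF k]]
    and D_att = L.hankel_schur_attained[OF weighted_low, folded low_gap_eq[OF k]]
    and E_le = U.hankel_schur_le[OF weighted_up, folded up_gap_eq[OF k]]
    and E_att = U.hankel_schur_attained[OF weighted_up, folded up_gap_eq[OF k]]
    and D'_le = L'.hankel_schur_le[OF weighted_low, folded low_gap_eq[OF k'(1)]]
    and D'_att = L'.hankel_schur_attained[OF weighted_low, folded low_gap_eq[OF k'(1)]]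
    and E'_le = U'.hankel_schur_le[OF weighted_up, folded up_gap_eq[OF k'(1), unfolded diff_Suc_1]]
    and E'_att = U'.hankel_schur_attained[OF weighted_up, folded up_gap_eq[OF k'(1), unfolded diff_Suc_1]]
  have qR: "qform ?R v = qform (low_gap p S (Suc k)) v + qform (up_gap p S (Suc k)) v" if "v \<in> carrier_vec p" for v
    unfolding g'(5) using g'(1,2) that by (intro qform_add) (auto simp: sym_mat_def)
  \<comment> \<open>Optimal polynomials for D at a + v and for E at a are transformed into two
    competitors of order k + 1, both with leading coefficient v.\<close>
  have le: "qform ?R v \<le> qform ?D (a + v) + qform ?E a" if v: "v \<in> carrier_vec p" and a: "a \<in> carrier_vec p" for v a
  proof (cases "even k")
    case True
    then obtain m where m: "k = 2 * m + 2" using k even_ge1 by blast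
    obtain F where F: "monic_like p (Suc m) F (a + v)" "moment_form p S 1 F = qform ?D (a + v)"
      using D_att[of "a + v"] a v m by (auto simp: low_weight_def)
    obtain G where G: "monic_like p m G a" "moment_form p S (pX * (1 - pX)) G = qform ?E a"
      using E_att[of a] a m by (auto simp: up_weight_def)
    define f where "f = (\<lambda>b. F b + (1 - pX) * G b)"
    define g where "g = (\<lambda>b. F b - pX * G b)"
    have "monic_like p (Suc m) f v" "monic_like p (Suc m) g v"
      using v a by (auto intro!: monic_likeI simp: f_def g_def coeff_1mX_mult coeff_X_mult monic_likeD[OF F(1)] monic_likeD[OF G(1)])
    then have "qform ?R v \<le> moment_form p S pX f + moment_form p S (1 - pX) g"
      using D'_le[of f v] E'_le[of g v] m qR[OF v] by (simp add: low_weight_def up_weight_def)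
    also have "\<dots> = moment_form p S 1 (\<lambda>a. pX * f a + (1 - pX) * g a) + moment_form p S (pX * (1 - pX)) (\<lambda>a. f a - g a)"
      by (rule moment_form_split)
    also have "(\<lambda>a. pX * f a + (1 - pX) * g a) = F" by (rule ext) (simp add: f_def g_def algebra_simps)
    also have "(\<lambda>a. f a - g a) = G" by (rule ext) (simp add: f_def g_def algebra_simps)
    finally show ?thesis using F G by simp
  next
    case False
    then obtain m where m: "k = 2 * m + 1" by (auto elim!: oddE)
    obtain f where f: "monic_like p m f (a + v)" "moment_form p S pX f = qform ?D (a + v)"
      using D_att[of "a + v"] a v m by (auto simp: low_weight_def)
    obtain g where g: "monic_like p m g a" "moment_form p S (1 - pX) g = qform ?E a"
      using E_att[of a] a m by (auto simp: up_weight_def)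
    define F where "F = (\<lambda>b. pX * f b + (1 - pX) * g b)"
    define G where "G = (\<lambda>b. f b - g b)"
    have "monic_like p (Suc m) F v" "monic_like p m G v"
      using v a by (auto intro!: monic_likeI simp: F_def G_def coeff_1mX_mult coeff_X_mult monic_likeD[OF f(1)] monic_likeD[OF g(1)])
    then have "qform ?R v \<le> moment_form p S 1 F + moment_form p S (pX * (1 - pX)) G"
      using D'_le[of F v] E'_le[of G v] m qR[OF v] by (simp add: low_weight_def up_weight_def)
    also have "\<dots> = moment_form p S pX f + moment_form p S (1 - pX) g"
      unfolding F_def G_def by (rule moment_form_split[symmetric])
    finally show ?thesis using f g by simp
  qed
  have att: "\<exists>a \<in> carrier_vec p. qform ?D (a + v) + qform ?E a \<le> qform ?R v" if v: "v \<in> carrier_vec p" for v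
  proof (cases "even k")
    case True
    then obtain m where m: "k = 2 * m + 2" using k even_ge1 by blast
    obtain f where f: "monic_like p (Suc m) f v" "moment_form p S pX f = qform (low_gap p S (Suc k)) v"
      using D'_att[of v] v m by (auto simp: low_weight_def)
    obtain g where g: "monic_like p (Suc m) g v" "moment_form p S (1 - pX) g = qform (up_gap p S (Suc k)) v"
      using E'_att[of v] v m by (auto simp: up_weight_def)
    define F where "F = (\<lambda>b. pX * f b + (1 - pX) * g b)"
    define G where "G = (\<lambda>b. f b - g b)"
    \<comment> \<open>The common leading coefficient v of f and g cancels in degree m + 2 of F and
      in degree m + 1 of G. What remains on top is a in G, and a + v in F.\<close>
    define a where "a = vec p (\<lambda>b. coeff (G b) m)"
    have a: "a \<in> carrier_vec p" by (simp add: a_def)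
    have "monic_like p (Suc m) F (a + v)"
    proof (rule monic_likeI)
      fix b i assume "b < p" "Suc m < i"
      then show "coeff (F b) i = 0"
        by (cases "i = Suc (Suc m)") (auto simp: F_def coeff_1mX_mult coeff_X_mult monic_likeD[OF f(1)] monic_likeD[OF g(1)])
    qed (use v in \<open>auto simp: a_def G_def F_def coeff_1mX_mult coeff_X_mult monic_likeD[OF f(1)] monic_likeD[OF g(1)]\<close>)
    moreover have "monic_like p m G a"
    proof (rule monic_likeI)
      fix b i assume "b < p" "m < i"
      then show "coeff (G b) i = 0"
        by (cases "i = Suc m") (auto simp: G_def monic_likeD[OF f(1)] monic_likeD[OF g(1)])
    qed (auto simp: a_def)
    ultimately have "qform ?D (a + v) + qform ?E a \<le> moment_form p S 1 F + moment_form p S (pX * (1 - pX)) G"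
      using D_le[of F "a + v"] E_le[of G a] m by (simp add: low_weight_def up_weight_def)
    also have "\<dots> = moment_form p S pX f + moment_form p S (1 - pX) g"
      unfolding F_def G_def by (rule moment_form_split[symmetric])
    finally show ?thesis using f g qR[OF v] a by auto
  next
    case False
    then obtain m where m: "k = 2 * m + 1" by (auto elim!: oddE)
    obtain F where F: "monic_like p (Suc m) F v" "moment_form p S 1 F = qform (low_gap p S (Suc k)) v"
      using D'_att[of v] v m by (auto simp: low_weight_def)
    obtain G where G: "monic_like p m G v" "moment_form p S (pX * (1 - pX)) G = qform (up_gap p S (Suc k)) v"
      using E'_att[of v] v m by (auto simp: up_weight_def)
    define f where "f = (\<lambda>b. F b + (1 - pX) * G b)"
    define g where "g = (\<lambda>b. F b - pX * G b)"
    \<comment> \<open>The common leading coefficient v of F and G cancels in degree m + 1 of both f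
      and g; in degree m these two differ by v, which gives a + v and a.\<close>
    define a where "a = vec p (\<lambda>b. coeff (g b) m)"
    have a: "a \<in> carrier_vec p" by (simp add: a_def)
    have "monic_like p m f (a + v)"
    proof (rule monic_likeI)
      fix b i assume "b < p" "m < i"
      then show "coeff (f b) i = 0"
        by (cases "i = Suc m") (auto simp: f_def coeff_1mX_mult coeff_X_mult monic_likeD[OF F(1)] monic_likeD[OF G(1)])
    qed (use v in \<open>auto simp: a_def g_def f_def coeff_1mX_mult coeff_X_mult monic_likeD[OF F(1)] monic_likeD[OF G(1)]\<close>)
    moreover have "monic_like p m g a"
    proof (rule monic_likeI)
      fix b i assume "b < p" "m < i"
      then show "coeff (g b) i = 0"
        by (cases "i = Suc m") (auto simp: g_def coeff_X_mult monic_likeD[OF F(1)] monic_likeD[OF G(1)])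
    qed (auto simp: a_def)
    ultimately have "qform ?D (a + v) + qform ?E a \<le> moment_form p S pX f + moment_form p S (1 - pX) g"
      using D_le[of f "a + v"] E_le[of g a] m by (simp add: low_weight_def up_weight_def)
    also have "\<dots> = moment_form p S 1 (\<lambda>a. pX * f a + (1 - pX) * g a) + moment_form p S (pX * (1 - pX)) (\<lambda>a. f a - g a)"
      by (rule moment_form_split)
    also have "(\<lambda>a. pX * f a + (1 - pX) * g a) = F" by (rule ext) (simp add: f_def g_def algebra_simps)
    also have "(\<lambda>a. f a - g a) = G" by (rule ext) (simp add: f_def g_def algebra_simps)
    finally show ?thesis using F G qR[OF v] a by auto
  qed
  show "pd p ?R" "det ?R = det ?D * det ?E / det (moment_range p S k)"
    using parallel_sum[OF g(1) pdD' g(2) pdE g'(4) le att] unfolding g(5) by auto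
qed

end

subsection \<open>Canonical moments\<close>

text \<open>The formula of \<open>canon\<close> with range and gap as free arguments: for fixed
  definite R it is a linear bijection of the symmetric matrices, and as such it is the substitution
  made in the integrals.\<close>

definition normalize_by :: "nat \<Rightarrow> real mat \<Rightarrow> real mat \<Rightarrow> real mat" where
  "normalize_by p R D = minv (msqrt p R) * D * minv (msqrt p R)"

lemma mat_plus_minus_cancel:
  "X \<in> carrier_mat n m \<Longrightarrow> Y \<in> carrier_mat n m \<Longrightarrow> X + Y - X = (Y :: real mat)"
  by (intro eq_matI) auto

lemma canon_eq: "canon p S k = normalize_by p (moment_range p S k) (low_gap p S k)"
  by (simp add: canon_def normalize_by_def moment_range_def low_gap_def Let_def)

context
  fixes p :: nat and R :: "real mat"
  assumes R: "sym_mat p R" "pd p R"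
begin

lemma msqrt_inv:
  shows "sym_mat p (minv (msqrt p R))" "det (minv (msqrt p R)) \<noteq> 0"
    "minv (msqrt p R) * msqrt p R = 1\<^sub>m p" "msqrt p R * minv (msqrt p R) = 1\<^sub>m p"
    "minv (msqrt p R) * R * minv (msqrt p R) = 1\<^sub>m p"
proof -
  note m = msqrt_props[OF R] and mc = sym_matD[OF msqrt_props(1)[OF R]]
  have d: "det (msqrt p R) \<noteq> 0" using msqrt_det_pos(1)[OF R] by simp
  note i = minv_props[OF mc(1) d]
  show "sym_mat p (minv (msqrt p R))" by (rule sym_minv[OF m(1) d])
  show "det (minv (msqrt p R)) \<noteq> 0" using d by (simp add: det_minv[OF mc(1) d])
  show e: "minv (msqrt p R) * msqrt p R = 1\<^sub>m p" "msqrt p R * minv (msqrt p R) = 1\<^sub>m p" by fact+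
  have "minv (msqrt p R) * (msqrt p R * msqrt p R) * minv (msqrt p R)
      = (minv (msqrt p R) * msqrt p R) * (msqrt p R * minv (msqrt p R))"
    using mc(1) i(1) by (simp add: assoc_mult_mat[of _ p p _ p _ p])
  then show "minv (msqrt p R) * R * minv (msqrt p R) = 1\<^sub>m p" unfolding m(3) e by simp
qed

text \<open>The last two clauses make conjugation by the root of R the two-sided inverse; through
  them S_k is recovered from U_k.\<close>

lemma normalize_by_props:
  assumes D: "sym_mat p D"
  shows "sym_mat p (normalize_by p R D)" "1\<^sub>m p - normalize_by p R D = normalize_by p R (R - D)"
    "det (normalize_by p R D) = det D / det R" "pd p (normalize_by p R D) \<longleftrightarrow> pd p D"
    "msqrt p R * normalize_by p R D * msqrt p R = D"
    "normalize_by p R (msqrt p R * D * msqrt p R) = D"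
proof -
  let ?B = "minv (msqrt p R)" and ?M = "msqrt p R"
  note B = msqrt_inv and Bc = sym_matD[OF msqrt_inv(1)] and Dc = sym_matD[OF D] and Rc = sym_matD[OF R(1)]
  note m = msqrt_props[OF R] and mc = sym_matD[OF msqrt_props(1)[OF R]]
  note as = assoc_mult_mat[of _ p p _ p _ p]
  show "sym_mat p (normalize_by p R D)"
    using sym_mat_congruence[OF D Bc(1)] unfolding Bc(2) normalize_by_def .
  show "1\<^sub>m p - normalize_by p R D = normalize_by p R (R - D)"
    unfolding normalize_by_def B(5)[symmetric] using Bc(1) Dc(1) Rc(1)
    by (simp add: mult_minus_distrib_mat[of _ p p _ p] minus_mult_distrib_mat[of _ p p _ _ p])
  show det: "det (normalize_by p R D) = det D / det R"
  proof -
    have "det ?B = 1 / det ?M" by (rule det_minv[OF mc(1)]) (use msqrt_det_pos(1)[OF R] in simp)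
    moreover have "det ?M * det ?M = det R" using det_mult[OF mc(1) mc(1)] m(3) by simp
    moreover have "det (normalize_by p R D) = det ?B * det D * det ?B"
      unfolding normalize_by_def using Bc(1) Dc(1) by (simp add: det_mult[of _ p])
    ultimately show ?thesis by simp
  qed
  have canc: "?B * (?M * Y) = Y" "?M * (?B * Y) = Y" if "Y \<in> carrier_mat p p" for Y
    using that Bc(1) mc(1) B(3,4) as[of ?B ?M Y] as[of ?M ?B Y] by simp_all
  show inv: "?M * normalize_by p R D * ?M = D"
    unfolding normalize_by_def using Bc(1) Dc(1) mc(1) by (simp add: as canc B(3))
  show "normalize_by p R (?M * D * ?M) = D"
    unfolding normalize_by_def using Bc(1) Dc(1) mc(1) by (simp add: as canc B(4))
  show "pd p (normalize_by p R D) \<longleftrightarrow> pd p D"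
  proof
    assume "pd p D"
    from pd_congruence[OF this Dc(1) Bc(1) B(2)] show "pd p (normalize_by p R D)" unfolding Bc(2) normalize_by_def .
  next
    assume a: "pd p (normalize_by p R D)"
    have "normalize_by p R D \<in> carrier_mat p p" unfolding normalize_by_def using Bc(1) Dc(1) by simp
    from pd_congruence[OF a this mc(1)] msqrt_det_pos(1)[OF R]
    show "pd p D" unfolding mc(2) inv by simp
  qed
qed

lemma in01_normalize_by:
  assumes D: "sym_mat p D"
  shows "in01 p (normalize_by p R D) \<longleftrightarrow> pd p D \<and> pd p (R - D)"
proof -
  have c: "normalize_by p R D \<in> carrier_mat p p" using normalize_by_props(1)[OF D] by (auto simp: sym_mat_def)
  have "normalize_by p R D - 0\<^sub>m p p = normalize_by p R D" using c by (intro eq_matI) auto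
  then show ?thesis unfolding in01_def mless_def
    using normalize_by_props(2,4)[OF D] normalize_by_props(4)[of "R - D"] sym_mat_minus[OF R(1) D] D
    using normalize_by_props(4)[OF sym_mat_minus[OF R(1) D]] by simp
qed

end

lemma lowh_cong: "(\<And>j. j \<le> N \<Longrightarrow> S j = S' j) \<Longrightarrow> lowh p S N = lowh p S' N"
  unfolding lowh_def by (auto intro!: bcol_cong elim!: evenE oddE)

lemma lowH_cong: "(\<And>j. j \<le> N \<Longrightarrow> S j = S' j) \<Longrightarrow> lowH p S N = lowH p S' N"
  unfolding lowH_def by (auto intro!: hank_cong elim!: evenE oddE)

lemma uph_cong: "(\<And>j. j \<le> N \<Longrightarrow> S j = S' j) \<Longrightarrow> uph p S N = uph p S' N"
  unfolding uph_def by (auto intro!: bcol_cong arg_cong2[of _ _ _ _ "(-)"] elim!: evenE oddE)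

lemma upH_cong: "(\<And>j. j \<le> N \<Longrightarrow> S j = S' j) \<Longrightarrow> upH p S N = upH p S' N"
  unfolding upH_def by (auto intro!: hank_cong arg_cong2[of _ _ _ _ "(-)"] elim!: evenE oddE)

text \<open>Together with \<open>splus_cong\<close> this is the triangular structure of the change
  of variables: the bounds for the k-th moment see only the moments before it.\<close>

lemma sminus_cong: "(\<And>j. j < k \<Longrightarrow> S j = S' j) \<Longrightarrow> sminus p S k = sminus p S' k"
  unfolding sminus_def using lowh_cong[of "k - 1" S S'] lowH_cong[of "k - 2" S S'] by auto

lemma splus_cong: "(\<And>j. j < k \<Longrightarrow> S j = S' j) \<Longrightarrow> splus p S k = splus p S' k"
  unfolding splus_def using uph_cong[of "k - 1" S S'] upH_cong[of "k - 2" S S'] by auto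

lemma gaps_cong:
  assumes "\<And>j. j \<le> k \<Longrightarrow> S j = S' j"
  shows "low_gap p S k = low_gap p S' k" "up_gap p S k = up_gap p S' k" "canon p S k = canon p S' k"
  unfolding low_gap_def up_gap_def canon_def
  using sminus_cong[of k S S' p] splus_cong[of k S S' p] assms by auto

lemma moment_range_cong: "(\<And>j. j < k \<Longrightarrow> S j = S' j) \<Longrightarrow> moment_range p S k = moment_range p S' k"
  unfolding moment_range_def using sminus_cong[of k S S' p] splus_cong[of k S S' p] by auto

context moment_seq
begin

lemma pd_moment_range:
  assumes "interior n" "1 \<le> k" "k \<le> n + 1"
  shows "pd p (moment_range p S k)"
proof (cases "k = 1")
  case True
  have "1\<^sub>m p - 0\<^sub>m p p = (1\<^sub>m p :: real mat)" by (intro eq_matI) auto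
  then show ?thesis using True pd_one by (simp add: moment_range_def splus_def sminus_def)
next
  case False
  then have "moment_range p S k = moment_range p S (Suc (k - 1))" using assms by simp
  then show ?thesis using moment_range_step(1)[OF interior_mono[OF assms(1)], of "k - 1"] False assms by simp
qed

lemma canon_props:
  assumes "interior n" "1 \<le> k" "k \<le> n + 1"
  shows "sym_mat p (canon p S k)" "in01 p (canon p S k) \<longleftrightarrow> pd p (low_gap p S k) \<and> pd p (up_gap p S k)"
    "det (canon p S k) = det (low_gap p S k) / det (moment_range p S k)"
    "det (1\<^sub>m p - canon p S k) = det (up_gap p S k) / det (moment_range p S k)"
proof -
  note g = gap_sym[OF assms] and R = pd_moment_range[OF assms]
  note n = normalize_by_props[OF g(4) R g(1)]
  have e: "moment_range p S k - low_gap p S k = up_gap p S k"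
    unfolding g(5) using sym_matD(1)[OF g(1)] sym_matD(1)[OF g(2)] by (intro eq_matI) auto
  show "sym_mat p (canon p S k)" unfolding canon_eq by (rule n(1))
  show "in01 p (canon p S k) \<longleftrightarrow> pd p (low_gap p S k) \<and> pd p (up_gap p S k)"
    unfolding canon_eq in01_normalize_by[OF g(4) R g(1)] e ..
  show "det (canon p S k) = det (low_gap p S k) / det (moment_range p S k)" unfolding canon_eq by (rule n(3))
  show "det (1\<^sub>m p - canon p S k) = det (up_gap p S k) / det (moment_range p S k)"
    unfolding canon_eq n(2) e by (rule normalize_by_props(3)[OF g(4) R g(2)])
qed

text \<open>Telescoping from R_1 = I: substituting det D = det R det U and det E = det R det (I - U)
  in the parallel sum leaves one new factor per order. The Jacobian thereby becomes a function of
  the earlier canonical moments alone.\<close>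

lemma det_moment_range:
  "interior n \<Longrightarrow> det (moment_range p S (Suc n)) = (\<Prod>k\<in>{1..n}. det (canon p S k) * det (1\<^sub>m p - canon p S k))"
proof (induction n)
  case 0
  have "1\<^sub>m p - 0\<^sub>m p p = (1\<^sub>m p :: real mat)" by (intro eq_matI) auto
  then show ?case by (simp add: moment_range_def splus_def sminus_def)
next
  case (Suc n)
  have n: "interior n" using interior_mono[OF Suc.prems] by simp
  have k: "1 \<le> Suc n" "Suc n \<le> Suc n + 1" by auto
  have d: "det (moment_range p S (Suc n)) > 0"
    using pd_det_pos[OF gap_sym(4)[OF Suc.prems k] pd_moment_range[OF Suc.prems k]] .
  let ?R = "moment_range p S (Suc n)"
  have "det (moment_range p S (Suc (Suc n))) = det ?R * (det (canon p S (Suc n)) * det (1\<^sub>m p - canon p S (Suc n)))"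
    unfolding moment_range_step(2)[OF Suc.prems k(1)] canon_props(3,4)[OF Suc.prems k]
    using d by (simp add: field_simps)
  then show ?case unfolding Suc.IH[OF n] by (simp add: prod.nat_ivl_Suc' mult.commute)
qed

text \<open>The nodes are the eigenvalues of the pencil \<open>(H1, H0)\<close> below; they lie in \<open>(0, 1)\<close> because \<open>H1\<close> and
  \<open>H2 = H0 - H1\<close> are both positive definite.\<close>

lemma quadrature_odd:
  assumes n: "interior n" "n = 2 * m + 1"
  shows "\<exists>N l w. (\<forall>r<N. 0 < l r \<and> l r < (1 :: real)) \<and>
    (\<forall>k\<le>n. \<forall>a<p. \<forall>b<p. S k $$ (a, b) = (\<Sum>r<(N :: nat). l r ^ k * w r a * w r b))"
proof -
  define N where "N = (m + 1) * p"
  define H0 where "H0 = hank p (m + 1) S"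
  define H1 where "H1 = hank p (m + 1) (\<lambda>k. S (k + 1))"
  define H2 where "H2 = hank p (m + 1) (\<lambda>k. S k - S (k + 1))"
  have pd1: "pd N H1" using interior_hank(1)[OF n(1), of n] n(2) unfolding N_def H1_def by (simp add: low_seq_def)
  have pd2: "pd N H2" using interior_hank(2)[OF n(1), of n] n(2) unfolding N_def H2_def by (simp add: up_seq_def)
  have c: "H0 \<in> carrier_mat N N" "H1 \<in> carrier_mat N N" "H2 \<in> carrier_mat N N"
    unfolding H0_def H1_def H2_def N_def by (rule hank_carrier)+
  have H0_sum: "H0 = H1 + H2"
  proof (rule eq_matI)
    fix i j assume ij: "i < dim_row (H1 + H2)" "j < dim_col (H1 + H2)"
    then have ij: "i < (m + 1) * p" "j < (m + 1) * p" using c by (auto simp: N_def)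
    then have p: "p > 0" by (cases p) auto
    show "H0 $$ (i, j) = (H1 + H2) $$ (i, j)"
      using ij p c unfolding N_def[symmetric] by (simp add: N_def H0_def H1_def H2_def hank_def)
  qed (use c in auto)
  have sym1: "sym_mat N H1" and sym0: "sym_mat N H0"
  proof -
    interpret A: hankel_block p 0 "\<lambda>k. S (k + 1)" by unfold_locales (auto simp: S_sym pd_dim0)
    interpret B: hankel_block p 0 S by unfold_locales (auto simp: S_sym pd_dim0)
    show "sym_mat N H1" "sym_mat N H0" unfolding N_def H1_def H0_def by (rule A.hank_sym, rule B.hank_sym)
  qed
  have pd0: "pd N H0" unfolding H0_sum by (rule pd_add[OF pd1 pd2 c(2,3)])
  let ?M = "msqrt N H0" and ?B = "minv (msqrt N H0)"
  note B = msqrt_inv[OF sym0 pd0] and Bc = sym_matD[OF msqrt_inv(1)[OF sym0 pd0]]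
  note M = msqrt_props[OF sym0 pd0] and Mc = sym_matD[OF msqrt_props(1)[OF sym0 pd0]]
  note as = assoc_mult_mat[of _ N N _ N _ N]
  \<comment> \<open>The pencil reduced to one symmetric matrix. I - A is the same congruence applied
    to H2, so both bounds on the eigenvalues come from definiteness.\<close>
  define A where "A = ?B * H1 * ?B"
  have A: "sym_mat N A" unfolding A_def using sym_mat_congruence[OF sym1 Bc(1)] Bc(2) by simp
  note Ac = sym_matD[OF A]
  obtain V l where V: "V \<in> carrier_mat N N" "V\<^sup>T * V = 1\<^sub>m N" "V * V\<^sup>T = 1\<^sub>m N" and Al: "A = V * mat_diag N l * V\<^sup>T"
    using spectral_theorem[OF A] by auto
  have VT: "V\<^sup>T \<in> carrier_mat N N" using V by simp
  have "pd N A" unfolding A_def using pd_congruence[OF pd1 c(2) Bc(1) B(2)] Bc(2) by simp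
  then have l0: "0 < l r" if "r < N" for r using that pd_spectral(1)[OF V, of l] unfolding Al by auto
  have "1\<^sub>m N - A = ?B * H2 * ?B"
  proof -
    have "Y * (H1 + H2) * Y = Y * H1 * Y + Y * H2 * Y" if "Y \<in> carrier_mat N N" for Y
      using c that
      by (simp only: mult_add_distrib_mat[of _ N N _ N] add_mult_distrib_mat[of _ N N _ _ N] mult_square_carrier_mat)
    from this[OF Bc(1)] have "?B * H0 * ?B = ?B * H1 * ?B + ?B * H2 * ?B"
      by (simp only: H0_sum[symmetric])
    then have "1\<^sub>m N = A + ?B * H2 * ?B" unfolding B(5) A_def .
    moreover have "?B * H2 * ?B \<in> carrier_mat N N" using c Bc(1) by simp
    ultimately show ?thesis using mat_plus_minus_cancel[OF Ac(1)] by metis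
  qed
  moreover have "1\<^sub>m N - A = V * mat_diag N (\<lambda>i. 1 - l i) * V\<^sup>T"
  proof -
    have "V * 1\<^sub>m N * V\<^sup>T - V * mat_diag N l * V\<^sup>T = V * (1\<^sub>m N - mat_diag N l) * V\<^sup>T"
      using V(1) VT
      by (simp add: mult_minus_distrib_mat[of _ N N _ N] minus_mult_distrib_mat[of _ N N _ _ N])
    moreover have "1\<^sub>m N - mat_diag N l = mat_diag N (\<lambda>i. 1 - l i)" by (auto simp: mat_diag_def intro!: eq_matI)
    ultimately show ?thesis unfolding Al using V by simp
  qed
  moreover have "pd N (?B * H2 * ?B)" using pd_congruence[OF pd2 c(3) Bc(1) B(2)] Bc(2) by simp
  ultimately have l1: "l r < 1" if "r < N" for r
    using that pd_spectral(1)[OF V, of "\<lambda>i. 1 - l i"] by auto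
  \<comment> \<open>Simultaneous diagonalisation: H0 = W W^T and H1 = W diag(l) W^T.\<close>
  define W where "W = ?M * V"
  have W: "W \<in> carrier_mat N N" unfolding W_def using Mc(1) V(1) by simp
  have WT: "W\<^sup>T = V\<^sup>T * ?M" unfolding W_def using transpose_mult[OF Mc(1) V(1)] Mc(2) by simp
  have canc: "V * (V\<^sup>T * Y) = Y" "V\<^sup>T * (V * Y) = Y" "?M * (?B * Y) = Y" "?B * (?M * Y) = Y" if "Y \<in> carrier_mat N N" for Y
    using that V VT Mc(1) Bc(1) B(3,4) as[of V "V\<^sup>T" Y] as[of "V\<^sup>T" V Y] as[of ?M ?B Y] as[of ?B ?M Y] by simp_all
  have AM: "?M * A * ?M = H1" unfolding A_def using Mc(1) Bc(1) c by (simp add: as canc B(3))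
  have H0W: "H0 = W * mat_diag N (\<lambda>_. 1) * W\<^sup>T"
    unfolding WT unfolding W_def using Mc(1) V(1) VT M(3) by (simp add: as canc)
  have H1W: "H1 = W * mat_diag N l * W\<^sup>T"
    unfolding WT AM[symmetric] unfolding W_def Al using Mc(1) V(1) VT by (simp add: as)
  have WTB: "W\<^sup>T * (?B * V) = 1\<^sub>m N" unfolding WT using Mc(1) V VT Bc(1) by (simp add: as canc)
  have cancel: "(W * mat_diag N d * W\<^sup>T) * (?B * V) = W * mat_diag N d" for d
    using WTB W Bc(1) V(1) by (simp add: as right_mult_one_mat[OF mat_diag_dim])
  have H0B: "H0 * (?B * V) = W"
    using cancel[of "\<lambda>_. 1", folded H0W] W by simp
  have H1B: "H1 * (?B * V) = W * mat_diag N l"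
    using cancel[of l, folded H1W] .
  have BV: "?B * V \<in> carrier_mat N N" using Bc(1) V(1) by simp
  have less: "i * p + a < N" if "i \<le> m" "a < p" for i a using block_index_less[of i "m + 1" a p] that by (simp add: N_def)
  \<comment> \<open>Block row j of H1 is block row j + 1 of H0. Multiplying both by B V compares W
    diag(l) with W, so passing to the next block row multiplies column r by its node; W is a block
    Vandermonde matrix.\<close>
  have rec: "W $$ (Suc j * p + a, r) = l r * W $$ (j * p + a, r)" if "j < m" "a < p" "r < N" for j a r
  proof -
    have i: "Suc j * p + a < N" "j * p + a < N" using less[of "Suc j" a] less[of j a] that by auto
    have "row H1 (j * p + a) = row H0 (Suc j * p + a)"
    proof (rule eq_vecI)
      fix s assume "s < dim_vec (row H0 (Suc j * p + a))"
      then have s: "s < N" using c by simp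
      have "(Suc j * p + a) div p = Suc j" "(j * p + a) div p = j"
        using that by (simp_all del: mult_Suc)
      then show "row H1 (j * p + a) $ s = row H0 (Suc j * p + a) $ s"
        using s i c that by (simp add: H0_def H1_def hank_def N_def del: mult_Suc)
    qed (use c in auto)
    then have "(H1 * (?B * V)) $$ (j * p + a, r) = (H0 * (?B * V)) $$ (Suc j * p + a, r)"
      using i that c V(1) by (simp del: mult_Suc)
    then show ?thesis unfolding H0B H1B using i that W
      by (simp add: mat_diag_mult_right[OF W] mult.commute del: mult_Suc)
  qed
  have Wj: "W $$ (j * p + a, r) = l r ^ j * W $$ (a, r)" if "j \<le> m" "a < p" "r < N" for j a r
    using that(1)
  proof (induction j)
    case (Suc j)
    then show ?case using rec[of j a r] that by (simp del: mult_Suc)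
  qed simp
  have main: "S k $$ (a, b) = (\<Sum>r<N. l r ^ k * W $$ (a, r) * W $$ (b, r))" if k: "k \<le> n" and ab: "a < p" "b < p" for k a b
  proof (cases "k = 0")
    case True
    have "S 0 $$ (a, b) = H0 $$ (0 * p + a, 0 * p + b)" unfolding H0_def
      using hank_index[of 0 "m + 1" a p 0 b S] ab by simp
    also have "\<dots> = (\<Sum>r<N. W $$ (a, r) * 1 * W $$ (b, r))"
      unfolding H0W using triple_product_index[OF W, of a b "\<lambda>_. 1"] less[of 0 a] less[of 0 b] ab by simp
    finally show ?thesis using True by simp
  next
    case False
    \<comment> \<open>An order k between 1 and 2 m + 1 is written as i + j + 1 with i and j at most
      m, so that S k occurs as a block of H1.\<close>
    define i where "i = min (k - 1) m"
    define j where "j = k - 1 - i"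
    have ij: "i \<le> m" "j \<le> m" "k = i + j + 1" using k n(2) False by (auto simp: i_def j_def)
    have "S k $$ (a, b) = H1 $$ (i * p + a, j * p + b)" unfolding H1_def
      using hank_index[of i "m + 1" a p j b "\<lambda>k. S (k + 1)"] ab ij by simp
    also have "\<dots> = (\<Sum>r<N. W $$ (i * p + a, r) * l r * W $$ (j * p + b, r))"
      unfolding H1W by (rule triple_product_index[OF W]) (use less ij ab in auto)
    also have "\<dots> = (\<Sum>r<N. l r ^ k * W $$ (a, r) * W $$ (b, r))"
      using ij ab by (intro sum.cong) (simp_all add: Wj power_add mult_ac)
    finally show ?thesis .
  qed
  show ?thesis
    by (rule exI[of _ N], rule exI[of _ l], rule exI[of _ "\<lambda>r a. W $$ (a, r)"]) (use l0 l1 main in auto)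
qed

text \<open>An even order is completed to an odd one by appending one more moment, placed halfway
  between its bounds so that both new gaps equal R / 2 and are definite.\<close>

lemma quadrature:
  assumes n: "interior n"
  shows "\<exists>N l w. (\<forall>r<N. 0 < l r \<and> l r < (1 :: real)) \<and>
    (\<forall>k\<le>n. \<forall>a<p. \<forall>b<p. S k $$ (a, b) = (\<Sum>r<(N :: nat). l r ^ k * w r a * w r b))"
proof (cases "odd n")
  case True
  then show ?thesis using quadrature_odd[OF n] by (auto elim!: oddE)
next
  case False
  then obtain m where m: "Suc n = 2 * m + 1" by (auto elim!: evenE)
  define R where "R = moment_range p S (Suc n)"
  have k: "1 \<le> Suc n" "Suc n \<le> n + 1" by auto
  note g = gap_sym[OF n k, folded R_def]
  have R: "sym_mat p R" "pd p R" using g(4) pd_moment_range[OF n k] by (auto simp: R_def)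
  note Rc = sym_matD[OF R(1)]
  define h where "h = (1 / 2) \<cdot>\<^sub>m R"
  have h: "sym_mat p h" unfolding h_def using R(1) by (auto simp: sym_mat_def intro!: eq_matI sym_mat_index)
  have pdh: "pd p h" unfolding pd_def
  proof (intro ballI impI)
    fix v :: "real vec" assume v: "v \<in> carrier_vec p" "v \<noteq> 0\<^sub>v p"
    have "qform h v = (1 / 2) * qform R v"
      unfolding qform_sum[OF sym_matD(1)[OF h] v(1)] qform_sum[OF Rc(1) v(1)] sum_distrib_left
      using Rc(1) by (intro sum.cong refl) (simp add: h_def)
    then show "qform h v > 0" using pdD[OF R(2) v] by simp
  qed
  have sm: "sym_mat p (sminus p S (Suc n))" by (rule g(3))
  define S' where "S' = S(Suc n := sminus p S (Suc n) + h)"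
  have S'S: "S' j = S j" if "j < Suc n" for j using that by (simp add: S'_def)
  interpret S': moment_seq p S'
    by unfold_locales (auto simp: S'_def S_sym S_0 intro: sym_mat_add[OF sm h])
  have S'n: "S' (Suc n) = sminus p S (Suc n) + h" by (simp add: S'_def)
  have bnd: "sminus p S' (Suc n) = sminus p S (Suc n)" "splus p S' (Suc n) = splus p S (Suc n)"
    by (intro sminus_cong splus_cong S'S; assumption)+
  have lo: "low_gap p S' (Suc n) = h"
    unfolding low_gap_def bnd S'n
    using sym_matD(1)[OF sm] sym_matD(1)[OF h] by (auto intro!: eq_matI)
  have up: "up_gap p S' (Suc n) = h"
  proof -
    have spc: "splus p S (Suc n) \<in> carrier_mat p p"
    proof -
      have up: "dim_col (uph p S j) = p" for j by (simp add: uph_def bcol_def)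
      show ?thesis unfolding splus_def by (intro carrier_matI) (simp_all add: up)
    qed
    then have "splus p S (Suc n) = sminus p S (Suc n) + R"
      unfolding R_def moment_range_def using sym_matD(1)[OF sm] by (intro eq_matI) auto
    then show ?thesis
      unfolding up_gap_def bnd S'n
      using sym_matD(1)[OF sm] sym_matD(1)[OF h] Rc(1) by (auto simp: h_def intro!: eq_matI)
  qed
  have "S'.interior n"
    unfolding S'.interior_def
  proof
    fix k assume "k \<in> {1..n}"
    then show "pd p (low_gap p S' k) \<and> pd p (up_gap p S' k)"
      using n gaps_cong(1,2)[of k S' S p] S'S by (auto simp: interior_def)
  qed
  then have "S'.interior (Suc n)" unfolding S'.interior_Suc lo up using pdh by simp
  from S'.quadrature_odd[OF this m] obtain N l w where "\<forall>r<N. 0 < l r \<and> l r < (1 :: real)"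
    "\<forall>k\<le>Suc n. \<forall>a<p. \<forall>b<p. S' k $$ (a, b) = (\<Sum>r<(N :: nat). l r ^ k * w r a * w r b)" by blast
  moreover have "S k = S' k" if "k \<le> n" for k using S'S[of k] that by simp
  ultimately show ?thesis by (intro exI[of _ N] exI[of _ l] exI[of _ w]) auto
qed

end

subsection \<open>Linear changes of variables\<close>

interpretation lborel_product: product_sigma_finite "\<lambda>_ :: 'i. lborel :: real measure" ..

lemma measurable_PiM_upd:
  assumes "f \<in> borel_measurable (PiM (insert i I) (\<lambda>_. lborel :: real measure))"
  shows "(\<lambda>(x, y). f (x(i := y))) \<in> borel_measurable (PiM I (\<lambda>_. lborel) \<Otimes>\<^sub>M lborel)"
  using measurable_compose[OF measurable_add_dim[of i I "\<lambda>_. lborel"] assms] by (simp add: case_prod_beta')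

lemma borel_measurable_inner_integral:
  fixes f :: "('i \<Rightarrow> real) \<Rightarrow> ennreal"
  assumes "f \<in> borel_measurable (PiM (insert i I) (\<lambda>_. lborel :: real measure))"
  shows "(\<lambda>x. \<integral>\<^sup>+y. f (x(i := y)) \<partial>lborel) \<in> borel_measurable (PiM I (\<lambda>_. lborel))"
  using lborel.borel_measurable_nn_integral[OF measurable_PiM_upd[OF assms]] by simp

text \<open>Coordinates are adjoined in order of increasing rank \<open>r\<close>. The one adjoined
  last occurs in no other component, so its inner integral is a one-dimensional affine substitution
  with slope \<open>s\<close>.\<close>

lemma nn_integral_triangular:
  fixes r :: "'i \<Rightarrow> nat" and s t :: "'i \<Rightarrow> real" and a :: "'i \<Rightarrow> 'i \<Rightarrow> real" and f :: "('i \<Rightarrow> real) \<Rightarrow> ennreal"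
  assumes "finite I" "\<And>i. i \<in> I \<Longrightarrow> s i \<noteq> 0" "f \<in> borel_measurable (PiM I (\<lambda>_. lborel))"
  shows "(\<integral>\<^sup>+x. f (\<lambda>i\<in>I. s i * x i + t i + (\<Sum>j\<in>{j\<in>I. r j < r i}. a i j * x j)) \<partial>PiM I (\<lambda>_. lborel))
    = ennreal (\<Prod>i\<in>I. 1 / \<bar>s i\<bar>) * (\<integral>\<^sup>+x. f x \<partial>PiM I (\<lambda>_. lborel))"
  using assms
proof (induction I arbitrary: f rule: finite_ranking_induct[where f = r])
  case empty
  then show ?case by (simp add: PiM_empty nn_integral_count_space_finite)
next
  case (insert i0 S)
  let ?P = "\<lambda>I. PiM I (\<lambda>_. lborel :: real measure)"
  define T where "T = (\<lambda>I (x :: 'i \<Rightarrow> real). \<lambda>i\<in>I. s i * x i + t i + (\<Sum>j\<in>{j\<in>I. r j < r i}. a i j * x j))"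
  \<comment> \<open>The shift of coordinate i0 involves only coordinates of strictly smaller rank,
    hence not i0 itself.\<close>
  define h where "h = (\<lambda>x :: 'i \<Rightarrow> real. t i0 + (\<Sum>j\<in>{j\<in>S. r j < r i0}. a i0 j * x j))"
  have Tm: "T I \<in> measurable (?P I) (?P I)" for I
    unfolding T_def
  proof (intro measurable_restrict)
    fix i assume i: "i \<in> I"
    have comp: "(\<lambda>x. x j) \<in> borel_measurable (?P I)" if "j \<in> I" for j
      using measurable_component_singleton[OF that, of "\<lambda>_. lborel"] by simp
    have "(\<lambda>x. s i * x i + t i + (\<Sum>j\<in>{j\<in>I. r j < r i}. a i j * x j)) \<in> borel_measurable (?P I)"
      by (intro borel_measurable_add borel_measurable_times borel_measurable_const borel_measurable_sum comp) (use i in auto)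
    then show "(\<lambda>x. s i * x i + t i + (\<Sum>j\<in>{j\<in>I. r j < r i}. a i j * x j)) \<in> measurable (?P I) lborel" by simp
  qed
  have fT: "(\<lambda>x. f (T (insert i0 S) x)) \<in> borel_measurable (?P (insert i0 S))"
    using measurable_compose[OF Tm insert.prems(2)] .
  have s0: "s i0 \<noteq> 0" using insert.prems by auto
  have upd: "T (insert i0 S) (x(i0 := y)) = (T S x)(i0 := h x + s i0 * y)" for x y
  proof
    fix i
    show "T (insert i0 S) (x(i0 := y)) i = ((T S x)(i0 := h x + s i0 * y)) i"
    proof (cases "i = i0")
      case True
      have e: "{j \<in> insert i0 S. r j < r i0} = {j \<in> S. r j < r i0}" by auto
      have "(\<Sum>j\<in>{j\<in>S. r j < r i0}. a i0 j * (x(i0 := y)) j) = (\<Sum>j\<in>{j\<in>S. r j < r i0}. a i0 j * x j)"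
        by (intro sum.cong) auto
      then show ?thesis using True by (simp add: T_def h_def e e[unfolded insert_iff])
    next
      case False
      show ?thesis
      proof (cases "i \<in> S")
        case True
        have e: "{j \<in> insert i0 S. r j < r i} = {j \<in> S. r j < r i}" using insert.hyps(2)[OF True] by auto
        have "(\<Sum>j\<in>{j\<in>S. r j < r i}. a i j * (x(i0 := y)) j) = (\<Sum>j\<in>{j\<in>S. r j < r i}. a i j * x j)"
          using insert.hyps(2)[OF True] by (intro sum.cong) auto
        then show ?thesis using True False by (simp add: T_def e e[unfolded insert_iff])
      qed (use False in \<open>simp add: T_def\<close>)
    qed
  qed
  show ?case
  proof (cases "i0 \<in> S")
    case True
    then have "insert i0 S = S" by auto
    then show ?thesis using insert.IH insert.prems by simp
  next
    case False
    define F where "F = (\<lambda>x. \<integral>\<^sup>+y. f (x(i0 := y)) \<partial>lborel)"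
    have F: "F \<in> borel_measurable (?P S)"
      unfolding F_def by (rule borel_measurable_inner_integral[OF insert.prems(2)])
    have "(\<integral>\<^sup>+x. f (T (insert i0 S) x) \<partial>?P (insert i0 S))
        = (\<integral>\<^sup>+x. (\<integral>\<^sup>+y. f ((T S x)(i0 := h x + s i0 * y)) \<partial>lborel) \<partial>?P S)"
      using lborel_product.product_nn_integral_insert[OF insert.hyps(1) False fT] by (simp add: upd)
    also have "\<dots> = (\<integral>\<^sup>+x. ennreal (1 / \<bar>s i0\<bar>) * F (T S x) \<partial>?P S)"
    proof (rule nn_integral_cong)
      fix x assume x: "x \<in> space (?P S)"
      have TS: "T S x \<in> space (?P S)" by (auto simp: T_def space_PiM)
      have m: "(\<lambda>y. f ((T S x)(i0 := y))) \<in> borel_measurable borel"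
        using measurable_compose[OF measurable_Pair1'[OF TS] measurable_PiM_upd[OF insert.prems(2)]]
        by (simp only: prod.case measurable_lborel2)
      have "F (T S x) = ennreal \<bar>s i0\<bar> * (\<integral>\<^sup>+y. f ((T S x)(i0 := h x + s i0 * y)) \<partial>lborel)"
        unfolding F_def by (rule nn_integral_real_affine[OF m s0])
      then have "ennreal (1 / \<bar>s i0\<bar>) * F (T S x) = (ennreal (1 / \<bar>s i0\<bar>) * ennreal \<bar>s i0\<bar>) * (\<integral>\<^sup>+y. f ((T S x)(i0 := h x + s i0 * y)) \<partial>lborel)"
        by (simp add: mult.assoc)
      also have "ennreal (1 / \<bar>s i0\<bar>) * ennreal \<bar>s i0\<bar> = 1"
        using s0 by (simp add: ennreal_mult[symmetric])
      finally show "(\<integral>\<^sup>+y. f ((T S x)(i0 := h x + s i0 * y)) \<partial>lborel) = ennreal (1 / \<bar>s i0\<bar>) * F (T S x)"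
        by (simp only: mult_1_left)
    qed
    also have "\<dots> = ennreal (1 / \<bar>s i0\<bar>) * (\<integral>\<^sup>+x. F (T S x) \<partial>?P S)"
      by (rule nn_integral_cmult) (rule measurable_compose[OF Tm F])
    also have "(\<integral>\<^sup>+x. F (T S x) \<partial>?P S) = ennreal (\<Prod>i\<in>S. 1 / \<bar>s i\<bar>) * (\<integral>\<^sup>+x. F x \<partial>?P S)"
      unfolding T_def by (rule insert.IH) (use insert.prems F in auto)
    also have "(\<integral>\<^sup>+x. F x \<partial>?P S) = (\<integral>\<^sup>+x. f x \<partial>?P (insert i0 S))"
      unfolding F_def by (rule lborel_product.product_nn_integral_insert[OF insert.hyps(1) False insert.prems(2), symmetric])
    also have "ennreal (1 / \<bar>s i0\<bar>) * (ennreal (\<Prod>i\<in>S. 1 / \<bar>s i\<bar>) * (\<integral>\<^sup>+x. f x \<partial>?P (insert i0 S)))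
      = ennreal (\<Prod>i\<in>insert i0 S. 1 / \<bar>s i\<bar>) * (\<integral>\<^sup>+x. f x \<partial>?P (insert i0 S))"
      unfolding prod.insert[OF insert.hyps(1) False]
      by (subst ennreal_mult) (auto intro!: prod_nonneg simp: mult.assoc)
    finally show ?thesis unfolding T_def .
  qed
qed

lemma nn_integral_PiM_translate:
  fixes f :: "('i \<Rightarrow> real) \<Rightarrow> ennreal"
  assumes "finite I" "f \<in> borel_measurable (PiM I (\<lambda>_. lborel))"
  shows "(\<integral>\<^sup>+x. f (\<lambda>i\<in>I. x i + t i) \<partial>PiM I (\<lambda>_. lborel)) = (\<integral>\<^sup>+x. f x \<partial>PiM I (\<lambda>_. lborel))"
  using nn_integral_triangular[OF assms(1) _ assms(2), where s = "\<lambda>_. 1" and t = t and a = "\<lambda>_ _. 0" and r = "\<lambda>_. 0"] by simp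

text \<open>Renaming of coordinates along an injection with left inverse \<open>g\<close>. It brings
  the coordinates of one moment, or those of one column, back to their plain index set.\<close>

lemma nn_integral_PiM_reindex:
  fixes f :: "('j \<Rightarrow> real) \<Rightarrow> ennreal"
  assumes "finite I" "\<And>i. i \<in> I \<Longrightarrow> g (e i) = i" "f \<in> borel_measurable (PiM (e ` I) (\<lambda>_. lborel))"
  shows "(\<integral>\<^sup>+x. f x \<partial>PiM (e ` I) (\<lambda>_. lborel)) = (\<integral>\<^sup>+y. f (\<lambda>k\<in>e ` I. y (g k)) \<partial>PiM I (\<lambda>_. lborel))"
  using assms
proof (induction I arbitrary: f rule: finite_induct)
  case empty
  then show ?case by (simp add: PiM_empty nn_integral_count_space_finite)
next
  case (insert i I)
  let ?P = "\<lambda>I. PiM I (\<lambda>_. lborel :: real measure)"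
  have nin: "e i \<notin> e ` I" using insert.prems(1) insert.hyps(2) by (metis image_iff insertCI)
  have f: "f \<in> borel_measurable (?P (insert (e i) (e ` I)))" using insert.prems(2) by simp
  have "(\<integral>\<^sup>+x. f x \<partial>?P (e ` insert i I)) = (\<integral>\<^sup>+x. (\<integral>\<^sup>+t. f (x(e i := t)) \<partial>lborel) \<partial>?P (e ` I))"
    using lborel_product.product_nn_integral_insert[OF _ nin f] insert.hyps(1) by simp
  also have "\<dots> = (\<integral>\<^sup>+y. (\<integral>\<^sup>+t. f ((\<lambda>k\<in>e ` I. y (g k))(e i := t)) \<partial>lborel) \<partial>?P I)"
    proof (rule insert.IH)
    show "(\<lambda>x. \<integral>\<^sup>+t. f (x(e i := t)) \<partial>lborel) \<in> borel_measurable (?P (e ` I))"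
      by (rule borel_measurable_inner_integral[OF f])
  qed (use insert.prems in auto)
  also have "\<dots> = (\<integral>\<^sup>+y. (\<integral>\<^sup>+t. f (\<lambda>k\<in>e ` insert i I. (y(i := t)) (g k)) \<partial>lborel) \<partial>?P I)"
  proof (intro nn_integral_cong arg_cong[where f = f] ext)
    fix y :: "_ \<Rightarrow> real" and t k
    show "((\<lambda>k\<in>e ` I. y (g k))(e i := t)) k = (\<lambda>k\<in>e ` insert i I. (y(i := t)) (g k)) k"
      using insert.prems(1) insert.hyps(2) nin by (auto simp: restrict_def)
  qed
  also have "\<dots> = (\<integral>\<^sup>+y. f (\<lambda>k\<in>e ` insert i I. y (g k)) \<partial>?P (insert i I))"
  proof (rule lborel_product.product_nn_integral_insert[OF insert.hyps(1,2), symmetric])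
    have "(\<lambda>y. \<lambda>k\<in>e ` insert i I. y (g k)) \<in> measurable (?P (insert i I)) (?P (e ` insert i I))"
      by (intro measurable_restrict measurable_component_singleton) (use insert.prems(1) in auto)
    from measurable_compose[OF this insert.prems(2)]
    show "(\<lambda>y. f (\<lambda>k\<in>e ` insert i I. y (g k))) \<in> borel_measurable (?P (insert i I))" .
  qed
  finally show ?case .
qed

section \<open>Coordinates of symmetric matrices and the Jacobian of a congruence\<close>

lemma finite_Tidx[simp]: "finite (Tidx p)"
  by (rule finite_subset[of _ "{..<p} \<times> {..<p}"]) (auto simp: Tidx_def)

lemma Tidx_iff[simp]: "(i, j) \<in> Tidx p \<longleftrightarrow> i \<le> j \<and> j < p"
  by (simp add: Tidx_def)

lemma TidxE:
  assumes "ij \<in> Tidx p" obtains i j where "ij = (i, j)" "i \<le> j" "j < p" "i < p"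
  using assms by (cases ij) auto

lemma Tidx_Suc: "Tidx (Suc p) = Tidx p \<union> (\<lambda>i. (i, p)) ` {..p}"
  by (auto simp: Tidx_def less_Suc_eq)

text \<open>Among the pairs i \<le> j every index occurs p + 1 times, the diagonal pair counting
  twice. This is the source of the exponent p + 1 in the Jacobians.\<close>

lemma prod_Tidx: "(\<Prod>(i, j)\<in>Tidx p. b i * b j) = (\<Prod>i<p. b i :: 'a :: comm_semiring_1) ^ (p + 1)"
proof (induction p)
  case 0
  then show ?case by (simp add: Tidx_def)
next
  case (Suc p)
  have "(\<Prod>(i, j)\<in>Tidx (Suc p). b i * b j) = (\<Prod>(i, j)\<in>Tidx p. b i * b j) * (\<Prod>i\<le>p. b i * b p)"
    unfolding Tidx_Suc
    by (subst prod.union_disjoint) (auto simp: prod.reindex inj_on_def)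
  also have "\<dots> = (\<Prod>i<Suc p. b i) ^ (Suc p + 1)"
    unfolding Suc by (simp add: prod.distrib lessThan_Suc_atMost[symmetric] power_mult_distrib mult_ac)
  finally show ?case .
qed

definition tcoords :: "nat \<Rightarrow> real mat \<Rightarrow> nat \<times> nat \<Rightarrow> real" where
  "tcoords p A = (\<lambda>ij\<in>Tidx p. A $$ ij)"

lemma tmat_carrier[simp]: "tmat p y \<in> carrier_mat p p" by (simp add: tmat_def)

lemma sym_tmat[simp]: "sym_mat p (tmat p y)"
  by (rule sym_matI) (auto simp: tmat_def min.commute max.commute)

lemma tmat_tcoords: "sym_mat p A \<Longrightarrow> tmat p (tcoords p A) = A"
proof (rule eq_matI)
  fix i j assume A: "sym_mat p A" and "i < dim_row A" "j < dim_col A"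
  then have "i < p" "j < p" by (auto simp: sym_mat_def)
  then show "tmat p (tcoords p A) $$ (i, j) = A $$ (i, j)"
    using sym_mat_index[OF A, of i j] by (cases "i \<le> j") (auto simp: tmat_def tcoords_def Tidx_def min_def max_def)
qed (auto simp: tmat_def sym_mat_def)

lemma tcoords_tmat: "y \<in> space (Sp p) \<Longrightarrow> tcoords p (tmat p y) = y"
  by (auto simp: tcoords_def tmat_def Sp_def space_PiM PiE_def extensional_def Tidx_def restrict_def fun_eq_iff min_def max_def)

text \<open>An off-diagonal coordinate of y sits at two matrix positions. Grouping the double sum by
  the sorted position gives the matrix of the congruence in the coordinates dx_ij.\<close>

lemma congruence_index:
  assumes "B \<in> carrier_mat p p" "i < p" "j < p"
  shows "(B * tmat p y * B\<^sup>T) $$ (i, j)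
    = (\<Sum>q\<in>Tidx p. (\<Sum>(k, l)\<in>{(k, l). k < p \<and> l < p \<and> (min k l, max k l) = q}. B $$ (i, k) * B $$ (j, l)) * y q)"
proof -
  have "(B * tmat p y * B\<^sup>T) $$ (i, j) = (\<Sum>l<p. (\<Sum>k<p. B $$ (i, k) * y (min k l, max k l)) * B $$ (j, l))"
    using assms by (simp add: scalar_prod_def atLeast0LessThan tmat_def)
  also have "\<dots> = (\<Sum>l<p. \<Sum>k<p. B $$ (i, k) * B $$ (j, l) * y (min k l, max k l))"
    by (simp add: sum_distrib_right sum_distrib_left mult_ac)
  also have "\<dots> = (\<Sum>k<p. \<Sum>l<p. B $$ (i, k) * B $$ (j, l) * y (min k l, max k l))" by (rule sum.swap)
  also have "\<dots> = (\<Sum>(k, l)\<in>{..<p} \<times> {..<p}. B $$ (i, k) * B $$ (j, l) * y (min k l, max k l))"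
    by (simp add: sum.cartesian_product)
  also have "\<dots> = (\<Sum>q\<in>Tidx p. \<Sum>(k, l)\<in>{x \<in> {..<p} \<times> {..<p}. (case x of (k, l) \<Rightarrow> (min k l, max k l)) = q}.
      B $$ (i, k) * B $$ (j, l) * y (min k l, max k l))"
    by (rule sum.group[symmetric]) auto
  also have "\<dots> = (\<Sum>q\<in>Tidx p. (\<Sum>(k, l)\<in>{(k, l). k < p \<and> l < p \<and> (min k l, max k l) = q}. B $$ (i, k) * B $$ (j, l)) * y q)"
    unfolding sum_distrib_right by (intro sum.cong refl) auto
  finally show ?thesis .
qed

text \<open>The row rank \<rho> lets one statement serve lower triangular B (rank increasing) and
  upper triangular B (rank decreasing). Coordinate (i, j) gets rank \<rho> i + \<rho> j, and its own
  coefficient is B_ii B_jj.\<close>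

lemma nn_integral_congruence_triangular:
  fixes f :: "(nat \<times> nat \<Rightarrow> real) \<Rightarrow> ennreal" and \<rho> :: "nat \<Rightarrow> nat"
  assumes B: "B \<in> carrier_mat p p" and f: "f \<in> borel_measurable (Sp p)"
    and tri: "\<And>i k. i < p \<Longrightarrow> k < p \<Longrightarrow> B $$ (i, k) \<noteq> 0 \<Longrightarrow> k = i \<or> \<rho> k < \<rho> i"
    and diag: "\<And>i. i < p \<Longrightarrow> B $$ (i, i) \<noteq> 0"
  shows "(\<integral>\<^sup>+y. f (tcoords p (B * tmat p y * B\<^sup>T)) \<partial>Sp p)
    = ennreal (1 / \<bar>\<Prod>i<p. B $$ (i, i)\<bar> ^ (p + 1)) * (\<integral>\<^sup>+y. f y \<partial>Sp p)"
proof -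
  define A where "A = (\<lambda>(i, j) q. \<Sum>(k, l)\<in>{(k, l). k < p \<and> l < p \<and> (min k l, max k l) = q}. B $$ (i, k) * B $$ (j, l))"
  define r where "r = (\<lambda>(i, j). \<rho> i + \<rho> j)"
  have fin: "finite {(k, l). k < p \<and> l < p \<and> (min k l, max k l) = q}" for q
    by (rule finite_subset[of _ "{..<p} \<times> {..<p}"]) auto
  have A0: "r q < r ij" if asm: "ij \<in> Tidx p" "q \<in> Tidx p" "q \<noteq> ij" "A ij q \<noteq> 0" for ij q
  proof -
    obtain i j where ij: "ij = (i, j)" "i \<le> j" "j < p" using TidxE[OF asm(1)] by metis
    have "\<exists>x\<in>{(k, l). k < p \<and> l < p \<and> (min k l, max k l) = q}. (case x of (k, l) \<Rightarrow> B $$ (i, k) * B $$ (j, l)) \<noteq> 0"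
    proof (rule ccontr)
      assume "\<not> ?thesis"
      then have "A ij q = 0" unfolding A_def ij prod.case by (intro sum.neutral) simp
      then show False using asm(4) by simp
    qed
    then obtain k l where kl: "k < p" "l < p" "(min k l, max k l) = q" "B $$ (i, k) * B $$ (j, l) \<noteq> 0"
      by fastforce
    have "k = i \<or> \<rho> k < \<rho> i" "l = j \<or> \<rho> l < \<rho> j" using tri[of i k] tri[of j l] kl ij by auto
    moreover have "\<not> (k = i \<and> l = j)" using kl(3) asm(3) ij by auto
    moreover have "r q = \<rho> k + \<rho> l" using kl(3) by (auto simp: r_def min_def max_def split: if_splits)
    ultimately show ?thesis unfolding ij r_def by auto
  qed
  have Ad: "A (i, j) (i, j) = B $$ (i, i) * B $$ (j, j)" if "i \<le> j" "j < p" for i j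
  proof (cases "i = j")
    case True
    then have "{(k, l). k < p \<and> l < p \<and> (min k l, max k l) = (i, j)} = {(i, i)}"
      using that by (auto simp: min_def max_def split: if_splits)
    then show ?thesis using True by (simp add: A_def)
  next
    case False
    then have e: "{(k, l). k < p \<and> l < p \<and> (min k l, max k l) = (i, j)} = {(i, j), (j, i)}"
      using that by (auto simp: min_def max_def split: if_splits)
    \<comment> \<open>Positions (i, j) and (j, i) both feed this coordinate; the second contribution
      vanishes because \<rho> cannot decrease in both directions.\<close>
    have "B $$ (i, j) * B $$ (j, i) = 0" using tri[of i j] tri[of j i] False that by force
    then show ?thesis using False unfolding A_def prod.case e by simp
  qed
  have T: "tcoords p (B * tmat p y * B\<^sup>T) =
      (\<lambda>ij\<in>Tidx p. (case ij of (i, j) \<Rightarrow> B $$ (i, i) * B $$ (j, j)) * y ij + 0 + (\<Sum>q\<in>{q \<in> Tidx p. r q < r ij}. A ij q * y q))" for y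
  proof
    fix ij
    show "tcoords p (B * tmat p y * B\<^sup>T) ij = (\<lambda>ij\<in>Tidx p. (case ij of (i, j) \<Rightarrow> B $$ (i, i) * B $$ (j, j)) * y ij + 0
      + (\<Sum>q\<in>{q \<in> Tidx p. r q < r ij}. A ij q * y q)) ij"
    proof (cases "ij \<in> Tidx p")
      case True
      then obtain i j where ij: "ij = (i, j)" "i \<le> j" "j < p" by (auto simp: Tidx_def)
      have "tcoords p (B * tmat p y * B\<^sup>T) ij = (\<Sum>q\<in>Tidx p. A ij q * y q)"
        using True ij congruence_index[OF B, of i j y] by (simp add: tcoords_def A_def)
      also have "\<dots> = (\<Sum>q\<in>insert ij {q \<in> Tidx p. r q < r ij}. A ij q * y q)"
        using A0[OF True] True by (intro sum.mono_neutral_right) auto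
      also have "\<dots> = A ij ij * y ij + (\<Sum>q\<in>{q \<in> Tidx p. r q < r ij}. A ij q * y q)"
        by (subst sum.insert) auto
      finally show ?thesis using True Ad[of i j] ij by simp
    qed (simp add: tcoords_def)
  qed
  have "(\<integral>\<^sup>+y. f (tcoords p (B * tmat p y * B\<^sup>T)) \<partial>Sp p)
      = ennreal (\<Prod>ij\<in>Tidx p. 1 / \<bar>case ij of (i, j) \<Rightarrow> B $$ (i, i) * B $$ (j, j)\<bar>) * (\<integral>\<^sup>+y. f y \<partial>Sp p)"
    unfolding T Sp_def
    by (rule nn_integral_triangular[where t = "\<lambda>_. 0"]) (use f diag in \<open>auto simp: Sp_def\<close>)
  also have "(\<Prod>ij\<in>Tidx p. 1 / \<bar>case ij of (i, j) \<Rightarrow> B $$ (i, i) * B $$ (j, j)\<bar>)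
      = (\<Prod>(i, j)\<in>Tidx p. 1 / \<bar>B $$ (i, i)\<bar> * (1 / \<bar>B $$ (j, j)\<bar>))"
    by (intro prod.cong) (auto simp: abs_mult)
  also have "\<dots> = (\<Prod>i<p. 1 / \<bar>B $$ (i, i)\<bar>) ^ (p + 1)" by (rule prod_Tidx)
  also have "\<dots> = 1 / \<bar>\<Prod>i<p. B $$ (i, i)\<bar> ^ (p + 1)"
    by (simp add: prod_dividef abs_prod power_divide)
  finally show ?thesis .
qed

lemma measurable_tcoords_congruence:
  assumes "B \<in> carrier_mat p p"
  shows "(\<lambda>y. tcoords p (B * tmat p y * B\<^sup>T)) \<in> measurable (Sp p) (Sp p)"
proof -
  have "(\<lambda>y. \<lambda>ij\<in>Tidx p. (B * tmat p y * B\<^sup>T) $$ ij) \<in> measurable (Sp p) (Sp p)"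
    unfolding Sp_def
  proof (intro measurable_restrict)
    fix ij assume "ij \<in> Tidx p"
    then obtain i j where ij: "ij = (i, j)" "i < p" "j < p" using TidxE[OF \<open>ij \<in> Tidx p\<close>] by metis
    show "(\<lambda>y. (B * tmat p y * B\<^sup>T) $$ ij) \<in> measurable (Pi\<^sub>M (Tidx p) (\<lambda>_. lborel)) lborel"
      unfolding ij(1) congruence_index[OF assms ij(2,3)] by measurable
  qed
  then show ?thesis by (simp add: tcoords_def)
qed

text \<open>With M = C C^T one has M Y M = C (C^T Y C) C^T, two triangular congruences of opposite
  shape. Each contributes det C to the power p + 1, and det C squared is det M.\<close>

lemma nn_integral_congruence_pd:
  fixes f :: "(nat \<times> nat \<Rightarrow> real) \<Rightarrow> ennreal"
  assumes M: "sym_mat p M" "pd p M" and f: "f \<in> borel_measurable (Sp p)"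
  shows "(\<integral>\<^sup>+y. f (tcoords p (M * tmat p y * M)) \<partial>Sp p) = ennreal (1 / det M ^ (p + 1)) * (\<integral>\<^sup>+y. f y \<partial>Sp p)"
proof -
  obtain C where C: "lower_tri p C" "M = C * C\<^sup>T" using cholesky[OF M] by auto
  have Cc: "C \<in> carrier_mat p p" "C\<^sup>T \<in> carrier_mat p p" using C(1) by (auto simp: lower_tri_def)
  have d: "(\<Prod>i<p. C $$ (i, i)) = det C" "det C > 0" "det M = det C * det C"
    using det_lower_tri[OF C(1)] C det_mult[OF Cc] det_transpose[OF Cc(1)] unfolding lower_tri_def by (auto intro: prod_pos)
  have dT: "(\<Prod>i<p. C\<^sup>T $$ (i, i)) = det C" unfolding d(1)[symmetric] using Cc by (intro prod.cong) auto
  define g where "g = (\<lambda>y. f (tcoords p (C * tmat p y * C\<^sup>T)))"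
  have g: "g \<in> borel_measurable (Sp p)"
    unfolding g_def by (rule measurable_compose[OF measurable_tcoords_congruence[OF Cc(1)] f])
  have e: "f (tcoords p (M * tmat p y * M)) = g (tcoords p (C\<^sup>T * tmat p y * C\<^sup>T\<^sup>T))" for y
  proof -
    have "sym_mat p (C\<^sup>T * tmat p y * C\<^sup>T\<^sup>T)" using sym_mat_congruence[OF sym_tmat Cc(1)] by simp
    then have "tmat p (tcoords p (C\<^sup>T * tmat p y * C\<^sup>T\<^sup>T)) = C\<^sup>T * tmat p y * C\<^sup>T\<^sup>T" by (rule tmat_tcoords)
    then show ?thesis unfolding g_def C(2) using Cc by (simp add: assoc_mult_mat[of _ p p _ p _ p])
  qed
  have "(\<integral>\<^sup>+y. f (tcoords p (M * tmat p y * M)) \<partial>Sp p) = ennreal (1 / \<bar>\<Prod>i<p. C\<^sup>T $$ (i, i)\<bar> ^ (p + 1)) * (\<integral>\<^sup>+y. g y \<partial>Sp p)"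
    unfolding e
  proof (rule nn_integral_congruence_triangular[where \<rho> = "\<lambda>i. p - i"])
    show "C\<^sup>T $$ (i, i) \<noteq> 0" if "i < p" for i
      using that Cc(1) C(1) unfolding lower_tri_def by (metis carrier_matD index_transpose_mat(1) less_irrefl)
    fix i k assume ik: "i < p" "k < p" "C\<^sup>T $$ (i, k) \<noteq> 0"
    then have "C $$ (k, i) \<noteq> 0" using Cc by auto
    then have "\<not> k < i" using C(1) ik unfolding lower_tri_def by auto
    then show "k = i \<or> p - k < p - i" using ik by auto
  qed (use Cc g in auto)
  also have "(\<integral>\<^sup>+y. g y \<partial>Sp p) = ennreal (1 / \<bar>\<Prod>i<p. C $$ (i, i)\<bar> ^ (p + 1)) * (\<integral>\<^sup>+y. f y \<partial>Sp p)"
    unfolding g_def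
  proof (rule nn_integral_congruence_triangular[where \<rho> = "\<lambda>i. i"])
    show "C $$ (i, i) \<noteq> 0" if "i < p" for i
      using that C(1) unfolding lower_tri_def by (metis less_irrefl)
    fix i k assume ik: "i < p" "k < p" "C $$ (i, k) \<noteq> 0"
    then have "\<not> i < k" using C(1) unfolding lower_tri_def by auto
    then show "k = i \<or> k < i" by auto
  qed (use Cc f in auto)
  finally show ?thesis unfolding d dT using d(2)
    by (simp add: mult.assoc[symmetric] ennreal_mult[symmetric] power_mult_distrib) (simp add: mult_ac)
qed

subsection \<open>Measurability of matrix functions\<close>

text \<open>Everything is asked only on the space of \<open>N\<close>, so the notion passes to the
  restriction to points where the inverses in question exist.\<close>

definition measurable_mat :: "'a measure \<Rightarrow> nat \<Rightarrow> nat \<Rightarrow> ('a \<Rightarrow> real mat) \<Rightarrow> bool" where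
  "measurable_mat N m n F \<longleftrightarrow> (\<forall>\<omega>\<in>space N. F \<omega> \<in> carrier_mat m n) \<and>
     (\<forall>i<m. \<forall>j<n. (\<lambda>\<omega>. F \<omega> $$ (i, j)) \<in> borel_measurable N)"

lemma measurable_matD:
  assumes "measurable_mat N m n F"
  shows "\<omega> \<in> space N \<Longrightarrow> F \<omega> \<in> carrier_mat m n"
    "i < m \<Longrightarrow> j < n \<Longrightarrow> (\<lambda>\<omega>. F \<omega> $$ (i, j)) \<in> borel_measurable N"
  using assms by (auto simp: measurable_mat_def)

lemma measurable_matI:
  assumes "\<And>\<omega>. \<omega> \<in> space N \<Longrightarrow> F \<omega> \<in> carrier_mat m n"
    "\<And>i j. i < m \<Longrightarrow> j < n \<Longrightarrow> \<exists>g\<in>borel_measurable N. \<forall>\<omega>\<in>space N. F \<omega> $$ (i, j) = g \<omega>"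
  shows "measurable_mat N m n F"
  unfolding measurable_mat_def
proof (intro conjI ballI allI impI assms(1))
  fix i j assume "i < m" "j < n"
  then obtain g where "g \<in> borel_measurable N" "\<forall>\<omega>\<in>space N. F \<omega> $$ (i, j) = g \<omega>" using assms(2) by blast
  then show "(\<lambda>\<omega>. F \<omega> $$ (i, j)) \<in> borel_measurable N"
    by (subst measurable_cong[where g = g]) auto
qed

lemma measurable_mat_cong:
  "measurable_mat N m n F \<Longrightarrow> (\<And>\<omega>. \<omega> \<in> space N \<Longrightarrow> F \<omega> = G \<omega>) \<Longrightarrow> measurable_mat N m n G"
  unfolding measurable_mat_def by (auto cong: measurable_cong)

lemma measurable_mat_mult:
  assumes F: "measurable_mat N m n F" and G: "measurable_mat N n k G"
  shows "measurable_mat N m k (\<lambda>\<omega>. F \<omega> * G \<omega>)"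
proof (rule measurable_matI)
  fix \<omega> assume "\<omega> \<in> space N"
  then show "F \<omega> * G \<omega> \<in> carrier_mat m k"
    by (intro mult_carrier_mat[of _ m n] measurable_matD(1)[OF F] measurable_matD(1)[OF G])
next
  fix i j assume ij: "i < m" "j < k"
  have "(\<lambda>\<omega>. \<Sum>l<n. F \<omega> $$ (i, l) * G \<omega> $$ (l, j)) \<in> borel_measurable N"
    by (intro borel_measurable_sum borel_measurable_times measurable_matD(2)[OF F] measurable_matD(2)[OF G]) (use ij in auto)
  moreover have "(F \<omega> * G \<omega>) $$ (i, j) = (\<Sum>l<n. F \<omega> $$ (i, l) * G \<omega> $$ (l, j))" if "\<omega> \<in> space N" for \<omega>
    using measurable_matD(1)[OF F that] measurable_matD(1)[OF G that] ij by (simp add: scalar_prod_def atLeast0LessThan)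
  ultimately show "\<exists>g\<in>borel_measurable N. \<forall>\<omega>\<in>space N. (F \<omega> * G \<omega>) $$ (i, j) = g \<omega>"
    by - (rule bexI[rotated], assumption, blast)
qed

lemma measurable_mat_minus:
  assumes F: "measurable_mat N m n F" and G: "measurable_mat N m n G"
  shows "measurable_mat N m n (\<lambda>\<omega>. F \<omega> - G \<omega>)"
proof (rule measurable_matI)
  fix \<omega> assume "\<omega> \<in> space N"
  then show "F \<omega> - G \<omega> \<in> carrier_mat m n" using measurable_matD(1)[OF F] measurable_matD(1)[OF G] by (auto intro: minus_carrier_mat)
next
  fix i j assume ij: "i < m" "j < n"
  have "(F \<omega> - G \<omega>) $$ (i, j) = F \<omega> $$ (i, j) - G \<omega> $$ (i, j)" if "\<omega> \<in> space N" for \<omega>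
    using measurable_matD(1)[OF F that] measurable_matD(1)[OF G that] ij by auto
  moreover have "(\<lambda>\<omega>. F \<omega> $$ (i, j) - G \<omega> $$ (i, j)) \<in> borel_measurable N"
    by (intro borel_measurable_diff measurable_matD(2)[OF F] measurable_matD(2)[OF G] ij)
  ultimately show "\<exists>g\<in>borel_measurable N. \<forall>\<omega>\<in>space N. (F \<omega> - G \<omega>) $$ (i, j) = g \<omega>"
    by - (rule bexI[rotated], assumption, blast)
qed

lemma measurable_mat_add:
  assumes F: "measurable_mat N m n F" and G: "measurable_mat N m n G"
  shows "measurable_mat N m n (\<lambda>\<omega>. F \<omega> + G \<omega>)"
proof (rule measurable_matI)
  fix \<omega> assume "\<omega> \<in> space N"
  then show "F \<omega> + G \<omega> \<in> carrier_mat m n" using measurable_matD(1)[OF F] measurable_matD(1)[OF G] by auto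
next
  fix i j assume ij: "i < m" "j < n"
  have "(F \<omega> + G \<omega>) $$ (i, j) = F \<omega> $$ (i, j) + G \<omega> $$ (i, j)" if "\<omega> \<in> space N" for \<omega>
    using measurable_matD(1)[OF F that] measurable_matD(1)[OF G that] ij by auto
  moreover have "(\<lambda>\<omega>. F \<omega> $$ (i, j) + G \<omega> $$ (i, j)) \<in> borel_measurable N"
    by (intro borel_measurable_add measurable_matD(2)[OF F] measurable_matD(2)[OF G] ij)
  ultimately show "\<exists>g\<in>borel_measurable N. \<forall>\<omega>\<in>space N. (F \<omega> + G \<omega>) $$ (i, j) = g \<omega>"
    by - (rule bexI[rotated], assumption, blast)
qed

lemma measurable_mat_smult:
  assumes F: "measurable_mat N m n F" and c: "c \<in> borel_measurable N"
  shows "measurable_mat N m n (\<lambda>\<omega>. c \<omega> \<cdot>\<^sub>m F \<omega>)"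
proof (rule measurable_matI)
  fix \<omega> assume "\<omega> \<in> space N"
  then show "c \<omega> \<cdot>\<^sub>m F \<omega> \<in> carrier_mat m n" using measurable_matD(1)[OF F] by auto
next
  fix i j assume ij: "i < m" "j < n"
  have "(c \<omega> \<cdot>\<^sub>m F \<omega>) $$ (i, j) = c \<omega> * F \<omega> $$ (i, j)" if "\<omega> \<in> space N" for \<omega>
    using measurable_matD(1)[OF F that] ij by auto
  moreover have "(\<lambda>\<omega>. c \<omega> * F \<omega> $$ (i, j)) \<in> borel_measurable N"
    by (intro borel_measurable_times measurable_matD(2)[OF F] ij c)
  ultimately show "\<exists>g\<in>borel_measurable N. \<forall>\<omega>\<in>space N. (c \<omega> \<cdot>\<^sub>m F \<omega>) $$ (i, j) = g \<omega>"
    by - (rule bexI[rotated], assumption, blast)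
qed

lemma measurable_mat_transpose:
  assumes F: "measurable_mat N m n F"
  shows "measurable_mat N n m (\<lambda>\<omega>. (F \<omega>)\<^sup>T)"
proof (rule measurable_matI)
  fix \<omega> assume "\<omega> \<in> space N"
  then show "(F \<omega>)\<^sup>T \<in> carrier_mat n m" using measurable_matD(1)[OF F] by auto
next
  fix i j assume ij: "i < n" "j < m"
  have "(F \<omega>)\<^sup>T $$ (i, j) = F \<omega> $$ (j, i)" if "\<omega> \<in> space N" for \<omega>
    using measurable_matD(1)[OF F that] ij by auto
  then show "\<exists>g\<in>borel_measurable N. \<forall>\<omega>\<in>space N. (F \<omega>)\<^sup>T $$ (i, j) = g \<omega>"
    using measurable_matD(2)[OF F ij(2,1)] by - (rule bexI[rotated], assumption, blast)
qed

lemma measurable_mat_const: "A \<in> carrier_mat m n \<Longrightarrow> measurable_mat N m n (\<lambda>_. A)"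
  by (simp add: measurable_mat_def)

lemma measurable_mat_mat:
  assumes "\<And>i j. i < m \<Longrightarrow> j < n \<Longrightarrow> (\<lambda>\<omega>. f \<omega> (i, j)) \<in> borel_measurable N"
  shows "measurable_mat N m n (\<lambda>\<omega>. Matrix.mat m n (f \<omega>))"
  using assms by (simp add: measurable_mat_def)

lemma borel_measurable_det:
  assumes F: "measurable_mat N n n F"
  shows "(\<lambda>\<omega>. det (F \<omega>)) \<in> borel_measurable N"
proof -
  have "(\<lambda>\<omega>. \<Sum>q\<in>{q. q permutes {0..<n}}. signof q * (\<Prod>i = 0..<n. F \<omega> $$ (i, q i))) \<in> borel_measurable N"
  proof (intro borel_measurable_sum borel_measurable_times borel_measurable_const borel_measurable_prod)
    fix q i assume "q \<in> {q. q permutes {0..<n}}" "i \<in> {0..<n}"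
    then show "(\<lambda>\<omega>. F \<omega> $$ (i, q i)) \<in> borel_measurable N"
      using permutes_in_image[of q "{0..<n}" i] by (intro measurable_matD(2)[OF F]) auto
  qed
  then show ?thesis
    by (subst measurable_cong[where g = "\<lambda>\<omega>. \<Sum>q\<in>{q. q permutes {0..<n}}. signof q * (\<Prod>i = 0..<n. F \<omega> $$ (i, q i))"])
      (auto simp: det_def'[OF measurable_matD(1)[OF F]])
qed

text \<open>Cramer's rule expresses the inverse, given by a description, through determinants of the
  entries, and so gives access to its measurability.\<close>

lemma minv_adj_mat:
  assumes "A \<in> carrier_mat n n" "det A \<noteq> (0 :: real)"
  shows "minv A = (1 / det A) \<cdot>\<^sub>m adj_mat A"
proof (rule minv_unique[OF assms(1)])
  note a = adj_mat[OF assms(1)]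
  show "(1 / det A) \<cdot>\<^sub>m adj_mat A \<in> carrier_mat n n" using a by simp
  have "A * ((1 / det A) \<cdot>\<^sub>m adj_mat A) = (1 / det A) \<cdot>\<^sub>m (det A \<cdot>\<^sub>m 1\<^sub>m n)"
    using a assms(1) by (simp add: mult_smult_distrib[of _ n n _ n])
  also have "\<dots> = 1\<^sub>m n" using assms(2) by (intro eq_matI) auto
  finally show "A * ((1 / det A) \<cdot>\<^sub>m adj_mat A) = 1\<^sub>m n" .
qed

lemma measurable_mat_minv:
  assumes F: "measurable_mat N n n F" and d: "\<And>\<omega>. \<omega> \<in> space N \<Longrightarrow> det (F \<omega>) \<noteq> 0"
  shows "measurable_mat N n n (\<lambda>\<omega>. minv (F \<omega>))"
proof -
  have "measurable_mat N n n (\<lambda>\<omega>. adj_mat (F \<omega>))"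
  proof (rule measurable_matI)
    fix \<omega> assume "\<omega> \<in> space N"
    then show "adj_mat (F \<omega>) \<in> carrier_mat n n" using adj_mat(1) measurable_matD(1)[OF F] by blast
  next
    fix i j assume ij: "i < n" "j < n"
    have "measurable_mat N (n - 1) (n - 1) (\<lambda>\<omega>. mat_delete (F \<omega>) j i)"
    proof (rule measurable_matI)
      fix \<omega> assume "\<omega> \<in> space N"
      then show "mat_delete (F \<omega>) j i \<in> carrier_mat (n - 1) (n - 1)"
        using measurable_matD(1)[OF F] mat_delete_carrier by blast
    next
      fix k l assume kl: "k < n - 1" "l < n - 1"
      let ?k = "if k < j then k else Suc k" and ?l = "if l < i then l else Suc l"
      have "(\<lambda>\<omega>. F \<omega> $$ (?k, ?l)) \<in> borel_measurable N" using kl by (intro measurable_matD(2)[OF F]) auto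
      moreover have "mat_delete (F \<omega>) j i $$ (k, l) = F \<omega> $$ (?k, ?l)" if "\<omega> \<in> space N" for \<omega>
        using measurable_matD(1)[OF F that] kl by (simp add: mat_delete_def)
      ultimately show "\<exists>g\<in>borel_measurable N. \<forall>\<omega>\<in>space N. mat_delete (F \<omega>) j i $$ (k, l) = g \<omega>"
    by - (rule bexI[rotated], assumption, blast)
    qed
    from borel_measurable_det[OF this]
    have "(\<lambda>\<omega>. (-1) ^ (j + i) * det (mat_delete (F \<omega>) j i)) \<in> borel_measurable N"
      by (intro borel_measurable_times borel_measurable_const)
    moreover have "adj_mat (F \<omega>) $$ (i, j) = (-1) ^ (j + i) * det (mat_delete (F \<omega>) j i)" if "\<omega> \<in> space N" for \<omega>
      using measurable_matD(1)[OF F that] ij by (simp add: adj_mat_def cofactor_def)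
    ultimately show "\<exists>g\<in>borel_measurable N. \<forall>\<omega>\<in>space N. adj_mat (F \<omega>) $$ (i, j) = g \<omega>"
    by - (rule bexI[rotated], assumption, blast)
  qed
  then have "measurable_mat N n n (\<lambda>\<omega>. (1 / det (F \<omega>)) \<cdot>\<^sub>m adj_mat (F \<omega>))"
    by (rule measurable_mat_smult) (intro borel_measurable_divide borel_measurable_const borel_measurable_det[OF F])
  then show ?thesis
    by (rule measurable_mat_cong) (use minv_adj_mat[OF measurable_matD(1)[OF F] d] in simp)
qed

lemma measurable_mat_msqrt:
  assumes F: "measurable_mat N n n F" and s: "\<And>\<omega>. \<omega> \<in> space N \<Longrightarrow> sym_mat n (F \<omega>)" "\<And>\<omega>. \<omega> \<in> space N \<Longrightarrow> pd n (F \<omega>)"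
  shows "measurable_mat N n n (\<lambda>\<omega>. msqrt n (F \<omega>))"
proof -
  have it: "measurable_mat N n n (\<lambda>\<omega>. msqrt_iter n k (G \<omega>))" if "measurable_mat N n n G" for k G
    by (induction k) (auto intro!: measurable_mat_const measurable_mat_add measurable_mat_smult measurable_mat_minus
        measurable_mat_mult that)
  show ?thesis unfolding measurable_mat_def
  proof (intro conjI ballI allI impI)
    fix \<omega> assume "\<omega> \<in> space N"
    then show "msqrt n (F \<omega>) \<in> carrier_mat n n" using msqrt_props(1)[OF s] sym_matD(1) by blast
  next
    fix i j assume ij: "i < n" "j < n"
    define c where "c = (\<lambda>\<omega>. \<Sum>i<n. \<Sum>j<n. \<bar>F \<omega> $$ (i, j)\<bar>)"
    have c: "c \<in> borel_measurable N" unfolding c_def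
      by (intro borel_measurable_sum borel_measurable_abs measurable_matD(2)[OF F]) auto
    show "(\<lambda>\<omega>. msqrt n (F \<omega>) $$ (i, j)) \<in> borel_measurable N"
    proof (rule borel_measurable_LIMSEQ_real)
      fix \<omega> assume "\<omega> \<in> space N"
      then show "(\<lambda>k. sqrt (c \<omega>) * msqrt_iter n k ((1 / c \<omega>) \<cdot>\<^sub>m F \<omega>) $$ (i, j)) \<longlonglongrightarrow> msqrt n (F \<omega>) $$ (i, j)"
        unfolding c_def by (intro msqrt_tendsto s ij)
    next
      fix k
      have "measurable_mat N n n (\<lambda>\<omega>. msqrt_iter n k ((1 / c \<omega>) \<cdot>\<^sub>m F \<omega>))"
        by (intro it measurable_mat_smult F borel_measurable_divide borel_measurable_const c)
      from measurable_matD(2)[OF this ij]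
      show "(\<lambda>\<omega>. sqrt (c \<omega>) * msqrt_iter n k ((1 / c \<omega>) \<cdot>\<^sub>m F \<omega>) $$ (i, j)) \<in> borel_measurable N"
        using c by measurable
    qed
  qed
qed

lemma measurable_mat_hank:
  assumes "\<And>k. measurable_mat N p p (\<lambda>\<omega>. T \<omega> k)"
  shows "measurable_mat N (d * p) (d * p) (\<lambda>\<omega>. hank p d (T \<omega>))"
  unfolding hank_def
proof (rule measurable_mat_mat)
  fix i j assume "i < d * p" "j < d * p"
  then have "p > 0" by (cases p) auto
  then show "(\<lambda>\<omega>. case (i, j) of (r, c) \<Rightarrow> T \<omega> (r div p + c div p) $$ (r mod p, c mod p)) \<in> borel_measurable N"
    using measurable_matD(2)[OF assms] by simp
qed

lemma measurable_mat_bcol: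
  assumes "\<And>k. measurable_mat N p p (\<lambda>\<omega>. T \<omega> k)"
  shows "measurable_mat N (d * p) p (\<lambda>\<omega>. bcol p d (T \<omega>))"
  unfolding bcol_def
proof (rule measurable_mat_mat)
  fix i j assume "i < d * p" "j < p"
  then show "(\<lambda>\<omega>. case (i, j) of (r, c) \<Rightarrow> T \<omega> (r div p) $$ (r mod p, c)) \<in> borel_measurable N"
    using measurable_matD(2)[OF assms] by (cases "p = 0") auto
qed

lemma sets_pd:
  assumes F: "measurable_mat N n n F" and s: "\<And>\<omega>. \<omega> \<in> space N \<Longrightarrow> sym_mat n (F \<omega>)"
  shows "{\<omega>\<in>space N. pd n (F \<omega>)} \<in> sets N"
proof -
  have m: "(\<lambda>\<omega>. det (lead k (F \<omega>))) \<in> borel_measurable N" if "k \<le> n" for k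
  proof (rule borel_measurable_det, unfold lead_def, rule measurable_mat_mat)
    fix i j assume "i < k" "j < k"
    then show "(\<lambda>\<omega>. F \<omega> $$ (i, j)) \<in> borel_measurable N" using that by (intro measurable_matD(2)[OF F]) auto
  qed
  have "{\<omega>\<in>space N. pd n (F \<omega>)} = {\<omega>\<in>space N. \<forall>k\<in>{1..n}. det (lead k (F \<omega>)) > 0}"
    using sylvester_criterion[OF s] by auto
  also have "\<dots> \<in> sets N"
  proof (rule sets.sets_Collect_finite_All)
    show "{\<omega>\<in>space N. det (lead k (F \<omega>)) > 0} \<in> sets N" if "k \<in> {1..n}" for k
      using borel_measurable_less[OF borel_measurable_const m[of k], of 0] that by simp
  qed auto
  finally show ?thesis .
qed

lemma measurable_mat_restrict: "measurable_mat N m n F \<Longrightarrow> measurable_mat (restrict_space N \<Omega>) m n F"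
  by (auto simp: measurable_mat_def space_restrict_space intro: measurable_restrict_space1)

context
  fixes N :: "'a measure" and p :: nat and S :: "'a \<Rightarrow> nat \<Rightarrow> real mat"
  assumes S: "\<And>\<omega>. \<omega> \<in> space N \<Longrightarrow> moment_seq p (S \<omega>)"
    and S_meas: "\<And>k. measurable_mat N p p (\<lambda>\<omega>. S \<omega> k)"
begin

lemma measurable_hankel_schur:
  assumes T: "\<And>k. measurable_mat N p p (\<lambda>\<omega>. T \<omega> k)" and d: "\<And>\<omega>. \<omega> \<in> space N \<Longrightarrow> hankel_block p d (T \<omega>)"
  shows "measurable_mat N p p (\<lambda>\<omega>. hankel_schur p d (T \<omega>))"
proof -
  have "measurable_mat N (d * p) (d * p) (\<lambda>\<omega>. minv (hank p d (T \<omega>)))"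
    by (rule measurable_mat_minv[OF measurable_mat_hank[OF T]]) (use hankel_block.det_hank[OF d] in auto)
  moreover have "measurable_mat N (d * p) p (\<lambda>\<omega>. bcol p d (\<lambda>i. T \<omega> (d + i)))"
    by (rule measurable_mat_bcol[OF T])
  ultimately show ?thesis unfolding hankel_schur_def
    by (intro measurable_mat_minus T measurable_mat_mult measurable_mat_transpose)
qed

text \<open>Inverse and root are under control only where Hankel blocks and range are definite.
  Hence all of \<open>N\<close> is assumed interior up to order n, which callers arrange by
  restricting the space; orders up to n + 1 are then covered.\<close>

lemma measurable_gaps:
  assumes n: "\<And>\<omega>. \<omega> \<in> space N \<Longrightarrow> moment_seq.interior p (S \<omega>) n" and k: "1 \<le> k" "k \<le> n + 1"
  shows "measurable_mat N p p (\<lambda>\<omega>. low_gap p (S \<omega>) k)" "measurable_mat N p p (\<lambda>\<omega>. up_gap p (S \<omega>) k)"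
    "measurable_mat N p p (\<lambda>\<omega>. moment_range p (S \<omega>) k)" "measurable_mat N p p (\<lambda>\<omega>. canon p (S \<omega>) k)"
proof -
  have lo: "measurable_mat N p p (\<lambda>\<omega>. low_seq (S \<omega>) k j)" for j
    using S_meas by (cases "even k") (simp_all add: low_seq_def)
  have up: "measurable_mat N p p (\<lambda>\<omega>. up_seq (S \<omega>) k j)" for j
    using S_meas by (cases "even k") (simp_all add: up_seq_def measurable_mat_minus)
  show l: "measurable_mat N p p (\<lambda>\<omega>. low_gap p (S \<omega>) k)"
    by (rule measurable_mat_cong[OF measurable_hankel_schur[OF lo moment_seq.interior_hankel_block(1)[OF S n k]]])
      (use moment_seq.low_gap_eq[OF S k(1)] in auto)
  show u: "measurable_mat N p p (\<lambda>\<omega>. up_gap p (S \<omega>) k)"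
    by (rule measurable_mat_cong[OF measurable_hankel_schur[OF up moment_seq.interior_hankel_block(2)[OF S n k]]])
      (use moment_seq.up_gap_eq[OF S k(1)] in auto)
  show R: "measurable_mat N p p (\<lambda>\<omega>. moment_range p (S \<omega>) k)"
    by (rule measurable_mat_cong[OF measurable_mat_add[OF l u]]) (use moment_seq.gap_sym(5)[OF S n k] in auto)
  have Rs: "sym_mat p (moment_range p (S \<omega>) k)" "pd p (moment_range p (S \<omega>) k)" if "\<omega> \<in> space N" for \<omega>
    using moment_seq.gap_sym(4)[OF S[OF that] n[OF that] k] moment_seq.pd_moment_range[OF S[OF that] n[OF that] k] by auto
  have R': "measurable_mat N p p (\<lambda>\<omega>. minv (msqrt p (moment_range p (S \<omega>) k)))"
    by (rule measurable_mat_minv[OF measurable_mat_msqrt[OF R Rs]]) (use msqrt_det_pos(1)[OF Rs] in force)+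
  show "measurable_mat N p p (\<lambda>\<omega>. canon p (S \<omega>) k)"
    unfolding canon_eq normalize_by_def by (rule measurable_mat_mult[OF measurable_mat_mult[OF R' l] R'])
qed

end

text \<open>Measurability of the domain and of the gaps must grow together: on the interior of order
  n, already measurable, the gaps of order n + 1 are measurable, and their definiteness cuts out the
  next interior.\<close>

lemma sets_interior:
  assumes S: "\<And>\<omega>. \<omega> \<in> space N \<Longrightarrow> moment_seq p (S \<omega>)"
    and S_meas: "\<And>k. measurable_mat N p p (\<lambda>\<omega>. S \<omega> k)"
  shows "{\<omega>\<in>space N. moment_seq.interior p (S \<omega>) n} \<in> sets N"
proof (induction n)
  case 0
  have "{\<omega>\<in>space N. moment_seq.interior p (S \<omega>) 0} = space N"
    using moment_seq.interior_def[OF S] by auto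
  then show ?case by simp
next
  case (Suc n)
  define A where "A = {\<omega>\<in>space N. moment_seq.interior p (S \<omega>) n}"
  define R where "R = restrict_space N A"
  have A: "A \<in> sets N" using Suc by (simp add: A_def)
  have spR: "space R = A" using A sets.sets_into_space[OF A] by (auto simp: R_def space_restrict_space)
  have S': "\<And>\<omega>. \<omega> \<in> space R \<Longrightarrow> moment_seq p (S \<omega>)" using S by (auto simp: spR A_def)
  have m: "\<And>k. measurable_mat R p p (\<lambda>\<omega>. S \<omega> k)" unfolding R_def by (intro measurable_mat_restrict S_meas)
  have n: "\<And>\<omega>. \<omega> \<in> space R \<Longrightarrow> moment_seq.interior p (S \<omega>) n" by (auto simp: spR A_def)
  have k: "1 \<le> Suc n" "Suc n \<le> n + 1" by auto
  note g = measurable_gaps[OF S' m n k]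
  note s = moment_seq.gap_sym[OF S' n k]
  have "{\<omega>\<in>space R. pd p (low_gap p (S \<omega>) (Suc n))} \<inter> {\<omega>\<in>space R. pd p (up_gap p (S \<omega>) (Suc n))} \<in> sets R"
    by (intro sets.Int sets_pd g s)
  also have "{\<omega>\<in>space R. pd p (low_gap p (S \<omega>) (Suc n))} \<inter> {\<omega>\<in>space R. pd p (up_gap p (S \<omega>) (Suc n))}
      = {\<omega>\<in>space N. moment_seq.interior p (S \<omega>) (Suc n)}"
    using moment_seq.interior_Suc[OF S] by (auto simp: spR A_def)
  finally have "{\<omega>\<in>space N. moment_seq.interior p (S \<omega>) (Suc n)} \<in> sets R" .
  then show ?case using A sets.sets_into_space[OF A] unfolding R_def
    by (subst (asm) sets_restrict_space_iff) (auto simp: Int_absorb2)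
qed

subsection \<open>The moment coordinates\<close>

lemma finite_Kidx[simp]: "finite (Kidx p n)"
  by (simp add: Kidx_def)

lemma Kidx_iff[simp]: "(k, ij) \<in> Kidx p n \<longleftrightarrow> 1 \<le> k \<and> k \<le> n \<and> ij \<in> Tidx p"
  by (auto simp: Kidx_def)

lemma Kidx_Suc: "Kidx p (Suc n) = Kidx p n \<union> Pair (Suc n) ` Tidx p"
  by (auto simp: le_Suc_eq)

text \<open>A point of order n + 1 seen as its first n moments together with the last one; the
  inductions on n in integrals run over this pairing.\<close>

definition append_moment :: "nat \<Rightarrow> nat \<Rightarrow> (nat \<times> nat \<times> nat \<Rightarrow> real) \<Rightarrow> (nat \<times> nat \<Rightarrow> real) \<Rightarrow> nat \<times> nat \<times> nat \<Rightarrow> real" where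
  "append_moment p n x y = (\<lambda>(k, ij)\<in>Kidx p (Suc n). if k = Suc n then y ij else x (k, ij))"

lemma append_moment_apply:
  "1 \<le> k \<Longrightarrow> k \<le> n \<Longrightarrow> ij \<in> Tidx p \<Longrightarrow> append_moment p n x y (k, ij) = x (k, ij)"
  "ij \<in> Tidx p \<Longrightarrow> append_moment p n x y (Suc n, ij) = y ij"
  by (auto simp: append_moment_def)

lemma append_moment_in_space[simp]: "append_moment p n x y \<in> space (SpN p (Suc n))"
  by (auto simp: SpN_def space_PiM append_moment_def)

lemma measurable_append_moment: "(\<lambda>(x, y). append_moment p n x y) \<in> measurable (SpN p n \<Otimes>\<^sub>M Sp p) (SpN p (Suc n))"
proof -
  have "(\<lambda>z. \<lambda>(k, ij)\<in>Kidx p (Suc n). if k = Suc n then snd z ij else fst z (k, ij))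
      \<in> measurable (SpN p n \<Otimes>\<^sub>M Sp p) (SpN p (Suc n))"
    unfolding SpN_def
  proof (rule measurable_restrict)
    fix kij assume "kij \<in> Kidx p (Suc n)"
    then obtain k ij where k: "kij = (k, ij)" "1 \<le> k" "k \<le> Suc n" "ij \<in> Tidx p" by (cases kij) auto
    show "(\<lambda>z. case kij of (k, ij) \<Rightarrow> if k = Suc n then snd z ij else fst z (k, ij))
        \<in> measurable (Pi\<^sub>M (Kidx p n) (\<lambda>_. lborel) \<Otimes>\<^sub>M Sp p) lborel"
    proof (cases "k = Suc n")
      case True
      have "(\<lambda>z. snd z ij) \<in> measurable (Pi\<^sub>M (Kidx p n) (\<lambda>_. lborel) \<Otimes>\<^sub>M Sp p) lborel"
        unfolding Sp_def using k by (intro measurable_compose[OF measurable_snd measurable_component_singleton]) auto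
      then show ?thesis using True k by simp
    next
      case False
      have "(\<lambda>z. fst z (k, ij)) \<in> measurable (Pi\<^sub>M (Kidx p n) (\<lambda>_. lborel) \<Otimes>\<^sub>M Sp p) lborel"
        using k False by (intro measurable_compose[OF measurable_fst measurable_component_singleton]) auto
      then show ?thesis using False k by simp
    qed
  qed
  then show ?thesis by (simp add: append_moment_def case_prod_beta')
qed

lemma measurable_append_moment_right:
  assumes "x \<in> space (SpN p n)" shows "append_moment p n x \<in> measurable (Sp p) (SpN p (Suc n))"
  using measurable_compose[OF measurable_Pair1'[OF assms] measurable_append_moment] by simp

lemma space_SpN_PiE: "x \<in> space (SpN p n) \<longleftrightarrow> x \<in> extensional (Kidx p n)"
  by (auto simp: SpN_def space_PiM PiE_def)

lemma nn_integral_SpN_Suc: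
  assumes f: "f \<in> borel_measurable (SpN p (Suc n))"
  shows "(\<integral>\<^sup>+x. f x \<partial>SpN p (Suc n)) = (\<integral>\<^sup>+x. (\<integral>\<^sup>+y. f (append_moment p n x y) \<partial>Sp p) \<partial>SpN p n)"
proof -
  let ?I = "Kidx p n" and ?J = "Pair (Suc n) ` Tidx p"
  have dis: "?I \<inter> ?J = {}" by auto
  have f': "f \<in> borel_measurable (PiM (?I \<union> ?J) (\<lambda>_. lborel))"
    using f by (simp add: SpN_def Kidx_Suc)
  have "(\<integral>\<^sup>+x. f x \<partial>SpN p (Suc n)) = (\<integral>\<^sup>+x. (\<integral>\<^sup>+y. f (merge ?I ?J (x, y)) \<partial>PiM ?J (\<lambda>_. lborel)) \<partial>PiM ?I (\<lambda>_. lborel))"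
    unfolding SpN_def Kidx_Suc by (rule lborel_product.product_nn_integral_fold[OF dis _ _ f']) auto
  also have "\<dots> = (\<integral>\<^sup>+x. (\<integral>\<^sup>+y. f (append_moment p n x y) \<partial>Sp p) \<partial>SpN p n)"
    unfolding SpN_def[of p n]
  proof (rule nn_integral_cong)
    fix x assume x: "x \<in> space (PiM ?I (\<lambda>_. lborel :: real measure))"
    have m: "(\<lambda>y. f (merge ?I ?J (x, y))) \<in> borel_measurable (PiM ?J (\<lambda>_. lborel))"
      using measurable_compose[OF measurable_Pair1'[OF x] measurable_compose[OF measurable_merge f']] .
    have "(\<integral>\<^sup>+y. f (merge ?I ?J (x, y)) \<partial>PiM ?J (\<lambda>_. lborel))
        = (\<integral>\<^sup>+y. f (merge ?I ?J (x, \<lambda>k\<in>?J. y (snd k))) \<partial>PiM (Tidx p) (\<lambda>_. lborel))"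
      by (rule nn_integral_PiM_reindex[where g = snd, OF _ _ m]) auto
    also have "\<dots> = (\<integral>\<^sup>+y. f (append_moment p n x y) \<partial>Sp p)"
      unfolding Sp_def
    proof (intro nn_integral_cong arg_cong[where f = f] ext)
      fix y :: "nat \<times> nat \<Rightarrow> real" and kij :: "nat \<times> nat \<times> nat"
      obtain k ij where "kij = (k, ij)" by (cases kij)
      then show "merge ?I ?J (x, \<lambda>k\<in>?J. y (snd k)) kij = append_moment p n x y kij"
        by (auto simp: merge_def append_moment_def le_Suc_eq)
    qed
    finally show "(\<integral>\<^sup>+y. f (merge ?I ?J (x, y)) \<partial>PiM ?J (\<lambda>_. lborel)) = (\<integral>\<^sup>+y. f (append_moment p n x y) \<partial>Sp p)" .
  qed
  finally show ?thesis .
qed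

interpretation Sp_sigma_finite: sigma_finite_measure "Sp p" for p
  unfolding Sp_def by (rule lborel_product.sigma_finite) simp

lemma borel_measurable_Sp_integral:
  assumes f: "f \<in> borel_measurable (SpN p (Suc n))"
  shows "(\<lambda>x. \<integral>\<^sup>+y. f (append_moment p n x y) \<partial>Sp p) \<in> borel_measurable (SpN p n)"
  using Sp_sigma_finite.borel_measurable_nn_integral[of "\<lambda>x y. f (append_moment p n x y)" "SpN p n" p]
    measurable_compose[OF measurable_append_moment f] by (simp add: case_prod_beta')

lemma sym_smat[simp]: "sym_mat p (smat p x k)"
  by (rule sym_matI) (auto simp: smat_def min.commute max.commute)

lemma smat_eq_tmat: "smat p x k = tmat p (\<lambda>ij. x (k, ij))"
  by (simp add: smat_def tmat_def)

lemma tmat_cong: "(\<And>ij. ij \<in> Tidx p \<Longrightarrow> y ij = y' ij) \<Longrightarrow> tmat p y = tmat p y'"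
  by (auto simp: tmat_def intro!: cong_mat)

lemma smat_append_moment: "1 \<le> k \<Longrightarrow> k \<le> n \<Longrightarrow> smat p (append_moment p n x y) k = smat p x k"
  "smat p (append_moment p n x y) (Suc n) = tmat p y"
  unfolding smat_eq_tmat by (auto intro!: tmat_cong simp: append_moment_apply)

lemma moment_seq_Sseq[simp]: "moment_seq p (Sseq p x)"
  by unfold_locales (auto simp: Sseq_def)

lemma Sseq_append_moment: "k \<le> n \<Longrightarrow> Sseq p (append_moment p n x y) k = Sseq p x k"
  "Sseq p (append_moment p n x y) (Suc n) = tmat p y"
  by (auto simp: Sseq_def smat_append_moment)

lemma Mint_iff: "x \<in> Mint p n \<longleftrightarrow> x \<in> space (SpN p n) \<and> moment_seq.interior p (Sseq p x) n"
  unfolding Mint_def moment_seq.interior_def[OF moment_seq_Sseq] mless_def low_gap_def up_gap_def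
  by (auto simp: Sseq_def)

text \<open>Off the index set, points of the product space have the constant value
  \<open>undefined\<close>, so evaluation is measurable at every index.\<close>

lemma borel_measurable_component_SpN: "(\<lambda>x. x q) \<in> borel_measurable (SpN p n)"
proof (cases "q \<in> Kidx p n")
  case True
  then show ?thesis unfolding SpN_def using measurable_component_singleton[OF True, of "\<lambda>_. lborel"] by simp
next
  case False
  then have "x q = undefined" if "x \<in> space (SpN p n)" for x
    using that False unfolding space_SpN_PiE by (intro extensional_arb)
  then show ?thesis by (subst measurable_cong[where g = "\<lambda>_. undefined"]) auto
qed

lemma borel_measurable_component_Sp: "(\<lambda>x. x q) \<in> borel_measurable (Sp p)"
proof (cases "q \<in> Tidx p")
  case True
  then show ?thesis unfolding Sp_def using measurable_component_singleton[OF True, of "\<lambda>_. lborel"] by simp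
next
  case False
  then have "x q = undefined" if "x \<in> space (Sp p)" for x
    using that False unfolding Sp_def space_PiM PiE_def by (intro extensional_arb) auto
  then show ?thesis by (subst measurable_cong[where g = "\<lambda>_. undefined"]) auto
qed

lemma measurable_mat_smat: "measurable_mat (SpN p n) p p (\<lambda>x. smat p x k)"
  unfolding smat_def by (rule measurable_mat_mat) (simp add: borel_measurable_component_SpN)

lemma measurable_mat_tmat: "measurable_mat (Sp p) p p (tmat p)"
  unfolding tmat_def by (rule measurable_mat_mat) (simp add: borel_measurable_component_Sp)

lemma measurable_mat_Sseq: "measurable_mat (SpN p n) p p (\<lambda>x. Sseq p x k)"
  by (cases "k = 0") (auto simp: Sseq_def measurable_mat_smat intro: measurable_mat_const)

lemma sets_Mint[measurable]: "Mint p n \<in> sets (SpN p n)"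
proof -
  have "Mint p n = {x \<in> space (SpN p n). moment_seq.interior p (Sseq p x) n}" by (auto simp: Mint_iff)
  then show ?thesis using sets_interior[OF moment_seq_Sseq measurable_mat_Sseq] by simp
qed

text \<open>Two measurable pieces glued along \<open>Mint\<close>: the canonical moments on the
  interior and the default value 0 elsewhere.\<close>

lemma measurable_Ucoords[measurable]: "Ucoords p n \<in> measurable (SpN p n) (SpN p n)"
proof -
  let ?N = "restrict_space (SpN p n) {x. x \<in> Mint p n}"
  have N: "\<omega> \<in> space ?N \<Longrightarrow> moment_seq.interior p (Sseq p \<omega>) n" for \<omega>
    by (auto simp: space_restrict_space Mint_iff)
  have c: "(\<lambda>x. canon p (Sseq p x) k $$ (i, j)) \<in> borel_measurable ?N" if "(k, i, j) \<in> Kidx p n" for k i j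
    by (rule measurable_matD(2)[OF measurable_gaps(4)[OF moment_seq_Sseq measurable_mat_restrict[OF measurable_mat_Sseq] N]])
      (use that in auto)
  have "(\<lambda>x. \<lambda>(k, i, j)\<in>Kidx p n. if x \<in> Mint p n then canon p (Sseq p x) k $$ (i, j) else 0) \<in> measurable (SpN p n) (SpN p n)"
    unfolding SpN_def
  proof (rule measurable_restrict, unfold SpN_def[symmetric])
    fix q assume "q \<in> Kidx p n"
    then obtain k i j where q: "q = (k, i, j)" "(k, i, j) \<in> Kidx p n" by (cases q) auto
    have "(\<lambda>x. if x \<in> Mint p n then canon p (Sseq p x) k $$ (i, j) else 0) \<in> borel_measurable (SpN p n)"
    proof (subst measurable_If_restrict_space_iff)
      have "{x \<in> space (SpN p n). x \<in> Mint p n} = Mint p n" by (auto simp: Mint_iff)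
      then show "{x \<in> space (SpN p n). x \<in> Mint p n} \<in> sets (SpN p n)" by simp
    qed (use c[OF q(2)] in auto)
    then show "(\<lambda>x. case q of (k, i, j) \<Rightarrow> if x \<in> Mint p n then canon p (Sseq p x) k $$ (i, j) else 0)
        \<in> measurable (SpN p n) lborel" by (simp add: q(1))
  qed
  moreover have "Ucoords p n = (\<lambda>x. \<lambda>(k, i, j)\<in>Kidx p n. if x \<in> Mint p n then canon p (Sseq p x) k $$ (i, j) else 0)"
    by (auto simp: Ucoords_def fun_eq_iff restrict_def)
  ultimately show ?thesis by simp
qed

lemma smat_Ucoords:
  assumes "x \<in> Mint p n" "1 \<le> k" "k \<le> n"
  shows "smat p (Ucoords p n x) k = canon p (Sseq p x) k"
proof -
  have "moment_seq.interior p (Sseq p x) n" "k \<le> n + 1" using assms by (auto simp: Mint_iff)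
  then have "sym_mat p (canon p (Sseq p x) k)" using moment_seq.canon_props(1)[OF moment_seq_Sseq] assms(2) by blast
  then have "tmat p (tcoords p (canon p (Sseq p x) k)) = canon p (Sseq p x) k" by (rule tmat_tcoords)
  moreover have "smat p (Ucoords p n x) k = tmat p (tcoords p (canon p (Sseq p x) k))"
    unfolding smat_eq_tmat using assms by (intro tmat_cong) (auto simp: Ucoords_def tcoords_def)
  ultimately show ?thesis by simp
qed

lemma append_moment_Mint_iff:
  assumes x: "x \<in> space (SpN p n)"
  shows "append_moment p n x y \<in> Mint p (Suc n) \<longleftrightarrow> x \<in> Mint p n \<and>
    pd p (low_gap p (Sseq p (append_moment p n x y)) (Suc n)) \<and> pd p (up_gap p (Sseq p (append_moment p n x y)) (Suc n))"
proof -
  have "moment_seq.interior p (Sseq p (append_moment p n x y)) n \<longleftrightarrow> moment_seq.interior p (Sseq p x) n"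
    unfolding moment_seq.interior_def[OF moment_seq_Sseq]
  proof (rule ball_cong[OF refl])
    fix k assume "k \<in> {1..n}"
    then have "\<And>j. j \<le> k \<Longrightarrow> Sseq p (append_moment p n x y) j = Sseq p x j" by (auto simp: Sseq_append_moment)
    from gaps_cong(1,2)[OF this]
    show "(pd p (low_gap p (Sseq p (append_moment p n x y)) k) \<and> pd p (up_gap p (Sseq p (append_moment p n x y)) k)) =
        (pd p (low_gap p (Sseq p x) k) \<and> pd p (up_gap p (Sseq p x) k))" by auto
  qed
  then show ?thesis using x by (auto simp: Mint_iff moment_seq.interior_Suc[OF moment_seq_Sseq])
qed

lemma Ucoords_append_moment:
  assumes "append_moment p n x y \<in> Mint p (Suc n)" "x \<in> Mint p n"
  shows "Ucoords p (Suc n) (append_moment p n x y)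
    = append_moment p n (Ucoords p n x) (tcoords p (canon p (Sseq p (append_moment p n x y)) (Suc n)))"
proof
  fix q :: "nat \<times> nat \<times> nat"
  obtain k i j where q: "q = (k, i, j)" by (cases q)
  show "Ucoords p (Suc n) (append_moment p n x y) q
    = append_moment p n (Ucoords p n x) (tcoords p (canon p (Sseq p (append_moment p n x y)) (Suc n))) q"
  proof (cases "q \<in> Kidx p (Suc n)")
    case False
    then show ?thesis using assms by (auto simp: Ucoords_def append_moment_def)
  next
    case True
    then have k: "1 \<le> k" "k \<le> Suc n" "(i, j) \<in> Tidx p" by (auto simp: q simp del: Tidx_iff)
    show ?thesis
    proof (cases "k = Suc n")
      case True
      then show ?thesis using assms k by (simp add: q Ucoords_def append_moment_apply tcoords_def)
    next
      case False
      then have "\<And>l. l \<le> k \<Longrightarrow> Sseq p (append_moment p n x y) l = Sseq p x l" using k by (auto simp: Sseq_append_moment)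
      from gaps_cong(3)[OF this] show ?thesis using assms k False by (simp add: q Ucoords_def append_moment_apply)
    qed
  qed
qed

text \<open>The asserted density without the factor 1 / Vol, kept real-valued.\<close>

definition canon_weight :: "nat \<Rightarrow> nat \<Rightarrow> (nat \<times> nat \<times> nat \<Rightarrow> real) \<Rightarrow> real" where
  "canon_weight p n u = (\<Prod>k \<in> {1..n}.
      (if in01 p (smat p u k)
       then det (smat p u k * (1\<^sub>m p - smat p u k)) powr (real ((p + 1) * (n - k)) / 2) else 0))"

lemma canon_weight_nonneg: "canon_weight p n u \<ge> 0"
  unfolding canon_weight_def by (intro prod_nonneg) auto

lemma in01_iff: "A \<in> carrier_mat p p \<Longrightarrow> in01 p A \<longleftrightarrow> pd p A \<and> pd p (1\<^sub>m p - A)"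
proof -
  assume A: "A \<in> carrier_mat p p"
  then have "A - 0\<^sub>m p p = A" by (intro eq_matI) auto
  then show ?thesis by (simp add: in01_def mless_def)
qed

lemma sets_in01:
  assumes "measurable_mat N p p F" "\<And>\<omega>. \<omega> \<in> space N \<Longrightarrow> sym_mat p (F \<omega>)"
  shows "{\<omega> \<in> space N. in01 p (F \<omega>)} \<in> sets N"
proof -
  have "{\<omega> \<in> space N. in01 p (F \<omega>)} = {\<omega> \<in> space N. pd p (F \<omega>)} \<inter> {\<omega> \<in> space N. pd p (1\<^sub>m p - F \<omega>)}"
    using in01_iff[OF measurable_matD(1)[OF assms(1)]] by auto
  also have "\<dots> \<in> sets N"
    by (intro sets.Int sets_pd measurable_mat_minus measurable_mat_const assms sym_mat_minus) auto
  finally show ?thesis .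
qed

lemma sets_in01_smat: "{u \<in> space (SpN p n). in01 p (smat p u k)} \<in> sets (SpN p n)"
  by (rule sets_in01[OF measurable_mat_smat]) simp

lemma sets_in01_tmat: "{y \<in> space (Sp p). in01 p (tmat p y)} \<in> sets (Sp p)"
  by (rule sets_in01[OF measurable_mat_tmat]) simp

lemma borel_measurable_det_smat:
  "(\<lambda>u. det (smat p u k * (1\<^sub>m p - smat p u k))) \<in> borel_measurable (SpN p n)"
  by (rule borel_measurable_det[OF measurable_mat_mult[OF measurable_mat_smat
      measurable_mat_minus[OF measurable_mat_const measurable_mat_smat]]]) simp

lemma borel_measurable_canon_weight[measurable]: "canon_weight p n \<in> borel_measurable (SpN p n)"
  unfolding canon_weight_def
proof (intro borel_measurable_prod measurable_If)
  fix k
  show "(\<lambda>u. det (smat p u k * (1\<^sub>m p - smat p u k)) powr (real ((p + 1) * (n - k)) / 2)) \<in> borel_measurable (SpN p n)"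
    using borel_measurable_det_smat by measurable
  show "{u \<in> space (SpN p n). in01 p (smat p u k)} \<in> sets (SpN p n)" by (rule sets_in01_smat)
qed auto

subsection \<open>Change of variables to canonical moments\<close>

lemma in01_props:
  assumes "sym_mat p A" "in01 p A"
  shows "det A > 0" "det (1\<^sub>m p - A) > 0" "det (A * (1\<^sub>m p - A)) = det A * det (1\<^sub>m p - A)"
proof -
  have A: "A \<in> carrier_mat p p" using assms(1) by (auto simp: sym_mat_def)
  have s: "sym_mat p (1\<^sub>m p - A)" using sym_mat_minus[OF sym_mat_one assms(1)] .
  show "det A > 0" "det (1\<^sub>m p - A) > 0"
    using pd_det_pos[OF assms(1)] pd_det_pos[OF s] assms(2) unfolding in01_iff[OF A] by auto
  show "det (A * (1\<^sub>m p - A)) = det A * det (1\<^sub>m p - A)"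
    by (rule det_mult[OF A sym_matD(1)[OF s]])
qed

lemma measurable_normalize_tmat:
  assumes R: "sym_mat p R" "pd p R"
  shows "measurable_mat (Sp p) p p (\<lambda>y. normalize_by p R (tmat p y))"
  unfolding normalize_by_def
  by (intro measurable_mat_mult[where n = p] measurable_mat_const measurable_mat_tmat sym_matD(1)[OF msqrt_inv(1)[OF R]])

lemma measurable_tcoords:
  assumes "measurable_mat N p p F"
  shows "(\<lambda>\<omega>. tcoords p (F \<omega>)) \<in> measurable N (Sp p)"
  unfolding tcoords_def Sp_def
proof (rule measurable_restrict)
  fix q assume "q \<in> Tidx p"
  then obtain i j where q: "q = (i, j)" "i < p" "j < p" by (cases q) auto
  then show "(\<lambda>\<omega>. F \<omega> $$ q) \<in> measurable N lborel"
    using measurable_matD(2)[OF assms] by simp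
qed

text \<open>One fibre of the change of variables, with all earlier moments fixed: a translation by
  C, then the congruence by the root M of R. The Jacobian is det M^(p + 1), which equals det R to
  the power (p + 1) / 2.\<close>

lemma nn_integral_normalize:
  fixes g :: "(nat \<times> nat \<Rightarrow> real) \<Rightarrow> ennreal"
  assumes R: "sym_mat p R" "pd p R" and C: "sym_mat p C" and g: "g \<in> borel_measurable (Sp p)"
  shows "(\<integral>\<^sup>+y. indicator {y. in01 p (normalize_by p R (tmat p y - C))} y * g (tcoords p (normalize_by p R (tmat p y - C))) \<partial>Sp p)
    = ennreal (det R powr (real (p + 1) / 2)) * (\<integral>\<^sup>+z. indicator {z. in01 p (tmat p z)} z * g z \<partial>Sp p)"
proof -
  define F where "F = (\<lambda>y. indicator {y. in01 p (normalize_by p R (tmat p y))} y * g (tcoords p (normalize_by p R (tmat p y))))"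
  have sn: "sym_mat p (normalize_by p R (tmat p y))" for y by (rule normalize_by_props(1)[OF R sym_tmat])
  have F: "F \<in> borel_measurable (Sp p)"
    unfolding F_def
  proof (rule borel_measurable_times_ennreal)
    show "indicator {y. in01 p (normalize_by p R (tmat p y))} \<in> borel_measurable (Sp p)"
      by (rule borel_measurable_indicator') (use sets_in01[OF measurable_normalize_tmat[OF R] sn] in \<open>simp add: vimage_def Int_def conj_commute\<close>)
    show "(\<lambda>y. g (tcoords p (normalize_by p R (tmat p y)))) \<in> borel_measurable (Sp p)"
      by (rule measurable_compose[OF measurable_tcoords[OF measurable_normalize_tmat[OF R]] g])
  qed
  let ?M = "msqrt p R"
  note M = msqrt_props[OF R] and Mc = sym_matD[OF msqrt_props(1)[OF R]]
  have dM: "det ?M > 0" "det ?M = sqrt (det R)" using msqrt_det_pos[OF R] by auto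
  have dR: "det R > 0" using pd_det_pos[OF R] .
  have tr: "tmat p y - C = tmat p (\<lambda>q\<in>Tidx p. y q + - tcoords p C q)" for y
  proof -
    have "tmat p y - C = tmat p y - tmat p (tcoords p C)" using tmat_tcoords[OF C] by simp
    also have "\<dots> = tmat p (\<lambda>q. y q + - tcoords p C q)" by (auto simp: tmat_def intro!: eq_matI)
    also have "\<dots> = tmat p (\<lambda>q\<in>Tidx p. y q + - tcoords p C q)" by (rule tmat_cong) simp
    finally show ?thesis .
  qed
  have Feq: "F (tcoords p (?M * tmat p z * ?M)) = indicator {z. in01 p (tmat p z)} z * g z" if z: "z \<in> space (Sp p)" for z
  proof -
    have "sym_mat p (?M * tmat p z * ?M)" using sym_mat_congruence[OF sym_tmat Mc(1), of z] Mc(2) by simp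
    then have "tmat p (tcoords p (?M * tmat p z * ?M)) = ?M * tmat p z * ?M" by (rule tmat_tcoords)
    moreover have "normalize_by p R (?M * tmat p z * ?M) = tmat p z" by (rule normalize_by_props(6)[OF R sym_tmat])
    ultimately show ?thesis unfolding F_def using tcoords_tmat[OF z] by (simp add: indicator_def)
  qed
  have "(\<integral>\<^sup>+y. indicator {y. in01 p (normalize_by p R (tmat p y - C))} y * g (tcoords p (normalize_by p R (tmat p y - C))) \<partial>Sp p)
      = (\<integral>\<^sup>+y. F (\<lambda>q\<in>Tidx p. y q + - tcoords p C q) \<partial>Sp p)"
    unfolding F_def tr by (simp add: indicator_def)
  also have "\<dots> = (\<integral>\<^sup>+y. F y \<partial>Sp p)"
    unfolding Sp_def by (rule nn_integral_PiM_translate) (use F in \<open>auto simp: Sp_def\<close>)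
  \<comment> \<open>The Jacobian is inserted together with its inverse so that the congruence
    formula can be read from right to left.\<close>
  also have "\<dots> = ennreal (det ?M ^ (p + 1)) * (ennreal (1 / det ?M ^ (p + 1)) * (\<integral>\<^sup>+y. F y \<partial>Sp p))"
    using dM(1) by (simp add: mult.assoc[symmetric] ennreal_mult[symmetric])
  also have "ennreal (1 / det ?M ^ (p + 1)) * (\<integral>\<^sup>+y. F y \<partial>Sp p) = (\<integral>\<^sup>+z. F (tcoords p (?M * tmat p z * ?M)) \<partial>Sp p)"
    by (rule nn_integral_congruence_pd[OF M(1,2) F, symmetric])
  also have "\<dots> = (\<integral>\<^sup>+z. indicator {z. in01 p (tmat p z)} z * g z \<partial>Sp p)"
    by (rule nn_integral_cong) (rule Feq)
  also have "det ?M ^ (p + 1) = det R powr (real (p + 1) / 2)"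
  proof -
    have "det ?M ^ (p + 1) = (det R powr (1 / 2)) powr real (p + 1)"
      unfolding dM(2) powr_half_sqrt[OF less_imp_le[OF dR], symmetric]
      using dR by (intro powr_realpow[symmetric]) simp
    then show ?thesis by (simp only: powr_powr) simp
  qed
  finally show ?thesis .
qed

text \<open>Passing from n to n + 1 raises every earlier exponent by (p + 1) / 2, exactly the
  Jacobian of the new fibre, while the new factor has exponent 0.\<close>

lemma canon_weight_append_moment:
  "canon_weight p (Suc n) (append_moment p n u z)
    = canon_weight p n u * (\<Prod>k\<in>{1..n}. det (smat p u k) * det (1\<^sub>m p - smat p u k)) powr (real (p + 1) / 2)
      * indicator {z. in01 p (tmat p z)} z"
proof -
  let ?w = "\<lambda>n k. if in01 p (smat p u k) then det (smat p u k * (1\<^sub>m p - smat p u k)) powr (real ((p + 1) * (n - k)) / 2) else 0"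
  \<comment> \<open>The value of \<open>powr\<close> at exponent 0 is 1 only for a nonzero base; the
    determinant is positive on the open interval.\<close>
  have last: "(if in01 p (tmat p z) then det (tmat p z * (1\<^sub>m p - tmat p z)) powr 0 else 0)
      = indicator {z. in01 p (tmat p z)} z"
    using in01_props[OF sym_tmat, of p z] by (auto simp: indicator_def)
  have "canon_weight p (Suc n) (append_moment p n u z) = (\<Prod>k\<in>{1..n}. ?w (Suc n) k) * indicator {z. in01 p (tmat p z)} z"
    unfolding canon_weight_def last[symmetric]
    by (subst prod.nat_ivl_Suc', simp, subst mult.commute, rule arg_cong2[where f = "(*)"])
      (auto intro!: prod.cong simp: smat_append_moment)
  also have "(\<Prod>k\<in>{1..n}. ?w (Suc n) k)
      = canon_weight p n u * (\<Prod>k\<in>{1..n}. det (smat p u k) * det (1\<^sub>m p - smat p u k)) powr (real (p + 1) / 2)"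
  proof (cases "\<forall>k\<in>{1..n}. in01 p (smat p u k)")
    case True
    have pos: "det (smat p u k) * det (1\<^sub>m p - smat p u k) > 0" if "k \<in> {1..n}" for k
      using in01_props(1,2)[OF sym_smat, of p u k] True that by auto
    have "(\<Prod>k\<in>{1..n}. ?w (Suc n) k)
        = (\<Prod>k\<in>{1..n}. ?w n k * (det (smat p u k) * det (1\<^sub>m p - smat p u k)) powr (real (p + 1) / 2))"
    proof (rule prod.cong[OF refl])
      fix k assume k: "k \<in> {1..n}"
      have e: "real ((p + 1) * (Suc n - k)) / 2 = real ((p + 1) * (n - k)) / 2 + real (p + 1) / 2"
        using k by (simp add: Suc_diff_le add_divide_distrib algebra_simps)
      show "?w (Suc n) k = ?w n k * (det (smat p u k) * det (1\<^sub>m p - smat p u k)) powr (real (p + 1) / 2)"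
        using True k in01_props(3)[OF sym_smat, of p u k] unfolding e powr_add by auto
    qed
    also have "\<dots> = canon_weight p n u * (\<Prod>k\<in>{1..n}. (det (smat p u k) * det (1\<^sub>m p - smat p u k)) powr (real (p + 1) / 2))"
      unfolding canon_weight_def prod.distrib ..
    also have "(\<Prod>k\<in>{1..n}. (det (smat p u k) * det (1\<^sub>m p - smat p u k)) powr (real (p + 1) / 2))
        = (\<Prod>k\<in>{1..n}. det (smat p u k) * det (1\<^sub>m p - smat p u k)) powr (real (p + 1) / 2)"
      by (rule prod_powr_distrib[symmetric])
    finally show ?thesis .
  next
    case False
    then obtain k where k: "k \<in> {1..n}" "\<not> in01 p (smat p u k)" by auto
    have "(\<Prod>k\<in>{1..n}. ?w (Suc n) k) = 0" "canon_weight p n u = 0"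
      unfolding canon_weight_def using k by (auto intro!: prod_zero)
    then show ?thesis by simp
  qed
  finally show ?thesis .
qed

text \<open>Stated for all nonnegative test functions so that the induction can be applied to
  \<open>h\<close>, the result of integrating out the last moment. That integral depends on the
  first n moments only through their canonical moments, because the Jacobian does.\<close>

theorem canonical_change_of_variables:
  fixes g :: "(nat \<times> nat \<times> nat \<Rightarrow> real) \<Rightarrow> ennreal"
  assumes "g \<in> borel_measurable (SpN p n)"
  shows "(\<integral>\<^sup>+x. indicator (Mint p n) x * g (Ucoords p n x) \<partial>SpN p n)
    = (\<integral>\<^sup>+u. ennreal (canon_weight p n u) * g u \<partial>SpN p n)"
  using assms
proof (induction n arbitrary: g)
  case 0
  show ?case
  proof (rule nn_integral_cong)
    fix x assume x: "x \<in> space (SpN p 0)"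
    then have "x \<in> Mint p 0" by (simp add: Mint_def)
    moreover have "Ucoords p 0 x = x" using x by (auto simp: Ucoords_def Mint_def SpN_def space_PiM Kidx_def)
    ultimately show "indicator (Mint p 0) x * g (Ucoords p 0 x) = ennreal (canon_weight p 0 x) * g x"
      by (simp add: canon_weight_def)
  qed
next
  case (Suc n)
  note g = Suc.prems
  \<comment> \<open>The Jacobian of the last fibre, det R to the power (p + 1) / 2 for the range of
    order n + 1, written in the canonical coordinates of the first n moments.\<close>
  define D where "D = (\<lambda>u. (\<Prod>k\<in>{1..n}. det (smat p u k) * det (1\<^sub>m p - smat p u k)) powr (real (p + 1) / 2))"
  define h where "h = (\<lambda>u. ennreal (D u) * (\<integral>\<^sup>+z. indicator {z. in01 p (tmat p z)} z * g (append_moment p n u z) \<partial>Sp p))"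
  have D: "D \<in> borel_measurable (SpN p n)"
  proof -
    have "(\<lambda>u. det (smat p u k)) \<in> borel_measurable (SpN p n)" for k
      by (rule borel_measurable_det[OF measurable_mat_smat])
    moreover have "(\<lambda>u. det (1\<^sub>m p - smat p u k)) \<in> borel_measurable (SpN p n)" for k
      by (rule borel_measurable_det[OF measurable_mat_minus[OF measurable_mat_const measurable_mat_smat]]) simp
    ultimately show ?thesis unfolding D_def by measurable
  qed
  have ind_meas: "(\<lambda>u. indicator {u. in01 p (smat p u (Suc n))} u :: ennreal) \<in> borel_measurable (SpN p (Suc n))"
    by (rule borel_measurable_indicator') (use sets_in01_smat[of p "Suc n" "Suc n"] in \<open>simp add: vimage_def Int_def conj_commute\<close>)
  have h: "h \<in> borel_measurable (SpN p n)"
  proof -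
    have "(\<lambda>u. indicator {u. in01 p (smat p u (Suc n))} u * g u) \<in> borel_measurable (SpN p (Suc n))"
      using ind_meas g by (rule borel_measurable_times_ennreal)
    from borel_measurable_Sp_integral[OF this]
    have "(\<lambda>u. \<integral>\<^sup>+z. indicator {z. in01 p (tmat p z)} z * g (append_moment p n u z) \<partial>Sp p) \<in> borel_measurable (SpN p n)"
      by (simp add: indicator_def smat_append_moment)
    then show ?thesis unfolding h_def using D by measurable
  qed
  have "(\<integral>\<^sup>+x. indicator (Mint p (Suc n)) x * g (Ucoords p (Suc n) x) \<partial>SpN p (Suc n))
      = (\<integral>\<^sup>+x. (\<integral>\<^sup>+y. indicator (Mint p (Suc n)) (append_moment p n x y) * g (Ucoords p (Suc n) (append_moment p n x y)) \<partial>Sp p) \<partial>SpN p n)"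
    by (rule nn_integral_SpN_Suc) (use g in measurable)
  also have "\<dots> = (\<integral>\<^sup>+x. indicator (Mint p n) x * h (Ucoords p n x) \<partial>SpN p n)"
  proof (rule nn_integral_cong)
    fix x assume x: "x \<in> space (SpN p n)"
    show "(\<integral>\<^sup>+y. indicator (Mint p (Suc n)) (append_moment p n x y) * g (Ucoords p (Suc n) (append_moment p n x y)) \<partial>Sp p)
        = indicator (Mint p n) x * h (Ucoords p n x)"
    proof (cases "x \<in> Mint p n")
      case False
      then have "append_moment p n x y \<notin> Mint p (Suc n)" for y using append_moment_Mint_iff[OF x] by auto
      then show ?thesis using False by simp
    next
      case True
      then have int: "moment_seq.interior p (Sseq p x) n" by (simp add: Mint_iff)
      have k: "1 \<le> Suc n" "Suc n \<le> n + 1" by auto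
      define R where "R = moment_range p (Sseq p x) (Suc n)"
      define C where "C = sminus p (Sseq p x) (Suc n)"
      have R: "sym_mat p R" "pd p R" and C: "sym_mat p C"
        unfolding R_def C_def using moment_seq.gap_sym(3,4)[OF moment_seq_Sseq int k] moment_seq.pd_moment_range[OF moment_seq_Sseq int k] by auto
      have ag: "\<And>y j. j < Suc n \<Longrightarrow> Sseq p (append_moment p n x y) j = Sseq p x j" by (simp add: Sseq_append_moment)
      have Re: "moment_range p (Sseq p (append_moment p n x y)) (Suc n) = R"
        and Ce: "sminus p (Sseq p (append_moment p n x y)) (Suc n) = C" for y
        unfolding R_def C_def using moment_range_cong[OF ag] sminus_cong[OF ag] by auto
      have lo: "low_gap p (Sseq p (append_moment p n x y)) (Suc n) = tmat p y - C" for y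
        unfolding low_gap_def Ce Sseq_append_moment ..
      have sy: "sym_mat p (tmat p y - C)" for y by (intro sym_mat_minus sym_tmat C)
      have up: "up_gap p (Sseq p (append_moment p n x y)) (Suc n) = R - (tmat p y - C)" for y
      proof -
        have "moment_seq.interior p (Sseq p (append_moment p n x y)) n"
          using int gaps_cong(1,2)[of _ "Sseq p (append_moment p n x y)" "Sseq p x" p] ag
          unfolding moment_seq.interior_def[OF moment_seq_Sseq] by auto
        note g5 = moment_seq.gap_sym[OF moment_seq_Sseq this k, unfolded Re lo]
        show ?thesis using mat_plus_minus_cancel[OF sym_matD(1)[OF sy] sym_matD(1)[OF g5(2)]] g5(5) by simp
      qed
      have can: "canon p (Sseq p (append_moment p n x y)) (Suc n) = normalize_by p R (tmat p y - C)" for y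
        unfolding canon_eq Re lo ..
      have mem: "append_moment p n x y \<in> Mint p (Suc n) \<longleftrightarrow> in01 p (normalize_by p R (tmat p y - C))" for y
        unfolding append_moment_Mint_iff[OF x] lo up in01_normalize_by[OF R sy] using True by simp
      define u where "u = Ucoords p n x"
      have u: "u \<in> space (SpN p n)" unfolding u_def using measurable_space[OF measurable_Ucoords x] .
      have gu: "(\<lambda>z. g (append_moment p n u z)) \<in> borel_measurable (Sp p)"
        by (rule measurable_compose[OF measurable_append_moment_right[OF u] g])
      have "(\<integral>\<^sup>+y. indicator (Mint p (Suc n)) (append_moment p n x y) * g (Ucoords p (Suc n) (append_moment p n x y)) \<partial>Sp p)
          = (\<integral>\<^sup>+y. indicator {y. in01 p (normalize_by p R (tmat p y - C))} y * g (append_moment p n u (tcoords p (normalize_by p R (tmat p y - C)))) \<partial>Sp p)"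
        using Ucoords_append_moment[OF _ True] by (intro nn_integral_cong) (auto simp: indicator_def mem can u_def)
      also have "\<dots> = ennreal (det R powr (real (p + 1) / 2)) * (\<integral>\<^sup>+z. indicator {z. in01 p (tmat p z)} z * g (append_moment p n u z) \<partial>Sp p)"
        by (rule nn_integral_normalize[OF R C gu])
      also have "det R powr (real (p + 1) / 2) = D u"
        unfolding D_def R_def moment_seq.det_moment_range[OF moment_seq_Sseq int] u_def
        using smat_Ucoords[OF True] by simp
      finally show ?thesis using True by (simp add: h_def u_def)
    qed
  qed
  also have "\<dots> = (\<integral>\<^sup>+u. ennreal (canon_weight p n u) * h u \<partial>SpN p n)" by (rule Suc.IH[OF h])
  also have "\<dots> = (\<integral>\<^sup>+u. (\<integral>\<^sup>+z. ennreal (canon_weight p (Suc n) (append_moment p n u z)) * g (append_moment p n u z) \<partial>Sp p) \<partial>SpN p n)"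
  proof (rule nn_integral_cong)
    fix u assume u: "u \<in> space (SpN p n)"
    have gu: "(\<lambda>z. g (append_moment p n u z)) \<in> borel_measurable (Sp p)"
      by (rule measurable_compose[OF measurable_append_moment_right[OF u] g])
    have im: "(\<lambda>z. indicator {z. in01 p (tmat p z)} z :: ennreal) \<in> borel_measurable (Sp p)"
      by (rule borel_measurable_indicator') (use sets_in01_tmat in \<open>simp add: vimage_def Int_def conj_commute\<close>)
    have D0: "D u \<ge> 0" by (simp add: D_def)
    have cw: "canon_weight p (Suc n) (append_moment p n u z) = canon_weight p n u * D u * indicator {z. in01 p (tmat p z)} z" for z
      by (simp only: canon_weight_append_moment D_def)
    have "(\<integral>\<^sup>+z. ennreal (canon_weight p (Suc n) (append_moment p n u z)) * g (append_moment p n u z) \<partial>Sp p)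
        = (\<integral>\<^sup>+z. ennreal (canon_weight p n u * D u) * (indicator {z. in01 p (tmat p z)} z * g (append_moment p n u z)) \<partial>Sp p)"
      unfolding cw by (intro nn_integral_cong) (auto simp: indicator_def)
    also have "\<dots> = ennreal (canon_weight p n u * D u) * (\<integral>\<^sup>+z. indicator {z. in01 p (tmat p z)} z * g (append_moment p n u z) \<partial>Sp p)"
      by (rule nn_integral_cmult) (rule borel_measurable_times_ennreal[OF im gu])
    finally show "ennreal (canon_weight p n u) * h u
        = (\<integral>\<^sup>+z. ennreal (canon_weight p (Suc n) (append_moment p n u z)) * g (append_moment p n u z) \<partial>Sp p)"
      unfolding h_def using canon_weight_nonneg D0 by (simp add: ennreal_mult mult.assoc)
  qed
  also have "\<dots> = (\<integral>\<^sup>+u. ennreal (canon_weight p (Suc n) u) * g u \<partial>SpN p (Suc n))"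
    by (rule nn_integral_SpN_Suc[symmetric]) (use g in measurable)
  finally show ?case .
qed

subsection \<open>Moments of matrix measures\<close>

lemma borel01_sets: "borel01 = sets (restrict_space borel {0..1})"
proof -
  have "sets (restrict_space borel {0..1 :: real}) = {A. A \<subseteq> {0..1} \<and> A \<in> sets borel}"
    by (auto simp: sets_restrict_space_iff) (auto simp: sets_restrict_space)
  then show ?thesis by (auto simp: borel01_def)
qed

lemma sigma_algebra_borel01: "sigma_algebra {0..1} borel01"
  using sets.sigma_algebra_axioms[of "restrict_space borel {0..1 :: real}"]
  by (simp add: borel01_sets space_restrict_space)

text \<open>For positive N these are half-open cells of width 1 / N, and the cell with s = N is the
  right endpoint alone; hence sums over cells run up to N inclusive.\<close>

definition grid :: "nat \<Rightarrow> nat \<Rightarrow> real set" where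
  "grid N s = {x \<in> {0..1}. nat \<lfloor>x * real N\<rfloor> = s}"

definition grid_floor :: "nat \<Rightarrow> real \<Rightarrow> real" where
  "grid_floor N x = real (nat \<lfloor>x * real N\<rfloor>) / real N"

lemma grid_borel01: "grid N s \<in> borel01"
proof -
  have "grid N s = {x \<in> space borel. 0 \<le> x \<and> x \<le> 1 \<and> nat \<lfloor>x * real N\<rfloor> = s}" by (auto simp: grid_def)
  also have "\<dots> \<in> sets borel" by measurable
  finally show ?thesis by (auto simp: borel01_def grid_def)
qed

lemma grid_Int[simp]: "grid N s \<inter> {0..1} = grid N s"
  by (auto simp: grid_def)

lemma grid_floor_step:
  assumes "x \<in> {0..1}"
  shows "(\<Sum>s\<le>N. f (real s / real N) * indicator (grid N s) x) = (f (grid_floor N x) :: real)"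
proof -
  have "x * real N \<le> real N" using assms by (simp add: mult_left_le_one_le)
  then have "nat \<lfloor>x * real N\<rfloor> \<le> N" by (simp add: nat_le_iff floor_le_iff)
  moreover have "(\<Sum>s\<le>N. f (real s / real N) * indicator (grid N s) x)
      = (\<Sum>s\<le>N. if nat \<lfloor>x * real N\<rfloor> = s then f (grid_floor N x) else 0)"
    using assms by (intro sum.cong) (auto simp: grid_def grid_floor_def)
  ultimately show ?thesis by simp
qed

lemma grid_floor_bounds:
  assumes "x \<in> {0..1}" "N > 0"
  shows "0 \<le> grid_floor N x" "grid_floor N x \<le> x" "x - grid_floor N x \<le> 1 / real N"
proof -
  show "0 \<le> grid_floor N x" by (simp add: grid_floor_def)
  have e: "real (nat \<lfloor>x * real N\<rfloor>) = of_int \<lfloor>x * real N\<rfloor>" using assms by simp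
  have "of_int \<lfloor>x * real N\<rfloor> \<le> x * real N" by simp
  then show "grid_floor N x \<le> x" unfolding grid_floor_def e using assms by (simp add: divide_le_eq)
  have "x * real N - of_int \<lfloor>x * real N\<rfloor> \<le> 1" by linarith
  then have "(x * real N - of_int \<lfloor>x * real N\<rfloor>) / real N \<le> 1 / real N" by (rule divide_right_mono) simp
  then show "x - grid_floor N x \<le> 1 / real N" unfolding grid_floor_def e using assms by (simp add: diff_divide_distrib)
qed

lemma grid_floor_tendsto:
  assumes "x \<in> {0..1}" shows "(\<lambda>m. grid_floor (Suc m) x) \<longlonglongrightarrow> x"
proof -
  have "(\<lambda>m. x - grid_floor (Suc m) x) \<longlonglongrightarrow> 0"
  proof (rule tendsto_sandwich[OF _ _ tendsto_const LIMSEQ_inverse_real_of_nat])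
    show "\<forall>\<^sub>F m in sequentially. 0 \<le> x - grid_floor (Suc m) x"
      using grid_floor_bounds(2)[OF assms] by simp
    show "\<forall>\<^sub>F m in sequentially. x - grid_floor (Suc m) x \<le> inverse (real (Suc m))"
      using grid_floor_bounds(3)[OF assms] by (intro always_eventually allI) (simp add: inverse_eq_divide del: of_nat_Suc)
  qed
  then have "(\<lambda>m. x - (x - grid_floor (Suc m) x)) \<longlonglongrightarrow> x - 0" by (intro tendsto_intros)
  then show ?thesis by simp
qed

lemma sum_swap_inner:
  "(\<Sum>i\<in>A. \<Sum>j\<in>B. \<Sum>r\<in>C. f i j r) = (\<Sum>r\<in>C. \<Sum>i\<in>A. \<Sum>j\<in>B. f i j r)"
proof -
  have "(\<Sum>i\<in>A. \<Sum>j\<in>B. \<Sum>r\<in>C. f i j r) = (\<Sum>i\<in>A. \<Sum>r\<in>C. \<Sum>j\<in>B. f i j r)"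
    by (intro sum.cong refl sum.swap)
  also have "\<dots> = (\<Sum>r\<in>C. \<Sum>i\<in>A. \<Sum>j\<in>B. f i j r)" by (rule sum.swap)
  finally show ?thesis .
qed

locale matrix_valued_measure =
  fixes p :: nat and \<mu> :: "real set \<Rightarrow> real mat"
  assumes mm: "Defs.matrix_measure p \<mu>"
begin

lemma mu_sym: "B \<in> borel01 \<Longrightarrow> sym_mat p (\<mu> B)" and mu_psd: "B \<in> borel01 \<Longrightarrow> psd p (\<mu> B)"
  and mu_one: "\<mu> {0..1} = 1\<^sub>m p"
  using mm by (auto simp: Defs.matrix_measure_def sym_mat_def)

lemma mu_sums:
  "range A \<subseteq> borel01 \<Longrightarrow> disjoint_family A \<Longrightarrow> i < p \<Longrightarrow> j < p \<Longrightarrow>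
    (\<lambda>m. \<mu> (A m) $$ (i, j)) sums (\<mu> (\<Union>m. A m) $$ (i, j))" for A :: "nat \<Rightarrow> real set"
  using mm by (auto simp: Defs.matrix_measure_def)

lemma qform_sums:
  assumes "range A \<subseteq> borel01" "disjoint_family A" "v \<in> carrier_vec p"
  shows "(\<lambda>m. qform (\<mu> (A m)) v) sums qform (\<mu> (\<Union>m. A m)) v"
proof -
  interpret sigma_algebra "{0..1}" borel01 by (rule sigma_algebra_borel01)
  have "(\<Union>m. A m) \<in> borel01" using assms(1) by auto
  moreover have "A m \<in> borel01" for m using assms(1) by auto
  moreover have "(\<lambda>m. \<Sum>i<p. \<Sum>j<p. \<mu> (A m) $$ (i, j) * v $ i * v $ j)
      sums (\<Sum>i<p. \<Sum>j<p. \<mu> (\<Union>m. A m) $$ (i, j) * v $ i * v $ j)"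
    by (intro sums_sum sums_mult2 mu_sums assms) auto
  ultimately show ?thesis using mu_sym assms(3) by (simp add: qform_sum[of _ p] sym_mat_def)
qed

text \<open>Countable additivity along the constant sequence of empty sets makes a constant series
  summable.\<close>

lemma mu_empty: "v \<in> carrier_vec p \<Longrightarrow> qform (\<mu> {}) v = 0"
proof -
  interpret sigma_algebra "{0..1}" borel01 by (rule sigma_algebra_borel01)
  assume "v \<in> carrier_vec p"
  from qform_sums[of "\<lambda>_. {}", OF _ _ this] have "summable (\<lambda>m :: nat. qform (\<mu> {}) v)"
    by (auto simp: disjoint_family_on_def sums_iff)
  then show ?thesis by (simp only: summable_const_iff)
qed

lemma space_qmeas[simp]: "space (qmeas \<mu> v) = {0..1}"
  and sets_qmeas[simp]: "sets (qmeas \<mu> v) = borel01"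
proof -
  interpret sigma_algebra "{0..1}" borel01 by (rule sigma_algebra_borel01)
  show "space (qmeas \<mu> v) = {0..1}" unfolding qmeas_def by (rule space_measure_of) (rule space_closed)
  show "sets (qmeas \<mu> v) = borel01" unfolding qmeas_def using sets_measure_of_eq by simp
qed

lemma emeasure_qmeas:
  assumes v: "v \<in> carrier_vec p" and B: "B \<in> borel01"
  shows "emeasure (qmeas \<mu> v) B = ennreal (qform (\<mu> B) v)"
  unfolding qmeas_def
proof (rule emeasure_measure_of_sigma[OF sigma_algebra_borel01 _ _ B])
  show "positive borel01 (\<lambda>B. ennreal (qform (\<mu> B) v))" by (simp add: positive_def mu_empty[OF v])
  show "countably_additive borel01 (\<lambda>B. ennreal (qform (\<mu> B) v))"
    unfolding countably_additive_def
  proof (intro allI impI)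
    fix A :: "nat \<Rightarrow> real set" assume A: "range A \<subseteq> borel01" "disjoint_family A" "\<Union> (range A) \<in> borel01"
    have "\<And>m. 0 \<le> qform (\<mu> (A m)) v" using A(1) by (intro psdD[OF mu_psd v]) auto
    then show "(\<Sum>m. ennreal (qform (\<mu> (A m)) v)) = ennreal (qform (\<mu> (\<Union> (range A))) v)"
      using qform_sums[OF A(1,2) v] by (intro suminf_ennreal_eq) auto
  qed
qed

lemma measure_qmeas:
  assumes v: "v \<in> carrier_vec p" and B: "B \<in> borel01"
  shows "measure (qmeas \<mu> v) B = qform (\<mu> B) v"
  unfolding measure_def emeasure_qmeas[OF assms] using psdD[OF mu_psd[OF B] v] by simp

lemma finite_qmeas: "v \<in> carrier_vec p \<Longrightarrow> finite_measure (qmeas \<mu> v)"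
proof (rule finite_measureI)
  interpret sigma_algebra "{0..1}" borel01 by (rule sigma_algebra_borel01)
  assume v: "v \<in> carrier_vec p"
  show "emeasure (qmeas \<mu> v) (space (qmeas \<mu> v)) \<noteq> \<infinity>" using emeasure_qmeas[OF v top] by simp
qed

lemma borel_measurable_qmeas: "(f :: real \<Rightarrow> real) \<in> borel_measurable borel \<Longrightarrow> f \<in> borel_measurable (qmeas \<mu> v)"
proof -
  assume f: "f \<in> borel_measurable borel"
  have "sets (qmeas \<mu> v) = sets (restrict_space borel {0..1})" by (simp add: borel01_sets)
  then have "borel_measurable (qmeas \<mu> v) = (borel_measurable (restrict_space borel {0..1}) :: (real \<Rightarrow> real) set)"
    by (rule measurable_cong_sets) (rule refl)
  then show ?thesis using measurable_restrict_space1[OF f, of "{0..1}"] by (simp only:)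
qed

text \<open>Left Riemann sums, by dominated convergence with bound 1 on a finite measure. The sums
  are linear in the values of \<mu> on grid cells, which allows polarisation to be undone cell by
  cell.\<close>

lemma qmeas_integral_tendsto:
  assumes v: "v \<in> carrier_vec p"
  shows "(\<lambda>m. \<Sum>s\<le>Suc m. (real s / real (Suc m)) ^ k * qform (\<mu> (grid (Suc m) s)) v) \<longlonglongrightarrow> (\<integral>x. x ^ k \<partial>qmeas \<mu> v)"
proof -
  interpret finite_measure "qmeas \<mu> v" by (rule finite_qmeas[OF v])
  have g: "(\<lambda>x. grid_floor N x ^ k) \<in> borel_measurable borel" for N unfolding grid_floor_def by measurable
  have "(\<lambda>m. \<integral>x. grid_floor (Suc m) x ^ k \<partial>qmeas \<mu> v) \<longlonglongrightarrow> (\<integral>x. x ^ k \<partial>qmeas \<mu> v)"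
  proof (rule integral_dominated_convergence[where w = "\<lambda>_. 1"])
    show "AE x in qmeas \<mu> v. (\<lambda>m. grid_floor (Suc m) x ^ k) \<longlonglongrightarrow> x ^ k"
      by (intro AE_I2 tendsto_power grid_floor_tendsto) simp
    show "AE x in qmeas \<mu> v. norm (grid_floor (Suc m) x ^ k) \<le> 1" for m
    proof (intro AE_I2)
      fix x assume "x \<in> space (qmeas \<mu> v)"
      then have "0 \<le> grid_floor (Suc m) x" "grid_floor (Suc m) x \<le> 1"
        using grid_floor_bounds(1,2)[of x "Suc m"] by auto
      then show "norm (grid_floor (Suc m) x ^ k) \<le> 1" by (simp add: power_le_one)
    qed
  qed (auto intro!: borel_measurable_qmeas g)
  moreover have "(\<integral>x. grid_floor N x ^ k \<partial>qmeas \<mu> v) = (\<Sum>s\<le>N. (real s / real N) ^ k * qform (\<mu> (grid N s)) v)" for N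
  proof -
    have "(\<integral>x. grid_floor N x ^ k \<partial>qmeas \<mu> v) = (\<integral>x. (\<Sum>s\<le>N. (real s / real N) ^ k * indicator (grid N s) x) \<partial>qmeas \<mu> v)"
      by (rule Bochner_Integration.integral_cong[OF refl])
        (simp only: space_qmeas grid_floor_step[where f = "\<lambda>y. y ^ k"])
    also have "\<dots> = (\<Sum>s\<le>N. (real s / real N) ^ k * measure (qmeas \<mu> v) (grid N s))"
      using grid_borel01 by (subst Bochner_Integration.integral_sum) (auto simp: emeasure_eq_measure)
    finally show ?thesis using measure_qmeas[OF v grid_borel01] by simp
  qed
  ultimately show ?thesis by simp
qed

lemma polarisation:
  assumes "B \<in> borel01" "i < p" "j < p"
  shows "qform (\<mu> B) (unit_vec p i + unit_vec p j) - qform (\<mu> B) (unit_vec p i - unit_vec p j) = 4 * \<mu> B $$ (i, j)"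
proof -
  note s = mu_sym[OF assms(1)] and c = sym_matD(1)[OF mu_sym[OF assms(1)]]
  let ?e = "unit_vec p i :: real vec" and ?f = "unit_vec p j :: real vec"
  have u: "(\<mu> B *\<^sub>v unit_vec p b) $ a = \<mu> B $$ (a, b)" if "a < p" "b < p" for a b
    using that c by (simp add: scalar_prod_right_unit)
  have ve: "\<mu> B *\<^sub>v ?e \<in> carrier_vec p" "\<mu> B *\<^sub>v ?f \<in> carrier_vec p" using c by auto
  have "\<mu> B *\<^sub>v (?e + ?f) = \<mu> B *\<^sub>v ?e + \<mu> B *\<^sub>v ?f" "\<mu> B *\<^sub>v (?e - ?f) = \<mu> B *\<^sub>v ?e - \<mu> B *\<^sub>v ?f"
    using c by (auto intro: mult_add_distrib_mat_vec mult_minus_distrib_mat_vec)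
  then show ?thesis
    using ve u assms(2,3) sym_mat_index[OF s assms(2,3)]
    by (simp add: add_scalar_prod_distrib[of _ p] scalar_prod_add_distrib[of _ p]
        minus_scalar_prod_distrib[of _ p] scalar_prod_minus_distrib[of _ p] scalar_prod_left_unit)
qed

text \<open>From here on the polarised integrals in the definition of the moments are replaced by
  finite sums of entries of \<mu>.\<close>

lemma mmoment_tendsto:
  assumes "i < p" "j < p"
  shows "(\<lambda>m. \<Sum>s\<le>Suc m. (real s / real (Suc m)) ^ k * \<mu> (grid (Suc m) s) $$ (i, j)) \<longlonglongrightarrow> mmoment p \<mu> k $$ (i, j)"
proof -
  have "(\<lambda>m. ((\<Sum>s\<le>Suc m. (real s / real (Suc m)) ^ k * qform (\<mu> (grid (Suc m) s)) (unit_vec p i + unit_vec p j))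
      - (\<Sum>s\<le>Suc m. (real s / real (Suc m)) ^ k * qform (\<mu> (grid (Suc m) s)) (unit_vec p i - unit_vec p j))) / 4)
    \<longlonglongrightarrow> ((\<integral>x. x ^ k \<partial>(qmeas \<mu> (unit_vec p i + unit_vec p j))) - (\<integral>x. x ^ k \<partial>(qmeas \<mu> (unit_vec p i - unit_vec p j)))) / 4"
    by (intro tendsto_intros qmeas_integral_tendsto) auto
  also have "((\<integral>x. x ^ k \<partial>(qmeas \<mu> (unit_vec p i + unit_vec p j))) - (\<integral>x. x ^ k \<partial>(qmeas \<mu> (unit_vec p i - unit_vec p j)))) / 4
      = mmoment p \<mu> k $$ (i, j)" using assms by (simp add: mmoment_def)
  moreover have "(\<Sum>s\<le>M. c s * (4 * a s)) / 4 = (\<Sum>s\<le>M. c s * a s)" for M :: nat and c a :: "nat \<Rightarrow> real"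
    by (simp add: sum_divide_distrib)
  ultimately show ?thesis
    unfolding sum_subtractf[symmetric] right_diff_distrib[symmetric] polarisation[OF grid_borel01 assms]
    by (simp only:)
qed

lemma mmoment_0: "mmoment p \<mu> 0 = 1\<^sub>m p"
proof (rule eq_matI)
  interpret sigma_algebra "{0..1}" borel01 by (rule sigma_algebra_borel01)
  fix i j assume "i < dim_row (1\<^sub>m p :: real mat)" "j < dim_col (1\<^sub>m p :: real mat)"
  then have ij: "i < p" "j < p" by auto
  have "(\<integral>x. x ^ 0 \<partial>qmeas \<mu> v) = qform (\<mu> {0..1}) v" if "v \<in> carrier_vec p" for v
    using measure_qmeas[OF that top] by simp
  then show "mmoment p \<mu> 0 $$ (i, j) = 1\<^sub>m p $$ (i, j)"
    using polarisation[OF top ij] ij mu_one by (simp add: mmoment_def)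
qed (auto simp: mmoment_def)

lemma mmoment_sym: "sym_mat p (mmoment p \<mu> k)"
proof (rule sym_matI)
  fix i j assume ij: "i < p" "j < p"
  have "\<mu> (grid N s) $$ (i, j) = \<mu> (grid N s) $$ (j, i)" for N s
    by (rule sym_mat_index[OF mu_sym[OF grid_borel01] ij])
  then show "mmoment p \<mu> k $$ (i, j) = mmoment p \<mu> k $$ (j, i)"
    using LIMSEQ_unique[OF mmoment_tendsto[OF ij, of k]] mmoment_tendsto[OF ij(2,1), of k] by simp
qed (simp add: mmoment_def)

sublocale moments: moment_seq p "mmoment p \<mu>"
  by unfold_locales (auto simp: mmoment_sym mmoment_0)

lemma moment_fun_tendsto:
  assumes "a < p" "b < p"
  shows "(\<lambda>m. \<Sum>s\<le>Suc m. poly q (real s / real (Suc m)) * \<mu> (grid (Suc m) s) $$ (a, b)) \<longlonglongrightarrow> moment_fun (mmoment p \<mu>) a b q"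
proof -
  have "(\<lambda>m. \<Sum>k\<le>degree q. coeff q k * (\<Sum>s\<le>Suc m. (real s / real (Suc m)) ^ k * \<mu> (grid (Suc m) s) $$ (a, b)))
      \<longlonglongrightarrow> moment_fun (mmoment p \<mu>) a b q"
    unfolding moment_fun_def by (intro tendsto_intros mmoment_tendsto assms)
  also have "(\<lambda>m. \<Sum>k\<le>degree q. coeff q k * (\<Sum>s\<le>Suc m. (real s / real (Suc m)) ^ k * \<mu> (grid (Suc m) s) $$ (a, b)))
      = (\<lambda>m. \<Sum>s\<le>Suc m. poly q (real s / real (Suc m)) * \<mu> (grid (Suc m) s) $$ (a, b))"
    unfolding poly_altdef sum_distrib_right sum_distrib_left
    by (subst sum.swap) (simp only: mult.assoc)
  finally show ?thesis .
qed

text \<open>Each Riemann sum is a sum over cells of w(t) times the form of the semidefinite matrix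
  \<mu> (cell) at the vector f(t), with t a point of [0,1].\<close>

lemma moment_form_nonneg:
  assumes w: "\<And>x. x \<in> {0..1} \<Longrightarrow> poly w x \<ge> 0"
  shows "moment_form p (mmoment p \<mu>) w f \<ge> 0"
proof (rule LIMSEQ_le_const)
  show "(\<lambda>m. \<Sum>a<p. \<Sum>b<p. \<Sum>s\<le>Suc m. poly (w * f a * f b) (real s / real (Suc m)) * \<mu> (grid (Suc m) s) $$ (a, b))
      \<longlonglongrightarrow> moment_form p (mmoment p \<mu>) w f"
    unfolding moment_form_def by (intro tendsto_sum moment_fun_tendsto) auto
  show "\<exists>N. \<forall>m\<ge>N. 0 \<le> (\<Sum>a<p. \<Sum>b<p. \<Sum>s\<le>Suc m. poly (w * f a * f b) (real s / real (Suc m)) * \<mu> (grid (Suc m) s) $$ (a, b))"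
  proof (intro exI allI impI)
    fix m :: nat
    let ?t = "\<lambda>s. real s / real (Suc m)"
    have "(\<Sum>a<p. \<Sum>b<p. \<Sum>s\<le>Suc m. poly (w * f a * f b) (?t s) * \<mu> (grid (Suc m) s) $$ (a, b))
        = (\<Sum>s\<le>Suc m. \<Sum>a<p. \<Sum>b<p. poly (w * f a * f b) (?t s) * \<mu> (grid (Suc m) s) $$ (a, b))"
      by (rule sum_swap_inner)
    also have "\<dots> = (\<Sum>s\<le>Suc m. poly w (?t s) * qform (\<mu> (grid (Suc m) s)) (vec p (\<lambda>a. poly (f a) (?t s))))"
      by (intro sum.cong refl, subst qform_sum[OF sym_matD(1)[OF mu_sym[OF grid_borel01]]])
        (auto simp: sum_distrib_left mult_ac intro!: sum.cong)
    also have "\<dots> \<ge> 0"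
      by (intro sum_nonneg mult_nonneg_nonneg w psdD[OF mu_psd[OF grid_borel01]]) (auto simp: divide_le_eq)
    finally show "0 \<le> (\<Sum>a<p. \<Sum>b<p. \<Sum>s\<le>Suc m. poly (w * f a * f b) (?t s) * \<mu> (grid (Suc m) s) $$ (a, b))" .
  qed
qed

text \<open>All weights are nonnegative on [0,1], so the Hankel matrices of a measure are
  semidefinite, and semidefiniteness passes to the Schur complement.\<close>

lemma gaps_psd:
  assumes "moments.interior n"
  shows "psd p (low_gap p (mmoment p \<mu>) (Suc n))" "psd p (up_gap p (mmoment p \<mu>) (Suc n))"
proof -
  have k: "1 \<le> Suc n" "Suc n \<le> n + 1" by auto
  interpret L: hankel_block p "Suc n div 2" "low_seq (mmoment p \<mu>) (Suc n)" by (rule moments.interior_hankel_block[OF assms k])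
  interpret U: hankel_block p "(Suc n - 1) div 2" "up_seq (mmoment p \<mu>) (Suc n)" by (rule moments.interior_hankel_block[OF assms k])
  have "poly (low_weight j) x \<ge> 0" "poly (up_weight j) x \<ge> 0" if "x \<in> {0..1}" for x j
    using that by (auto simp: low_weight_def up_weight_def pX_def)
  then have "psd (e * p) (hank p e (low_seq (mmoment p \<mu>) j))" "psd (e * p) (hank p e (up_seq (mmoment p \<mu>) j))" for e j
    unfolding psd_def by (auto simp: qform_hank[OF moments.weighted_low] qform_hank[OF moments.weighted_up] intro!: moment_form_nonneg)
  then show "psd p (low_gap p (mmoment p \<mu>) (Suc n))" "psd p (up_gap p (mmoment p \<mu>) (Suc n))"
    unfolding moments.low_gap_eq[OF k(1)] moments.up_gap_eq[OF k(1)]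
    by (blast intro: L.psd_hankel_schur, blast intro: U.psd_hankel_schur)
qed

end

lemma Mint_subset_Mn: "Mint p n \<subseteq> Mn p n"
proof
  fix x assume x: "x \<in> Mint p n"
  then have int: "moment_seq.interior p (Sseq p x) n" by (simp add: Mint_iff)
  obtain N l w where l: "\<forall>r<N. 0 < l r \<and> l r < (1 :: real)"
    and S: "\<forall>k\<le>n. \<forall>a<p. \<forall>b<p. Sseq p x k $$ (a, b) = (\<Sum>r<(N :: nat). l r ^ k * w r a * w r b)"
    using moment_seq.quadrature[OF moment_seq_Sseq int] by blast
  \<comment> \<open>Mass w_r w_r^T at the node l_r, with weights and nodes from the quadrature
    formula.\<close>
  define \<mu> where "\<mu> = (\<lambda>B. Matrix.mat p p (\<lambda>(a, b). \<Sum>r<N. indicator B (l r) * w r a * w r b))"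
  interpret matrix_valued_measure p \<mu>
  proof
    show "Defs.matrix_measure p \<mu>"
      unfolding Defs.matrix_measure_def
    proof (intro conjI ballI allI impI)
      fix B
      show c: "\<mu> B \<in> carrier_mat p p" by (simp add: \<mu>_def)
      show "(\<mu> B)\<^sup>T = \<mu> B" by (intro eq_matI) (auto simp: \<mu>_def mult_ac)
      show "psd p (\<mu> B)" unfolding psd_def
      proof
        fix v :: "real vec" assume v: "v \<in> carrier_vec p"
        have "qform (\<mu> B) v = (\<Sum>i<p. \<Sum>j<p. \<Sum>r<N. indicator B (l r) * w r i * w r j * v $ i * v $ j)"
          unfolding qform_sum[OF c v] by (intro sum.cong refl) (simp add: \<mu>_def sum_distrib_right)
        also have "\<dots> = (\<Sum>r<N. \<Sum>i<p. \<Sum>j<p. indicator B (l r) * w r i * w r j * v $ i * v $ j)"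
          by (rule sum_swap_inner)
        also have "\<dots> = (\<Sum>r<N. indicator B (l r) * (\<Sum>i<p. w r i * v $ i)\<^sup>2)"
          by (intro sum.cong refl) (simp add: power2_eq_square sum_product sum_distrib_left mult_ac)
        also have "\<dots> \<ge> 0" by (intro sum_nonneg mult_nonneg_nonneg) (auto simp: indicator_def)
        finally show "qform (\<mu> B) v \<ge> 0" .
      qed
    next
      fix A :: "nat \<Rightarrow> real set" and i j assume A: "disjoint_family A" and ij: "i < p" "j < p"
      have "(\<lambda>m. \<Sum>r<N. indicator (A m) (l r) * w r i * w r j) sums (\<Sum>r<N. indicator (\<Union>m. A m) (l r) * w r i * w r j)"
        by (intro sums_sum sums_mult2 indicator_sums) (use A in \<open>auto simp: disjoint_family_on_def\<close>)
      then show "(\<lambda>m. \<mu> (A m) $$ (i, j)) sums (\<mu> (\<Union>m. A m) $$ (i, j))" using ij by (simp add: \<mu>_def)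
    next
      show "\<mu> {0..1} = 1\<^sub>m p"
      proof (rule eq_matI)
        fix i j assume "i < dim_row (1\<^sub>m p :: real mat)" "j < dim_col (1\<^sub>m p :: real mat)"
        then have ij: "i < p" "j < p" by auto
        \<comment> \<open>The normalisation is the quadrature formula for k = 0, as all nodes lie in
          the interval.\<close>
        have "\<mu> {0..1} $$ (i, j) = (\<Sum>r<N. l r ^ 0 * w r i * w r j)"
          using ij l by (simp add: \<mu>_def less_imp_le)
        also have "\<dots> = Sseq p x 0 $$ (i, j)" using S ij by auto
        finally show "\<mu> {0..1} $$ (i, j) = 1\<^sub>m p $$ (i, j)" by (simp add: Sseq_def)
      qed (auto simp: \<mu>_def)
    qed
  qed
  have "smat p x k = mmoment p \<mu> k" if k: "k \<in> {1..n}" for k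
  proof (rule eq_matI)
    fix i j assume "i < dim_row (mmoment p \<mu> k)" "j < dim_col (mmoment p \<mu> k)"
    then have ij: "i < p" "j < p" by (auto simp: mmoment_def)
    have entry: "\<mu> B $$ (i, j) = (\<Sum>r<N. indicator B (l r) * (w r i * w r j))" for B
      using ij by (simp add: \<mu>_def mult.assoc)
    \<comment> \<open>The integrals defining the moments are reached through their grid sums, which
      for this measure merely round each node down to the grid.\<close>
    have "(\<lambda>m. \<Sum>r<N. grid_floor (Suc m) (l r) ^ k * w r i * w r j) \<longlonglongrightarrow> (\<Sum>r<N. l r ^ k * w r i * w r j)"
      using l by (intro tendsto_intros grid_floor_tendsto) (auto simp: less_imp_le)
    moreover have "(\<Sum>r<N. grid_floor (Suc m) (l r) ^ k * w r i * w r j)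
        = (\<Sum>s\<le>Suc m. (real s / real (Suc m)) ^ k * \<mu> (grid (Suc m) s) $$ (i, j))" for m
    proof -
      have "(\<Sum>s\<le>Suc m. (real s / real (Suc m)) ^ k * \<mu> (grid (Suc m) s) $$ (i, j))
          = (\<Sum>s\<le>Suc m. \<Sum>r<N. (real s / real (Suc m)) ^ k * indicator (grid (Suc m) s) (l r) * (w r i * w r j))"
        unfolding entry by (simp only: sum_distrib_left mult.assoc)
      also have "\<dots> = (\<Sum>r<N. (\<Sum>s\<le>Suc m. (real s / real (Suc m)) ^ k * indicator (grid (Suc m) s) (l r)) * (w r i * w r j))"
        unfolding sum_distrib_right by (rule sum.swap)
      also have "\<dots> = (\<Sum>r<N. grid_floor (Suc m) (l r) ^ k * w r i * w r j)"
        using l by (intro sum.cong refl, subst grid_floor_step[of _ "\<lambda>y. y ^ k"]) (auto simp: less_imp_le)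
      finally show ?thesis by simp
    qed
    ultimately have "mmoment p \<mu> k $$ (i, j) = (\<Sum>r<N. l r ^ k * w r i * w r j)"
      using LIMSEQ_unique[OF mmoment_tendsto[OF ij, of k]] by simp
    also have "\<dots> = Sseq p x k $$ (i, j)" using S ij k by auto
    finally show "smat p x k $$ (i, j) = mmoment p \<mu> k $$ (i, j)" using k by (simp add: Sseq_def)
  qed (auto simp: smat_def mmoment_def)
  moreover have "x \<in> space (SpN p n)" using x by (simp add: Mint_iff)
  ultimately show "x \<in> Mn p n" using mm unfolding Mn_def by blast
qed

subsection \<open>The boundary of the moment space is a null set\<close>

text \<open>As a function of t the determinant is the product of d_i + t over the eigenvalues
  d_i.\<close>

lemma finite_det_shift:
  assumes "sym_mat p A" shows "finite {t. det (A + t \<cdot>\<^sub>m 1\<^sub>m p) = 0}"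
proof -
  obtain V d where V: "V \<in> carrier_mat p p" "V\<^sup>T * V = 1\<^sub>m p" "V * V\<^sup>T = 1\<^sub>m p" and A: "A = V * mat_diag p d * V\<^sup>T"
    using spectral_theorem[OF assms] by auto
  have VT: "V\<^sup>T \<in> carrier_mat p p" using V by simp
  have "A + t \<cdot>\<^sub>m 1\<^sub>m p = V * mat_diag p (\<lambda>i. d i + t) * V\<^sup>T" for t
  proof -
    have "mat_diag p (\<lambda>i. d i + t) = mat_diag p d + t \<cdot>\<^sub>m 1\<^sub>m p" by (auto simp: mat_diag_def intro!: eq_matI)
    then have "V * mat_diag p (\<lambda>i. d i + t) * V\<^sup>T = V * mat_diag p d * V\<^sup>T + V * (t \<cdot>\<^sub>m 1\<^sub>m p) * V\<^sup>T"
      using V(1) VT by (simp add: mult_add_distrib_mat[of _ p p _ p] add_mult_distrib_mat[of _ p p _ _ p])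
    also have "V * (t \<cdot>\<^sub>m 1\<^sub>m p) * V\<^sup>T = t \<cdot>\<^sub>m 1\<^sub>m p"
      using V by (simp add: mult_smult_distrib[of _ p p _ p] mult_smult_assoc_mat[of _ p p _ p])
    finally show ?thesis unfolding A by simp
  qed
  then have "det (A + t \<cdot>\<^sub>m 1\<^sub>m p) = (\<Prod>i<p. d i + t)" for t using det_spectral[OF V(1,3)] by simp
  then have "{t. det (A + t \<cdot>\<^sub>m 1\<^sub>m p) = 0} \<subseteq> (\<lambda>i. - d i) ` {..<p}" by (auto simp: eq_neg_iff_add_eq_0 add.commute)
  then show ?thesis by (rule finite_subset) simp
qed

interpretation SpN_sigma_finite: sigma_finite_measure "SpN p n" for p n
  unfolding SpN_def by (rule lborel_product.sigma_finite) simp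

text \<open>Adds t I to the k-th moment and leaves the later ones alone; as a translation it
  preserves Lebesgue measure.\<close>

definition shift_moment :: "nat \<Rightarrow> nat \<Rightarrow> nat \<Rightarrow> real \<Rightarrow> (nat \<times> nat \<times> nat \<Rightarrow> real) \<Rightarrow> nat \<times> nat \<times> nat \<Rightarrow> real" where
  "shift_moment p n k t x = (\<lambda>q\<in>Kidx p n. x q + t * (case q of (l, i, j) \<Rightarrow> of_bool (l = k \<and> i = j)))"

lemma shift_moment_space[simp]: "shift_moment p n k t x \<in> space (SpN p n)"
  by (auto simp: shift_moment_def SpN_def space_PiM)

lemma nn_integral_shift_moment:
  "f \<in> borel_measurable (SpN p n) \<Longrightarrow> (\<integral>\<^sup>+x. f (shift_moment p n k t x) \<partial>SpN p n) = (\<integral>\<^sup>+x. f x \<partial>SpN p n)"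
  unfolding shift_moment_def SpN_def by (rule nn_integral_PiM_translate) auto

lemma Sseq_shift_moment:
  assumes "1 \<le> k" "k \<le> n"
  shows "Sseq p (shift_moment p n k t x) k = Sseq p x k + t \<cdot>\<^sub>m 1\<^sub>m p"
    "j < k \<Longrightarrow> Sseq p (shift_moment p n k t x) j = Sseq p x j"
  using assms by (auto simp: Sseq_def smat_def shift_moment_def intro!: eq_matI)

lemma measurable_shift_moment:
  "(\<lambda>(t, x). shift_moment p n k t x) \<in> measurable (lborel \<Otimes>\<^sub>M SpN p n) (SpN p n)"
proof -
  have "(\<lambda>z. \<lambda>q\<in>Kidx p n. snd z q + fst z * (case q of (l, i, j) \<Rightarrow> of_bool (l = k \<and> i = j)))
      \<in> measurable (lborel \<Otimes>\<^sub>M SpN p n) (PiM (Kidx p n) (\<lambda>_. lborel))"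
  proof (rule measurable_restrict)
    fix q :: "nat \<times> nat \<times> nat"
    have "(\<lambda>z. snd z q) \<in> borel_measurable (lborel \<Otimes>\<^sub>M SpN p n)"
      by (rule measurable_compose[OF measurable_snd borel_measurable_component_SpN])
    moreover have "(\<lambda>z. fst z) \<in> borel_measurable (lborel \<Otimes>\<^sub>M SpN p n)"
      using measurable_fst[of "lborel :: real measure" "SpN p n"] by simp
    ultimately have "(\<lambda>z. snd z q + fst z * (case q of (l, i, j) \<Rightarrow> of_bool (l = k \<and> i = j))) \<in> borel_measurable (lborel \<Otimes>\<^sub>M SpN p n)"
      by (intro borel_measurable_add borel_measurable_times borel_measurable_const)
    then show "(\<lambda>z. snd z q + fst z * (case q of (l, i, j) \<Rightarrow> of_bool (l = k \<and> i = j))) \<in> measurable (lborel \<Otimes>\<^sub>M SpN p n) lborel"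
      by simp
  qed
  then show ?thesis by (simp add: shift_moment_def[abs_def] SpN_def[of p n, symmetric] case_prod_beta')
qed

text \<open>Averaging over t: translation invariance makes the inner integral constant in t, whereas
  Tonelli gives zero because each line of shifts meets Z in finitely many points.\<close>

lemma null_sets_shift:
  assumes Z: "Z \<in> sets (SpN p n)"
    and fin: "\<And>x. x \<in> space (SpN p n) \<Longrightarrow> finite {t. shift_moment p n k t x \<in> Z}"
  shows "Z \<in> null_sets (SpN p n)"
proof -
  let ?f = "indicator Z :: _ \<Rightarrow> ennreal"
  have f: "?f \<in> borel_measurable (SpN p n)" using Z by simp
  interpret P: pair_sigma_finite lborel "SpN p n" ..
  have m: "(\<lambda>(t, x). ?f (shift_moment p n k t x)) \<in> borel_measurable (lborel \<Otimes>\<^sub>M SpN p n)"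
    using measurable_compose[OF measurable_shift_moment f] by (simp add: case_prod_beta')
  \<comment> \<open>The left side is the measure of Z times the infinite length of the real line, so
    it can vanish only for a null set.\<close>
  have "(\<integral>\<^sup>+t. emeasure (SpN p n) Z \<partial>(lborel :: real measure)) = (\<integral>\<^sup>+t. (\<integral>\<^sup>+x. ?f (shift_moment p n k t x) \<partial>SpN p n) \<partial>lborel)"
    unfolding nn_integral_shift_moment[OF f] using Z by simp
  also have "\<dots> = (\<integral>\<^sup>+x. (\<integral>\<^sup>+t. ?f (shift_moment p n k t x) \<partial>lborel) \<partial>SpN p n)"
    using P.Fubini'[OF m] by simp
  also have "\<dots> = (\<integral>\<^sup>+x. 0 \<partial>SpN p n)"
  proof (rule nn_integral_cong)
    fix x assume x: "x \<in> space (SpN p n)"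
    have "{t. shift_moment p n k t x \<in> Z} \<in> null_sets lborel" by (rule finite_imp_null_set_lborel[OF fin[OF x]])
    then have "AE t in lborel. shift_moment p n k t x \<notin> Z" by (rule AE_I') auto
    then show "(\<integral>\<^sup>+t. ?f (shift_moment p n k t x) \<partial>lborel) = 0"
      by (subst nn_integral_cong_AE[where v = "\<lambda>_. 0"]) auto
  qed
  finally have "emeasure (SpN p n) Z = 0" by simp
  then show ?thesis using Z by auto
qed

definition boundary_piece :: "nat \<Rightarrow> nat \<Rightarrow> nat \<Rightarrow> (nat \<times> nat \<times> nat \<Rightarrow> real) set" where
  "boundary_piece p n k = {x \<in> space (SpN p n). moment_seq.interior p (Sseq p x) k \<and>
     (det (low_gap p (Sseq p x) (Suc k)) = 0 \<or> det (up_gap p (Sseq p x) (Suc k)) = 0)}"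

lemma sets_boundary_piece: "boundary_piece p n k \<in> sets (SpN p n)"
proof -
  define A where "A = {x \<in> space (SpN p n). moment_seq.interior p (Sseq p x) k}"
  define R where "R = restrict_space (SpN p n) A"
  have A: "A \<in> sets (SpN p n)" unfolding A_def by (rule sets_interior[OF moment_seq_Sseq measurable_mat_Sseq])
  have spR: "space R = A" using sets.sets_into_space[OF A] by (auto simp: R_def space_restrict_space)
  have n: "\<And>x. x \<in> space R \<Longrightarrow> moment_seq.interior p (Sseq p x) k" by (auto simp: spR A_def)
  have k: "1 \<le> Suc k" "Suc k \<le> k + 1" by auto
  note g = measurable_gaps[OF moment_seq_Sseq measurable_mat_restrict[OF measurable_mat_Sseq, of p n A, folded R_def] n k]
  have "{x \<in> space R. det (low_gap p (Sseq p x) (Suc k)) = 0} \<in> sets R" "{x \<in> space R. det (up_gap p (Sseq p x) (Suc k)) = 0} \<in> sets R"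
    using borel_measurable_eq[OF borel_measurable_det[OF g(1)] borel_measurable_const]
      borel_measurable_eq[OF borel_measurable_det[OF g(2)] borel_measurable_const] by auto
  then have "{x \<in> space R. det (low_gap p (Sseq p x) (Suc k)) = 0} \<union> {x \<in> space R. det (up_gap p (Sseq p x) (Suc k)) = 0} \<in> sets R"
    by (rule sets.Un)
  also have "{x \<in> space R. det (low_gap p (Sseq p x) (Suc k)) = 0} \<union> {x \<in> space R. det (up_gap p (Sseq p x) (Suc k)) = 0}
      = boundary_piece p n k" by (auto simp: spR A_def boundary_piece_def)
  finally show ?thesis using A sets.sets_into_space[OF A] unfolding R_def
    by (subst (asm) sets_restrict_space_iff) (auto simp: Int_absorb2)
qed

text \<open>Shifting the moment of order k + 1 keeps its bounds fixed, so the lower gap moves by t I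
  and the upper gap by - t I; each becomes singular for finitely many t.\<close>

lemma boundary_piece_null:
  assumes k: "k < n" shows "boundary_piece p n k \<in> null_sets (SpN p n)"
proof (rule null_sets_shift[where k = "Suc k"])
  show "boundary_piece p n k \<in> sets (SpN p n)" by (rule sets_boundary_piece)
  fix x assume x: "x \<in> space (SpN p n)"
  have k': "1 \<le> Suc k" "Suc k \<le> n" "Suc k \<le> k + 1" using k by auto
  let ?x = "\<lambda>t. shift_moment p n (Suc k) t x"
  have ag: "\<And>t j. j < Suc k \<Longrightarrow> Sseq p (?x t) j = Sseq p x j" using Sseq_shift_moment(2)[OF k'(1,2)] by blast
  have int: "moment_seq.interior p (Sseq p (?x t)) k \<longleftrightarrow> moment_seq.interior p (Sseq p x) k" for t
    unfolding moment_seq.interior_def[OF moment_seq_Sseq]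
    using gaps_cong(1,2)[of _ "Sseq p (?x t)" "Sseq p x" p] ag by auto
  show "finite {t. ?x t \<in> boundary_piece p n k}"
  proof (cases "moment_seq.interior p (Sseq p x) k")
    case False
    then show ?thesis using int by (simp add: boundary_piece_def)
  next
    case True
    note g = moment_seq.gap_sym[OF moment_seq_Sseq True k'(1,3)]
    have "low_gap p (Sseq p (?x t)) (Suc k) = low_gap p (Sseq p x) (Suc k) + t \<cdot>\<^sub>m 1\<^sub>m p" for t
    proof -
      have "sminus p (Sseq p (?x t)) (Suc k) = sminus p (Sseq p x) (Suc k)" by (rule sminus_cong) (rule ag)
      then show ?thesis unfolding low_gap_def Sseq_shift_moment(1)[OF k'(1,2)]
        using sym_matD(1)[OF g(3)] moment_seq.S_carrier[OF moment_seq_Sseq, of p x "Suc k"] by (intro eq_matI) auto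
    qed
    moreover have "up_gap p (Sseq p (?x t)) (Suc k) = up_gap p (Sseq p x) (Suc k) + (- t) \<cdot>\<^sub>m 1\<^sub>m p" for t
    proof -
      have e: "splus p (Sseq p (?x t)) (Suc k) = splus p (Sseq p x) (Suc k)" by (rule splus_cong) (rule ag)
      have up: "dim_row (splus p (Sseq p x) (Suc k)) = p" "dim_col (splus p (Sseq p x) (Suc k)) = p"
        unfolding splus_def using moment_seq.S_carrier[OF moment_seq_Sseq, of p x "Suc 0"] by (auto simp: uph_def bcol_def)
      show ?thesis unfolding up_gap_def e Sseq_shift_moment(1)[OF k'(1,2)]
        using up moment_seq.S_carrier[OF moment_seq_Sseq, of p x "Suc k"] by (intro eq_matI) auto
    qed
    moreover have "{t. det (up_gap p (Sseq p x) (Suc k) + (- t) \<cdot>\<^sub>m 1\<^sub>m p) = 0}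
        = uminus ` {t. det (up_gap p (Sseq p x) (Suc k) + t \<cdot>\<^sub>m 1\<^sub>m p) = 0}"
      by (force simp: image_iff)
    ultimately have "{t. ?x t \<in> boundary_piece p n k} \<subseteq> {t. det (low_gap p (Sseq p x) (Suc k) + t \<cdot>\<^sub>m 1\<^sub>m p) = 0}
        \<union> uminus ` {t. det (up_gap p (Sseq p x) (Suc k) + t \<cdot>\<^sub>m 1\<^sub>m p) = 0}"
      by (auto simp: boundary_piece_def)
    then show ?thesis using finite_det_shift[OF g(1)] finite_det_shift[OF g(2)] by (meson finite_Un finite_imageI finite_subset)
  qed
qed

text \<open>At the first order where interiority fails both gaps exist and are semidefinite, so one
  of them must be singular.\<close>

lemma Mn_boundary: "Mn p n - Mint p n \<subseteq> (\<Union>k<n. boundary_piece p n k)"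
proof
  fix x assume x: "x \<in> Mn p n - Mint p n"
  then obtain \<mu> where \<mu>: "Defs.matrix_measure p \<mu>" "\<forall>k\<in>{1..n}. smat p x k = mmoment p \<mu> k" and sp: "x \<in> space (SpN p n)"
    by (auto simp: Mn_def)
  interpret matrix_valued_measure p \<mu> using \<mu>(1) by unfold_locales
  let ?S = "Sseq p x"
  have eq: "?S k = mmoment p \<mu> k" if "k \<le> n" for k
    using \<mu>(2) mmoment_0 that by (cases "k = 0") (auto simp: Sseq_def)
  have 0: "moment_seq.interior p ?S 0" by (simp add: moment_seq.interior_def[OF moment_seq_Sseq])
  have not: "\<not> moment_seq.interior p ?S n" using x sp by (simp add: Mint_iff)
  obtain k where k: "k < n" "moment_seq.interior p ?S k" "\<not> moment_seq.interior p ?S (Suc k)"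
  proof -
    have "\<exists>k<n. moment_seq.interior p ?S k \<and> \<not> moment_seq.interior p ?S (Suc k)"
    proof (rule ccontr)
      assume a: "\<not> ?thesis"
      have "k \<le> n \<Longrightarrow> moment_seq.interior p ?S k" for k
        by (induction k) (use 0 a in auto)
      then show False using not by simp
    qed
    then show ?thesis using that by blast
  qed
  have k': "1 \<le> Suc k" "Suc k \<le> k + 1" by auto
  have ge: "low_gap p ?S j = low_gap p (mmoment p \<mu>) j" "up_gap p ?S j = up_gap p (mmoment p \<mu>) j" if "j \<le> n" for j
    using gaps_cong(1,2)[of j ?S "mmoment p \<mu>" p] eq that by auto
  have "moments.interior k"
    unfolding moments.interior_def using k(1,2) ge unfolding moment_seq.interior_def[OF moment_seq_Sseq] by auto
  from gaps_psd[OF this] have psd: "psd p (low_gap p ?S (Suc k))" "psd p (up_gap p ?S (Suc k))" using ge[of "Suc k"] k(1) by auto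
  note g = moment_seq.gap_sym[OF moment_seq_Sseq k(2) k']
  have "det (low_gap p ?S (Suc k)) = 0 \<or> det (up_gap p ?S (Suc k)) = 0"
    using psd_det_nonzero_pd[OF g(1) psd(1)] psd_det_nonzero_pd[OF g(2) psd(2)] k(2,3)
      moment_seq.interior_Suc[OF moment_seq_Sseq] by blast
  then show "x \<in> (\<Union>k<n. boundary_piece p n k)" using k sp by (auto simp: boundary_piece_def)
qed

text \<open>The two sets differ inside a measurable null set, which is all that integration of the
  uniform density sees.\<close>

lemma AE_Mn_Mint: "AE x in SpN p n. x \<in> Mn p n \<longleftrightarrow> x \<in> Mint p n"
proof -
  have "(\<Union>k<n. boundary_piece p n k) \<in> null_sets (SpN p n)"
    by (intro null_sets_UN' boundary_piece_null) auto
  then show ?thesis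
    by (rule AE_I') (use Mn_boundary Mint_subset_Mn in blast)
qed

subsection \<open>The matrix-variate Beta integral\<close>

lemma nn_integral_Beta_01:
  assumes "a > 0" "b > 0"
  shows "(\<integral>\<^sup>+t. ennreal (if 0 < t \<and> t < 1 then t powr (a - 1) * (1 - t) powr (b - 1) else 0) \<partial>lborel) = ennreal (Beta a b)"
proof (rule nn_integral_has_integral_lborel)
  let ?f = "\<lambda>t. if 0 < t \<and> t < 1 then t powr (a - 1) * (1 - t) powr (b - 1) else (0 :: real)"
  show "?f \<in> borel_measurable borel" by measurable
  have "?f = (\<lambda>t. if t \<in> {0..1} then t powr (a - 1) * (1 - t) powr (b - 1) else 0)" by (auto simp: fun_eq_iff)
  then show "(?f has_integral Beta a b) UNIV"
    using has_integral_Beta_real[OF assms] by (simp only: has_integral_restrict_UNIV)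
qed auto

lemma nn_integral_Beta_interval:
  assumes "a > -1" "b > -1"
  shows "(\<integral>\<^sup>+t. ennreal (if u < t \<and> t < v then (t - u) powr a * (v - t) powr b else 0) \<partial>lborel)
    = ennreal (if u < v then (v - u) powr (a + b + 1) * Beta (a + 1) (b + 1) else 0)"
proof (cases "u < v")
  case False
  then have "(\<lambda>t. ennreal (if u < t \<and> t < v then (t - u) powr a * (v - t) powr b else 0)) = (\<lambda>t. 0)" by auto
  then show ?thesis using False by simp
next
  case True
  define L where "L = v - u"
  have L: "L > 0" using True by (simp add: L_def)
  have "(\<integral>\<^sup>+t. ennreal (if u < t \<and> t < v then (t - u) powr a * (v - t) powr b else 0) \<partial>lborel)
      = ennreal \<bar>L\<bar> * (\<integral>\<^sup>+s. ennreal (if u < u + L * s \<and> u + L * s < v then (u + L * s - u) powr a * (v - (u + L * s)) powr b else 0) \<partial>lborel)"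
    by (rule nn_integral_real_affine) (use L in auto)
  also have "\<dots> = ennreal L * (\<integral>\<^sup>+s. ennreal (L powr (a + b)) * ennreal (if 0 < s \<and> s < 1 then s powr (a + 1 - 1) * (1 - s) powr (b + 1 - 1) else 0) \<partial>lborel)"
  proof (intro arg_cong2[where f = "(*)"] nn_integral_cong)
    fix s
    have v: "v - (u + L * s) = L * (1 - s)" by (simp add: L_def algebra_simps)
    have c: "u < u + L * s \<and> u + L * s < v \<longleftrightarrow> 0 < s \<and> s < 1"
    proof -
      have "u + L * s < v \<longleftrightarrow> 0 < L * (1 - s)" unfolding v[symmetric] by auto
      then show ?thesis using L by (auto simp: zero_less_mult_iff)
    qed
    show "ennreal (if u < u + L * s \<and> u + L * s < v then (u + L * s - u) powr a * (v - (u + L * s)) powr b else 0)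
        = ennreal (L powr (a + b)) * ennreal (if 0 < s \<and> s < 1 then s powr (a + 1 - 1) * (1 - s) powr (b + 1 - 1) else 0)"
      unfolding c v using L by (auto simp: ennreal_mult[symmetric] powr_mult powr_add)
  qed (use L in simp)
  also have "\<dots> = ennreal L * (ennreal (L powr (a + b)) * ennreal (Beta (a + 1) (b + 1)))"
    using assms by (subst nn_integral_cmult) (auto simp: nn_integral_Beta_01)
  also have "\<dots> = ennreal (L powr (a + b + 1) * Beta (a + 1) (b + 1))"
  proof -
    have "L powr (a + b + 1) = L * L powr (a + b)" using powr_add[of L "a + b" 1] L by simp
    moreover have "Beta (a + 1) (b + 1) \<ge> 0" using assms by (auto simp: Beta_def intro!: divide_nonneg_nonneg mult_nonneg_nonneg)
    ultimately show ?thesis using L by (simp add: ennreal_mult mult.assoc)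
  qed
  finally show ?thesis using True by (simp add: L_def)
qed

text \<open>The complex duplication formula restricted to the positive axis; it simplifies the
  symmetric Beta value in the next integral.\<close>

lemma Gamma_duplication_real:
  assumes "x > (0 :: real)"
  shows "Gamma x * Gamma (x + 1 / 2) = 2 powr (1 - 2 * x) * sqrt pi * Gamma (2 * x)"
proof -
  have nn: "z \<notin> \<int>\<^sub>\<le>\<^sub>0" if "Re z > 0" for z
    using that by (auto elim!: nonpos_Ints_cases)
  have "complex_of_real (Gamma x * Gamma (x + 1 / 2)) = Gamma (of_real x) * Gamma (of_real x + 1 / 2)"
    using Gamma_complex_of_real[of x] Gamma_complex_of_real[of "x + 1 / 2"] by simp
  also have "\<dots> = exp ((1 - 2 * of_real x) * of_real (ln 2)) * of_real (sqrt pi) * Gamma (2 * of_real x)"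
    by (rule Gamma_legendre_duplication) (use assms in \<open>auto intro!: nn\<close>)
  also have "exp ((1 - 2 * complex_of_real x) * of_real (ln 2)) = of_real (2 powr (1 - 2 * x))"
    by (simp add: powr_def exp_of_real[symmetric] del: exp_of_real)
  also have "Gamma (2 * complex_of_real x) = of_real (Gamma (2 * x))"
    using Gamma_complex_of_real[of "2 * x"] by simp
  finally have "complex_of_real (Gamma x * Gamma (x + 1 / 2)) = of_real (2 powr (1 - 2 * x) * sqrt pi * Gamma (2 * x))" by simp
  then show ?thesis by (simp only: of_real_eq_iff)
qed

text \<open>L - t^2 factors at the endpoints \<plusminus> sqrt L, which gives a Beta integral with
  equal parameters over an interval of length 2 sqrt L; duplication removes the power of
  two.\<close>

lemma nn_integral_semicircle:
  assumes c: "c > -1"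
  shows "(\<integral>\<^sup>+t. ennreal (if t\<^sup>2 < L then (L - t\<^sup>2) powr c else 0) \<partial>lborel)
    = ennreal (if 0 < L then L powr (c + 1 / 2) * (sqrt pi * Gamma (c + 1) / Gamma (c + 3 / 2)) else 0)"
proof (cases "L > 0")
  case False
  then have "\<not> t\<^sup>2 < L" for t by (smt (verit) zero_le_power2)
  then show ?thesis using False by simp
next
  case True
  let ?r = "sqrt L"
  have r: "?r > 0" "?r * ?r = L" using True by auto
  have "(\<integral>\<^sup>+t. ennreal (if t\<^sup>2 < L then (L - t\<^sup>2) powr c else 0) \<partial>lborel)
      = (\<integral>\<^sup>+t. ennreal (if - ?r < t \<and> t < ?r then (t - (- ?r)) powr c * (?r - t) powr c else 0) \<partial>lborel)"
  proof (intro nn_integral_cong arg_cong[where f = ennreal])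
    fix t :: real
    have c: "t\<^sup>2 < L \<longleftrightarrow> - ?r < t \<and> t < ?r"
      using real_less_rsqrt real_sqrt_abs abs_less_iff
      by (metis minus_less_iff real_sqrt_less_iff)
    have "(L - t\<^sup>2) powr c = (t - (- ?r)) powr c * (?r - t) powr c" if "- ?r < t" "t < ?r"
    proof -
      have "L - t\<^sup>2 = (t - (- ?r)) * (?r - t)" using r(2) by (simp add: algebra_simps power2_eq_square)
      then show ?thesis using that by (simp add: powr_mult)
    qed
    then show "(if t\<^sup>2 < L then (L - t\<^sup>2) powr c else 0) = (if - ?r < t \<and> t < ?r then (t - (- ?r)) powr c * (?r - t) powr c else 0)"
      using c by auto
  qed
  also have "\<dots> = ennreal ((?r - - ?r) powr (c + c + 1) * Beta (c + 1) (c + 1))"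
    using r(1) by (subst nn_integral_Beta_interval[OF c c]) auto
  also have "(?r - - ?r) powr (c + c + 1) * Beta (c + 1) (c + 1) = L powr (c + 1 / 2) * (sqrt pi * Gamma (c + 1) / Gamma (c + 3 / 2))"
  proof -
    have "(?r - - ?r) powr (c + c + 1) = 2 powr (2 * c + 1) * (L powr (1 / 2)) powr (2 * c + 1)"
      using r(1) True by (simp add: powr_mult[symmetric] powr_half_sqrt)
    also have "(L powr (1 / 2)) powr (2 * c + 1) = L powr (c + 1 / 2)"
      by (simp add: powr_powr add_divide_distrib)
    finally have 1: "(?r - - ?r) powr (c + c + 1) = 2 powr (2 * c + 1) * L powr (c + 1 / 2)" .
    have d: "Gamma (c + 1) * Gamma (c + 3 / 2) = 2 powr (- 1 - 2 * c) * sqrt pi * Gamma (2 * c + 2)"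
      using Gamma_duplication_real[of "c + 1"] c by (simp add: algebra_simps)
    have g: "Gamma (c + 1) > 0" "Gamma (c + 3 / 2) > 0" "Gamma (2 * c + 2) > 0" using c by auto
    have p: "2 powr (2 * c + 1) * 2 powr (- 1 - 2 * c) = (1 :: real)" by (simp add: powr_add[symmetric])
    have "2 powr (2 * c + 1) * Beta (c + 1) (c + 1) = sqrt pi * Gamma (c + 1) / Gamma (c + 3 / 2)"
    proof -
      have "2 powr (2 * c + 1) * (Gamma (c + 1) * Gamma (c + 3 / 2)) = (2 powr (2 * c + 1) * 2 powr (- 1 - 2 * c)) * sqrt pi * Gamma (2 * c + 2)"
        unfolding d by (simp add: mult_ac)
      then have "2 powr (2 * c + 1) * (Gamma (c + 1) * Gamma (c + 3 / 2)) = sqrt pi * Gamma (2 * c + 2)" unfolding p by simp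
      then have e: "2 powr (2 * c + 1) * Gamma (c + 1) / Gamma (2 * c + 2) = sqrt pi / Gamma (c + 3 / 2)"
        using g by (simp add: field_simps)
      have "2 powr (2 * c + 1) * Beta (c + 1) (c + 1) = Gamma (c + 1) * (2 powr (2 * c + 1) * Gamma (c + 1) / Gamma (2 * c + 2))"
        by (simp add: Beta_def algebra_simps)
      then show ?thesis unfolding e by simp
    qed
    moreover have "(?r - - ?r) powr (c + c + 1) * Beta (c + 1) (c + 1) = L powr (c + 1 / 2) * (2 powr (2 * c + 1) * Beta (c + 1) (c + 1))"
      by (simp only: 1 mult_ac)
    ultimately show ?thesis by (simp only:)
  qed
  finally show ?thesis using True by simp
qed

text \<open>Closed form of the integral of (1 - |x|^2)^c over the unit ball in dimension d.\<close>

definition ball_integral :: "nat \<Rightarrow> real \<Rightarrow> real" where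
  "ball_integral d c = pi powr (real d / 2) * Gamma (c + 1) / Gamma (c + 1 + real d / 2)"

text \<open>Integrating out one coordinate raises the exponent c by 1/2 and lowers the dimension by
  one; the Gamma quotients telescope.\<close>

lemma nn_integral_ball:
  "c > -1 \<Longrightarrow> (\<integral>\<^sup>+x. ennreal (if (\<Sum>i<d. (x i)\<^sup>2) < 1 then (1 - (\<Sum>i<d. (x i)\<^sup>2)) powr c else 0) \<partial>PiM {..<d} (\<lambda>_. lborel))
    = ennreal (ball_integral d c)"
proof (induction d arbitrary: c)
  case 0
  then have "Gamma (c + 1) > 0" by simp
  then show ?case by (simp add: PiM_empty nn_integral_count_space_finite ball_integral_def)
next
  case (Suc d)
  let ?P = "\<lambda>d. PiM {..<d} (\<lambda>_. lborel :: real measure)"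
  let ?f = "\<lambda>d c x. ennreal (if (\<Sum>i<d. (x i)\<^sup>2) < 1 then (1 - (\<Sum>i<d. (x i)\<^sup>2)) powr c else (0 :: real))"
  define K where "K = sqrt pi * Gamma (c + 1) / Gamma (c + 3 / 2)"
  have K: "K \<ge> 0" using Suc.prems by (simp add: K_def less_imp_le)
  have comp: "(\<lambda>x. x i) \<in> borel_measurable (?P d)" if "i < d" for i d
    using measurable_component_singleton[of i "{..<d}" "\<lambda>_. lborel"] that by simp
  have m: "?f d c \<in> borel_measurable (?P d)" for d c
  proof -
    have "(\<lambda>x. \<Sum>i<d. (x i)\<^sup>2) \<in> borel_measurable (?P d)" by (intro borel_measurable_sum borel_measurable_power comp) auto
    then show ?thesis by measurable
  qed
  have ins: "{..<Suc d} = insert d {..<d}" by auto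
  have "(\<integral>\<^sup>+x. ?f (Suc d) c x \<partial>?P (Suc d)) = (\<integral>\<^sup>+x. (\<integral>\<^sup>+t. ?f (Suc d) c (x(d := t)) \<partial>lborel) \<partial>?P d)"
    using lborel_product.product_nn_integral_insert[of "{..<d}" d "?f (Suc d) c"] m[of "Suc d" c] unfolding ins by simp
  also have "\<dots> = (\<integral>\<^sup>+x. ennreal K * ?f d (c + 1 / 2) x \<partial>?P d)"
  proof (rule nn_integral_cong)
    fix x :: "nat \<Rightarrow> real"
    let ?s = "\<Sum>i<d. (x i)\<^sup>2"
    have "(\<Sum>i<Suc d. ((x(d := t)) i)\<^sup>2) = ?s + t\<^sup>2" for t by simp
    then have "?f (Suc d) c (x(d := t)) = ennreal (if t\<^sup>2 < 1 - ?s then (1 - ?s - t\<^sup>2) powr c else 0)" for t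
      by (simp add: algebra_simps)
    then have "(\<integral>\<^sup>+t. ?f (Suc d) c (x(d := t)) \<partial>lborel)
        = ennreal (if 0 < 1 - ?s then (1 - ?s) powr (c + 1 / 2) * K else 0)"
      unfolding K_def by (simp only: nn_integral_semicircle[OF Suc.prems])
    also have "\<dots> = ennreal K * ?f d (c + 1 / 2) x"
      using K by (simp add: ennreal_mult'[symmetric] mult.commute)
    finally show "(\<integral>\<^sup>+t. ?f (Suc d) c (x(d := t)) \<partial>lborel) = ennreal K * ?f d (c + 1 / 2) x" .
  qed
  also have "\<dots> = ennreal K * (\<integral>\<^sup>+x. ?f d (c + 1 / 2) x \<partial>?P d)" by (rule nn_integral_cmult[OF m])
  also have "(\<integral>\<^sup>+x. ?f d (c + 1 / 2) x \<partial>?P d) = ennreal (ball_integral d (c + 1 / 2))"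
    by (rule Suc.IH) (use Suc.prems in simp)
  also have "ennreal K * ennreal (ball_integral d (c + 1 / 2)) = ennreal (K * ball_integral d (c + 1 / 2))"
    using K by (simp add: ennreal_mult')
  also have "K * ball_integral d (c + 1 / 2) = ball_integral (Suc d) c"
  proof -
    have g: "Gamma (c + 3 / 2) > 0" using Suc.prems by simp
    have e: "pi powr (real (Suc d) / 2) = sqrt pi * pi powr (real d / 2)"
      by (simp add: powr_half_sqrt[symmetric] powr_add[symmetric] add_divide_distrib)
    have e2: "c + 1 / 2 + 1 + real d / 2 = c + 1 + real (Suc d) / 2" by (auto simp: field_simps)
    have e3: "c + 1 / 2 + 1 = c + 3 / 2" by simp
    show ?thesis unfolding ball_integral_def K_def e e2 unfolding e3 using g by (simp del: of_nat_Suc)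
  qed
  finally show ?case .
qed

section \<open>Integrating out the last column of a symmetric matrix\<close>

definition append_column :: "nat \<Rightarrow> (nat \<times> nat \<Rightarrow> real) \<Rightarrow> (nat \<Rightarrow> real) \<Rightarrow> nat \<times> nat \<Rightarrow> real" where
  "append_column q y c = (\<lambda>(i, j)\<in>Tidx (Suc q). if j = q then c i else y (i, j))"

lemma nn_integral_Sp_Suc:
  assumes f: "f \<in> borel_measurable (Sp (Suc q))"
  shows "(\<integral>\<^sup>+y. f y \<partial>Sp (Suc q))
    = (\<integral>\<^sup>+y. (\<integral>\<^sup>+x. (\<integral>\<^sup>+t. f (append_column q y (x(q := t))) \<partial>lborel) \<partial>PiM {..<q} (\<lambda>_. lborel)) \<partial>Sp q)"
proof -
  let ?J = "(\<lambda>i. (i, q)) ` {..q}"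
  have f': "f \<in> borel_measurable (PiM (Tidx q \<union> ?J) (\<lambda>_. lborel))" using f by (simp add: Sp_def Tidx_Suc)
  have "(\<integral>\<^sup>+y. f y \<partial>Sp (Suc q)) = (\<integral>\<^sup>+y. (\<integral>\<^sup>+z. f (merge (Tidx q) ?J (y, z)) \<partial>PiM ?J (\<lambda>_. lborel)) \<partial>PiM (Tidx q) (\<lambda>_. lborel))"
    unfolding Sp_def Tidx_Suc by (rule lborel_product.product_nn_integral_fold[OF _ _ _ f']) auto
  also have "\<dots> = (\<integral>\<^sup>+y. (\<integral>\<^sup>+x. (\<integral>\<^sup>+t. f (append_column q y (x(q := t))) \<partial>lborel) \<partial>PiM {..<q} (\<lambda>_. lborel)) \<partial>Sp q)"
    unfolding Sp_def[of q]
  proof (rule nn_integral_cong)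
    fix y assume y: "y \<in> space (PiM (Tidx q) (\<lambda>_. lborel :: real measure))"
    have m: "(\<lambda>z. f (merge (Tidx q) ?J (y, z))) \<in> borel_measurable (PiM ?J (\<lambda>_. lborel))"
      using measurable_compose[OF measurable_Pair1'[OF y] measurable_compose[OF measurable_merge f']] .
    have ap: "merge (Tidx q) ?J (y, \<lambda>k\<in>?J. c (fst k)) = append_column q y c" for c
      by (rule ext) (auto simp: merge_def append_column_def less_Suc_eq)
    have "(\<lambda>c. \<lambda>k\<in>?J. c (fst k)) \<in> measurable (PiM {..q} (\<lambda>_. lborel)) (PiM ?J (\<lambda>_. lborel :: real measure))"
      by (intro measurable_restrict measurable_component_singleton) auto
    from measurable_compose[OF this m]
    have m': "(\<lambda>c. f (append_column q y c)) \<in> borel_measurable (PiM (insert q {..<q}) (\<lambda>_. lborel))"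
      unfolding ap by (simp add: lessThan_Suc_atMost[symmetric] lessThan_Suc)
    have "(\<integral>\<^sup>+z. f (merge (Tidx q) ?J (y, z)) \<partial>PiM ?J (\<lambda>_. lborel))
        = (\<integral>\<^sup>+c. f (merge (Tidx q) ?J (y, \<lambda>k\<in>?J. c (fst k))) \<partial>PiM {..q} (\<lambda>_. lborel))"
      by (rule nn_integral_PiM_reindex[where g = fst, OF _ _ m]) auto
    also have "\<dots> = (\<integral>\<^sup>+c. f (append_column q y c) \<partial>PiM (insert q {..<q}) (\<lambda>_. lborel))"
      unfolding ap by (simp add: lessThan_Suc_atMost[symmetric] lessThan_Suc)
    also have "\<dots> = (\<integral>\<^sup>+x. (\<integral>\<^sup>+t. f (append_column q y (x(q := t))) \<partial>lborel) \<partial>PiM {..<q} (\<lambda>_. lborel))"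
      by (rule lborel_product.product_nn_integral_insert[OF _ _ m']) auto
    finally show "(\<integral>\<^sup>+z. f (merge (Tidx q) ?J (y, z)) \<partial>PiM ?J (\<lambda>_. lborel))
        = (\<integral>\<^sup>+x. (\<integral>\<^sup>+t. f (append_column q y (x(q := t))) \<partial>lborel) \<partial>PiM {..<q} (\<lambda>_. lborel))" .
  qed
  finally show ?thesis .
qed

lemma tmat_dim[simp]: "dim_row (tmat p y) = p" "dim_col (tmat p y) = p"
  by (auto simp: tmat_def)

lemma append_column_index:
  shows "i < q \<Longrightarrow> j < q \<Longrightarrow> tmat (Suc q) (append_column q y c) $$ (i, j) = tmat q y $$ (i, j)"
    and "i \<le> q \<Longrightarrow> tmat (Suc q) (append_column q y c) $$ (i, q) = c i"
  by (auto simp: tmat_def append_column_def min_def max_def)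

definition beta_kernel :: "nat \<Rightarrow> real \<Rightarrow> real \<Rightarrow> (nat \<times> nat \<Rightarrow> real) \<Rightarrow> real" where
  "beta_kernel p a b y = (if in01 p (tmat p y)
     then det (tmat p y) powr (a - (real p + 1) / 2) * det (1\<^sub>m p - tmat p y) powr (b - (real p + 1) / 2) else 0)"

lemma beta_kernel_nonneg: "beta_kernel p a b y \<ge> 0"
  by (simp add: beta_kernel_def)

lemma borel_measurable_beta_kernel[measurable]: "beta_kernel p a b \<in> borel_measurable (Sp p)"
  unfolding beta_kernel_def
proof (intro measurable_If sets_in01_tmat)
  have "(\<lambda>y. det (tmat p y)) \<in> borel_measurable (Sp p)" "(\<lambda>y. det (1\<^sub>m p - tmat p y)) \<in> borel_measurable (Sp p)"
    by (auto intro!: borel_measurable_det[where n = p] measurable_mat_minus measurable_mat_const measurable_mat_tmat)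
  then show "(\<lambda>y. det (tmat p y) powr (a - (real p + 1) / 2) * det (1\<^sub>m p - tmat p y) powr (b - (real p + 1) / 2)) \<in> borel_measurable (Sp p)"
    by measurable
qed auto

text \<open>Pivots of A and of I - A: with the leading block Y fixed, both pivots are affine in the
  corner t, one increasing and one decreasing. Definiteness confines t to an interval, on which the
  kernel is a scalar Beta integrand.\<close>

lemma beta_kernel_Suc:
  fixes q :: nat and y :: "nat \<times> nat \<Rightarrow> real" and x :: "nat \<Rightarrow> real" and t :: real
  defines "Y \<equiv> tmat q y" and "w \<equiv> vec q x"
  assumes Y: "in01 q Y"
  shows "beta_kernel (Suc q) a b (append_column q y (x(q := t)))
    = det Y powr (a - (real q + 2) / 2) * det (1\<^sub>m q - Y) powr (b - (real q + 2) / 2) *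
      (if qform (minv Y) w < t \<and> t < 1 - qform (minv (1\<^sub>m q - Y)) w
       then (t - qform (minv Y) w) powr (a - (real q + 2) / 2) * (1 - qform (minv (1\<^sub>m q - Y)) w - t) powr (b - (real q + 2) / 2) else 0)"
proof -
  let ?A = "tmat (Suc q) (append_column q y (x(q := t)))" and ?I = "1\<^sub>m (Suc q) :: real mat"
  have Ys: "sym_mat q Y" "sym_mat q (1\<^sub>m q - Y)" unfolding Y_def by (auto intro: sym_mat_minus)
  have Yp: "pd q Y" "pd q (1\<^sub>m q - Y)" using Y in01_iff[OF sym_matD(1)[OF Ys(1)]] by auto
  have d: "det Y > 0" "det (1\<^sub>m q - Y) > 0" using pd_det_pos Ys Yp by auto
  have A: "sym_mat (Suc q) ?A" "sym_mat (Suc q) (?I - ?A)" by (auto intro: sym_mat_minus)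
  have Ac: "?A \<in> carrier_mat (Suc q) (Suc q)" by simp
  have lA: "lead q ?A = Y" unfolding Y_def by (intro eq_matI) (auto simp: append_column_index lead_def)
  have lI: "lead q (?I - ?A) = 1\<^sub>m q - Y"
    unfolding Y_def using Ac by (intro eq_matI) (auto simp: append_column_index lead_def)
  have cA: "vec q (\<lambda>i. ?A $$ (i, q)) = w" unfolding w_def by (intro eq_vecI) (auto simp: append_column_index)
  have wc: "w \<in> carrier_vec q" by (simp add: w_def)
  have cI: "vec q (\<lambda>i. (?I - ?A) $$ (i, q)) = - w"
    unfolding w_def using Ac by (intro eq_vecI) (auto simp: append_column_index)
  have s1: "schur_last q ?A = t - qform (minv Y) w"
    unfolding schur_last_def lA cA by (simp add: append_column_index)
  have "qform (minv (1\<^sub>m q - Y)) (- w) = qform (minv (1\<^sub>m q - Y)) w"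
  proof -
    have "minv (1\<^sub>m q - Y) \<in> carrier_mat q q" using minv_props(1)[OF sym_matD(1)[OF Ys(2)]] d(2) by simp
    then show ?thesis using wc by (simp add: qform_sum[of _ q])
  qed
  then have s2: "schur_last q (?I - ?A) = 1 - qform (minv (1\<^sub>m q - Y)) w - t"
    unfolding schur_last_def lI cI using Ac by (simp add: append_column_index)
  have dA: "det (lead q ?A) \<noteq> 0" "det (lead q (?I - ?A)) \<noteq> 0" using d by (auto simp: lA lI)
  note S1 = schur_last[OF A(1) dA(1), unfolded lA s1] and S2 = schur_last[OF A(2) dA(2), unfolded lI s2]
  have i: "in01 (Suc q) ?A \<longleftrightarrow> qform (minv Y) w < t \<and> t < 1 - qform (minv (1\<^sub>m q - Y)) w"
    unfolding in01_iff[OF Ac] S1(2)[OF Yp(1)] S2(2)[OF Yp(2)] by auto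
  show ?thesis
    unfolding beta_kernel_def i S1(1) S2(1) using d by (auto simp: powr_mult mult_ac add.commute)
qed

lemma beta_kernel_Suc_zero:
  assumes "\<not> in01 q (tmat q y)"
  shows "beta_kernel (Suc q) a b (append_column q y c) = 0"
proof -
  let ?A = "tmat (Suc q) (append_column q y c)" and ?I = "1\<^sub>m (Suc q) :: real mat"
  have Ac: "?A \<in> carrier_mat (Suc q) (Suc q)" by simp
  have lA: "lead q ?A = tmat q y" by (intro eq_matI) (auto simp: append_column_index lead_def)
  have lI: "lead q (?I - ?A) = 1\<^sub>m q - tmat q y"
    using Ac by (intro eq_matI) (auto simp: append_column_index lead_def)
  have "\<not> in01 (Suc q) ?A"
  proof
    assume "in01 (Suc q) ?A"
    then have "pd (Suc q) ?A" "pd (Suc q) (?I - ?A)" using in01_iff[OF Ac] by auto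
    then have "pd q (tmat q y)" "pd q (1\<^sub>m q - tmat q y)"
      using pd_lead[of q ?A] pd_lead[of q "?I - ?A"] Ac minus_carrier_mat[OF Ac] unfolding lA lI by auto
    then show False using assms in01_iff[of "tmat q y" q] by simp
  qed
  then show ?thesis by (simp add: beta_kernel_def)
qed

text \<open>With G = C C^T the form is the squared length of C^T x. This substitution is upper
  triangular, hence the decreasing rank q - j, and det C is the root of det G.\<close>

lemma nn_integral_ellipsoid:
  assumes G: "sym_mat q G" "pd q G" and c: "c > -1"
  shows "(\<integral>\<^sup>+x. ennreal (if qform G (vec q x) < 1 then (1 - qform G (vec q x)) powr c else 0) \<partial>PiM {..<q} (\<lambda>_. lborel))
    = ennreal (ball_integral q c / sqrt (det G))"
proof -
  obtain C where C: "lower_tri q C" "G = C * C\<^sup>T" using cholesky[OF G] by auto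
  have Cc: "C \<in> carrier_mat q q" "C\<^sup>T \<in> carrier_mat q q" using C(1) by (auto simp: lower_tri_def)
  have diag: "C $$ (i, i) > 0" if "i < q" for i using C(1) that by (auto simp: lower_tri_def)
  have low: "C $$ (j, i) = 0" if "j < i" "i < q" for i j using C(1) that by (auto simp: lower_tri_def)
  define f where "f = (\<lambda>x :: nat \<Rightarrow> real. ennreal (if (\<Sum>i<q. (x i)\<^sup>2) < 1 then (1 - (\<Sum>i<q. (x i)\<^sup>2)) powr c else 0))"
  have f: "f \<in> borel_measurable (PiM {..<q} (\<lambda>_. lborel))"
  proof -
    have "(\<lambda>x. x i) \<in> borel_measurable (PiM {..<q} (\<lambda>_. lborel :: real measure))" if "i < q" for i
      using measurable_component_singleton[of i "{..<q}" "\<lambda>_. lborel"] that by simp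
    then have "(\<lambda>x. \<Sum>i<q. (x i)\<^sup>2) \<in> borel_measurable (PiM {..<q} (\<lambda>_. lborel :: real measure))"
      by (intro borel_measurable_sum borel_measurable_power) auto
    then show ?thesis unfolding f_def by measurable
  qed
  let ?T = "\<lambda>x. \<lambda>i\<in>{..<q}. C $$ (i, i) * x i + 0 + (\<Sum>j\<in>{j\<in>{..<q}. q - j < q - i}. C $$ (j, i) * x j)"
  have T: "?T x i = (\<Sum>j<q. C $$ (j, i) * x j)" if i: "i < q" for x i
  proof -
    have "(\<Sum>j<q. C $$ (j, i) * x j) = (\<Sum>j\<in>insert i {j\<in>{..<q}. q - j < q - i}. C $$ (j, i) * x j)"
      using i low[of _ i] by (intro sum.mono_neutral_right) (auto simp: not_less, metis diff_le_mono2 le_neq_implies_less diff_less_mono2 le_less_trans linorder_neqE_nat)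
    also have "\<dots> = C $$ (i, i) * x i + (\<Sum>j\<in>{j\<in>{..<q}. q - j < q - i}. C $$ (j, i) * x j)" by (subst sum.insert) auto
    finally show ?thesis using i by simp
  qed
  have q: "qform G (vec q x) = (\<Sum>i<q. (?T x i)\<^sup>2)" for x
  proof -
    have v: "vec q x \<in> carrier_vec q" by simp
    have "qform G (vec q x) = (C\<^sup>T *\<^sub>v vec q x) \<bullet> (C\<^sup>T *\<^sub>v vec q x)"
    proof -
      have "G *\<^sub>v vec q x = C *\<^sub>v (C\<^sup>T *\<^sub>v vec q x)" unfolding C(2) by (rule assoc_mult_mat_vec[OF Cc v])
      then show ?thesis using scalar_prod_transpose[OF Cc(1) v, of "C\<^sup>T *\<^sub>v vec q x"] Cc by simp
    qed
    also have "\<dots> = (\<Sum>i<q. ((C\<^sup>T *\<^sub>v vec q x) $ i)\<^sup>2)" using Cc by (intro scalar_self_sum) auto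
    also have "\<dots> = (\<Sum>i<q. (?T x i)\<^sup>2)"
      using Cc by (intro sum.cong refl, subst T) (auto simp: scalar_prod_def atLeast0LessThan)
    finally show ?thesis .
  qed
  have "(\<integral>\<^sup>+x. ennreal (if qform G (vec q x) < 1 then (1 - qform G (vec q x)) powr c else 0) \<partial>PiM {..<q} (\<lambda>_. lborel))
      = (\<integral>\<^sup>+x. f (?T x) \<partial>PiM {..<q} (\<lambda>_. lborel))"
    unfolding q f_def ..
  also have "\<dots> = ennreal (\<Prod>i<q. 1 / \<bar>C $$ (i, i)\<bar>) * (\<integral>\<^sup>+x. f x \<partial>PiM {..<q} (\<lambda>_. lborel))"
    by (rule nn_integral_triangular[where t = "\<lambda>_. 0" and r = "\<lambda>j. q - j"]) (use f diag in force)+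
  also have "(\<integral>\<^sup>+x. f x \<partial>PiM {..<q} (\<lambda>_. lborel)) = ennreal (ball_integral q c)"
    unfolding f_def by (rule nn_integral_ball[OF c])
  also have "(\<Prod>i<q. 1 / \<bar>C $$ (i, i)\<bar>) = 1 / sqrt (det G)"
  proof -
    have "det G = det C * det C" using det_mult[OF Cc] det_transpose[OF Cc(1)] C(2) by simp
    moreover have "det C > 0" unfolding det_lower_tri[OF C(1)] using diag by (intro prod_pos) auto
    moreover have "(\<Prod>i<q. 1 / \<bar>C $$ (i, i)\<bar>) = 1 / det C"
      unfolding det_lower_tri[OF C(1)] using diag by (simp add: prod_dividef less_imp_le abs_of_pos)
    ultimately show ?thesis by simp
  qed
  also have "ennreal (1 / sqrt (det G)) * ennreal (ball_integral q c) = ennreal (ball_integral q c / sqrt (det G))"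
    using pd_det_pos[OF G] by (simp add: ennreal_mult'[symmetric])
  finally show ?thesis .
qed

lemma mGamma_Suc: "mGamma (Suc q) a = mGamma q a * pi powr (real q / 2) * Gamma (a - real q / 2)"
proof -
  have e: "real (Suc q * (Suc q - 1)) / 4 = real (q * (q - 1)) / 4 + real q / 2"
    by (cases q) (auto simp: field_simps)
  show ?thesis unfolding mGamma_def e powr_add by (simp add: prod.nat_ivl_Suc' mult_ac)
qed

lemma mGamma_pos: "a > (real p - 1) / 2 \<Longrightarrow> mGamma p a > 0"
  unfolding mGamma_def by (intro mult_pos_pos prod_pos ballI Gamma_real_pos) (auto simp: field_simps)

lemma mBeta_pos:
  assumes "a > (real p - 1) / 2" "b > (real p - 1) / 2" "p \<ge> 1"
  shows "mBeta p a b > 0"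
  unfolding mBeta_def using assms by (intro divide_pos_pos mult_pos_pos mGamma_pos) auto

text \<open>The bracket is what the last column contributes: a scalar Beta value from the corner
  entry and a ball integral from the entries above it.\<close>

lemma mBeta_Suc:
  assumes "a > real q / 2" "b > real q / 2"
  shows "mBeta (Suc q) a b
    = mBeta q a b * (Beta (a - real q / 2) (b - real q / 2) * ball_integral q (a + b - real q - 1))"
proof -
  have g: "Gamma (a + b - real q) > 0" using assms by (intro Gamma_real_pos) (simp add: field_simps)
  have e: "a - real q / 2 + (b - real q / 2) = a + b - real q" "a + b - real q - 1 + 1 = a + b - real q"
    "a + b - real q + real q / 2 = a + b - real q / 2" by (auto simp: field_simps)
  have p: "pi powr (real q / 2) > 0" by simp
  show ?thesis unfolding mBeta_def mGamma_Suc ball_integral_def Beta_def e using g p by (simp add: field_simps)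
qed

text \<open>Induction on the size, integrating first the corner entry, then the rest of the last
  column. The remaining function of the leading block is again a Beta kernel with the same a and
  b.\<close>

theorem nn_integral_beta_kernel:
  "a > (real p - 1) / 2 \<Longrightarrow> b > (real p - 1) / 2 \<Longrightarrow> (\<integral>\<^sup>+y. ennreal (beta_kernel p a b y) \<partial>Sp p) = ennreal (mBeta p a b)"
proof (induction p)
  case 0
  have d: "det (tmat 0 y) = 1" "det (1\<^sub>m 0 - tmat 0 y) = 1" for y
    by (rule det_dim_zero, simp add: minus_carrier_mat)+
  have "beta_kernel 0 a b y = 1" for y
    unfolding beta_kernel_def in01_iff[OF tmat_carrier] by (simp add: d pd_dim0)
  then show ?case
    by (simp add: Sp_def Tidx_def PiM_empty nn_integral_count_space_finite mBeta_def mGamma_def)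
next
  case (Suc q)
  have ab: "a > real q / 2" "b > real q / 2" using Suc.prems by (auto simp: field_simps)
  let ?\<alpha> = "a - (real q + 2) / 2" and ?\<beta> = "b - (real q + 2) / 2"
  have ex: "?\<alpha> > -1" "?\<beta> > -1" "?\<alpha> + ?\<beta> + 1 > -1" using ab by (auto simp: field_simps)
  define K where "K = Beta (?\<alpha> + 1) (?\<beta> + 1) * ball_integral q (?\<alpha> + ?\<beta> + 1)"
  have B0: "Beta (?\<alpha> + 1) (?\<beta> + 1) \<ge> 0" using ex by (auto simp: Beta_def intro!: divide_nonneg_nonneg mult_nonneg_nonneg)
  have J0: "ball_integral q (?\<alpha> + ?\<beta> + 1) \<ge> 0"
    using ex unfolding ball_integral_def
    by (intro divide_nonneg_nonneg mult_nonneg_nonneg Gamma_real_nonneg) (auto simp: add_pos_nonneg)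
  have inner: "(\<integral>\<^sup>+x. (\<integral>\<^sup>+t. ennreal (beta_kernel (Suc q) a b (append_column q y (x(q := t)))) \<partial>lborel) \<partial>PiM {..<q} (\<lambda>_. lborel))
      = ennreal K * ennreal (beta_kernel q a b y)" if y: "y \<in> space (Sp q)" for y
  proof (cases "in01 q (tmat q y)")
    case False
    then show ?thesis by (simp add: beta_kernel_Suc_zero[OF False] beta_kernel_def[of q])
  next
    case True
    let ?Y = "tmat q y" and ?Z = "1\<^sub>m q - tmat q y"
    have Ys: "sym_mat q ?Y" "sym_mat q ?Z" by (auto intro: sym_mat_minus)
    have Yp: "pd q ?Y" "pd q ?Z" using True in01_iff[of ?Y q] by auto
    have d: "det ?Y > 0" "det ?Z > 0" using pd_det_pos[OF Ys(1) Yp(1)] pd_det_pos[OF Ys(2) Yp(2)] by auto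
    note mY = minv_props[OF sym_matD(1)[OF Ys(1)]] and mZ = minv_props[OF sym_matD(1)[OF Ys(2)]]
    have dn: "det ?Y \<noteq> 0" "det ?Z \<noteq> 0" using d by auto
    \<comment> \<open>The interval left for the corner has length 1 minus the form of G at the
      column, so the column is integrated over an ellipsoid.\<close>
    define G where "G = minv ?Y + minv ?Z"
    have G: "sym_mat q G" "pd q G"
      unfolding G_def
      by (rule sym_mat_add[OF sym_minv[OF Ys(1) dn(1)] sym_minv[OF Ys(2) dn(2)]],
          rule pd_add[OF pd_minv[OF Ys(1) Yp(1)] pd_minv[OF Ys(2) Yp(2)] mY(1)[OF dn(1)] mZ(1)[OF dn(2)]])
    define D where "D = det ?Y powr ?\<alpha> * det ?Z powr ?\<beta>"
    have D0: "D \<ge> 0" by (simp add: D_def)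
    \<comment> \<open>Y G Z = Z + Y = I, because Z = I - Y.\<close>
    have detG: "det G = 1 / (det ?Y * det ?Z)"
    proof -
      have c: "?Y \<in> carrier_mat q q" "?Z \<in> carrier_mat q q" using Ys by (auto simp: sym_mat_def)
      note mY = mY[OF dn(1)] and mZ = mZ[OF dn(2)]
      have "?Y * G * ?Z = ?Y * minv ?Y * ?Z + ?Y * (minv ?Z * ?Z)"
        unfolding G_def using c mY(1) mZ(1)
        by (simp add: mult_add_distrib_mat[of _ q q _ q] add_mult_distrib_mat[of _ q q _ _ q] assoc_mult_mat[of _ q q _ q _ q])
      also have "\<dots> = ?Z + ?Y" using c mY mZ by simp
      also have "\<dots> = 1\<^sub>m q" using c by (intro eq_matI) auto
      finally have "det ?Y * det G * det ?Z = 1"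
        using det_mult[of "?Y * G" q ?Z] det_mult[of ?Y q G] c sym_matD(1)[OF G(1)] by simp
      then show ?thesis using d by (simp add: field_simps)
    qed
    have "(\<integral>\<^sup>+x. (\<integral>\<^sup>+t. ennreal (beta_kernel (Suc q) a b (append_column q y (x(q := t)))) \<partial>lborel) \<partial>PiM {..<q} (\<lambda>_. lborel))
        = (\<integral>\<^sup>+x. ennreal (D * Beta (?\<alpha> + 1) (?\<beta> + 1)) *
            ennreal (if qform G (vec q x) < 1 then (1 - qform G (vec q x)) powr (?\<alpha> + ?\<beta> + 1) else 0) \<partial>PiM {..<q} (\<lambda>_. lborel))"
    proof (rule nn_integral_cong)
      fix x :: "nat \<Rightarrow> real"
      let ?u = "qform (minv ?Y) (vec q x)" and ?v = "1 - qform (minv ?Z) (vec q x)"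
      have qG: "qform G (vec q x) = ?u + (1 - ?v)"
        unfolding G_def using qform_add[OF mY(1)[OF dn(1)] mZ(1)[OF dn(2)], of "vec q x"] by simp
      have "(\<integral>\<^sup>+t. ennreal (beta_kernel (Suc q) a b (append_column q y (x(q := t)))) \<partial>lborel)
          = (\<integral>\<^sup>+t. ennreal D * ennreal (if ?u < t \<and> t < ?v then (t - ?u) powr ?\<alpha> * (?v - t) powr ?\<beta> else 0) \<partial>lborel)"
        unfolding beta_kernel_Suc[OF True] D_def[symmetric] using D0 by (simp add: ennreal_mult')
      also have "\<dots> = ennreal D * (\<integral>\<^sup>+t. ennreal (if ?u < t \<and> t < ?v then (t - ?u) powr ?\<alpha> * (?v - t) powr ?\<beta> else 0) \<partial>lborel)"
        by (rule nn_integral_cmult) measurable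
      also have "\<dots> = ennreal D * ennreal (if ?u < ?v then (?v - ?u) powr (?\<alpha> + ?\<beta> + 1) * Beta (?\<alpha> + 1) (?\<beta> + 1) else 0)"
        unfolding nn_integral_Beta_interval[OF ex(1,2)] ..
      also have "\<dots> = ennreal (D * Beta (?\<alpha> + 1) (?\<beta> + 1)) *
          ennreal (if qform G (vec q x) < 1 then (1 - qform G (vec q x)) powr (?\<alpha> + ?\<beta> + 1) else 0)"
      proof -
        have e: "?u < ?v \<longleftrightarrow> qform G (vec q x) < 1" "?v - ?u = 1 - qform G (vec q x)" unfolding qG by auto
        show ?thesis unfolding e using D0 B0 by (auto simp: ennreal_mult[symmetric] mult_ac)
      qed
      finally show "(\<integral>\<^sup>+t. ennreal (beta_kernel (Suc q) a b (append_column q y (x(q := t)))) \<partial>lborel)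
          = ennreal (D * Beta (?\<alpha> + 1) (?\<beta> + 1)) *
            ennreal (if qform G (vec q x) < 1 then (1 - qform G (vec q x)) powr (?\<alpha> + ?\<beta> + 1) else 0)" .
    qed
    also have "\<dots> = ennreal (D * Beta (?\<alpha> + 1) (?\<beta> + 1)) *
        (\<integral>\<^sup>+x. ennreal (if qform G (vec q x) < 1 then (1 - qform G (vec q x)) powr (?\<alpha> + ?\<beta> + 1) else 0) \<partial>PiM {..<q} (\<lambda>_. lborel))"
    proof (rule nn_integral_cmult)
      have c: "(\<lambda>x. x i) \<in> borel_measurable (PiM {..<q} (\<lambda>_. lborel :: real measure))" if "i < q" for i
        using measurable_component_singleton[of i "{..<q}" "\<lambda>_. lborel"] that by simp
      have c': "(\<lambda>x. vec q x $ i) \<in> borel_measurable (PiM {..<q} (\<lambda>_. lborel :: real measure))" if "i < q" for i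
        using c[OF that] that by simp
      have qm: "(\<lambda>x. qform G (vec q x)) \<in> borel_measurable (PiM {..<q} (\<lambda>_. lborel :: real measure))"
        unfolding qform_sum[OF sym_matD(1)[OF G(1)] vec_carrier]
        by (intro borel_measurable_sum borel_measurable_times borel_measurable_const c') auto
      show "(\<lambda>x. ennreal (if qform G (vec q x) < 1 then (1 - qform G (vec q x)) powr (?\<alpha> + ?\<beta> + 1) else 0))
          \<in> borel_measurable (PiM {..<q} (\<lambda>_. lborel))" using qm by measurable
    qed
    also have "\<dots> = ennreal (D * Beta (?\<alpha> + 1) (?\<beta> + 1)) * ennreal (ball_integral q (?\<alpha> + ?\<beta> + 1) / sqrt (det G))"
      unfolding nn_integral_ellipsoid[OF G ex(3)] ..
    also have "\<dots> = ennreal (D * Beta (?\<alpha> + 1) (?\<beta> + 1) * (ball_integral q (?\<alpha> + ?\<beta> + 1) / sqrt (det G)))"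
      by (rule ennreal_mult'[symmetric]) (use D0 B0 in simp)
    also have "D * Beta (?\<alpha> + 1) (?\<beta> + 1) * (ball_integral q (?\<alpha> + ?\<beta> + 1) / sqrt (det G)) = K * beta_kernel q a b y"
    proof -
      \<comment> \<open>The ellipsoid contributes the square root of det Y det Z, which raises both
        exponents by 1/2, precisely to those of the kernel of size q.\<close>
      have e: "a - (real q + 1) / 2 = ?\<alpha> + 1 / 2" "b - (real q + 1) / 2 = ?\<beta> + 1 / 2" by (auto simp: field_simps)
      have "1 / sqrt (det G) = det ?Y powr (1 / 2) * det ?Z powr (1 / 2)"
        unfolding detG using d by (simp add: real_sqrt_divide real_sqrt_mult powr_half_sqrt)
      moreover have "beta_kernel q a b y = D * (det ?Y powr (1 / 2) * det ?Z powr (1 / 2))"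
        unfolding beta_kernel_def e powr_add D_def using True by simp
      ultimately have "beta_kernel q a b y = D / sqrt (det G)" by (metis times_divide_eq_right mult.right_neutral)
      then show ?thesis unfolding K_def by (simp add: mult_ac)
    qed
    also have "ennreal (K * beta_kernel q a b y) = ennreal K * ennreal (beta_kernel q a b y)"
      by (rule ennreal_mult[OF _ beta_kernel_nonneg]) (use B0 J0 in \<open>simp add: K_def\<close>)
    finally show ?thesis .
  qed
  have "(\<integral>\<^sup>+y. ennreal (beta_kernel (Suc q) a b y) \<partial>Sp (Suc q))
      = (\<integral>\<^sup>+y. (\<integral>\<^sup>+x. (\<integral>\<^sup>+t. ennreal (beta_kernel (Suc q) a b (append_column q y (x(q := t)))) \<partial>lborel) \<partial>PiM {..<q} (\<lambda>_. lborel)) \<partial>Sp q)"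
    by (rule nn_integral_Sp_Suc) measurable
  also have "\<dots> = (\<integral>\<^sup>+y. ennreal K * ennreal (beta_kernel q a b y) \<partial>Sp q)"
    by (rule nn_integral_cong) (rule inner)
  also have "\<dots> = ennreal K * (\<integral>\<^sup>+y. ennreal (beta_kernel q a b y) \<partial>Sp q)"
    by (rule nn_integral_cmult) measurable
  also have "(\<integral>\<^sup>+y. ennreal (beta_kernel q a b y) \<partial>Sp q) = ennreal (mBeta q a b)"
    by (rule Suc.IH) (use ab in auto)
  also have "ennreal K * ennreal (mBeta q a b) = ennreal (K * mBeta q a b)"
    by (rule ennreal_mult'[symmetric]) (use B0 J0 in \<open>simp add: K_def\<close>)
  also have "K * mBeta q a b = mBeta (Suc q) a b"
  proof -
    have "?\<alpha> + 1 = a - real q / 2" "?\<beta> + 1 = b - real q / 2" "?\<alpha> + ?\<beta> + 1 = a + b - real q - 1" by (auto simp: field_simps)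
    then show ?thesis unfolding K_def mBeta_Suc[OF ab] by (simp only: mult_ac)
  qed
  finally show ?case .
qed

subsection \<open>The law of the canonical moments\<close>

definition slice :: "nat \<Rightarrow> nat \<Rightarrow> (nat \<times> nat \<times> nat \<Rightarrow> real) \<Rightarrow> nat \<times> nat \<Rightarrow> real" where
  "slice p k u = restrict (\<lambda>(i, j). u (k, i, j)) (Tidx p)"

lemma Ucoord_slice: "Ucoord p n k x = slice p k (Ucoords p n x)"
  by (simp add: Ucoord_def slice_def)

lemma measurable_slice[measurable]: "slice p k \<in> measurable (SpN p n) (Sp p)"
proof -
  have "(\<lambda>u. \<lambda>ij\<in>Tidx p. u (k, ij)) \<in> measurable (SpN p n) (Sp p)"
    unfolding Sp_def using borel_measurable_component_SpN by (intro measurable_restrict) simp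
  then show ?thesis unfolding slice_def[abs_def] by (simp add: case_prod_beta')
qed

lemma tmat_slice: "tmat p (slice p k u) = smat p u k"
  unfolding smat_eq_tmat by (rule tmat_cong) (auto simp: slice_def)

lemma slice_append_moment:
  "1 \<le> k \<Longrightarrow> k \<le> n \<Longrightarrow> slice p k (append_moment p n x y) = slice p k x"
  "y \<in> space (Sp p) \<Longrightarrow> slice p (Suc n) (append_moment p n x y) = y"
  by (auto simp: slice_def append_moment_def fun_eq_iff restrict_def Sp_def space_PiM PiE_def extensional_def)

lemma nn_integral_SpN_prod:
  fixes h :: "nat \<Rightarrow> (nat \<times> nat \<Rightarrow> real) \<Rightarrow> ennreal"
  assumes h: "\<And>k. h k \<in> borel_measurable (Sp p)"
  shows "(\<integral>\<^sup>+u. (\<Prod>k\<in>{1..n}. h k (slice p k u)) \<partial>SpN p n) = (\<Prod>k\<in>{1..n}. \<integral>\<^sup>+y. h k y \<partial>Sp p)"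
proof (induction n)
  case 0
  then show ?case by (simp add: SpN_def Kidx_def PiM_empty nn_integral_count_space_finite)
next
  case (Suc n)
  have m: "(\<lambda>u. \<Prod>k\<in>{1..n}. h k (slice p k u)) \<in> borel_measurable (SpN p n)" for n
    using h by (intro borel_measurable_prod_ennreal measurable_compose[OF measurable_slice h])
  have "(\<integral>\<^sup>+u. (\<Prod>k\<in>{1..Suc n}. h k (slice p k u)) \<partial>SpN p (Suc n))
      = (\<integral>\<^sup>+x. (\<integral>\<^sup>+y. (\<Prod>k\<in>{1..Suc n}. h k (slice p k (append_moment p n x y))) \<partial>Sp p) \<partial>SpN p n)"
    by (rule nn_integral_SpN_Suc[OF m])
  also have "\<dots> = (\<integral>\<^sup>+x. (\<integral>\<^sup>+y. h (Suc n) y * (\<Prod>k\<in>{1..n}. h k (slice p k x)) \<partial>Sp p) \<partial>SpN p n)"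
    by (intro nn_integral_cong, subst prod.nat_ivl_Suc') (auto simp: slice_append_moment)
  also have "\<dots> = (\<integral>\<^sup>+x. (\<integral>\<^sup>+y. h (Suc n) y \<partial>Sp p) * (\<Prod>k\<in>{1..n}. h k (slice p k x)) \<partial>SpN p n)"
    by (intro nn_integral_cong nn_integral_multc h)
  also have "\<dots> = (\<integral>\<^sup>+y. h (Suc n) y \<partial>Sp p) * (\<Prod>k\<in>{1..n}. \<integral>\<^sup>+y. h k y \<partial>Sp p)"
    unfolding nn_integral_cmult[OF m] Suc ..
  finally show ?case by (simp add: prod.nat_ivl_Suc' mult.commute)
qed

text \<open>The origin of the Beta parameters: (p + 1) (n - k) / 2 plus the (p + 1) / 2 built into
  the Beta exponent is (n - k + 1) (p + 1) / 2.\<close>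

lemma canon_weight_prod:
  "canon_weight p n u = (\<Prod>k\<in>{1..n}. beta_kernel p (real (n - k + 1) * (real p + 1) / 2) (real (n - k + 1) * (real p + 1) / 2) (slice p k u))"
  unfolding canon_weight_def
proof (rule prod.cong[OF refl])
  fix k
  have e: "real (n - k + 1) * (real p + 1) / 2 - (real p + 1) / 2 = real ((p + 1) * (n - k)) / 2"
    by (simp add: field_simps)
  show "(if in01 p (smat p u k) then det (smat p u k * (1\<^sub>m p - smat p u k)) powr (real ((p + 1) * (n - k)) / 2) else 0)
      = beta_kernel p (real (n - k + 1) * (real p + 1) / 2) (real (n - k + 1) * (real p + 1) / 2) (slice p k u)"
    unfolding beta_kernel_def e tmat_slice using in01_props[OF sym_smat, of p u k]
    by (auto simp: powr_mult)
qed

lemma canon_dens_weight: "canon_dens p n u = ennreal (1 / Vol p n * canon_weight p n u)"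
  by (simp add: canon_dens_def canon_weight_def)

lemma beta_dens_kernel: "beta_dens p a b y = ennreal (beta_kernel p a b y / mBeta p a b)"
  by (simp add: beta_dens_def beta_kernel_def)

theorem theorem3p5:
  fixes p n :: nat and M :: "'a measure" and S :: "'a \<Rightarrow> (nat \<times> nat \<times> nat \<Rightarrow> real)"
  assumes "p \<ge> 1" and "n \<ge> 1"
    and "prob_space M"
    and "distributed M (SpN p n) S (unif_dens p n)"
  shows "distributed M (SpN p n) (\<lambda>\<omega>. Ucoords p n (S \<omega>)) (canon_dens p n) \<and>
      prob_space.indep_vars M (\<lambda>_. Sp p) (\<lambda>k \<omega>. Ucoord p n k (S \<omega>)) {1..n} \<and>
      (\<forall>k \<in> {1..n}. distributed M (Sp p) (\<lambda>\<omega>. Ucoord p n k (S \<omega>))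
           (beta_dens p (real (n - k + 1) * (real p + 1) / 2) (real (n - k + 1) * (real p + 1) / 2)))"
proof -
  interpret prob_space M by fact
  have Sm: "S \<in> measurable M (SpN p n)" and um: "unif_dens p n \<in> borel_measurable (SpN p n)"
    and dS: "distr M (SpN p n) S = density (SpN p n) (unif_dens p n)"
    using assms(4) by (auto simp: distributed_def)
  define a where "a = (\<lambda>k. real (n - k + 1) * (real p + 1) / 2)"
  have ap: "a k > (real p - 1) / 2" for k
  proof -
    have "1 * (real p + 1) \<le> real (n - k + 1) * (real p + 1)" by (intro mult_right_mono) auto
    then have "(1 * (real p + 1)) / 2 \<le> a k" unfolding a_def by (rule divide_right_mono) simp
    then show ?thesis by simp
  qed
  have Bpos: "mBeta p (a k) (a k) > 0" for k by (rule mBeta_pos[OF ap ap assms(1)])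
  \<comment> \<open>With zero volume the factor 1 / Vol is 0 by convention, so the assumed density
    would be zero and could not have total mass one.\<close>
  have "Vol p n \<noteq> 0"
  proof
    assume "Vol p n = 0"
    then have "unif_dens p n = (\<lambda>_. 0)" by (simp add: unif_dens_def fun_eq_iff)
    then have "emeasure (distr M (SpN p n) S) (space (SpN p n)) = 0" unfolding dS by (simp add: emeasure_density)
    moreover have "emeasure (distr M (SpN p n) S) (space (SpN p n)) = 1"
      using prob_space.emeasure_space_1[OF prob_space_distr[OF Sm]] by simp
    ultimately show False by simp
  qed
  then have V: "Vol p n > 0" by (simp add: Vol_def less_le)
  let ?U = "\<lambda>\<omega>. Ucoords p n (S \<omega>)"
  have Um: "?U \<in> measurable M (SpN p n)" using Sm measurable_Ucoords by (rule measurable_compose)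
  have cm: "canon_dens p n \<in> borel_measurable (SpN p n)"
    unfolding canon_dens_weight[abs_def] by measurable
  have dU: "distr M (SpN p n) ?U = density (SpN p n) (canon_dens p n)"
  proof (rule measure_eqI)
    fix A assume "A \<in> sets (distr M (SpN p n) ?U)"
    then have A: "A \<in> sets (SpN p n)" by simp
    have im: "(\<lambda>x. indicator A (Ucoords p n x) :: ennreal) \<in> borel_measurable (SpN p n)"
      using A by measurable
    have "emeasure (distr M (SpN p n) ?U) A = (\<integral>\<^sup>+\<omega>. indicator A (?U \<omega>) \<partial>M)"
      using nn_integral_distr[OF Um, of "indicator A"] A by simp
    also have "\<dots> = (\<integral>\<^sup>+x. indicator A (Ucoords p n x) \<partial>distr M (SpN p n) S)"
      by (rule nn_integral_distr[OF Sm, symmetric]) (use im in simp)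
    also have "\<dots> = (\<integral>\<^sup>+x. unif_dens p n x * indicator A (Ucoords p n x) \<partial>SpN p n)"
      unfolding dS by (rule nn_integral_density[OF um im])
    \<comment> \<open>The moment space is exchanged for the interior up to a null set; only there
      does \<open>Ucoords\<close> carry the canonical moments.\<close>
    also have "\<dots> = (\<integral>\<^sup>+x. ennreal (1 / Vol p n) * (indicator (Mint p n) x * indicator A (Ucoords p n x)) \<partial>SpN p n)"
      by (rule nn_integral_cong_AE) (use AE_Mn_Mint in \<open>eventually_elim, auto simp: unif_dens_def indicator_def\<close>)
    also have "\<dots> = ennreal (1 / Vol p n) * (\<integral>\<^sup>+x. indicator (Mint p n) x * indicator A (Ucoords p n x) \<partial>SpN p n)"
      by (rule nn_integral_cmult) (use im in measurable)
    also have "\<dots> = ennreal (1 / Vol p n) * (\<integral>\<^sup>+u. ennreal (canon_weight p n u) * indicator A u \<partial>SpN p n)"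
      using A by (subst canonical_change_of_variables) auto
    also have "\<dots> = (\<integral>\<^sup>+u. ennreal (1 / Vol p n) * (ennreal (canon_weight p n u) * indicator A u) \<partial>SpN p n)"
      by (rule nn_integral_cmult[symmetric]) (use A in measurable)
    also have "\<dots> = (\<integral>\<^sup>+u. canon_dens p n u * indicator A u \<partial>SpN p n)"
    proof (rule nn_integral_cong)
      fix u
      have "canon_dens p n u = ennreal (1 / Vol p n) * ennreal (canon_weight p n u)"
        unfolding canon_dens_weight by (rule ennreal_mult'') (rule canon_weight_nonneg)
      then show "ennreal (1 / Vol p n) * (ennreal (canon_weight p n u) * indicator A u) = canon_dens p n u * indicator A u"
        by (simp only: mult.assoc)
    qed
    also have "\<dots> = emeasure (density (SpN p n) (canon_dens p n)) A"
      by (rule emeasure_density[OF cm A, symmetric])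
    finally show "emeasure (distr M (SpN p n) ?U) A = emeasure (density (SpN p n) (canon_dens p n)) A" .
  qed simp
  have D1: "distributed M (SpN p n) ?U (canon_dens p n)"
    using Um cm dU by (simp add: distributed_def)
  let ?X = "\<lambda>k \<omega>. Ucoord p n k (S \<omega>)"
  have Xm: "?X k \<in> measurable M (Sp p)" for k
    unfolding Ucoord_slice by (rule measurable_compose[OF Um measurable_slice])
  define B where "B = (\<lambda>k A. \<integral>\<^sup>+y. beta_dens p (a k) (a k) y * indicator A y \<partial>Sp p)"
  have bm: "beta_dens p (a k) (a k) \<in> borel_measurable (Sp p)" for k
    unfolding beta_dens_kernel[abs_def] by measurable
  have B_space: "B k (space (Sp p)) = 1" for k
  proof -
    have "B k (space (Sp p)) = (\<integral>\<^sup>+y. ennreal (1 / mBeta p (a k) (a k)) * ennreal (beta_kernel p (a k) (a k) y) \<partial>Sp p)"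
      unfolding B_def beta_dens_kernel using Bpos[of k] beta_kernel_nonneg
      by (intro nn_integral_cong) (simp add: ennreal_mult'[symmetric])
    also have "\<dots> = ennreal (1 / mBeta p (a k) (a k)) * ennreal (mBeta p (a k) (a k))"
      by (subst nn_integral_cmult) (auto simp: nn_integral_beta_kernel[OF ap ap])
    also have "\<dots> = 1" using Bpos[of k] by (simp add: ennreal_mult'[symmetric])
    finally show ?thesis .
  qed
  \<comment> \<open>The joint density is this constant times the product of the normalised Beta
    densities.\<close>
  define c where "c = ennreal (1 / Vol p n * (\<Prod>k\<in>{1..n}. mBeta p (a k) (a k)))"
  have joint_c: "emeasure M {\<omega> \<in> space M. \<forall>k\<in>{1..n}. ?X k \<omega> \<in> A k} = c * (\<Prod>k\<in>{1..n}. B k (A k))"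
    if A: "\<And>k. A k \<in> sets (Sp p)" for A
  proof -
    define E where "E = {u \<in> space (SpN p n). \<forall>k\<in>{1..n}. slice p k u \<in> A k}"
    have E: "E \<in> sets (SpN p n)"
      unfolding E_def using A by (intro sets.sets_Collect_finite_All measurable_sets_Collect[OF measurable_slice]) auto
    have ind: "indicator E u = (\<Prod>k\<in>{1..n}. indicator (A k) (slice p k u) :: ennreal)" if u: "u \<in> space (SpN p n)" for u
    proof (cases "u \<in> E")
      case True
      then show ?thesis by (simp add: E_def)
    next
      case False
      then obtain k where "k \<in> {1..n}" "slice p k u \<notin> A k" using u by (auto simp: E_def)
      then have "(\<Prod>k\<in>{1..n}. indicator (A k) (slice p k u) :: ennreal) = 0"
        by (intro prod_zero bexI[of _ k]) auto
      then show ?thesis using False by simp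
    qed
    have "{\<omega> \<in> space M. \<forall>k\<in>{1..n}. ?X k \<omega> \<in> A k} = ?U -` E \<inter> space M"
      using measurable_space[OF Um] by (auto simp: E_def Ucoord_slice)
    then have "emeasure M {\<omega> \<in> space M. \<forall>k\<in>{1..n}. ?X k \<omega> \<in> A k} = emeasure (density (SpN p n) (canon_dens p n)) E"
      using dU emeasure_distr[OF Um E] by simp
    also have "\<dots> = (\<integral>\<^sup>+u. canon_dens p n u * indicator E u \<partial>SpN p n)" by (rule emeasure_density[OF cm E])
    also have "\<dots> = (\<integral>\<^sup>+u. c * (\<Prod>k\<in>{1..n}. beta_dens p (a k) (a k) (slice p k u) * indicator (A k) (slice p k u)) \<partial>SpN p n)"
    proof (rule nn_integral_cong)
      fix u assume u: "u \<in> space (SpN p n)"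
      have "canon_dens p n u = c * (\<Prod>k\<in>{1..n}. beta_dens p (a k) (a k) (slice p k u))"
      proof -
        have cw: "canon_weight p n u = (\<Prod>k\<in>{1..n}. beta_kernel p (a k) (a k) (slice p k u))"
          unfolding a_def by (rule canon_weight_prod)
        have w: "canon_weight p n u = (\<Prod>k\<in>{1..n}. mBeta p (a k) (a k)) *
            (\<Prod>k\<in>{1..n}. beta_kernel p (a k) (a k) (slice p k u) / mBeta p (a k) (a k))"
          unfolding cw prod.distrib[symmetric] using Bpos
          by (intro prod.cong) (auto simp: less_imp_neq[symmetric])
        have b: "(\<Prod>k\<in>{1..n}. beta_dens p (a k) (a k) (slice p k u))
            = ennreal (\<Prod>k\<in>{1..n}. beta_kernel p (a k) (a k) (slice p k u) / mBeta p (a k) (a k))"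
          unfolding beta_dens_kernel using Bpos beta_kernel_nonneg
          by (intro prod_ennreal divide_nonneg_pos) auto
        have nn: "1 / Vol p n * (\<Prod>k\<in>{1..n}. mBeta p (a k) (a k)) \<ge> 0"
          using V Bpos by (intro mult_nonneg_nonneg prod_nonneg) (auto intro: less_imp_le)
        show ?thesis unfolding canon_dens_weight c_def w b mult.assoc[symmetric] by (rule ennreal_mult'[OF nn])
      qed
      then show "canon_dens p n u * indicator E u
          = c * (\<Prod>k\<in>{1..n}. beta_dens p (a k) (a k) (slice p k u) * indicator (A k) (slice p k u))"
        unfolding ind[OF u] prod.distrib by (simp add: mult.assoc)
    qed
    also have "\<dots> = c * (\<integral>\<^sup>+u. (\<Prod>k\<in>{1..n}. beta_dens p (a k) (a k) (slice p k u) * indicator (A k) (slice p k u)) \<partial>SpN p n)"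
      using A by (intro nn_integral_cmult borel_measurable_prod_ennreal borel_measurable_times_ennreal
          measurable_compose[OF measurable_slice bm] measurable_compose[OF measurable_slice borel_measurable_indicator])
    also have "(\<integral>\<^sup>+u. (\<Prod>k\<in>{1..n}. beta_dens p (a k) (a k) (slice p k u) * indicator (A k) (slice p k u)) \<partial>SpN p n)
        = (\<Prod>k\<in>{1..n}. B k (A k))"
      unfolding B_def using A
      by (intro nn_integral_SpN_prod[where h = "\<lambda>k y. beta_dens p (a k) (a k) y * indicator (A k) y"]
          borel_measurable_times_ennreal bm borel_measurable_indicator)
    finally show ?thesis .
  qed
  \<comment> \<open>Taking whole spaces for all A k compares total masses and gives c = 1;
    equivalently, the volume is the product of the Beta normalisations.\<close>
  have "{\<omega> \<in> space M. \<forall>k\<in>{1..n}. ?X k \<omega> \<in> space (Sp p)} = space M"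
    using measurable_space[OF Xm] by auto
  then have "c = 1"
    using joint_c[of "\<lambda>_. space (Sp p)"] emeasure_space_1 by (simp only: B_space) simp
  with joint_c have joint: "emeasure M {\<omega> \<in> space M. \<forall>k\<in>{1..n}. ?X k \<omega> \<in> A k} = (\<Prod>k\<in>{1..n}. B k (A k))"
    if "\<And>k. A k \<in> sets (Sp p)" for A using that by simp
  \<comment> \<open>Indices outside J are filled with the whole space, whose Beta mass is 1.
    Marginals are the singleton case, and independence follows for every J.\<close>
  have joint_J: "emeasure M (\<Inter>j\<in>J. ?X j -` A j \<inter> space M) = (\<Prod>j\<in>J. B j (A j))"
    if J: "J \<subseteq> {1..n}" "J \<noteq> {}" and A: "\<And>j. j \<in> J \<Longrightarrow> A j \<in> sets (Sp p)" for J A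
  proof -
    let ?A = "\<lambda>k. if k \<in> J then A k else space (Sp p)"
    have "(\<Inter>j\<in>J. ?X j -` A j \<inter> space M) = {\<omega> \<in> space M. \<forall>k\<in>{1..n}. ?X k \<omega> \<in> ?A k}"
      using J measurable_space[OF Xm] by (auto split: if_splits)
    then have "emeasure M (\<Inter>j\<in>J. ?X j -` A j \<inter> space M) = (\<Prod>k\<in>{1..n}. B k (?A k))"
      using joint[of ?A] A by simp
    also have "\<dots> = (\<Prod>k\<in>J. B k (?A k))"
      using J by (intro prod.mono_neutral_right) (auto simp: B_space)
    finally show ?thesis by simp
  qed
  have marg: "emeasure M (?X k -` A \<inter> space M) = B k A" if "k \<in> {1..n}" "A \<in> sets (Sp p)" for k A
    using joint_J[of "{k}" "\<lambda>_. A"] that by simp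
  have D3: "distributed M (Sp p) (?X k) (beta_dens p (a k) (a k))" if k: "k \<in> {1..n}" for k
    unfolding distributed_def
  proof (intro conjI Xm bm measure_eqI)
    fix A assume "A \<in> sets (distr M (Sp p) (?X k))"
    then have A: "A \<in> sets (Sp p)" by simp
    show "emeasure (distr M (Sp p) (?X k)) A = emeasure (density (Sp p) (beta_dens p (a k) (a k))) A"
      unfolding emeasure_distr[OF Xm A] marg[OF k A] emeasure_density[OF bm A] B_def ..
  qed simp
  have D2: "indep_vars (\<lambda>_. Sp p) ?X {1..n}"
    unfolding indep_vars_def2 indep_sets_def
  proof (intro conjI ballI allI impI)
    fix k show "random_variable (Sp p) (?X k)" by (rule Xm)
  next
    fix k show "{?X k -` A \<inter> space M |A. A \<in> sets (Sp p)} \<subseteq> events"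
      using measurable_sets[OF Xm] by auto
  next
    fix J F assume J: "J \<subseteq> {1..n}" "J \<noteq> {}" "finite J" and F: "F \<in> (\<Pi> k\<in>J. {?X k -` A \<inter> space M |A. A \<in> sets (Sp p)})"
    have "\<forall>k\<in>J. \<exists>A. A \<in> sets (Sp p) \<and> F k = ?X k -` A \<inter> space M"
      using Pi_mem[OF F] by (smt (verit, ccfv_threshold) mem_Collect_eq)
    then obtain A where A: "\<And>k. k \<in> J \<Longrightarrow> A k \<in> sets (Sp p)" "\<And>k. k \<in> J \<Longrightarrow> F k = ?X k -` A k \<inter> space M"
      by metis
    have "emeasure M (\<Inter>k\<in>J. F k) = (\<Prod>k\<in>J. B k (A k))"
      using joint_J[OF J(1,2) A(1)] A(2) by simp
    also have "\<dots> = (\<Prod>k\<in>J. emeasure M (F k))"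
      using J(1) A marg by (intro prod.cong refl) auto
    finally have "ennreal (prob (\<Inter>k\<in>J. F k)) = ennreal (\<Prod>k\<in>J. prob (F k))"
      unfolding emeasure_eq_measure by (simp add: prod_ennreal)
    then show "prob (\<Inter>k\<in>J. F k) = (\<Prod>k\<in>J. prob (F k))" by (simp add: prod_nonneg)
  qed
  show ?thesis using D1 D2 D3 unfolding a_def by blast
qed

end
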